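(* Let $a,b\in\mathbb Z$ and let $(\mathcal A,\cdot,[\ ,\ ],d)$ be a differential graded $(a,b)$-algebra. With the notation of the context, $\big(S^+(\mathcal H[a-b]),\Delta,\delta'',Q=m+\ell''\big)$, where $\mathcal H=\underline{\bigotimes}^+(\mathcal A[-a+1])$, is a graded codifferential bicoalgebra, that is: (1) $\Delta$ (of degree $0$) is cocommutative and coassociative: $\tau''\circ\Delta=\Delta$ and $(\Delta\otimes id)\circ\Delta=(id\otimes\Delta)\circ\Delta$; (2) $\delta''$ is a Lie cobracket of degree $a-b$: $\tau''\circ\delta''=-(-1)^{a-b}\delta''$ and $\big(id^{\otimes 3}+\tau''_{12}\circ\tau''_{23}+\tau''_{23}\circ\tau''_{12}\big)\circ(\delta''\otimes id)\circ\delta''=0$; (3) $\Delta$ and $\delta''$ satisfy the coLeibniz identity $(id\otimes\Delta)\circ\delta''=(\delta''\otimes id)\circ\Delta+\tau''_{12}\circ(id\otimes\delta'')\circ\Delta$; (4) $Q$ has degree $1$, $Q\circ Q=0$, and $Q$ is a coderivation of both structures: $(Q\otimes id+id\otimes Q)\circ\Delta=\Delta\circ Q$ and $(Q\otimes id+id\otimes Q)\circ\delta''=(-1)^{a-b}\,\delta''\circ Q$.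
   Context: Vector spaces are $\mathbb Z$-graded; $V[k]_i=V_{i+k}$ (so an element of degree $n$ in $V$ has degree $n-k$ in $V[k]$). The Koszul rule is used: $(f\otimes g)(X\otimes Y)=(-1)^{\deg(g)\deg(X)}f(X)\otimes g(Y)$. $\varepsilon\binom{\dots}{\dots}$ denotes the Koszul sign of a reordering of homogeneous elements (the signature of the permutation induced on the odd elements). Differential graded $(a,b)$-algebra: a graded space $\mathcal A$ (degree $|\cdot|$) with a product $\cdot$ of degree $a$, a bracket $[\ ,\ ]$ of degree $b$, and a linear map $d$ of degree $1$ such that, for homogeneous $\alpha,\beta,\gamma$: $\alpha\cdot\beta=(-1)^{(|\alpha|+a)(|\beta|+a)}\beta\cdot\alpha$; $\alpha\cdot(\beta\cdot\gamma)=(\alpha\cdot\beta)\cdot\gamma$; $[\alpha,\beta]=-(-1)^{(|\alpha|+b)(|\beta|+b)}[\beta,\alpha]$; $(-1)^{(|\alpha|+b)(|\gamma|+b)}[[\alpha,\beta],\gamma]+(-1)^{(|\beta|+b)(|\alpha|+b)}[[\beta,\gamma],\alpha]+(-1)^{(|\gamma|+b)(|\beta|+b)}[[\gamma,\alpha],\beta]=0$; $[\alpha,\beta\cdot\gamma]=[\alpha,\beta]\cdot\gamma+(-1)^{(|\beta|+a)(|\alpha|+b)}\beta\cdot[\alpha,\gamma]$; $d^2=0$, $d(\alpha\cdot\beta)=d\alpha\cdot\beta+(-1)^{|\alpha|+a}\alpha\cdot d\beta$, $d[\alpha,\beta]=[d\alpha,\beta]+(-1)^{|\alpha|+b}[\alpha,d\beta]$.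 On $\mathcal A[-a+1]$ the degree is $|\alpha|+a-1$; in exponents it is simply written $\alpha$. There, $\mu(\alpha,\beta)=(-1)^{\alpha}\alpha\cdot\beta$ (degree $1$) and $\ell(\alpha,\beta)=(-1)^{(b-a+1)\alpha}[\alpha,\beta]$ (degree $b-a+1$). A $(p,q)$-shuffle ($p,q\ge1$) is $\sigma\in S_{p+q}$ with $\sigma(1)<\dots<\sigma(p)$ and $\sigma(p+1)<\dots<\sigma(p+q)$; $Bat(p,q)$ is their set; $\varepsilon_\alpha(\sigma^{-1})$ is the Koszul sign of passing from $\alpha_1,\dots,\alpha_{p+q}$ to $\alpha_{\sigma^{-1}(1)},\dots,\alpha_{\sigma^{-1}(p+q)}$; and $bat_{p,q}(\alpha_1\otimes\dots\otimes\alpha_p,\alpha_{p+1}\otimes\dots\otimes\alpha_{p+q})=\sum_{\sigma\in Bat(p,q)}\varepsilon_\alpha(\sigma^{-1})\alpha_{\sigma^{-1}(1)}\otimes\dots\otimes\alpha_{\sigma^{-1}(p+q)}$. For $V=\mathcal A[-a+1]$, $\underline\bigotimes^nV=V^{\otimes n}/\sum_{p+q=n,\,p,q\ge1}\mathrm{Im}(bat_{p,q})$ and $\mathcal H=\underline\bigotimes^+V=\bigoplus_{n\ge1}\underline\bigotimes^nV$; the class of $\alpha_1\otimes\dots\otimes\alpha_n$ is $X=\alpha_1\underline\otimes\dots\underline\otimes\alpha_n$, of degree $x=\alpha_1+\dots+\alpha_n$. "$U\underline\otimes V=X$, $U,V\ne\emptyset$" means summing over the cuts $U=\alpha_1\underline\otimes\dots\underline\otimes\alpha_j$,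 $V=\alpha_{j+1}\underline\otimes\dots\underline\otimes\alpha_n$, $1\le j\le n-1$. $D=d_1+\mu_1$ on $\mathcal H$, with $d_1(\alpha_1\underline\otimes\dots\underline\otimes\alpha_n)=\sum_{1\le k\le n}(-1)^{\sum_{i<k}\alpha_i}\alpha_1\underline\otimes\dots\underline\otimes d(\alpha_k)\underline\otimes\dots\underline\otimes\alpha_n$ and $\mu_1(\alpha_1\underline\otimes\dots\underline\otimes\alpha_n)=\sum_{1\le k<n}(-1)^{\sum_{i<k}\alpha_i}\alpha_1\underline\otimes\dots\underline\otimes\mu(\alpha_k,\alpha_{k+1})\underline\otimes\dots\underline\otimes\alpha_n$. For $X=\alpha_1\underline\otimes\dots\underline\otimes\alpha_p$, $Y=\alpha_{p+1}\underline\otimes\dots\underline\otimes\alpha_{p+q}$: $\ell_2(X,Y)=\sum\varepsilon_\alpha(\sigma^{-1})(-1)^{(b-a+1)\sum_{s<k}\alpha_{\sigma^{-1}(s)}}\alpha_{\sigma^{-1}(1)}\underline\otimes\dots\underline\otimes\ell(\alpha_{\sigma^{-1}(k)},\alpha_{\sigma^{-1}(k+1)})\underline\otimes\dots\underline\otimes\alpha_{\sigma^{-1}(p+q)}$, summed over $\sigma\in Bat(p,q)$ and $k$ with $\sigma^{-1}(k)\le p<\sigma^{-1}(k+1)$. On $\mathcal H[a-b-1]$, of degree $x'=x-a+b+1$: $\ell'_2(X,Y)=(-1)^{(a-b-1)x'}\ell_2(X,Y)$. On $\mathcal H[a-b]$, of degree $x''=x'-1=x-a+b$: $\ell''_2(X,Y)=(-1)^{x''}\ell'_2(X,Y)$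 (degree $1$). $S^+(\mathcal H[a-b])=\bigoplus_{n\ge1}S^n(\mathcal H[a-b])$ (graded symmetric powers, degree $x''$), and $\tau''(X\otimes Y)=(-1)^{x''y''}Y\otimes X$ on its tensor square, $\tau''_{12}=\tau''\otimes id$, $\tau''_{23}=id\otimes\tau''$. For $I=\{i_1<\dots<i_r\}$, $X_I=X_{i_1}\cdots X_{i_r}$. Unions $I\cup J$ below are disjoint, and in $\delta''$ the sets $I,J$ may be empty. $\Delta(X_1\cdots X_n)=\sum_{I\cup J=\{1,\dots,n\},\ \#I,\#J>0}\varepsilon\binom{x_1''\dots x_n''}{x_I''x_J''}X_I\otimes X_J$. $\delta''(X_1\cdots X_n)=\sum_{1\le s\le n,\ I\cup J=\{1,\dots,n\}\setminus\{s\}}\varepsilon\binom{x_1''\dots x_n''}{x_I''x_s''x_J''}\sum_{U_s\underline\otimes V_s=X_s,\ U_s,V_s\ne\emptyset}(-1)^{(a-b)(x_I''+u_s'')}\big(X_I.U_s\otimes V_s.X_J+(-1)^{u_s''v_s''+a-b+1}X_I.V_s\otimes U_s.X_J\big)$, a cobracket to which the degree $a-b$ is assigned (also in the Koszul rule). $m(X_1\cdots X_n)=\sum_{i=1}^n\varepsilon\binom{x_1''\dots x_n''}{x_i''x_1''\dots\widehat{i}\dots x_n''}D(X_i).X_1\cdots\widehat{i}\cdots X_n$ and $\ell''(X_1\cdots X_n)=\sum_{i<j}\varepsilon\binom{x_1''\dots x_n''}{x_i''x_j''x_1''\dots\widehat{ij}\dots x_n''}\ell''_2(X_i,X_j).X_1\cdots\widehat{ij}\cdots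 X_n$; $Q=m+\ell''$. *)

theory Defs
  imports Complex_Main "HOL-Library.Poly_Mapping" "HOL-Combinatorics.Permutations"
begin

section \<open>Differential graded (a,b)-algebras\<close>

text \<open>The graded space is the internal direct sum of the subspaces \<open>A i\<close>; the ground field is
  arbitrary. \<open>x \<in> A i\<close> means that \<open>x\<close> is homogeneous of degree \<open>i\<close>.\<close>

locale dg_ab_algebra = vector_space scale
  for scale :: "'k::field \<Rightarrow> 'v::ab_group_add \<Rightarrow> 'v" +
  fixes A :: "int \<Rightarrow> 'v set"
    and a b :: int
    and mul brk :: "'v \<Rightarrow> 'v \<Rightarrow> 'v"
    and d :: "'v \<Rightarrow> 'v"
  assumes subspace_A: "subspace (A i)"
    and span_A: "span (\<Union>i. A i) = UNIV"
    and independent_A: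
      "finite I \<Longrightarrow> (\<And>i. i \<in> I \<Longrightarrow> f i \<in> A i) \<Longrightarrow> (\<Sum>i\<in>I. f i) = 0 \<Longrightarrow> i \<in> I \<Longrightarrow> f i = 0"
    and mul_linear: "Vector_Spaces.linear scale scale (mul x)"
      "Vector_Spaces.linear scale scale (\<lambda>x. mul x y)"
    and brk_linear: "Vector_Spaces.linear scale scale (brk x)"
      "Vector_Spaces.linear scale scale (\<lambda>x. brk x y)"
    and d_linear: "Vector_Spaces.linear scale scale d"
    and mul_degree: "x \<in> A i \<Longrightarrow> y \<in> A j \<Longrightarrow> mul x y \<in> A (i + j + a)"
    and brk_degree: "x \<in> A i \<Longrightarrow> y \<in> A j \<Longrightarrow> brk x y \<in> A (i + j + b)"
    and d_degree: "x \<in> A i \<Longrightarrow> d x \<in> A (i + 1)"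
    and mul_commute: "x \<in> A i \<Longrightarrow> y \<in> A j \<Longrightarrow>
      mul x y = scale ((-1) powi ((i + a) * (j + a))) (mul y x)"
    and mul_assoc: "x \<in> A i \<Longrightarrow> y \<in> A j \<Longrightarrow> z \<in> A l \<Longrightarrow>
      mul x (mul y z) = mul (mul x y) z"
    and brk_skew: "x \<in> A i \<Longrightarrow> y \<in> A j \<Longrightarrow>
      brk x y = - scale ((-1) powi ((i + b) * (j + b))) (brk y x)"
    and brk_jacobi: "x \<in> A i \<Longrightarrow> y \<in> A j \<Longrightarrow> z \<in> A l \<Longrightarrow>
      scale ((-1) powi ((i + b) * (l + b))) (brk (brk x y) z)
      + scale ((-1) powi ((j + b) * (i + b))) (brk (brk y z) x)
      + scale ((-1) powi ((l + b) * (j + b))) (brk (brk z x) y) = 0"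
    and brk_leibniz: "x \<in> A i \<Longrightarrow> y \<in> A j \<Longrightarrow> z \<in> A l \<Longrightarrow>
      brk x (mul y z) = mul (brk x y) z + scale ((-1) powi ((j + a) * (i + b))) (mul y (brk x z))"
    and d_square: "d (d x) = 0"
    and d_mul: "x \<in> A i \<Longrightarrow> y \<in> A j \<Longrightarrow>
      d (mul x y) = mul (d x) y + scale ((-1) powi (i + a)) (mul x (d y))"
    and d_brk: "x \<in> A i \<Longrightarrow> y \<in> A j \<Longrightarrow>
      d (brk x y) = brk (d x) y + scale ((-1) powi (i + b)) (brk x (d y))"


section \<open>Graded vector spaces given by homogeneous generators and relations\<close>

text \<open>A record \<open>P\<close> of type \<open>('g, 'k) gspace\<close> stands for the quotient of the free
  \<open>'k\<close>-vector space on the homogeneous generators \<open>gens P\<close> by the span of \<open>grels P\<close>.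
  Its elements are the classes \<open>qclass P p\<close> with \<open>p \<in> free P\<close>.\<close>

record (overloaded) ('g, 'k) gspace =
  gens :: "'g set"
  gdeg :: "'g \<Rightarrow> int"
  grels :: "('g \<Rightarrow>\<^sub>0 'k) set"

definition smul :: "'k::field \<Rightarrow> ('g \<Rightarrow>\<^sub>0 'k) \<Rightarrow> ('g \<Rightarrow>\<^sub>0 'k)" where
  "smul c p = Poly_Mapping.map ((*) c) p"

lemma lookup_smul: "Poly_Mapping.lookup (smul c p) g = c * Poly_Mapping.lookup p g"
  by (simp add: smul_def Poly_Mapping.map.rep_eq when_def)

lemma vector_space_smul: "vector_space smul"
  by unfold_locales (auto intro!: poly_mapping_eqI simp: lookup_smul lookup_add algebra_simps)

definition free :: "('g, 'k::field) gspace \<Rightarrow> ('g \<Rightarrow>\<^sub>0 'k) set" where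
  "free P = {p. Poly_Mapping.keys p \<subseteq> gens P}"

definition free_deg :: "('g, 'k::field) gspace \<Rightarrow> int \<Rightarrow> ('g \<Rightarrow>\<^sub>0 'k) set" where
  "free_deg P n = {p \<in> free P. \<forall>g\<in>Poly_Mapping.keys p. gdeg P g = n}"

definition qclass :: "('g, 'k::field) gspace \<Rightarrow> ('g \<Rightarrow>\<^sub>0 'k) \<Rightarrow> ('g \<Rightarrow>\<^sub>0 'k) set" where
  "qclass P p = {q \<in> free P. q - p \<in> module.span smul (grels P)}"

text \<open>Linear maps are given by their values on generators: \<open>f :: 'g \<Rightarrow> ('h \<Rightarrow>\<^sub>0 'k)\<close> extends to
  \<open>lin f\<close> on the free spaces, and \<open>induces P P' f\<close> says that this is well defined as a map
  between the quotients. \<open>same_map P P' f g\<close> is equality of the two maps to the quotient \<open>P'\<close>.\<close>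

definition lin :: "('g \<Rightarrow> ('h \<Rightarrow>\<^sub>0 'k::field)) \<Rightarrow> ('g \<Rightarrow>\<^sub>0 'k) \<Rightarrow> ('h \<Rightarrow>\<^sub>0 'k)" where
  "lin f p = (\<Sum>g\<in>Poly_Mapping.keys p. smul (Poly_Mapping.lookup p g) (f g))"

definition lcomp :: "('h \<Rightarrow> ('l \<Rightarrow>\<^sub>0 'k::field)) \<Rightarrow> ('g \<Rightarrow> ('h \<Rightarrow>\<^sub>0 'k)) \<Rightarrow> 'g \<Rightarrow> ('l \<Rightarrow>\<^sub>0 'k)"
    (infixl "\<odot>" 70) where
  "f \<odot> g = (\<lambda>x. lin f (g x))"

definition lid :: "'g \<Rightarrow> ('g \<Rightarrow>\<^sub>0 'k::field)" where
  "lid g = Poly_Mapping.single g 1"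

definition induces :: "('g, 'k::field) gspace \<Rightarrow> ('h, 'k) gspace \<Rightarrow> ('g \<Rightarrow> ('h \<Rightarrow>\<^sub>0 'k)) \<Rightarrow> bool" where
  "induces P P' f \<longleftrightarrow> (\<forall>p\<in>free P. lin f p \<in> free P') \<and>
    (\<forall>p\<in>free P. \<forall>q\<in>free P. qclass P p = qclass P q \<longrightarrow> qclass P' (lin f p) = qclass P' (lin f q))"

definition same_map :: "('g, 'k::field) gspace \<Rightarrow> ('h, 'k) gspace \<Rightarrow>
    ('g \<Rightarrow> ('h \<Rightarrow>\<^sub>0 'k)) \<Rightarrow> ('g \<Rightarrow> ('h \<Rightarrow>\<^sub>0 'k)) \<Rightarrow> bool" where
  "same_map P P' f g \<longleftrightarrow> (\<forall>p\<in>free P. qclass P' (lin f p) = qclass P' (lin g p))"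

definition has_degree :: "int \<Rightarrow> ('g, 'k::field) gspace \<Rightarrow> ('h, 'k) gspace \<Rightarrow>
    ('g \<Rightarrow> ('h \<Rightarrow>\<^sub>0 'k)) \<Rightarrow> bool" where
  "has_degree n P P' f \<longleftrightarrow> (\<forall>k. \<forall>p\<in>free_deg P k.
    \<exists>q\<in>free_deg P' (k + n). qclass P' (lin f p) = qclass P' q)"

text \<open>The shift \<open>V[k]\<close>.\<close>

definition shift :: "int \<Rightarrow> ('g, 'k::field) gspace \<Rightarrow> ('g, 'k) gspace" where
  "shift k P = P\<lparr>gdeg := (\<lambda>g. gdeg P g - k)\<rparr>"


section \<open>Tensor products, symmetric powers and the Koszul sign\<close>

definition tens :: "('g \<Rightarrow>\<^sub>0 'k::field) \<Rightarrow> ('h \<Rightarrow>\<^sub>0 'k) \<Rightarrow> ('g \<times> 'h \<Rightarrow>\<^sub>0 'k)" where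
  "tens p q = (\<Sum>g\<in>Poly_Mapping.keys p. \<Sum>h\<in>Poly_Mapping.keys q.
     Poly_Mapping.single (g, h) (Poly_Mapping.lookup p g * Poly_Mapping.lookup q h))"

definition tensor :: "('g, 'k::field) gspace \<Rightarrow> ('h, 'k) gspace \<Rightarrow> ('g \<times> 'h, 'k) gspace"
    (infixr "\<otimes>\<^sub>s" 72) where
  "P \<otimes>\<^sub>s R = \<lparr>gens = gens P \<times> gens R,
     gdeg = (\<lambda>(g, h). gdeg P g + gdeg R h),
     grels = {tens r (Poly_Mapping.single h 1) |r h. r \<in> grels P \<and> h \<in> gens R}
           \<union> {tens (Poly_Mapping.single g 1) r |g r. g \<in> gens P \<and> r \<in> grels R}\<rparr>"

text \<open>\<open>ktensor e f n g\<close> is \<open>f \<otimes> g\<close> with the Koszul rule, where \<open>n\<close> is the degree of \<open>g\<close> and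
  \<open>e\<close> the degree function on the source of \<open>f\<close>.\<close>

definition ktensor :: "('g \<Rightarrow> int) \<Rightarrow> ('g \<Rightarrow> ('g' \<Rightarrow>\<^sub>0 'k::field)) \<Rightarrow> int \<Rightarrow> ('h \<Rightarrow> ('h' \<Rightarrow>\<^sub>0 'k)) \<Rightarrow>
    'g \<times> 'h \<Rightarrow> ('g' \<times> 'h' \<Rightarrow>\<^sub>0 'k)" where
  "ktensor e f n g = (\<lambda>(x, y). smul ((-1) powi (n * e x)) (tens (f x) (g y)))"

definition reassoc :: "('g \<times> 'h) \<times> 'l \<Rightarrow> ('g \<times> 'h \<times> 'l \<Rightarrow>\<^sub>0 'k::field)" where
  "reassoc = (\<lambda>((x, y), z). Poly_Mapping.single (x, y, z) 1)"

definition twist :: "('g \<Rightarrow> int) \<Rightarrow> 'g \<times> 'g \<Rightarrow> ('g \<times> 'g \<Rightarrow>\<^sub>0 'k::field)" where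
  "twist e = (\<lambda>(x, y). Poly_Mapping.single (y, x) ((-1) powi (e x * e y)))"

definition twist12 :: "('g \<Rightarrow> int) \<Rightarrow> 'g \<times> 'g \<times> 'g \<Rightarrow> ('g \<times> 'g \<times> 'g \<Rightarrow>\<^sub>0 'k::field)" where
  "twist12 e = (\<lambda>(x, y, z). Poly_Mapping.single (y, x, z) ((-1) powi (e x * e y)))"

definition twist23 :: "('g \<Rightarrow> int) \<Rightarrow> 'g \<times> 'g \<times> 'g \<Rightarrow> ('g \<times> 'g \<times> 'g \<Rightarrow>\<^sub>0 'k::field)" where
  "twist23 e = (\<lambda>(x, y, z). Poly_Mapping.single (x, z, y) ((-1) powi (e y * e z)))"

definition word_deg :: "('g \<Rightarrow> int) \<Rightarrow> 'g list \<Rightarrow> int" where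
  "word_deg e w = sum_list (map e w)"

text \<open>The sum of the tensor powers \<open>P\<^sup>\<otimes>\<^sup>n\<close>, \<open>n \<ge> 1\<close>; the word \<open>[g\<^sub>1, \<dots>, g\<^sub>n]\<close> stands for
  \<open>g\<^sub>1 \<otimes> \<dots> \<otimes> g\<^sub>n\<close>.\<close>

definition tensor_plus :: "('g, 'k::field) gspace \<Rightarrow> ('g list, 'k) gspace" where
  "tensor_plus P = \<lparr>gens = {w. w \<noteq> [] \<and> set w \<subseteq> gens P},
     gdeg = word_deg (gdeg P),
     grels = {lin (\<lambda>g. Poly_Mapping.single (u @ g # v) 1) r |u v r.
                set u \<subseteq> gens P \<and> set v \<subseteq> gens P \<and> r \<in> grels P}\<rparr>"

text \<open>The sum of the graded symmetric powers \<open>S\<^sup>n(P)\<close>, \<open>n \<ge> 1\<close>; the word \<open>[g\<^sub>1, \<dots>, g\<^sub>n]\<close> now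
  stands for the product \<open>g\<^sub>1 \<cdots> g\<^sub>n\<close>.\<close>

definition sym_plus :: "('g, 'k::field) gspace \<Rightarrow> ('g list, 'k) gspace" where
  "sym_plus P = (tensor_plus P)\<lparr>grels := grels (tensor_plus P) \<union>
     {Poly_Mapping.single (u @ g # h # v) 1
        - Poly_Mapping.single (u @ h # g # v) ((-1) powi (gdeg P g * gdeg P h)) |u v g h.
        set u \<subseteq> gens P \<and> set v \<subseteq> gens P \<and> g \<in> gens P \<and> h \<in> gens P}\<rparr>"

text \<open>\<open>koszul e js\<close> is the Koszul sign of passing from elements of degrees \<open>e 0, e 1, \<dots>\<close> to
  their rearrangement in the order \<open>js\<close>: the signature, computed by counting inversions, of the
  permutation induced on the odd elements.\<close>

definition koszul :: "(nat \<Rightarrow> int) \<Rightarrow> nat list \<Rightarrow> 'k::field" where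
  "koszul e js = (-1) ^ card {(r, s). r < s \<and> s < length js \<and> js ! s < js ! r \<and>
                                odd (e (js ! r)) \<and> odd (e (js ! s))}"


section \<open>Shuffles and the space \<open>\<H>\<close>\<close>

text \<open>Positions are counted from 0.\<close>

definition Bat :: "nat \<Rightarrow> nat \<Rightarrow> (nat \<Rightarrow> nat) set" where
  "Bat p q = {\<sigma>. \<sigma> permutes {..<p + q} \<and> strict_mono_on {..<p} \<sigma> \<and> strict_mono_on {p..<p + q} \<sigma>}"

definition rearrange :: "(nat \<Rightarrow> nat) \<Rightarrow> 'g list \<Rightarrow> 'g list" where
  "rearrange \<sigma> w = map (\<lambda>i. w ! inv \<sigma> i) [0..<length w]"

definition koszul_inv :: "('g \<Rightarrow> int) \<Rightarrow> 'g list \<Rightarrow> (nat \<Rightarrow> nat) \<Rightarrow> 'k::field" where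
  "koszul_inv e w \<sigma> = koszul (\<lambda>i. e (w ! i)) (map (inv \<sigma>) [0..<length w])"

definition bat :: "('g \<Rightarrow> int) \<Rightarrow> 'g list \<Rightarrow> 'g list \<Rightarrow> ('g list \<Rightarrow>\<^sub>0 'k::field)" where
  "bat e u v = (\<Sum>\<sigma>\<in>Bat (length u) (length v).
     Poly_Mapping.single (rearrange \<sigma> (u @ v)) (koszul_inv e (u @ v) \<sigma>))"

definition bat_quotient :: "('g, 'k::field) gspace \<Rightarrow> ('g list, 'k) gspace" where
  "bat_quotient P = (tensor_plus P)\<lparr>grels := grels (tensor_plus P) \<union>
     {bat (gdeg P) u v |u v. u \<in> gens (tensor_plus P) \<and> v \<in> gens (tensor_plus P)}\<rparr>"

text \<open>The graded space \<open>\<A>\<close> itself: the generator \<open>(i, x)\<close> is the element \<open>x \<in> A i\<close>, and the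
  relations are those of the vector spaces \<open>A i\<close>.\<close>

definition algebra_space :: "('k::field \<Rightarrow> 'v::ab_group_add \<Rightarrow> 'v) \<Rightarrow> (int \<Rightarrow> 'v set) \<Rightarrow>
    (int \<times> 'v, 'k) gspace" where
  "algebra_space scale A = \<lparr>gens = {(i, x). x \<in> A i}, gdeg = fst,
     grels = {Poly_Mapping.single (i, scale s x + scale t y) 1
                - Poly_Mapping.single (i, x) s - Poly_Mapping.single (i, y) t |i x y s t.
                x \<in> A i \<and> y \<in> A i}\<rparr>"

definition V_space :: "('k::field \<Rightarrow> 'v::ab_group_add \<Rightarrow> 'v) \<Rightarrow> (int \<Rightarrow> 'v set) \<Rightarrow> int \<Rightarrow>
    (int \<times> 'v, 'k) gspace" where
  "V_space scale A a = shift (- a + 1) (algebra_space scale A)"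

definition H_space :: "('k::field \<Rightarrow> 'v::ab_group_add \<Rightarrow> 'v) \<Rightarrow> (int \<Rightarrow> 'v set) \<Rightarrow> int \<Rightarrow>
    ((int \<times> 'v) list, 'k) gspace" where
  "H_space scale A a = bat_quotient (V_space scale A a)"

definition S_space :: "('k::field \<Rightarrow> 'v::ab_group_add \<Rightarrow> 'v) \<Rightarrow> (int \<Rightarrow> 'v set) \<Rightarrow> int \<Rightarrow> int \<Rightarrow>
    ((int \<times> 'v) list list, 'k) gspace" where
  "S_space scale A a b = sym_plus (shift (a - b) (H_space scale A a))"

text \<open>The degree functions of \<open>\<A>[-a+1]\<close> (letters), \<open>\<H>\<close> (written \<open>x\<close>) and \<open>\<H>[a-b]\<close> (written
  \<open>x''\<close>).\<close>

definition ldeg :: "int \<Rightarrow> int \<times> 'v \<Rightarrow> int" where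
  "ldeg a \<alpha> = fst \<alpha> + a - 1"

definition hdeg :: "int \<Rightarrow> (int \<times> 'v) list \<Rightarrow> int" where
  "hdeg a = word_deg (ldeg a)"

definition hdeg2 :: "int \<Rightarrow> int \<Rightarrow> (int \<times> 'v) list \<Rightarrow> int" where
  "hdeg2 a b X = hdeg a X - a + b"

lemma gdeg_spaces:
  "gdeg (V_space scale A a) = ldeg a"
  "gdeg (H_space scale A a) = hdeg a"
  "gdeg (shift (a - b) (H_space scale A a)) = hdeg2 a b"
  "gdeg (S_space scale A a b) = word_deg (hdeg2 a b)"
  by (auto simp: V_space_def H_space_def S_space_def algebra_space_def shift_def bat_quotient_def
      sym_plus_def tensor_plus_def ldeg_def hdeg_def hdeg2_def fun_eq_iff word_deg_def algebra_simps
      intro!: arg_cong[of _ _ sum_list])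


section \<open>The operations\<close>

definition d_letter :: "('v \<Rightarrow> 'v) \<Rightarrow> int \<times> 'v \<Rightarrow> int \<times> 'v" where
  "d_letter d = (\<lambda>(i, x). (i + 1, d x))"

definition mu_letter :: "('k::field \<Rightarrow> 'v::ab_group_add \<Rightarrow> 'v) \<Rightarrow> int \<Rightarrow> ('v \<Rightarrow> 'v \<Rightarrow> 'v) \<Rightarrow>
    int \<times> 'v \<Rightarrow> int \<times> 'v \<Rightarrow> int \<times> 'v" where
  "mu_letter scale a mul \<alpha> \<beta> =
     (fst \<alpha> + fst \<beta> + a, scale ((-1) powi ldeg a \<alpha>) (mul (snd \<alpha>) (snd \<beta>)))"

definition ell_letter :: "('k::field \<Rightarrow> 'v::ab_group_add \<Rightarrow> 'v) \<Rightarrow> int \<Rightarrow> int \<Rightarrow> ('v \<Rightarrow> 'v \<Rightarrow> 'v) \<Rightarrow>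
    int \<times> 'v \<Rightarrow> int \<times> 'v \<Rightarrow> int \<times> 'v" where
  "ell_letter scale a b brk \<alpha> \<beta> =
     (fst \<alpha> + fst \<beta> + b, scale ((-1) powi ((b - a + 1) * ldeg a \<alpha>)) (brk (snd \<alpha>) (snd \<beta>)))"

definition d1 :: "int \<Rightarrow> ('v \<Rightarrow> 'v) \<Rightarrow> (int \<times> 'v) list \<Rightarrow> ((int \<times> 'v) list \<Rightarrow>\<^sub>0 'k::field)" where
  "d1 a d w = (\<Sum>k<length w.
     Poly_Mapping.single (take k w @ d_letter d (w ! k) # drop (k + 1) w)
       ((-1) powi hdeg a (take k w)))"

definition mu1 :: "('k::field \<Rightarrow> 'v::ab_group_add \<Rightarrow> 'v) \<Rightarrow> int \<Rightarrow> ('v \<Rightarrow> 'v \<Rightarrow> 'v) \<Rightarrow>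
    (int \<times> 'v) list \<Rightarrow> ((int \<times> 'v) list \<Rightarrow>\<^sub>0 'k)" where
  "mu1 scale a mul w = (\<Sum>k<length w - 1.
     Poly_Mapping.single (take k w @ mu_letter scale a mul (w ! k) (w ! (k + 1)) # drop (k + 2) w)
       ((-1) powi hdeg a (take k w)))"

definition D :: "('k::field \<Rightarrow> 'v::ab_group_add \<Rightarrow> 'v) \<Rightarrow> int \<Rightarrow> ('v \<Rightarrow> 'v \<Rightarrow> 'v) \<Rightarrow> ('v \<Rightarrow> 'v) \<Rightarrow>
    (int \<times> 'v) list \<Rightarrow> ((int \<times> 'v) list \<Rightarrow>\<^sub>0 'k)" where
  "D scale a mul d w = d1 a d w + mu1 scale a mul w"

definition ell2 :: "('k::field \<Rightarrow> 'v::ab_group_add \<Rightarrow> 'v) \<Rightarrow> int \<Rightarrow> int \<Rightarrow> ('v \<Rightarrow> 'v \<Rightarrow> 'v) \<Rightarrow>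
    (int \<times> 'v) list \<Rightarrow> (int \<times> 'v) list \<Rightarrow> ((int \<times> 'v) list \<Rightarrow>\<^sub>0 'k)" where
  "ell2 scale a b brk X Y =
     (let p = length X; q = length Y in
      \<Sum>\<sigma>\<in>Bat p q. \<Sum>k\<in>{k. k + 1 < p + q \<and> inv \<sigma> k < p \<and> p \<le> inv \<sigma> (k + 1)}.
        let w = rearrange \<sigma> (X @ Y) in
        Poly_Mapping.single
          (take k w @ ell_letter scale a b brk (w ! k) (w ! (k + 1)) # drop (k + 2) w)
          (koszul_inv (ldeg a) (X @ Y) \<sigma> * (-1) powi ((b - a + 1) * hdeg a (take k w))))"

text \<open>\<open>\<ell>'\<^sub>2\<close>, with \<open>x' = x - a + b + 1\<close>, and \<open>\<ell>''\<^sub>2\<close>.\<close>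

definition ell2' :: "('k::field \<Rightarrow> 'v::ab_group_add \<Rightarrow> 'v) \<Rightarrow> int \<Rightarrow> int \<Rightarrow> ('v \<Rightarrow> 'v \<Rightarrow> 'v) \<Rightarrow>
    (int \<times> 'v) list \<Rightarrow> (int \<times> 'v) list \<Rightarrow> ((int \<times> 'v) list \<Rightarrow>\<^sub>0 'k)" where
  "ell2' scale a b brk X Y =
     smul ((-1) powi ((a - b - 1) * (hdeg a X - a + b + 1))) (ell2 scale a b brk X Y)"

definition ell2'' :: "('k::field \<Rightarrow> 'v::ab_group_add \<Rightarrow> 'v) \<Rightarrow> int \<Rightarrow> int \<Rightarrow> ('v \<Rightarrow> 'v \<Rightarrow> 'v) \<Rightarrow>
    (int \<times> 'v) list \<Rightarrow> (int \<times> 'v) list \<Rightarrow> ((int \<times> 'v) list \<Rightarrow>\<^sub>0 'k)" where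
  "ell2'' scale a b brk X Y = smul ((-1) powi hdeg2 a b X) (ell2' scale a b brk X Y)"

text \<open>Below \<open>Xs = [X\<^sub>0, \<dots>, X\<^sub>n\<^sub>-\<^sub>1]\<close> is the product \<open>X\<^sub>0 \<cdots> X\<^sub>n\<^sub>-\<^sub>1\<close> and \<open>nths Xs I\<close> is \<open>X\<^sub>I\<close>.
  \<open>eps\<close> is the Koszul sign for the degrees \<open>x''\<close>.\<close>

definition eps :: "int \<Rightarrow> int \<Rightarrow> (int \<times> 'v) list list \<Rightarrow> nat list \<Rightarrow> 'k::field" where
  "eps a b Xs js = koszul (\<lambda>i. hdeg2 a b (Xs ! i)) js"

definition Delta :: "int \<Rightarrow> int \<Rightarrow> (int \<times> 'v) list list \<Rightarrow>
    ((int \<times> 'v) list list \<times> (int \<times> 'v) list list \<Rightarrow>\<^sub>0 'k::field)" where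
  "Delta a b Xs =
     (\<Sum>(I, J)\<in>{(I, J). I \<union> J = {..<length Xs} \<and> I \<inter> J = {} \<and> I \<noteq> {} \<and> J \<noteq> {}}.
        Poly_Mapping.single (nths Xs I, nths Xs J)
          (eps a b Xs (sorted_list_of_set I @ sorted_list_of_set J)))"

definition delta :: "int \<Rightarrow> int \<Rightarrow> (int \<times> 'v) list list \<Rightarrow>
    ((int \<times> 'v) list list \<times> (int \<times> 'v) list list \<Rightarrow>\<^sub>0 'k::field)" where
  "delta a b Xs =
     (\<Sum>s<length Xs. \<Sum>(I, J)\<in>{(I, J). I \<union> J = {..<length Xs} - {s} \<and> I \<inter> J = {}}.
        smul (eps a b Xs (sorted_list_of_set I @ [s] @ sorted_list_of_set J))
          (\<Sum>j\<in>{1..<length (Xs ! s)}.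
             let U = take j (Xs ! s); V = drop j (Xs ! s); u = hdeg2 a b U; v = hdeg2 a b V in
             smul ((-1) powi ((a - b) * (word_deg (hdeg2 a b) (nths Xs I) + u)))
               (Poly_Mapping.single (nths Xs I @ [U], [V] @ nths Xs J) 1
                + Poly_Mapping.single (nths Xs I @ [V], [U] @ nths Xs J)
                    ((-1) powi (u * v + a - b + 1)))))"

definition m_map :: "('k::field \<Rightarrow> 'v::ab_group_add \<Rightarrow> 'v) \<Rightarrow> int \<Rightarrow> int \<Rightarrow> ('v \<Rightarrow> 'v \<Rightarrow> 'v) \<Rightarrow>
    ('v \<Rightarrow> 'v) \<Rightarrow> (int \<times> 'v) list list \<Rightarrow> ((int \<times> 'v) list list \<Rightarrow>\<^sub>0 'k)" where
  "m_map scale a b mul d Xs =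
     (\<Sum>i<length Xs. let K = {..<length Xs} - {i} in
        smul (eps a b Xs (i # sorted_list_of_set K))
          (lin (\<lambda>w. Poly_Mapping.single (w # nths Xs K) 1) (D scale a mul d (Xs ! i))))"

definition ell_map :: "('k::field \<Rightarrow> 'v::ab_group_add \<Rightarrow> 'v) \<Rightarrow> int \<Rightarrow> int \<Rightarrow> ('v \<Rightarrow> 'v \<Rightarrow> 'v) \<Rightarrow>
    (int \<times> 'v) list list \<Rightarrow> ((int \<times> 'v) list list \<Rightarrow>\<^sub>0 'k)" where
  "ell_map scale a b brk Xs =
     (\<Sum>j<length Xs. \<Sum>i<j. let K = {..<length Xs} - {i, j} in
        smul (eps a b Xs (i # j # sorted_list_of_set K))
          (lin (\<lambda>w. Poly_Mapping.single (w # nths Xs K) 1) (ell2'' scale a b brk (Xs ! i) (Xs ! j))))"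

definition Q_map :: "('k::field \<Rightarrow> 'v::ab_group_add \<Rightarrow> 'v) \<Rightarrow> int \<Rightarrow> int \<Rightarrow> ('v \<Rightarrow> 'v \<Rightarrow> 'v) \<Rightarrow>
    ('v \<Rightarrow> 'v \<Rightarrow> 'v) \<Rightarrow> ('v \<Rightarrow> 'v) \<Rightarrow> (int \<times> 'v) list list \<Rightarrow> ((int \<times> 'v) list list \<Rightarrow>\<^sub>0 'k)" where
  "Q_map scale a b mul brk d Xs = m_map scale a b mul d Xs + ell_map scale a b brk Xs"


section \<open>Graded codifferential bicoalgebras\<close>

text \<open>Threefold tensors are identified with \<open>C \<otimes>\<^sub>s C \<otimes>\<^sub>s C\<close>, bracketed to the right. In the Koszul
  rule the cobracket has degree \<open>n\<close>; on degrees it is homogeneous of degree \<open>-n\<close>, which has the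
  same parity (for \<open>\<delta>''\<close>: \<open>n = a - b\<close> and \<open>u'' + v'' = x'' - (a - b)\<close>).\<close>

definition codifferential_bicoalgebra :: "int \<Rightarrow> ('c, 'k::field) gspace \<Rightarrow>
    ('c \<Rightarrow> ('c \<times> 'c \<Rightarrow>\<^sub>0 'k)) \<Rightarrow> ('c \<Rightarrow> ('c \<times> 'c \<Rightarrow>\<^sub>0 'k)) \<Rightarrow> ('c \<Rightarrow> ('c \<Rightarrow>\<^sub>0 'k)) \<Rightarrow> bool" where
  "codifferential_bicoalgebra n C \<Delta> \<delta> Q \<longleftrightarrow>
   (let e = gdeg C;
        CC = C \<otimes>\<^sub>s C;
        CCC = C \<otimes>\<^sub>s C \<otimes>\<^sub>s C;
        \<tau> = twist e; \<tau>12 = twist12 e; \<tau>23 = twist23 e;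
        \<Delta>_id = reassoc \<odot> ktensor e \<Delta> 0 lid;
        id_\<Delta> = ktensor e lid 0 \<Delta>;
        \<delta>_id = reassoc \<odot> ktensor e \<delta> 0 lid;
        id_\<delta> = ktensor e lid n \<delta>;
        Q_id_Q = (\<lambda>x. ktensor e Q 0 lid x + ktensor e lid 1 Q x)
    in
     \<comment> \<open>cocommutative coassociative coproduct\<close>
     induces C CC \<Delta> \<and> has_degree 0 C CC \<Delta> \<and>
     same_map C CC (\<tau> \<odot> \<Delta>) \<Delta> \<and>
     same_map C CCC (\<Delta>_id \<odot> \<Delta>) (id_\<Delta> \<odot> \<Delta>) \<and>
     \<comment> \<open>Lie cobracket\<close>
     induces C CC \<delta> \<and> has_degree (- n) C CC \<delta> \<and>
     same_map C CC (\<tau> \<odot> \<delta>) (\<lambda>x. - smul ((-1) powi n) (\<delta> x)) \<and>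
     same_map C CCC
       (\<lambda>x. (\<delta>_id \<odot> \<delta>) x + (\<tau>12 \<odot> \<tau>23 \<odot> \<delta>_id \<odot> \<delta>) x + (\<tau>23 \<odot> \<tau>12 \<odot> \<delta>_id \<odot> \<delta>) x) (\<lambda>x. 0) \<and>
     \<comment> \<open>coLeibniz identity\<close>
     same_map C CCC (id_\<Delta> \<odot> \<delta>) (\<lambda>x. (\<delta>_id \<odot> \<Delta>) x + (\<tau>12 \<odot> id_\<delta> \<odot> \<Delta>) x) \<and>
     \<comment> \<open>codifferential\<close>
     induces C C Q \<and> has_degree 1 C C Q \<and>
     same_map C C (Q \<odot> Q) (\<lambda>x. 0) \<and>
     same_map C CC (Q_id_Q \<odot> \<Delta>) (\<Delta> \<odot> Q) \<and>
     same_map C CC (Q_id_Q \<odot> \<delta>) (\<lambda>x. smul ((-1) powi n) ((\<delta> \<odot> Q) x)))"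

end

(* An element of a quotient of a free space is zero iff every functional that kills the relations
   kills it, so each identity between maps becomes an identity between their transposes, acting on
   functionals. On words, shuffles, D, l_2 and the deconcatenation satisfy recursions on the first
   letters; induction on words shows that, on functionals vanishing on shuffles and on the relations
   of the letters, D and l''_2 form a differential graded Lie algebra on H[a-b] and the
   antisymmetrized deconcatenation a Lie cobracket compatible with both. For any such Lie bialgebra
   modulo relations, unshuffling, the coLeibniz extension of the cobracket and the
   Chevalley-Eilenberg coderivation make the symmetric coalgebra a codifferential bicoalgebra, by
   induction on the number of factors. *)
theory Submission
  imports Defs
begin

section \<open>Linear functionals on quotients of free spaces\<close>

text \<open>Almost every identity holds already on tensor words, for functionals that respect only
  the linear relations between letters. Shuffle relations enter when the operations have to descend
  to \<H>, and among the identities only in the compatibility of cobracket and bracket: a cut of a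
  shuffle or of a bracket has mixed terms that vanish only modulo shuffles. With functionals these
  become side conditions on \<phi>, no representatives are chosen, and a composite of maps becomes a
  nest of functionals in the opposite order. Two obstacles shape the rest. Signs depend on the
  degree of the word handed to the functional, so each operation has a congruence rule that fixes
  this degree, and relations are required to be homogeneous so that signs factor out of them. The
  list types contain lists that are no generators, so functionals are clipped and operations are
  extended by 0. The constants come from the shift to \<H>[a-b]: with \<open>n = a - b\<close> the
  bracket has degree \<open>c = 1 - n\<close> on words and degree 1 after the shift, and the two
  sign changes in its definition multiply to -(-1)^(n x).\<close>

definition ev :: "('g \<Rightarrow> 'k::field) \<Rightarrow> ('g \<Rightarrow>\<^sub>0 'k) \<Rightarrow> 'k" where
  "ev \<phi> p = (\<Sum>g\<in>Poly_Mapping.keys p. Poly_Mapping.lookup p g * \<phi> g)"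

lemma ev_superset:
  assumes "finite S" "Poly_Mapping.keys p \<subseteq> S"
  shows "ev \<phi> p = (\<Sum>g\<in>S. Poly_Mapping.lookup p g * \<phi> g)"
  unfolding ev_def using assms by (intro sum.mono_neutral_left) (auto simp: in_keys_iff)

lemma ev_zero [simp]: "ev \<phi> 0 = 0"
  by (simp add: ev_def)

lemma ev_single [simp]: "ev \<phi> (Poly_Mapping.single g c) = c * \<phi> g"
  by (subst ev_superset[of "{g}"]) (auto simp: lookup_single)

lemma ev_add [simp]: "ev \<phi> (p + q) = ev \<phi> p + ev \<phi> q"
proof -
  let ?S = "Poly_Mapping.keys p \<union> Poly_Mapping.keys q"
  have "Poly_Mapping.keys (p + q) \<subseteq> ?S" by (rule keys_add)
  then show ?thesis
    by (simp add: ev_superset[of ?S] lookup_add sum.distrib distrib_right)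
qed

lemma ev_smul [simp]: "ev \<phi> (smul c p) = c * ev \<phi> p"
proof -
  have "Poly_Mapping.keys (smul c p) \<subseteq> Poly_Mapping.keys p"
    by (auto simp: in_keys_iff lookup_smul)
  then show ?thesis
    by (simp add: ev_superset[of "Poly_Mapping.keys p"] lookup_smul sum_distrib_left mult.assoc)
qed

lemma ev_uminus [simp]: "ev \<phi> (- p) = - ev \<phi> p"
proof -
  have "- p = smul (-1) p"
    by (rule poly_mapping_eqI) (simp add: lookup_smul)
  then show ?thesis by simp
qed

lemma ev_diff [simp]: "ev \<phi> (p - q) = ev \<phi> p - ev \<phi> q"
  using ev_add[of \<phi> p "- q"] by simp

lemma ev_sum [simp]: "ev \<phi> (\<Sum>i\<in>I. f i) = (\<Sum>i\<in>I. ev \<phi> (f i))"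
  by (induction I rule: infinite_finite_induct) auto

lemma ev_lin [simp]: "ev \<phi> (lin f p) = ev (\<lambda>g. ev \<phi> (f g)) p"
  by (simp add: lin_def ev_def[of _ p])

lemma ev_tens [simp]: "ev \<phi> (tens p q) = ev (\<lambda>g. ev (\<lambda>h. \<phi> (g, h)) q) p"
  by (simp add: tens_def ev_def[of _ p] ev_def[of _ q] sum_distrib_left mult.assoc)

lemma ev_cong: "(\<And>g. g \<in> Poly_Mapping.keys p \<Longrightarrow> \<phi> g = \<psi> g) \<Longrightarrow> ev \<phi> p = ev \<psi> p"
  by (simp add: ev_def)

lemma ev_fun_zero [simp]: "ev (\<lambda>g. 0) p = 0"
  by (simp add: ev_def)

lemma ev_fun_add: "ev (\<lambda>g. \<phi> g + \<psi> g) p = ev \<phi> p + ev \<psi> p"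
  by (simp add: ev_def distrib_left sum.distrib)

lemma ev_fun_uminus: "ev (\<lambda>g. - \<phi> g) p = - ev \<phi> p"
  by (simp add: ev_def sum_negf)

lemma ev_fun_diff: "ev (\<lambda>g. \<phi> g - \<psi> g) p = ev \<phi> p - ev \<psi> p"
  by (simp add: ev_def right_diff_distrib sum_subtractf)

lemma ev_fun_mult: "ev (\<lambda>g. c * \<phi> g) p = c * ev \<phi> p"
  by (simp add: ev_def sum_distrib_left mult.left_commute)

lemma ev_fun_mult_right: "ev (\<lambda>g. \<phi> g * c) p = ev \<phi> p * c"
  by (simp add: ev_def sum_distrib_right mult.assoc)

lemma ev_swap: "ev (\<lambda>x. ev (\<lambda>y. F x y) q) p = ev (\<lambda>y. ev (\<lambda>x. F x y) p) q"
  unfolding ev_def sum_distrib_left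
  by (subst sum.swap) (simp add: mult.left_commute)

text \<open>\<open>algebra_simps\<close> sorts products, so a factor that is constant in the bound
  variable may end up anywhere in a right-nested product, while \<open>ev_fun_mult\<close> sees it
  only as an outermost factor. One rule per depth lets the simplifier extract it. The lists of the
  same shape for the other operations serve the same purpose.\<close>

lemma ev_mult_deep:
  "ev (\<lambda>x. f x * (k * g x)) p = k * ev (\<lambda>x. f x * g x) p"
  "ev (\<lambda>x. f x * (g x * k)) p = k * ev (\<lambda>x. f x * g x) p"
  "ev (\<lambda>x. f x * (h x * (k * g x))) p = k * ev (\<lambda>x. f x * (h x * g x)) p"
  "ev (\<lambda>x. f x * (h x * (g x * k))) p = k * ev (\<lambda>x. f x * (h x * g x)) p"
  "ev (\<lambda>x. f x * (h x * (h2 x * (k * g x)))) p = k * ev (\<lambda>x. f x * (h x * (h2 x * g x))) p"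
  "ev (\<lambda>x. f x * (h x * (h2 x * (g x * k)))) p = k * ev (\<lambda>x. f x * (h x * (h2 x * g x))) p"
  "ev (\<lambda>x. f x * (h x * (h2 x * (h3 x * (k * g x))))) p = k * ev (\<lambda>x. f x * (h x * (h2 x * (h3 x * g x)))) p"
  "ev (\<lambda>x. f x * (h x * (h2 x * (h3 x * (g x * k))))) p = k * ev (\<lambda>x. f x * (h x * (h2 x * (h3 x * g x)))) p"
  by (simp_all only: ev_fun_mult[symmetric] ac_simps)

lemmas ev_lins = ev_fun_add ev_fun_uminus ev_fun_diff ev_fun_mult ev_fun_mult_right ev_mult_deep

lemma poly_mapping_eq_sum:
  "p = (\<Sum>g\<in>Poly_Mapping.keys p. smul (Poly_Mapping.lookup p g) (Poly_Mapping.single g 1))"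
  by (rule poly_mapping_eqI)
    (auto simp: lookup_sum lookup_smul lookup_single when_def in_keys_iff if_distrib cong: if_cong)

text \<open>If \<open>p\<close> were outside the span, then \<open>p\<close> and a basis
  \<open>B\<close> of the span chosen inside \<open>R\<close> would be independent, and some linear
  functional would be 1 at \<open>p\<close> and 0 on \<open>B\<close>. This separation of a point
  from a subspace is what makes the passage to functionals faithful.\<close>

lemma in_span_if_ev:
  fixes p :: "'g \<Rightarrow>\<^sub>0 'k::field"
  assumes "\<And>\<phi>. (\<And>r. r \<in> R \<Longrightarrow> ev \<phi> r = 0) \<Longrightarrow> ev \<phi> p = 0"
  shows "p \<in> module.span smul R"
proof (rule ccontr)
  interpret V: vector_space "smul :: 'k \<Rightarrow> ('g \<Rightarrow>\<^sub>0 'k) \<Rightarrow> _" by (rule vector_space_smul)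
  interpret K: vector_space "(*) :: 'k \<Rightarrow> 'k \<Rightarrow> 'k" by unfold_locales (auto simp: algebra_simps)
  interpret VK: vector_space_pair "smul :: 'k \<Rightarrow> ('g \<Rightarrow>\<^sub>0 'k) \<Rightarrow> _" "(*) :: 'k \<Rightarrow> 'k \<Rightarrow> 'k" ..
  assume p: "p \<notin> V.span R"
  obtain B where B: "B \<subseteq> R" "V.independent B" "R \<subseteq> V.span B"
    using V.maximal_independent_subset[of R] by auto
  have span: "V.span B = V.span R"
    using B by (metis V.span_mono V.span_span subset_antisym)
  have "V.independent (insert p B)"
    using p B span by (simp add: V.independent_insert)
  from VK.linear_independent_extend[OF this, of "\<lambda>x. if x = p then 1 else 0"]
  obtain f where f: "Vector_Spaces.linear smul (*) f"
    and fB: "\<And>x. x \<in> insert p B \<Longrightarrow> f x = (if x = p then 1 else 0)" by blast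
  interpret f: Vector_Spaces.linear smul "(*)" f by (rule f)
  \<comment> \<open>A linear functional on the free space is determined by its values on the
    generators, hence equals \<open>ev \<phi>\<close>.\<close>
  define \<phi> where "\<phi> = (\<lambda>g. f (Poly_Mapping.single g 1))"
  have ev: "ev \<phi> q = f q" for q
    by (subst (2) poly_mapping_eq_sum[of q]) (simp add: ev_def \<phi>_def f.sum f.scale)
  have "p \<notin> B" using p span V.span_base by auto
  then have "f x = 0" if "x \<in> B" for x using fB that by auto
  then have "f x = 0" if "x \<in> V.span B" for x
    using that by (rule VK.linear_eq_0_on_span[OF f])
  then have "ev \<phi> r = 0" if "r \<in> R" for r using that B by (auto simp: ev)
  from assms[OF this] show False using fB[of p] by (simp add: ev)
qed

lemma ev_in_span:
  assumes "p \<in> module.span smul R" "\<And>r. r \<in> R \<Longrightarrow> ev \<phi> r = 0"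
  shows "ev \<phi> p = (0::'k::field)"
proof -
  interpret V: vector_space "smul :: 'k \<Rightarrow> _" by (rule vector_space_smul)
  show ?thesis using assms(1)
    by (induction rule: V.span_induct_alt) (auto simp: assms(2))
qed

text \<open>Applied to the indicator of a disallowed generator \<open>g\<close>, the assumption says
  that the coefficient of \<open>p\<close> at \<open>g\<close> is 0.\<close>

lemma free_degI:
  fixes p :: "'g \<Rightarrow>\<^sub>0 'k::field"
  assumes "\<And>\<phi>. (\<And>g. g \<in> gens P \<Longrightarrow> gdeg P g = k \<Longrightarrow> \<phi> g = 0) \<Longrightarrow> ev \<phi> p = 0"
  shows "p \<in> free_deg P k"
proof -
  have "g \<in> gens P \<and> gdeg P g = k" if "g \<in> Poly_Mapping.keys p" for g
  proof (rule ccontr)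
    assume n: "\<not> (g \<in> gens P \<and> gdeg P g = k)"
    have "ev (\<lambda>h. if h = g then 1 else 0) p = 0"
      using n by (intro assms) auto
    moreover have "ev (\<lambda>h. if h = g then 1 else 0) p = Poly_Mapping.lookup p g"
      using that by (simp add: ev_def if_distrib cong: if_cong)
    ultimately show False using that by (simp add: in_keys_iff)
  qed
  then show ?thesis by (auto simp: free_deg_def free_def)
qed

lemma qclass_eqI:
  fixes p :: "'g \<Rightarrow>\<^sub>0 'k::field"
  assumes "\<And>\<phi>. (\<And>r. r \<in> grels P \<Longrightarrow> ev \<phi> r = 0) \<Longrightarrow> ev \<phi> p = ev \<phi> q"
  shows "qclass P p = qclass P q"
proof -
  interpret V: vector_space "smul :: 'k \<Rightarrow> ('g \<Rightarrow>\<^sub>0 'k) \<Rightarrow> _" by (rule vector_space_smul)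
  have pq: "p - q \<in> V.span (grels P)"
    by (rule in_span_if_ev) (simp add: assms)
  have "h - p \<in> V.span (grels P) \<longleftrightarrow> h - q \<in> V.span (grels P)" for h
    using V.span_add[OF _ pq, of "h - p"] V.span_diff[OF _ pq, of "h - q"] by auto
  then show ?thesis by (simp add: qclass_def)
qed

lemma ev_eq_if_qclass_eq:
  fixes p :: "'g \<Rightarrow>\<^sub>0 'k::field"
  assumes "qclass P p = qclass P q" "p \<in> free P" "\<And>r. r \<in> grels P \<Longrightarrow> ev \<phi> r = 0"
  shows "ev \<phi> p = ev \<phi> q"
proof -
  interpret V: vector_space "smul :: 'k \<Rightarrow> ('g \<Rightarrow>\<^sub>0 'k) \<Rightarrow> _" by (rule vector_space_smul)
  \<comment> \<open>A class contains elements of \<open>free P\<close> only, so \<open>p\<close>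
    represents its own class because it lies there.\<close>
  have "p \<in> qclass P p" using assms(2) by (simp add: qclass_def V.span_zero)
  then have "p \<in> qclass P q" by (simp only: assms(1))
  then have "p - q \<in> V.span (grels P)" by (simp add: qclass_def)
  from ev_in_span[OF this, of \<phi>] show ?thesis by (simp add: assms(3))
qed

lemma same_mapI:
  assumes "\<And>\<phi> g. (\<And>r. r \<in> grels P' \<Longrightarrow> ev \<phi> r = 0) \<Longrightarrow> g \<in> gens P \<Longrightarrow>
    ev \<phi> (f g) = ev \<phi> (f' g)"
  shows "same_map P P' f f'"
  unfolding same_map_def
proof (intro ballI qclass_eqI)
  fix p \<phi> assume "p \<in> free P" and *: "\<And>r. r \<in> grels P' \<Longrightarrow> ev \<phi> r = 0"
  then show "ev \<phi> (lin f p) = ev \<phi> (lin f' p)"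
    using assms[OF *] by (auto simp: free_def intro!: ev_cong)
qed

lemma has_degreeI:
  fixes f :: "'g \<Rightarrow> ('h \<Rightarrow>\<^sub>0 'k::field)"
  assumes "\<And>\<phi> g. g \<in> gens P \<Longrightarrow> (\<And>h. h \<in> gens P' \<Longrightarrow> gdeg P' h = gdeg P g + n \<Longrightarrow> \<phi> h = 0) \<Longrightarrow>
    ev \<phi> (f g) = 0"
  shows "has_degree n P P' f"
  unfolding has_degree_def
proof (intro allI ballI)
  fix k p assume p: "p \<in> free_deg P k"
  \<comment> \<open>The representative of degree \<open>k + n\<close> is \<open>lin f p\<close>
    itself.\<close>
  have "lin f p \<in> free_deg P' (k + n)"
  proof (rule free_degI)
    fix \<phi> assume \<phi>: "\<And>h. h \<in> gens P' \<Longrightarrow> gdeg P' h = k + n \<Longrightarrow> \<phi> h = (0::'k)"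
    have "ev (\<lambda>g. ev \<phi> (f g)) p = ev (\<lambda>g. 0) p"
      by (rule ev_cong) (use p in \<open>auto simp: free_deg_def free_def intro!: assms \<phi>\<close>)
    then show "ev \<phi> (lin f p) = 0" by simp
  qed
  then show "\<exists>q\<in>free_deg P' (k + n). qclass P' (lin f p) = qclass P' q" by blast
qed

lemma inducesI:
  fixes f :: "'g \<Rightarrow> ('h \<Rightarrow>\<^sub>0 'k::field)"
  assumes deg: "\<And>\<phi> g. g \<in> gens P \<Longrightarrow> (\<And>h. h \<in> gens P' \<Longrightarrow> \<phi> h = 0) \<Longrightarrow> ev \<phi> (f g) = 0"
    and rel: "\<And>\<phi> r. (\<And>r. r \<in> grels P' \<Longrightarrow> ev \<phi> r = 0) \<Longrightarrow> r \<in> grels P \<Longrightarrow>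
      ev (\<lambda>g. ev \<phi> (f g)) r = 0"
  shows "induces P P' f"
  unfolding induces_def
proof (intro conjI ballI impI qclass_eqI)
  fix p assume p: "p \<in> free P"
  \<comment> \<open>With all degrees set to 0, \<open>free_degI\<close> becomes a test for
    membership in \<open>free P'\<close>.\<close>
  let ?P = "P'\<lparr>gdeg := \<lambda>_. 0\<rparr>"
  have "lin f p \<in> free_deg ?P 0"
  proof (rule free_degI)
    fix \<phi> assume \<phi>: "\<And>h. h \<in> gens ?P \<Longrightarrow> gdeg ?P h = 0 \<Longrightarrow> \<phi> h = (0::'k)"
    have "ev (\<lambda>g. ev \<phi> (f g)) p = ev (\<lambda>g. 0) p"
      by (rule ev_cong) (use p in \<open>auto simp: free_def intro!: deg \<phi>\<close>)
    then show "ev \<phi> (lin f p) = 0" by simp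
  qed
  then show "lin f p \<in> free P'" by (simp add: free_deg_def free_def)
next
  fix p q \<phi> assume "p \<in> free P" "q \<in> free P" "qclass P p = qclass P q"
    and *: "\<And>r. r \<in> grels P' \<Longrightarrow> ev \<phi> r = (0::'k)"
  then show "ev \<phi> (lin f p) = ev \<phi> (lin f q)"
    unfolding ev_lin by (intro ev_eq_if_qclass_eq[of P]) (auto intro: rel)
qed

section \<open>Signs (-1)^n over an arbitrary field\<close>

definition sg :: "int \<Rightarrow> 'k::field" where
  "sg n = (-1) powi n"

lemma sg_fold: "(-1) powi n = sg n"
  by (simp add: sg_def)

lemma sg_alt: "sg n = (if even n then 1 else -1)"
  by (simp add: sg_def power_int_minus_left)

lemma sg_0 [simp]: "sg 0 = 1" and sg_1 [simp]: "sg 1 = -1"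
  by (simp_all add: sg_alt)

text \<open>Exponents matter only modulo 2. Sums become products of signs, squares of variables
  collapse and even coefficients disappear, so every sign is brought to a product of signs of
  squarefree monomials, in which equal factors cancel.\<close>

lemma sg_add: "sg (x + y) = sg x * sg y"
  and sg_diff: "sg (x - y) = sg x * sg y"
  and sg_uminus: "sg (- x) = sg x"
  and sg_mult_self: "sg x * sg x = 1"
  and sg_mult_self_left: "sg x * (sg x * k) = k"
  and sg_square: "sg (x * x) = sg x"
  and sg_square_left: "sg (x * (x * y)) = sg (x * y)"
  and sg_Bit0: "sg (numeral (num.Bit0 m) * z) = 1" "sg (z * numeral (num.Bit0 m)) = 1"
    "sg (x * (z * numeral (num.Bit0 m))) = 1" "sg (x * (y * (z * numeral (num.Bit0 m)))) = 1"
  and sg_Bit1: "sg (numeral (num.Bit1 m) * z) = sg z" "sg (z * numeral (num.Bit1 m)) = sg z"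
    "sg (x * (z * numeral (num.Bit1 m))) = sg (x * z)"
  by (auto simp: sg_alt)

lemmas sg_simps = sg_add sg_diff sg_uminus sg_mult_self sg_mult_self_left sg_square sg_square_left
  sg_Bit0 sg_Bit1

lemma word_deg_simps [simp]:
  "word_deg e [] = 0" "word_deg e (x # w) = e x + word_deg e w"
  "word_deg e (v @ w) = word_deg e v + word_deg e w"
  by (simp_all add: word_deg_def)

section \<open>Words\<close>

text \<open>An operation \<open>F\<close> on words is represented by its transpose \<open>\<phi> \<mapsto> (X \<mapsto> \<phi> (F X))\<close>. In this form
  the shuffle product, the bracket \<open>\<ell>\<^sub>2\<close>, the differential \<open>D\<close> and the deconcatenation are the
  recursive functions \<open>sh\<close>, \<open>br\<close>, \<open>wD\<close> and \<open>dc\<close>.\<close>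

fun sh :: "('l \<Rightarrow> int) \<Rightarrow> ('l list \<Rightarrow> 'k::field) \<Rightarrow> 'l list \<Rightarrow> 'l list \<Rightarrow> 'k" where
  "sh e \<phi> [] Y = \<phi> Y"
| "sh e \<phi> (x # X) [] = \<phi> (x # X)"
| "sh e \<phi> (x # X) (y # Y) = sh e (\<lambda>W. \<phi> (x # W)) X (y # Y)
     + sg (e y * (e x + word_deg e X)) * sh e (\<lambda>W. \<phi> (y # W)) (x # X) Y"

lemma sh_Nil_left [simp]: "sh e \<phi> [] = \<phi>"
  by (simp add: fun_eq_iff)

lemma sh_Nil_right [simp]: "sh e \<phi> X [] = \<phi> X"
  by (cases X) auto

text \<open>Every word of a shuffle has the letters and the total degree of its two factors. As a
  congruence rule this lets the simplifier evaluate the degree of the bound word inside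
  signs.\<close>

lemma sh_cong:
  "(\<And>W. word_deg e W = word_deg e X + word_deg e Y \<Longrightarrow> set W = set X \<union> set Y \<Longrightarrow> \<phi> W = \<psi> W)
    \<Longrightarrow> sh e \<phi> X Y = sh e \<psi> X Y"
proof (induction e \<phi> X Y arbitrary: \<psi> rule: sh.induct)
  case (3 e \<phi> x X y Y)
  have "sh e (\<lambda>W. \<phi> (x # W)) X (y # Y) = sh e (\<lambda>W. \<psi> (x # W)) X (y # Y)"
    by (rule "3.IH"(1)) (rule "3.prems"; auto)
  moreover have "sh e (\<lambda>W. \<phi> (y # W)) (x # X) Y = sh e (\<lambda>W. \<psi> (y # W)) (x # X) Y"
    by (rule "3.IH"(2)) (rule "3.prems"; auto)
  ultimately show ?case by simp
qed auto

lemma sh_zero [simp]: "sh e (\<lambda>W. 0) X Y = (0::'k::field)"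
  by (induction e "\<lambda>W::'a list. 0::'k" X Y rule: sh.induct) auto

lemma sh_add: "sh e (\<lambda>W. \<phi> W + \<psi> W) X Y = sh e \<phi> X Y + sh e \<psi> X Y"
proof (induction e \<phi> X Y arbitrary: \<psi> rule: sh.induct)
  case (3 e \<phi> x X y Y)
  show ?case by (simp only: sh.simps "3.IH") (simp add: algebra_simps)
qed auto

lemma sh_mult: "sh e (\<lambda>W. k * \<phi> W) X Y = k * sh e \<phi> X Y"
  by (induction e \<phi> X Y rule: sh.induct) (auto simp: algebra_simps)

lemma sh_mult_right: "sh e (\<lambda>W. \<phi> W * k) X Y = sh e \<phi> X Y * k"
  by (simp add: sh_mult mult.commute[of _ k])

lemma sh_uminus: "sh e (\<lambda>W. - \<phi> W) X Y = - sh e \<phi> X Y"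
  using sh_mult[of e "-1"] by simp

lemma sh_diff: "sh e (\<lambda>W. \<phi> W - \<psi> W) X Y = sh e \<phi> X Y - sh e \<psi> X Y"
  using sh_add[of e \<phi> "\<lambda>W. - \<psi> W"] by (simp add: sh_uminus)

lemma sh_ev: "sh e (\<lambda>W. ev (\<lambda>z. F z W) p) X Y = ev (\<lambda>z. sh e (F z) X Y) p"
  by (induction e "\<lambda>W. ev (\<lambda>z. F z W) p" X Y arbitrary: F rule: sh.induct) (auto simp: ev_lins)

lemma sh_mult_deep:
  "sh e (\<lambda>W. f W * (k * g W)) X Y = k * sh e (\<lambda>W. f W * g W) X Y"
  "sh e (\<lambda>W. f W * (g W * k)) X Y = k * sh e (\<lambda>W. f W * g W) X Y"
  "sh e (\<lambda>W. f W * (h W * (k * g W))) X Y = k * sh e (\<lambda>W. f W * (h W * g W)) X Y"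
  "sh e (\<lambda>W. f W * (h W * (g W * k))) X Y = k * sh e (\<lambda>W. f W * (h W * g W)) X Y"
  "sh e (\<lambda>W. f W * (h W * (h2 W * (k * g W)))) X Y = k * sh e (\<lambda>W. f W * (h W * (h2 W * g W))) X Y"
  "sh e (\<lambda>W. f W * (h W * (h2 W * (g W * k)))) X Y = k * sh e (\<lambda>W. f W * (h W * (h2 W * g W))) X Y"
  "sh e (\<lambda>W. f W * (h W * (h2 W * (h3 W * (k * g W))))) X Y = k * sh e (\<lambda>W. f W * (h W * (h2 W * (h3 W * g W)))) X Y"
  "sh e (\<lambda>W. f W * (h W * (h2 W * (h3 W * (g W * k))))) X Y = k * sh e (\<lambda>W. f W * (h W * (h2 W * (h3 W * g W)))) X Y"
  by (simp_all only: sh_mult[symmetric] ac_simps)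

lemmas sh_lins = sh_add sh_mult sh_mult_right sh_uminus sh_diff sh_mult_deep

lemma sh_commute: "sh e \<phi> X Y = sg (word_deg e X * word_deg e Y) * sh e \<phi> Y X"
proof (induction e \<phi> X Y rule: sh.induct)
  case (3 e \<phi> x X y Y)
  then show ?case by (simp add: sg_simps algebra_simps)
qed auto

text \<open>Both sides split according to the source of the first letter of the shuffled word, which
  is \<open>x\<close>, \<open>y\<close> or \<open>z\<close>; the three parts match by
  induction.\<close>

lemma sh_assoc: "sh e (\<lambda>W. sh e \<phi> W Z) X Y = sh e (\<lambda>W. sh e \<phi> X W) Y Z"
proof (induction "length X + length Y + length Z" arbitrary: X Y Z \<phi> rule: less_induct)
  case less
  show ?case
  proof (cases "X = [] \<or> Y = [] \<or> Z = []")
    case False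
    then obtain x X' y Y' z Z' where *: "X = x # X'" "Y = y # Y'" "Z = z # Z'"
      by (meson list.exhaust)
    have 1: "sh e (\<lambda>W. sh e (\<lambda>W. \<phi> (x # W)) W Z) X' Y = sh e (\<lambda>W. sh e (\<lambda>W. \<phi> (x # W)) X' W) Y Z"
      by (rule less) (simp add: *)
    have 2: "sh e (\<lambda>W. sh e (\<lambda>W. \<phi> (y # W)) W Z) X Y' = sh e (\<lambda>W. sh e (\<lambda>W. \<phi> (y # W)) X W) Y' Z"
      by (rule less) (simp add: *)
    have 3: "sh e (\<lambda>W. sh e (\<lambda>W. \<phi> (z # W)) W Z') X Y = sh e (\<lambda>W. sh e (\<lambda>W. \<phi> (z # W)) X W) Y Z'"
      by (rule less) (simp add: *)
    let ?s = "sg (e y * word_deg e X)" let ?t = "sg (e z * (word_deg e X + word_deg e Y))"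
    have "sh e (\<lambda>W. sh e \<phi> W Z) X Y = sh e (\<lambda>W. sh e (\<lambda>W. \<phi> (x # W)) W Z) X' Y
       + ?s * sh e (\<lambda>W. sh e (\<lambda>W. \<phi> (y # W)) W Z) X Y' + ?t * sh e (\<lambda>W. sh e (\<lambda>W. \<phi> (z # W)) W Z') X Y"
      unfolding * by (simp add: sh_lins sg_simps algebra_simps cong: sh_cong)
    also have "\<dots> = sh e (\<lambda>W. sh e \<phi> X W) Y Z"
      unfolding 1 2 3 unfolding * by (simp add: sh_lins sg_simps algebra_simps cong: sh_cong)
    finally show ?thesis .
  qed auto
qed

fun br :: "('l \<Rightarrow> int) \<Rightarrow> int \<Rightarrow> ('l \<Rightarrow> 'l \<Rightarrow> ('l \<Rightarrow>\<^sub>0 'k::field)) \<Rightarrow> ('l list \<Rightarrow> 'k) \<Rightarrow>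
    'l list \<Rightarrow> 'l list \<Rightarrow> 'k" where
  "br e c el \<phi> [] Y = 0"
| "br e c el \<phi> (x # X) [] = 0"
| "br e c el \<phi> (x # X) (y # Y) = sg (c * e x) * br e c el (\<lambda>W. \<phi> (x # W)) X (y # Y)
     + sg (c * e y + e y * (e x + word_deg e X)) * br e c el (\<lambda>W. \<phi> (y # W)) (x # X) Y
     + sg (e y * word_deg e X) * ev (\<lambda>z. sh e (\<lambda>W. \<phi> (z # W)) X Y) (el x y)"

fun head_mul :: "('l \<Rightarrow> 'l \<Rightarrow> ('l \<Rightarrow>\<^sub>0 'k::field)) \<Rightarrow> ('l list \<Rightarrow> 'k) \<Rightarrow> 'l \<Rightarrow> 'l list \<Rightarrow> 'k" where
  "head_mul mu \<phi> x [] = 0"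
| "head_mul mu \<phi> x (y # Y) = ev (\<lambda>z. \<phi> (z # Y)) (mu x y)"

fun wD :: "('l \<Rightarrow> int) \<Rightarrow> ('l \<Rightarrow> ('l \<Rightarrow>\<^sub>0 'k::field)) \<Rightarrow> ('l \<Rightarrow> 'l \<Rightarrow> ('l \<Rightarrow>\<^sub>0 'k)) \<Rightarrow>
    ('l list \<Rightarrow> 'k) \<Rightarrow> 'l list \<Rightarrow> 'k" where
  "wD e dl mu \<phi> [] = 0"
| "wD e dl mu \<phi> (x # X) = ev (\<lambda>z. \<phi> (z # X)) (dl x) + sg (e x) * wD e dl mu (\<lambda>W. \<phi> (x # W)) X
     + head_mul mu \<phi> x X"

fun dc :: "('l list \<Rightarrow> 'l list \<Rightarrow> 'k::field) \<Rightarrow> 'l list \<Rightarrow> 'k" where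
  "dc \<psi> [] = \<psi> [] []"
| "dc \<psi> (x # X) = \<psi> [] (x # X) + dc (\<lambda>U V. \<psi> (x # U) V) X"

lemma br_Nil_left [simp]: "br e c el \<phi> [] = (\<lambda>Y. 0)"
  by (simp add: fun_eq_iff)

lemma br_Nil_right [simp]: "br e c el \<phi> X [] = 0"
  by (cases X) auto

lemma br_zero [simp]: "br e c el (\<lambda>W. 0) X Y = (0::'k::field)"
  by (induction e c el "\<lambda>W::'a list. 0::'k" X Y rule: br.induct) auto

lemma br_add: "br e c el (\<lambda>W. \<phi> W + \<psi> W) X Y = br e c el \<phi> X Y + br e c el \<psi> X Y"
proof (induction e c el \<phi> X Y arbitrary: \<psi> rule: br.induct)
  case (3 e c el \<phi> x X y Y)
  show ?case by (simp only: br.simps "3.IH" sh_add ev_fun_add) (simp add: algebra_simps)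
qed auto

lemma br_mult: "br e c el (\<lambda>W. k * \<phi> W) X Y = k * br e c el \<phi> X Y"
proof (induction e c el \<phi> X Y rule: br.induct)
  case (3 e c el \<phi> x X y Y)
  show ?case by (simp only: br.simps "3.IH" sh_mult ev_fun_mult) (simp add: algebra_simps)
qed auto

lemma br_mult_right: "br e c el (\<lambda>W. \<phi> W * k) X Y = br e c el \<phi> X Y * k"
  by (simp add: br_mult mult.commute[of _ k])

lemma br_uminus: "br e c el (\<lambda>W. - \<phi> W) X Y = - br e c el \<phi> X Y"
  using br_mult[of e c el "-1"] by simp

lemma br_diff: "br e c el (\<lambda>W. \<phi> W - \<psi> W) X Y = br e c el \<phi> X Y - br e c el \<psi> X Y"
  using br_add[of e c el \<phi> "\<lambda>W. - \<psi> W"] by (simp add: br_uminus)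

lemma br_ev: "br e c el (\<lambda>W. ev (\<lambda>z. F z W) p) X Y = ev (\<lambda>z. br e c el (F z) X Y) p"
proof (induction e c el "\<lambda>W. ev (\<lambda>z. F z W) p" X Y arbitrary: F rule: br.induct)
  case (3 e c el x X y Y)
  show ?case
    using "3.hyps"(1)[of "\<lambda>z W. F z (x # W)"] "3.hyps"(2)[of "\<lambda>z W. F z (y # W)"]
    by (simp add: ev_lins sh_ev ev_swap[of _ p "el x y"])
qed auto

lemma br_mult_deep:
  "br e c el (\<lambda>W. f W * (k * g W)) X Y = k * br e c el (\<lambda>W. f W * g W) X Y"
  "br e c el (\<lambda>W. f W * (g W * k)) X Y = k * br e c el (\<lambda>W. f W * g W) X Y"
  "br e c el (\<lambda>W. f W * (h W * (k * g W))) X Y = k * br e c el (\<lambda>W. f W * (h W * g W)) X Y"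
  "br e c el (\<lambda>W. f W * (h W * (g W * k))) X Y = k * br e c el (\<lambda>W. f W * (h W * g W)) X Y"
  "br e c el (\<lambda>W. f W * (h W * (h2 W * (k * g W)))) X Y = k * br e c el (\<lambda>W. f W * (h W * (h2 W * g W))) X Y"
  "br e c el (\<lambda>W. f W * (h W * (h2 W * (g W * k)))) X Y = k * br e c el (\<lambda>W. f W * (h W * (h2 W * g W))) X Y"
  "br e c el (\<lambda>W. f W * (h W * (h2 W * (h3 W * (k * g W))))) X Y = k * br e c el (\<lambda>W. f W * (h W * (h2 W * (h3 W * g W)))) X Y"
  "br e c el (\<lambda>W. f W * (h W * (h2 W * (h3 W * (g W * k))))) X Y = k * br e c el (\<lambda>W. f W * (h W * (h2 W * (h3 W * g W)))) X Y"
  by (simp_all only: br_mult[symmetric] ac_simps)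

lemmas br_lins = br_add br_mult br_mult_right br_uminus br_diff br_mult_deep

lemma head_mul_add: "head_mul mu (\<lambda>W. \<phi> W + \<psi> W) x X = head_mul mu \<phi> x X + head_mul mu \<psi> x X"
  and head_mul_mult: "head_mul mu (\<lambda>W. k * \<phi> W) x X = k * head_mul mu \<phi> x X"
  and head_mul_zero [simp]: "head_mul mu (\<lambda>W. 0) x X = 0"
  and head_mul_ev: "head_mul mu (\<lambda>W. ev (\<lambda>z. F z W) p) x X = ev (\<lambda>z. head_mul mu (F z) x X) p"
  by (cases X; simp add: ev_lins ev_swap[of _ p])+

lemma wD_zero [simp]: "wD e dl mu (\<lambda>W. 0) X = (0::'k::field)"
  by (induction e dl mu "\<lambda>W::'a list. 0::'k" X rule: wD.induct) auto

lemma wD_add: "wD e dl mu (\<lambda>W. \<phi> W + \<psi> W) X = wD e dl mu \<phi> X + wD e dl mu \<psi> X"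
proof (induction e dl mu \<phi> X arbitrary: \<psi> rule: wD.induct)
  case (2 e dl mu \<phi> x X)
  show ?case by (simp only: wD.simps "2.IH" head_mul_add ev_fun_add) (simp add: algebra_simps)
qed auto

lemma wD_mult: "wD e dl mu (\<lambda>W. k * \<phi> W) X = k * wD e dl mu \<phi> X"
proof (induction e dl mu \<phi> X rule: wD.induct)
  case (2 e dl mu \<phi> x X)
  show ?case by (simp only: wD.simps "2.IH" head_mul_mult ev_fun_mult) (simp add: algebra_simps)
qed auto

lemma wD_mult_right: "wD e dl mu (\<lambda>W. \<phi> W * k) X = wD e dl mu \<phi> X * k"
  by (simp add: wD_mult mult.commute[of _ k])

lemma wD_uminus: "wD e dl mu (\<lambda>W. - \<phi> W) X = - wD e dl mu \<phi> X"
  using wD_mult[of e dl mu "-1"] by simp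

lemma wD_diff: "wD e dl mu (\<lambda>W. \<phi> W - \<psi> W) X = wD e dl mu \<phi> X - wD e dl mu \<psi> X"
  using wD_add[of e dl mu \<phi> "\<lambda>W. - \<psi> W"] by (simp add: wD_uminus)

lemma wD_ev: "wD e dl mu (\<lambda>W. ev (\<lambda>z. F z W) p) X = ev (\<lambda>z. wD e dl mu (F z) X) p"
proof (induction e dl mu "\<lambda>W. ev (\<lambda>z. F z W) p" X arbitrary: F rule: wD.induct)
  case (2 e dl mu x X)
  show ?case
    using "2.hyps"[of "\<lambda>z W. F z (x # W)"]
    by (simp add: ev_lins head_mul_ev ev_swap[of _ p "dl x"])
qed auto

lemma wD_mult_deep:
  "wD e dl mu (\<lambda>W. f W * (k * g W)) X = k * wD e dl mu (\<lambda>W. f W * g W) X"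
  "wD e dl mu (\<lambda>W. f W * (g W * k)) X = k * wD e dl mu (\<lambda>W. f W * g W) X"
  "wD e dl mu (\<lambda>W. f W * (h W * (k * g W))) X = k * wD e dl mu (\<lambda>W. f W * (h W * g W)) X"
  "wD e dl mu (\<lambda>W. f W * (h W * (g W * k))) X = k * wD e dl mu (\<lambda>W. f W * (h W * g W)) X"
  "wD e dl mu (\<lambda>W. f W * (h W * (h2 W * (k * g W)))) X = k * wD e dl mu (\<lambda>W. f W * (h W * (h2 W * g W))) X"
  "wD e dl mu (\<lambda>W. f W * (h W * (h2 W * (g W * k)))) X = k * wD e dl mu (\<lambda>W. f W * (h W * (h2 W * g W))) X"
  "wD e dl mu (\<lambda>W. f W * (h W * (h2 W * (h3 W * (k * g W))))) X = k * wD e dl mu (\<lambda>W. f W * (h W * (h2 W * (h3 W * g W)))) X"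
  "wD e dl mu (\<lambda>W. f W * (h W * (h2 W * (h3 W * (g W * k))))) X = k * wD e dl mu (\<lambda>W. f W * (h W * (h2 W * (h3 W * g W)))) X"
  by (simp_all only: wD_mult[symmetric] ac_simps)

lemmas wD_lins = wD_add wD_mult wD_mult_right wD_uminus wD_diff wD_mult_deep

lemma dc_cong: "(\<And>U V. U @ V = X \<Longrightarrow> \<psi> U V = \<psi>' U V) \<Longrightarrow> dc \<psi> X = dc \<psi>' X"
proof (induction \<psi> X arbitrary: \<psi>' rule: dc.induct)
  case (2 \<psi> x X)
  have "dc (\<lambda>U V. \<psi> (x # U) V) X = dc (\<lambda>U V. \<psi>' (x # U) V) X"
    by (rule "2.IH") (simp add: "2.prems")
  then show ?case by (simp add: "2.prems")
qed auto

lemma dc_zero [simp]: "dc (\<lambda>U V. 0) X = (0::'k::field)"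
  by (induction "\<lambda>(U::'a list) (V::'a list). 0::'k" X rule: dc.induct) auto

lemma dc_add: "dc (\<lambda>U V. \<phi> U V + \<psi> U V) X = dc \<phi> X + dc \<psi> X"
proof (induction \<phi> X arbitrary: \<psi> rule: dc.induct)
  case (2 \<phi> x X)
  show ?case by (simp only: dc.simps "2.IH") (simp add: algebra_simps)
qed auto

lemma dc_mult: "dc (\<lambda>U V. k * \<phi> U V) X = k * dc \<phi> X"
proof (induction \<phi> X rule: dc.induct)
  case (2 \<phi> x X)
  show ?case by (simp only: dc.simps "2.IH") (simp add: algebra_simps)
qed auto

lemma dc_mult_right: "dc (\<lambda>U V. \<phi> U V * k) X = dc \<phi> X * k"
  by (simp add: dc_mult mult.commute[of _ k])

lemma dc_uminus: "dc (\<lambda>U V. - \<phi> U V) X = - dc \<phi> X"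
  using dc_mult[of "-1"] by simp

lemma dc_diff: "dc (\<lambda>U V. \<phi> U V - \<psi> U V) X = dc \<phi> X - dc \<psi> X"
  using dc_add[of \<phi> "\<lambda>U V. - \<psi> U V"] by (simp add: dc_uminus)

lemma dc_ev: "dc (\<lambda>U V. ev (\<lambda>z. F z U V) p) X = ev (\<lambda>z. dc (F z) X) p"
proof (induction "\<lambda>U V. ev (\<lambda>z. F z U V) p" X arbitrary: F rule: dc.induct)
  case (2 x X)
  show ?case
    using "2.hyps"[of "\<lambda>z U V. F z (x # U) V"] by (simp add: ev_lins)
qed auto

lemma dc_mult_deep:
  "dc (\<lambda>U V. f U V * (k * g U V)) X = k * dc (\<lambda>U V. f U V * g U V) X"
  "dc (\<lambda>U V. f U V * (g U V * k)) X = k * dc (\<lambda>U V. f U V * g U V) X"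
  "dc (\<lambda>U V. f U V * (h U V * (k * g U V))) X = k * dc (\<lambda>U V. f U V * (h U V * g U V)) X"
  "dc (\<lambda>U V. f U V * (h U V * (g U V * k))) X = k * dc (\<lambda>U V. f U V * (h U V * g U V)) X"
  "dc (\<lambda>U V. f U V * (h U V * (h2 U V * (k * g U V)))) X = k * dc (\<lambda>U V. f U V * (h U V * (h2 U V * g U V))) X"
  "dc (\<lambda>U V. f U V * (h U V * (h2 U V * (g U V * k)))) X = k * dc (\<lambda>U V. f U V * (h U V * (h2 U V * g U V))) X"
  "dc (\<lambda>U V. f U V * (h U V * (h2 U V * (h3 U V * (k * g U V))))) X = k * dc (\<lambda>U V. f U V * (h U V * (h2 U V * (h3 U V * g U V)))) X"
  "dc (\<lambda>U V. f U V * (h U V * (h2 U V * (h3 U V * (g U V * k))))) X = k * dc (\<lambda>U V. f U V * (h U V * (h2 U V * (h3 U V * g U V)))) X"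
  by (simp_all only: dc_mult[symmetric] ac_simps)

lemmas dc_lins = dc_add dc_mult dc_mult_right dc_uminus dc_diff dc_mult_deep

lemma br_cong:
  assumes "\<And>x y z. z \<in> Poly_Mapping.keys (el x y) \<Longrightarrow> e z = e x + e y + c"
    and "\<And>W. word_deg e W = word_deg e X + word_deg e Y + c \<Longrightarrow> \<phi> W = \<psi> W"
  shows "br e c el \<phi> X Y = br e c el \<psi> X Y"
  using assms
proof (induction e c el \<phi> X Y arbitrary: \<psi> rule: br.induct)
  case (3 e c el \<phi> x X y Y)
  have "br e c el (\<lambda>W. \<phi> (x # W)) X (y # Y) = br e c el (\<lambda>W. \<psi> (x # W)) X (y # Y)"
    by (rule "3.IH"(1)[OF "3.prems"(1) "3.prems"(2)]; simp)
  moreover have "br e c el (\<lambda>W. \<phi> (y # W)) (x # X) Y = br e c el (\<lambda>W. \<psi> (y # W)) (x # X) Y"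
    by (rule "3.IH"(2)[OF "3.prems"(1) "3.prems"(2)]; simp)
  moreover have "ev (\<lambda>z. sh e (\<lambda>W. \<phi> (z # W)) X Y) (el x y) = ev (\<lambda>z. sh e (\<lambda>W. \<psi> (z # W)) X Y) (el x y)"
    by (intro ev_cong sh_cong "3.prems"(2)) (simp add: "3.prems"(1))
  ultimately show ?case by simp
qed auto

lemma wD_cong:
  assumes "\<And>x z. z \<in> Poly_Mapping.keys (dl x) \<Longrightarrow> e z = e x + 1"
    and "\<And>x y z. z \<in> Poly_Mapping.keys (mu x y) \<Longrightarrow> e z = e x + e y + 1"
    and "\<And>W. word_deg e W = word_deg e X + 1 \<Longrightarrow> \<phi> W = \<psi> W"
  shows "wD e dl mu \<phi> X = wD e dl mu \<psi> X"
  using assms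
proof (induction e dl mu \<phi> X arbitrary: \<psi> rule: wD.induct)
  case (2 e dl mu \<phi> x X)
  have "wD e dl mu (\<lambda>W. \<phi> (x # W)) X = wD e dl mu (\<lambda>W. \<psi> (x # W)) X"
    by (rule "2.IH"[OF "2.prems"(1,2) "2.prems"(3)]; simp)
  moreover have "ev (\<lambda>z. \<phi> (z # X)) (dl x) = ev (\<lambda>z. \<psi> (z # X)) (dl x)"
    by (intro ev_cong "2.prems"(3)) (simp add: "2.prems"(1))
  moreover have "head_mul mu \<phi> x X = head_mul mu \<psi> x X"
    by (cases X) (auto intro!: ev_cong "2.prems"(3) simp: "2.prems"(2))
  ultimately show ?case by simp
qed auto

text \<open>Structure on the shifted space of letters: the commutative product becomes
  \<open>mu\<close>, graded antisymmetric of degree 1, and the Lie bracket becomes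
  \<open>el\<close>, of degree \<open>c\<close>. The signs are the ones created by the shift.
  \<open>R\<close> holds the relations that make the letters add and scale, so an algebra identity
  is tested only by functionals that kill \<open>R\<close>.\<close>

locale letters =
  fixes e :: "'l \<Rightarrow> int" and c :: int
    and dl :: "'l \<Rightarrow> ('l \<Rightarrow>\<^sub>0 'k::field)"
    and mu el :: "'l \<Rightarrow> 'l \<Rightarrow> ('l \<Rightarrow>\<^sub>0 'k)"
    and R :: "('l \<Rightarrow>\<^sub>0 'k) set"
  assumes dl_deg: "z \<in> Poly_Mapping.keys (dl x) \<Longrightarrow> e z = e x + 1"
    and mu_deg: "z \<in> Poly_Mapping.keys (mu x y) \<Longrightarrow> e z = e x + e y + 1"
    and el_deg: "z \<in> Poly_Mapping.keys (el x y) \<Longrightarrow> e z = e x + e y + c"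
    and el_skew: "(\<And>r. r \<in> R \<Longrightarrow> ev \<psi> r = 0) \<Longrightarrow>
      ev \<psi> (el x y) = - (sg (c + e x * e y) * ev \<psi> (el y x))"
    and el_jacobi: "(\<And>r. r \<in> R \<Longrightarrow> ev \<psi> r = 0) \<Longrightarrow>
      ev (\<lambda>w. ev \<psi> (el x w)) (el y z) = sg (c * e x + c) * ev (\<lambda>w. ev \<psi> (el w z)) (el x y)
        + sg (e x * e y + c * e x + c * e y + c) * ev (\<lambda>w. ev \<psi> (el y w)) (el x z)"
    and mu_skew: "(\<And>r. r \<in> R \<Longrightarrow> ev \<psi> r = 0) \<Longrightarrow>
      ev \<psi> (mu x y) = - (sg (e x * e y) * ev \<psi> (mu y x))"
    and mu_assoc: "(\<And>r. r \<in> R \<Longrightarrow> ev \<psi> r = 0) \<Longrightarrow>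
      ev (\<lambda>w. ev \<psi> (mu w z)) (mu x y) = - (sg (e x) * ev (\<lambda>w. ev \<psi> (mu x w)) (mu y z))"
    and el_mu: "(\<And>r. r \<in> R \<Longrightarrow> ev \<psi> r = 0) \<Longrightarrow>
      ev (\<lambda>w. ev \<psi> (el x w)) (mu y z) = sg (e x + c) * ev (\<lambda>w. ev \<psi> (mu w z)) (el x y)
        + sg ((e y + 1) * (e x + c)) * ev (\<lambda>w. ev \<psi> (mu y w)) (el x z)"
    and dl_dl: "(\<And>r. r \<in> R \<Longrightarrow> ev \<psi> r = 0) \<Longrightarrow> ev (\<lambda>w. ev \<psi> (dl w)) (dl x) = 0"
    and dl_mu: "(\<And>r. r \<in> R \<Longrightarrow> ev \<psi> r = 0) \<Longrightarrow>
      ev (\<lambda>w. ev \<psi> (dl w)) (mu x y) = - ev (\<lambda>w. ev \<psi> (mu w y)) (dl x)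
        - sg (e x) * ev (\<lambda>w. ev \<psi> (mu x w)) (dl y)"
    and dl_el: "(\<And>r. r \<in> R \<Longrightarrow> ev \<psi> r = 0) \<Longrightarrow>
      ev (\<lambda>w. ev \<psi> (dl w)) (el x y) = sg c * ev (\<lambda>w. ev \<psi> (el w y)) (dl x)
        + sg (e x + c) * ev (\<lambda>w. ev \<psi> (el x w)) (dl y)"
    and R_dl: "(\<And>r. r \<in> R \<Longrightarrow> ev \<psi> r = 0) \<Longrightarrow> r \<in> R \<Longrightarrow> ev (\<lambda>x. ev \<psi> (dl x)) r = 0"
    and R_mu_left: "(\<And>r. r \<in> R \<Longrightarrow> ev \<psi> r = 0) \<Longrightarrow> r \<in> R \<Longrightarrow> ev (\<lambda>x. ev \<psi> (mu x y)) r = 0"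
    and R_mu_right: "(\<And>r. r \<in> R \<Longrightarrow> ev \<psi> r = 0) \<Longrightarrow> r \<in> R \<Longrightarrow> ev (\<lambda>y. ev \<psi> (mu x y)) r = 0"
    and R_el_left: "(\<And>r. r \<in> R \<Longrightarrow> ev \<psi> r = 0) \<Longrightarrow> r \<in> R \<Longrightarrow> ev (\<lambda>x. ev \<psi> (el x y)) r = 0"
    and R_hom: "r \<in> R \<Longrightarrow> \<exists>m. \<forall>z\<in>Poly_Mapping.keys r. e z = m"
begin

abbreviation "Sh \<equiv> sh e"
abbreviation "Br \<equiv> br e c el"
abbreviation "Dw \<equiv> wD e dl mu"

text \<open>These are the functionals that descend to the tensor powers of the space of letters
  modulo \<open>R\<close>.\<close>

definition "kills_words \<phi> \<longleftrightarrow> (\<forall>u v. \<forall>r\<in>R. ev (\<lambda>z. \<phi> (u @ z # v)) r = 0)"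

lemma kills_words_Cons: "kills_words \<phi> \<Longrightarrow> kills_words (\<lambda>W. \<phi> (x # W))"
  unfolding kills_words_def
proof (intro allI ballI)
  fix u v r assume "\<forall>u v. \<forall>r\<in>R. ev (\<lambda>z. \<phi> (u @ z # v)) r = 0" "r \<in> R"
  then have "ev (\<lambda>z. \<phi> ((x # u) @ z # v)) r = 0" by blast
  then show "ev (\<lambda>z. \<phi> (x # u @ z # v)) r = 0" by simp
qed

lemma kills_words_head: "kills_words \<phi> \<Longrightarrow> r \<in> R \<Longrightarrow> ev (\<lambda>z. \<phi> (z # W)) r = 0"
  unfolding kills_words_def by (drule spec[where x = "[]"]) simp

lemma kills_words_head_sh: "kills_words \<phi> \<Longrightarrow> r \<in> R \<Longrightarrow> ev (\<lambda>z. Sh (\<lambda>W. \<phi> (z # W)) X Y) r = 0"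
  by (simp add: sh_ev[symmetric] kills_words_head)

lemma Br_cong:
  "(\<And>W. word_deg e W = word_deg e X + word_deg e Y + c \<Longrightarrow> \<phi> W = \<psi> W) \<Longrightarrow> Br \<phi> X Y = Br \<psi> X Y"
  by (rule br_cong) (auto simp: el_deg)

lemma Dw_cong:
  "(\<And>W. word_deg e W = word_deg e X + 1 \<Longrightarrow> \<phi> W = \<psi> W) \<Longrightarrow> Dw \<phi> X = Dw \<psi> X"
  by (rule wD_cong) (auto simp: dl_deg mu_deg)

lemmas deg_simps = dl_deg mu_deg el_deg
lemmas lins = ev_lins sh_lins br_lins wD_lins dc_lins
lemmas cps_congs = ev_cong sh_cong Br_cong Dw_cong

text \<open>Exchanging \<open>X\<close> and \<open>Y\<close> exchanges the two branches in which the
  first letter is left alone. In the third branch the antisymmetry of \<open>el\<close> meets the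
  commutativity of the shuffle of the two tails.\<close>

lemma Br_skew: "kills_words \<phi> \<Longrightarrow> Br \<phi> X Y = - (sg (c + word_deg e X * word_deg e Y) * Br \<phi> Y X)"
proof (induction "length X + length Y" arbitrary: X Y \<phi> rule: less_induct)
  case less
  show ?case
  proof (cases "X = [] \<or> Y = []")
    case False
    then obtain x X' y Y' where *: "X = x # X'" "Y = y # Y'"
      by (meson list.exhaust)
    have 1: "Br (\<lambda>W. \<phi> (x # W)) X' Y = - (sg (c + word_deg e X' * word_deg e Y) * Br (\<lambda>W. \<phi> (x # W)) Y X')"
      by (rule less) (simp_all add: * less kills_words_Cons)
    have 2: "Br (\<lambda>W. \<phi> (y # W)) X Y' = - (sg (c + word_deg e X * word_deg e Y') * Br (\<lambda>W. \<phi> (y # W)) Y' X)"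
      by (rule less) (simp_all add: * less kills_words_Cons)
    have 3: "ev (\<lambda>z. Sh (\<lambda>W. \<phi> (z # W)) X' Y') (el x y) =
      - (sg (c + e x * e y + word_deg e X' * word_deg e Y') * ev (\<lambda>z. Sh (\<lambda>W. \<phi> (z # W)) Y' X') (el y x))"
      by (subst el_skew, simp add: kills_words_head_sh less)
        (simp add: sh_commute[of e _ X' Y'] lins sg_simps algebra_simps)
    show ?thesis
      using 1 2 3 unfolding * by (simp add: lins sg_simps algebra_simps cong: cps_congs)
  qed auto
qed

end

section \<open>Shuffle product, bracket and deconcatenation of words\<close>

context letters begin

lemma dc_deg_cong:
  "(\<And>U V. word_deg e V = word_deg e X - word_deg e U \<Longrightarrow> \<psi> U V = \<psi>' U V) \<Longrightarrow> dc \<psi> X = dc \<psi>' X"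
  by (rule dc_cong) auto

lemmas cps = lins sg_simps algebra_simps deg_simps sh_ev[symmetric] br_ev[symmetric] wD_ev[symmetric] dc_ev[symmetric]

lemma sh_left_commute:
  "Sh (\<lambda>V. Sh \<phi> Y V) X Z = sg (word_deg e X * word_deg e Y) * Sh (\<lambda>V. Sh \<phi> X V) Y Z"
proof -
  have "Sh (\<lambda>V. Sh \<phi> Y V) X Z = Sh (\<lambda>V. Sh \<phi> V Z) Y X" by (simp only: sh_assoc)
  also have "\<dots> = sg (word_deg e X * word_deg e Y) * Sh (\<lambda>V. Sh \<phi> V Z) X Y"
    by (subst sh_commute) (simp add: mult.commute)
  finally show ?thesis by (simp only: sh_assoc)
qed

text \<open>Leibniz rule of \<ell>_2 over the shuffle product: the letter of \<open>X\<close> that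
  is contracted meets a letter of either \<open>Y\<close> or \<open>Z\<close>. It is the reason why
  the bracket with a shuffle is again a combination of shuffles.\<close>

lemma Br_sh_right:
  "Sh (\<lambda>W. Br \<phi> X W) Y Z = Br (\<lambda>U. Sh \<phi> U Z) X Y
     + sg (word_deg e Y * (word_deg e X + c)) * Br (\<lambda>V. Sh \<phi> Y V) X Z"
proof (induction "length X + length Y + length Z" arbitrary: X Y Z \<phi> rule: less_induct)
  case less
  show ?case
  proof (cases "X = [] \<or> Y = [] \<or> Z = []")
    case False
    then obtain x X' y Y' z Z' where *: "X = x # X'" "Y = y # Y'" "Z = z # Z'"
      by (meson list.exhaust)
    have IH: "Sh (\<lambda>W. Br (\<lambda>W. \<phi> (x # W)) X' W) Y Z = Br (\<lambda>U. Sh (\<lambda>W. \<phi> (x # W)) U Z) X' Y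
        + sg (word_deg e Y * (word_deg e X' + c)) * Br (\<lambda>V. Sh (\<lambda>W. \<phi> (x # W)) Y V) X' Z"
      "Sh (\<lambda>W. Br (\<lambda>W. \<phi> (y # W)) X W) Y' Z = Br (\<lambda>U. Sh (\<lambda>W. \<phi> (y # W)) U Z) X Y'
        + sg (word_deg e Y' * (word_deg e X + c)) * Br (\<lambda>V. Sh (\<lambda>W. \<phi> (y # W)) Y' V) X Z"
      "Sh (\<lambda>W. Br (\<lambda>W. \<phi> (z # W)) X W) Y Z' = Br (\<lambda>U. Sh (\<lambda>W. \<phi> (z # W)) U Z') X Y
        + sg (word_deg e Y * (word_deg e X + c)) * Br (\<lambda>V. Sh (\<lambda>W. \<phi> (z # W)) Y V) X Z'"
      by (rule less; simp add: *)+
    have "Sh (\<lambda>W. Br \<phi> X W) Y Z = sg (c * e x) * Sh (\<lambda>W. Br (\<lambda>W. \<phi> (x # W)) X' W) Y Z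
      + sg (c * e y + e y * word_deg e X) * Sh (\<lambda>W. Br (\<lambda>W. \<phi> (y # W)) X W) Y' Z
      + sg (c * e z + e z * (word_deg e X + word_deg e Y)) * Sh (\<lambda>W. Br (\<lambda>W. \<phi> (z # W)) X W) Y Z'
      + sg (e y * word_deg e X') * ev (\<lambda>l. Sh (\<lambda>W. Sh (\<lambda>W. \<phi> (l # W)) X' W) Y' Z) (el x y)
      + sg (e z * (word_deg e X' + word_deg e Y)) *
          ev (\<lambda>l. Sh (\<lambda>W. Sh (\<lambda>W. \<phi> (l # W)) X' W) Y Z') (el x z)"
      unfolding * by (simp add: cps cong: cps_congs)
    also have "\<dots> = Br (\<lambda>U. Sh \<phi> U Z) X Y
     + sg (word_deg e Y * (word_deg e X + c)) * Br (\<lambda>V. Sh \<phi> Y V) X Z"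
      unfolding IH sh_assoc[of e _ Z X' Y', symmetric] sh_left_commute[of _ X' Y Z']
      unfolding * by (simp add: cps cong: cps_congs)
    finally show ?thesis .
  qed auto
qed

text \<open>The Leibniz rule in the other argument, by the same induction on first letters. Deriving
  it from \<open>Br_skew\<close> would restrict it to functionals that satisfy
  \<open>kills_words\<close>.\<close>

lemma Br_sh_left:
  "Sh (\<lambda>W. Br \<phi> W Z) X Y = sg (c * word_deg e X) * Br (\<lambda>V. Sh \<phi> X V) Y Z
     + sg (word_deg e Y * (word_deg e X + c)) * Br (\<lambda>V. Sh \<phi> Y V) X Z"
proof (induction "length X + length Y + length Z" arbitrary: X Y Z \<phi> rule: less_induct)
  case less
  show ?case
  proof (cases "X = [] \<or> Y = [] \<or> Z = []")
    case False
    then obtain x X' y Y' z Z' where *: "X = x # X'" "Y = y # Y'" "Z = z # Z'"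
      by (meson list.exhaust)
    have IH: "Sh (\<lambda>W. Br (\<lambda>W. \<phi> (x # W)) W Z) X' Y =
        sg (c * word_deg e X') * Br (\<lambda>V. Sh (\<lambda>W. \<phi> (x # W)) X' V) Y Z
     + sg (word_deg e Y * (word_deg e X' + c)) * Br (\<lambda>V. Sh (\<lambda>W. \<phi> (x # W)) Y V) X' Z"
      "Sh (\<lambda>W. Br (\<lambda>W. \<phi> (y # W)) W Z) X Y' =
        sg (c * word_deg e X) * Br (\<lambda>V. Sh (\<lambda>W. \<phi> (y # W)) X V) Y' Z
     + sg (word_deg e Y' * (word_deg e X + c)) * Br (\<lambda>V. Sh (\<lambda>W. \<phi> (y # W)) Y' V) X Z"
      "Sh (\<lambda>W. Br (\<lambda>W. \<phi> (z # W)) W Z') X Y =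
        sg (c * word_deg e X) * Br (\<lambda>V. Sh (\<lambda>W. \<phi> (z # W)) X V) Y Z'
     + sg (word_deg e Y * (word_deg e X + c)) * Br (\<lambda>V. Sh (\<lambda>W. \<phi> (z # W)) Y V) X Z'"
      by (rule less; simp add: *)+
    have "Sh (\<lambda>W. Br \<phi> W Z) X Y = sg (c * e x) * Sh (\<lambda>W. Br (\<lambda>W. \<phi> (x # W)) W Z) X' Y
      + sg (c * e y + e y * word_deg e X) * Sh (\<lambda>W. Br (\<lambda>W. \<phi> (y # W)) W Z) X Y'
      + sg (c * e z + e z * (word_deg e X + word_deg e Y)) * Sh (\<lambda>W. Br (\<lambda>W. \<phi> (z # W)) W Z') X Y
      + sg (e z * (word_deg e X' + word_deg e Y)) *
          ev (\<lambda>l. Sh (\<lambda>W. Sh (\<lambda>W. \<phi> (l # W)) W Z') X' Y) (el x z)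
      + sg (e y * word_deg e X + e z * (word_deg e X + word_deg e Y')) *
          ev (\<lambda>l. Sh (\<lambda>W. Sh (\<lambda>W. \<phi> (l # W)) W Z') X Y') (el y z)"
      unfolding * by (simp add: cps cong: cps_congs)
    also have "\<dots> = sg (c * word_deg e X) * Br (\<lambda>V. Sh \<phi> X V) Y Z
     + sg (word_deg e Y * (word_deg e X + c)) * Br (\<lambda>V. Sh \<phi> Y V) X Z"
      unfolding IH sh_assoc[of e _ Z'] sh_left_commute[of _ X' Y Z']
      unfolding * by (simp add: cps cong: cps_congs)
    finally show ?thesis .
  qed auto
qed

text \<open>Shuffle product and deconcatenation form a bialgebra: a cut of a shuffle cuts both
  factors, and the sign comes from moving the start \<open>Y1\<close> of the second word past the
  end \<open>X2\<close> of the first.\<close>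

lemma dc_sh:
  "Sh (\<lambda>W. dc \<psi> W) X Y = dc (\<lambda>X1 X2. dc (\<lambda>Y1 Y2.
     sg (word_deg e X2 * word_deg e Y1) * Sh (\<lambda>A. Sh (\<lambda>B. \<psi> A B) X2 Y2) X1 Y1) Y) X"
proof (induction "length X + length Y" arbitrary: X Y \<psi> rule: less_induct)
  case less
  show ?case
  proof (cases "X = [] \<or> Y = []")
    case False
    then obtain x X' y Y' where *: "X = x # X'" "Y = y # Y'"
      by (meson list.exhaust)
    have IH: "Sh (\<lambda>W. dc (\<lambda>U V. \<psi> (x # U) V) W) X' Y = dc (\<lambda>X1 X2. dc (\<lambda>Y1 Y2.
     sg (word_deg e X2 * word_deg e Y1) * Sh (\<lambda>A. Sh (\<lambda>B. \<psi> (x # A) B) X2 Y2) X1 Y1) Y) X'"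
     "Sh (\<lambda>W. dc (\<lambda>U V. \<psi> (y # U) V) W) X Y' = dc (\<lambda>X1 X2. dc (\<lambda>Y1 Y2.
     sg (word_deg e X2 * word_deg e Y1) * Sh (\<lambda>A. Sh (\<lambda>B. \<psi> (y # A) B) X2 Y2) X1 Y1) Y') X"
      by (rule less; simp add: *)+
    have "Sh (\<lambda>W. dc \<psi> W) X Y = Sh (\<psi> []) X Y + Sh (\<lambda>W. dc (\<lambda>U V. \<psi> (x # U) V) W) X' Y
      + sg (e y * word_deg e X) * Sh (\<lambda>W. dc (\<lambda>U V. \<psi> (y # U) V) W) X Y'"
      unfolding * by (simp add: cps cong: cps_congs)
    also have "\<dots> = dc (\<lambda>X1 X2. dc (\<lambda>Y1 Y2.
     sg (word_deg e X2 * word_deg e Y1) * Sh (\<lambda>A. Sh (\<lambda>B. \<psi> A B) X2 Y2) X1 Y1) Y) X"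
      unfolding IH unfolding * by (simp add: cps cong: cps_congs dc_deg_cong)
    finally show ?thesis .
  qed auto
qed

text \<open>A cut of a word occurring in \<ell>_2(X, Y) leaves the contracted letter on one side:
  the bracket acts there and the other two halves are merely shuffled.\<close>

lemma dc_br:
  "Br (\<lambda>W. dc \<psi> W) X Y = dc (\<lambda>X1 X2. dc (\<lambda>Y1 Y2. sg (word_deg e X2 * word_deg e Y1) *
     (Br (\<lambda>A. Sh (\<lambda>B. \<psi> A B) X2 Y2) X1 Y1
      + sg (c * (word_deg e X1 + word_deg e Y1)) * Sh (\<lambda>A. Br (\<lambda>B. \<psi> A B) X2 Y2) X1 Y1)) Y) X"
proof (induction "length X + length Y" arbitrary: X Y \<psi> rule: less_induct)
  case less
  show ?case
  proof (cases "X = [] \<or> Y = []")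
    case False
    then obtain x X' y Y' where *: "X = x # X'" "Y = y # Y'"
      by (meson list.exhaust)
    let ?F = "\<lambda>\<psi> X Y. dc (\<lambda>X1 X2. dc (\<lambda>Y1 Y2. sg (word_deg e X2 * word_deg e Y1) *
     (Br (\<lambda>A. Sh (\<lambda>B. \<psi> A B) X2 Y2) X1 Y1
      + sg (c * (word_deg e X1 + word_deg e Y1)) * Sh (\<lambda>A. Br (\<lambda>B. \<psi> A B) X2 Y2) X1 Y1)) Y) X"
    have IH: "Br (\<lambda>W. dc (\<lambda>U V. \<psi> (x # U) V) W) X' Y = ?F (\<lambda>U V. \<psi> (x # U) V) X' Y"
     "Br (\<lambda>W. dc (\<lambda>U V. \<psi> (y # U) V) W) X Y' = ?F (\<lambda>U V. \<psi> (y # U) V) X Y'"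
      by (rule less; simp add: *)+
    have "Br (\<lambda>W. dc \<psi> W) X Y = Br (\<psi> []) X Y
      + sg (c * e x) * Br (\<lambda>W. dc (\<lambda>U V. \<psi> (x # U) V) W) X' Y
      + sg (c * e y + e y * word_deg e X) * Br (\<lambda>W. dc (\<lambda>U V. \<psi> (y # U) V) W) X Y'
      + sg (e y * word_deg e X') * ev (\<lambda>l. Sh (\<lambda>W. dc (\<lambda>U V. \<psi> (l # U) V) W) X' Y') (el x y)"
      unfolding * by (simp add: cps cong: cps_congs)
    also have "\<dots> = ?F \<psi> X Y"
      unfolding IH dc_sh unfolding * by (simp add: cps cong: cps_congs dc_deg_cong)
    finally show ?thesis .
  next
    case True
    then show ?thesis by (auto simp: dc_lins)
  qed
qed

text \<open>\<open>D\<close> changes a letter or joins two neighbours, so its result lies entirely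
  on one side of a cut; it is therefore a coderivation of deconcatenation.\<close>

lemma dc_D:
  "Dw (\<lambda>W. dc \<psi> W) X = dc (\<lambda>U V. Dw (\<lambda>A. \<psi> A V) U + sg (word_deg e U) * Dw (\<psi> U) V) X"
proof (induction X arbitrary: \<psi>)
  case (Cons x X)
  have IH: "Dw (\<lambda>W. dc (\<lambda>U. \<psi> (x # U)) W) X =
     dc (\<lambda>U V. Dw (\<lambda>A. \<psi> (x # A) V) U + sg (word_deg e U) * Dw (\<psi> (x # U)) V) X"
    by (rule Cons)
  have "Dw (\<lambda>W. dc \<psi> W) (x # X) = Dw (\<psi> []) (x # X)
     + ev (\<lambda>z. dc (\<lambda>U V. \<psi> (z # U) V) X) (dl x)
     + sg (e x) * Dw (\<lambda>W. dc (\<lambda>U. \<psi> (x # U)) W) X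
     + (case X of [] \<Rightarrow> 0 | y # Y \<Rightarrow> ev (\<lambda>z. dc (\<lambda>U V. \<psi> (z # U) V) Y) (mu x y))"
    by (cases X; hypsubst_thin; simp add: cps cong: cps_congs)
  also have "\<dots> = dc (\<lambda>U V. Dw (\<lambda>A. \<psi> A V) U + sg (word_deg e U) * Dw (\<psi> U) V) (x # X)"
    unfolding IH by (cases X; hypsubst_thin; simp add: cps cong: cps_congs dc_deg_cong)
  finally show ?case .
qed simp

end

section \<open>The differential on words\<close>

context letters begin

text \<open>Antisymmetry moves the Leibniz rule \<open>el_mu\<close> to the first argument: it is
  applied once to the bracket with the product and once to each of the two brackets that
  result.\<close>

lemma el_mu_left:
  assumes "\<And>r. r \<in> R \<Longrightarrow> ev \<psi> r = 0"
  shows "ev (\<lambda>w. ev \<psi> (el w z)) (mu x y) = sg (c + e y * e z) * ev (\<lambda>w. ev \<psi> (mu w y)) (el x z)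
        + sg (c + c * e x) * ev (\<lambda>w. ev \<psi> (mu x w)) (el y z)"
proof -
  have 1: "ev \<psi> (el w z) = - (sg (c + e w * e z) * ev \<psi> (el z w))" for w
    by (rule el_skew) (rule assms)
  have 2: "ev (\<lambda>w. ev \<psi> (mu w y)) (el z x) = - (sg (c + e z * e x) * ev (\<lambda>w. ev \<psi> (mu w y)) (el x z))"
    by (rule el_skew) (rule R_mu_left[OF assms])
  have 3: "ev (\<lambda>w. ev \<psi> (mu x w)) (el z y) = - (sg (c + e z * e y) * ev (\<lambda>w. ev \<psi> (mu x w)) (el y z))"
    by (rule el_skew) (rule R_mu_right[OF assms])
  have "ev (\<lambda>w. ev \<psi> (el w z)) (mu x y)
      = - (sg (c + (e x + e y + 1) * e z) * ev (\<lambda>w. ev \<psi> (el z w)) (mu x y))"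
    by (simp only: 1) (simp add: cps cong: ev_cong)
  also have "\<dots> = sg (c + e y * e z) * ev (\<lambda>w. ev \<psi> (mu w y)) (el x z)
        + sg (c + c * e x) * ev (\<lambda>w. ev \<psi> (mu x w)) (el y z)"
    by (simp add: el_mu[OF assms] 2 3 cps)
  finally show ?thesis .
qed

text \<open>A letter \<open>z\<close> taken from a relation picks up signs that involve
  \<open>e z\<close> while it is shuffled. By \<open>R_hom\<close> this degree is the same for all
  keys of \<open>r\<close>, so the signs come out of \<open>ev\<close>; later appeals to homogeneity
  of relations have the same purpose.\<close>

lemma kills_words_sh:
  assumes "kills_words \<phi>" shows "kills_words (\<lambda>U. Sh \<phi> U Y)"
proof -
  have "ev (\<lambda>z. Sh \<phi> (u @ z # v) Y) r = 0" if "r \<in> R" for u v r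
    using assms
  proof (induction "length u + length Y" arbitrary: u Y \<phi> rule: less_induct)
    case less
    note k = kills_words_Cons[OF less.prems]
    obtain m where m: "z \<in> Poly_Mapping.keys r \<Longrightarrow> e z = m" for z
      using R_hom[OF \<open>r \<in> R\<close>] by blast
    show ?case
    proof (cases Y)
      case Nil
      then show ?thesis using less.prems \<open>r \<in> R\<close> by (simp add: kills_words_def)
    next
      case (Cons y Y')
      have 1: "ev (\<lambda>z. Sh (\<lambda>W. \<phi> (y # W)) (u @ z # v) Y') r = 0"
        by (rule less.hyps) (simp_all add: k Cons)
      show ?thesis
      proof (cases u)
        case Nil
        then show ?thesis
          using Cons 1 kills_words_head[OF less.prems \<open>r \<in> R\<close>]
          by (simp add: m lins sg_simps algebra_simps sh_ev[symmetric] cong: ev_cong)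
      next
        case (Cons x u')
        have 2: "ev (\<lambda>z. Sh (\<lambda>W. \<phi> (x # W)) (u' @ z # v) Y) r = 0"
          by (rule less.hyps) (simp_all add: k Cons)
        then show ?thesis
          using 1 unfolding \<open>Y = y # Y'\<close> Cons
          by (simp add: m lins sg_simps algebra_simps cong: ev_cong)
      qed
    qed
  qed
  then show ?thesis by (simp add: kills_words_def)
qed

lemma kills_words_ev: "kills_words (\<lambda>W. ev (\<lambda>l. \<phi> (l # W)) p)" if "kills_words \<phi>"
  unfolding kills_words_def using kills_words_Cons[OF that]
  by (auto simp: ev_swap[of _ p] kills_words_def)

text \<open>The only obstruction to \<open>D\<close> being a derivation of the shuffle product are
  products of a letter of \<open>X\<close> with a neighbouring letter of \<open>Y\<close>. Each such
  pair occurs in both orders, and \<open>mu_skew\<close> cancels the two.\<close>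

lemma D_sh: "Sh (\<lambda>W. Dw \<phi> W) X Y = Dw (\<lambda>U. Sh \<phi> U Y) X + sg (word_deg e X) * Dw (\<lambda>V. Sh \<phi> X V) Y"
  if "kills_words \<phi>"
  using that
proof (induction "length X + length Y" arbitrary: X Y \<phi> rule: less_induct)
  case less
  \<comment> \<open>\<open>?G\<close> is the defect of the identity. The value of \<open>?G\<close>
    on longer words is first written as a combination of values on shorter ones, a formal identity
    that expansion checks; the induction hypothesis enters afterwards. Most inductions below are
    arranged in this way.\<close>
  let ?G = "\<lambda>\<phi> X Y. Sh (\<lambda>W. Dw \<phi> W) X Y
    - (Dw (\<lambda>U. Sh \<phi> U Y) X + sg (word_deg e X) * Dw (\<lambda>V. Sh \<phi> X V) Y)"
  have "?G \<phi> X Y = 0"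
  proof (cases "X = [] \<or> Y = []")
    case False
    then obtain x X' y Y' where *: "X = x # X'" "Y = y # Y'"
      by (meson list.exhaust)
    have "?G (\<lambda>W. \<phi> (x # W)) X' Y = 0" "?G (\<lambda>W. \<phi> (y # W)) X Y' = 0"
      unfolding right_minus_eq by (rule less; simp add: * less kills_words_Cons)+
    moreover have "?G \<phi> X Y = sg (e x) * ?G (\<lambda>W. \<phi> (x # W)) X' Y
        + sg (e y + e y * word_deg e X) * ?G (\<lambda>W. \<phi> (y # W)) X Y'"
      unfolding * using kills_words_head[OF less.prems]
      by (cases X'; cases Y'; hypsubst_thin; simp add: cps mu_skew[where x = y and y = x] cong: cps_congs)
    ultimately show ?thesis by simp
  qed auto
  then show ?case by simp
qed

text \<open>After the terms covered by induction, only expressions in at most the first three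
  letters remain: the square of \<open>dl\<close>, \<open>dl\<close> against \<open>mu\<close>, and
  a double product. The letter axioms \<open>dl_dl\<close>, \<open>dl_mu\<close> and
  \<open>mu_assoc\<close> remove them.\<close>

lemma D_D: "Dw (\<lambda>W. Dw \<phi> W) X = 0" if "kills_words \<phi>"
  using that
proof (induction X arbitrary: \<phi>)
  case (Cons x X)
  have IH: "Dw (\<lambda>W. Dw (\<lambda>W. \<phi> (x # W)) W) X = 0"
    by (rule Cons.IH) (simp add: Cons.prems kills_words_Cons)
  moreover have "Dw (\<lambda>W. Dw \<phi> W) (x # X) = Dw (\<lambda>W. Dw (\<lambda>W. \<phi> (x # W)) W) X"
  proof (cases X)
    case (Cons y Y)
    then show ?thesis
      using kills_words_head[OF \<open>kills_words \<phi>\<close>]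
      by (cases Y; hypsubst_thin; simp add: cps dl_dl dl_mu mu_assoc
          ev_swap[where p = "dl x"] ev_swap[where p = "mu x y"] head_mul_ev[symmetric] cong: cps_congs)
  next
    case Nil
    show ?thesis
      unfolding Nil using kills_words_head[OF \<open>kills_words \<phi>\<close>] by (simp add: cps dl_dl cong: cps_congs)
  qed
  ultimately show ?case by simp
qed simp

end

section \<open>The differential against the bracket, and double brackets of words\<close>

context letters begin

text \<open>Operations on different letters commute, but \<open>ev_swap\<close> as a rewrite rule
  prefers neither order. These instances fix one, with \<open>dl\<close> or \<open>mu\<close>
  outermost.\<close>

lemmas ev_order = ev_swap[where p = "el u v" and q = "dl w" for u v w]
  ev_swap[where p = "el u v" and q = "mu w w'" for u v w w'] head_mul_ev[symmetric]

lemma D_br: "Br (\<lambda>W. Dw \<phi> W) X Y = sg c * Dw (\<lambda>U. Br \<phi> U Y) X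
    + sg (c + word_deg e X) * Dw (\<lambda>V. Br \<phi> X V) Y"
  if "kills_words \<phi>"
  using that
proof (induction "length X + length Y" arbitrary: X Y \<phi> rule: less_induct)
  case less
  let ?G = "\<lambda>\<phi> X Y. Br (\<lambda>W. Dw \<phi> W) X Y
    - (sg c * Dw (\<lambda>U. Br \<phi> U Y) X + sg (c + word_deg e X) * Dw (\<lambda>V. Br \<phi> X V) Y)"
  have "?G \<phi> X Y = 0"
  proof (cases "X = [] \<or> Y = []")
    case False
    then obtain x X' y Y' where *: "X = x # X'" "Y = y # Y'"
      by (meson list.exhaust)
    have "?G (\<lambda>W. \<phi> (x # W)) X' Y = 0" "?G (\<lambda>W. \<phi> (y # W)) X Y' = 0"
      unfolding right_minus_eq by (rule less; simp add: * less kills_words_Cons)+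
    \<comment> \<open>Once \<open>x\<close> and \<open>y\<close> are contracted to the first letter,
      \<open>D\<close> acts on the shuffle of the two tails.\<close>
    moreover have "Sh (\<lambda>W. Dw (\<lambda>W. ev (\<lambda>l. \<phi> (l # W)) (el x y)) W) X' Y'
        - (Dw (\<lambda>U. Sh (\<lambda>W. ev (\<lambda>l. \<phi> (l # W)) (el x y)) U Y') X'
          + sg (word_deg e X') * Dw (\<lambda>V. Sh (\<lambda>W. ev (\<lambda>l. \<phi> (l # W)) (el x y)) X' V) Y') = 0" (is "?S = 0")
      unfolding right_minus_eq by (rule D_sh[OF kills_words_ev[OF less.prems]])
    \<comment> \<open>These are the terms with a product at the head of the word. They cancel by the
      Leibniz rules for \<open>el\<close> and \<open>mu\<close> in both arguments, and by
      \<open>mu_skew\<close> where \<open>x\<close> and \<open>y\<close> become neighbours in both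
      orders.\<close>
    moreover have "sg (c * e x) * Br (\<lambda>W. head_mul mu \<phi> x W) X' Y
        + sg (c * e y + e y * word_deg e X) * Br (\<lambda>W. head_mul mu \<phi> y W) X Y'
        + sg (e y * word_deg e X') * ev (\<lambda>l. Sh (\<lambda>W. head_mul mu \<phi> l W) X' Y') (el x y)
        - (sg c * head_mul mu (\<lambda>U. Br \<phi> U Y) x X' + sg (c + word_deg e X) * head_mul mu (\<lambda>V. Br \<phi> X V) y Y'
          - sg (e x + c * e x + c + word_deg e X') * head_mul mu (\<lambda>V. Br (\<lambda>W. \<phi> (x # W)) X' V) y Y'
          - sg (c * e y + e y + e y * word_deg e X + c) * head_mul mu (\<lambda>U. Br (\<lambda>W. \<phi> (y # W)) U Y') x X') = 0"
      (is "?H = 0")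
      unfolding * using kills_words_head[OF less.prems]
      by (cases X'; cases Y'; hypsubst_thin; simp add: cps mu_skew[where x = y and y = x]
          el_mu el_mu_left dl_el ev_order cong: cps_congs)
    moreover have "?G \<phi> X Y = sg (e x + c * e x) * ?G (\<lambda>W. \<phi> (x # W)) X' Y
        + sg (c * e y + e y + e y * word_deg e X) * ?G (\<lambda>W. \<phi> (y # W)) X Y'
        + sg (e y * word_deg e X' + e x + e y + c) * ?S + ?H"
      unfolding * using kills_words_head[OF less.prems]
      by (simp add: cps dl_el ev_order cong: cps_congs)
    ultimately show ?thesis by simp
  qed auto
  then show ?case by simp
qed

text \<open>The first letter of a double bracket is one of the three original heads, or a
  contraction of two of them, or the contraction of all three. This gives the seven terms, here and
  in the companion for the bracket nested on the left.\<close>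

lemma Br_Br_Cons:
  assumes *: "X = x # X'" "Y = y # Y'" "Z = z # Z'"
  shows "Br (\<lambda>W. Br \<phi> X W) Y Z = sg (c * e x) * Br (\<lambda>W. Br (\<lambda>W. \<phi> (x # W)) X' W) Y Z
    + sg (e y * word_deg e X) * Br (\<lambda>W. Br (\<lambda>W. \<phi> (y # W)) X W) Y' Z
    + sg (e z * (word_deg e X + word_deg e Y)) * Br (\<lambda>W. Br (\<lambda>W. \<phi> (z # W)) X W) Y Z'
    + sg (c * e y + e y * word_deg e X') * Br (\<lambda>W. Sh (\<lambda>W. ev (\<lambda>l. \<phi> (l # W)) (el x y)) X' W) Y' Z
    + sg (c * e z + e z * word_deg e Y + e z * word_deg e X') *
        Br (\<lambda>W. Sh (\<lambda>W. ev (\<lambda>l. \<phi> (l # W)) (el x z)) X' W) Y Z'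
    + sg (e z * word_deg e Y' + (e y + e z + c) * (c + word_deg e X)) *
        Sh (\<lambda>W. Br (\<lambda>W. ev (\<lambda>l. \<phi> (l # W)) (el y z)) X W) Y' Z'
    + sg (e z * word_deg e Y' + (e y + e z + c) * word_deg e X') *
        Sh (\<lambda>W. Sh (\<lambda>W. ev (\<lambda>w. ev (\<lambda>l. \<phi> (l # W)) (el x w)) (el y z)) X' W) Y' Z'"
  unfolding * by (simp add: cps cong: cps_congs)

lemma Br_Br_Cons':
  assumes *: "X = x # X'" "Y = y # Y'" "Z = z # Z'"
  shows "Br (\<lambda>W. Br \<phi> W Z) X Y = Br (\<lambda>W. Br (\<lambda>W. \<phi> (x # W)) W Z) X' Y
    + sg (e y * word_deg e X) * Br (\<lambda>W. Br (\<lambda>W. \<phi> (y # W)) W Z) X Y'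
    + sg (e z * (word_deg e X + word_deg e Y)) * Br (\<lambda>W. Br (\<lambda>W. \<phi> (z # W)) W Z') X Y
    + sg (e y * word_deg e X' + c * (e x + e y + c)) * Sh (\<lambda>W. Br (\<lambda>W. ev (\<lambda>l. \<phi> (l # W)) (el x y)) W Z) X' Y'
    + sg (c * e x + e z * (word_deg e X' + word_deg e Y + c)) *
        Br (\<lambda>U. Sh (\<lambda>W. ev (\<lambda>l. \<phi> (l # W)) (el x z)) U Z') X' Y
    + sg (c * e y + e y * word_deg e X + e z * (word_deg e X + word_deg e Y' + c)) *
        Br (\<lambda>U. Sh (\<lambda>W. ev (\<lambda>l. \<phi> (l # W)) (el y z)) U Z') X Y'
    + sg (e y * word_deg e X' + e z * (word_deg e X' + word_deg e Y')) *
        Sh (\<lambda>W. Sh (\<lambda>W. ev (\<lambda>w. ev (\<lambda>l. \<phi> (l # W)) (el w z)) (el x y)) W Z') X' Y'"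
  unfolding * by (simp add: cps cong: cps_congs)

end

section \<open>The Jacobi identity on words\<close>

context letters begin

text \<open>The seven terms of each double bracket are compared. Untouched heads fall under
  induction, the contraction of three heads is \<open>el_jacobi\<close>, and contractions of two
  heads reduce to the Leibniz rules between \<open>Br\<close> and \<open>Sh\<close>. In the last
  bracket \<open>X\<close> and \<open>Y\<close> have changed roles, so one of its terms has to be
  turned round by \<open>Br_skew\<close>.\<close>

lemma Br_jacobi: "Br (\<lambda>W. Br \<phi> X W) Y Z = sg (c * word_deg e X + c) * Br (\<lambda>W. Br \<phi> W Z) X Y
     + sg (word_deg e X * word_deg e Y + c * word_deg e X + c * word_deg e Y + c) * Br (\<lambda>W. Br \<phi> Y W) X Z"
  if "kills_words \<phi>"
  using that
proof (induction "length X + length Y + length Z" arbitrary: X Y Z \<phi> rule: less_induct)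
  case less
  let ?G = "\<lambda>\<phi> X Y Z. Br (\<lambda>W. Br \<phi> X W) Y Z - (sg (c * word_deg e X + c) * Br (\<lambda>W. Br \<phi> W Z) X Y
     + sg (word_deg e X * word_deg e Y + c * word_deg e X + c * word_deg e Y + c) * Br (\<lambda>W. Br \<phi> Y W) X Z)"
  have "?G \<phi> X Y Z = 0"
  proof (cases "X = [] \<or> Y = [] \<or> Z = []")
    case False
    then obtain x X' y Y' z Z' where *: "X = x # X'" "Y = y # Y'" "Z = z # Z'"
      by (meson list.exhaust)
    have "?G (\<lambda>W. \<phi> (x # W)) X' Y Z = 0" "?G (\<lambda>W. \<phi> (y # W)) X Y' Z = 0" "?G (\<lambda>W. \<phi> (z # W)) X Y Z' = 0"
      unfolding right_minus_eq by (rule less; simp add: * less kills_words_Cons)+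
    moreover have jac: "ev (\<lambda>w. ev (\<lambda>l. \<phi> (l # W)) (el x w)) (el y z)
        = sg (c * e x + c) * ev (\<lambda>w. ev (\<lambda>l. \<phi> (l # W)) (el w z)) (el x y)
        + sg (e x * e y + c * e x + c * e y + c) * ev (\<lambda>w. ev (\<lambda>l. \<phi> (l # W)) (el y w)) (el x z)" for W
      by (rule el_jacobi) (rule kills_words_head[OF less.prems])
    moreover have skew_xy: "ev (\<lambda>l. \<phi> (l # W)) (el y x) = - (sg (c + e y * e x) * ev (\<lambda>l. \<phi> (l # W)) (el x y))" for W
      by (rule el_skew) (rule kills_words_head[OF less.prems])
    moreover have deg: "word_deg e X = e x + word_deg e X'" "word_deg e Y = e y + word_deg e Y'"
      "word_deg e Z = e z + word_deg e Z'" by (simp_all add: *)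
    moreover have skew: "Br (\<lambda>U. Sh (\<lambda>W. ev (\<lambda>l. \<phi> (l # W)) p) U Z') Y X' = - (sg (c + word_deg e Y * word_deg e X')
        * Br (\<lambda>U. Sh (\<lambda>W. ev (\<lambda>l. \<phi> (l # W)) p) U Z') X' Y)" for p
      by (rule Br_skew[OF kills_words_sh[OF kills_words_ev[OF less.prems]]])
    moreover have "?G \<phi> X Y Z = sg (c * e x) * ?G (\<lambda>W. \<phi> (x # W)) X' Y Z
        + sg (e y * word_deg e X) * ?G (\<lambda>W. \<phi> (y # W)) X Y' Z
        + sg (e z * (word_deg e X + word_deg e Y)) * ?G (\<lambda>W. \<phi> (z # W)) X Y Z'"
      unfolding Br_Br_Cons[OF *] Br_Br_Cons'[OF *] Br_Br_Cons[OF *(2,1,3)] jac skew_xy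
        Br_sh_left[of _ Z X' Y'] Br_sh_right[of _ X Y' Z'] Br_sh_right[of _ Y X' Z'] skew
        sh_assoc[of e _ Z' X' Y'] sh_left_commute[of _ Y' X' Z'] deg
      by (simp add: lins sg_simps algebra_simps cong: cps_congs)
    ultimately show ?thesis by simp
  qed auto
  then show ?case by simp
qed

end

section \<open>The symmetric coalgebra of a differential graded Lie bialgebra\<close>

definition ev2 :: "('g \<Rightarrow> 'h \<Rightarrow> 'k::field) \<Rightarrow> ('g \<times> 'h \<Rightarrow>\<^sub>0 'k) \<Rightarrow> 'k" where
  "ev2 \<psi> p = ev (\<lambda>(u, v). \<psi> u v) p"

lemma ev2_cong: "(\<And>u v. (u, v) \<in> Poly_Mapping.keys p \<Longrightarrow> \<phi> u v = \<psi> u v) \<Longrightarrow> ev2 \<phi> p = ev2 \<psi> p"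
  unfolding ev2_def by (rule ev_cong) auto

lemma ev2_add: "ev2 (\<lambda>u v. \<phi> u v + \<psi> u v) p = ev2 \<phi> p + ev2 \<psi> p"
  by (simp add: ev2_def ev_def case_prod_unfold algebra_simps sum.distrib sum_distrib_left)

lemma ev2_mult: "ev2 (\<lambda>u v. k * \<phi> u v) p = k * ev2 \<phi> p"
  by (simp add: ev2_def ev_def case_prod_unfold algebra_simps sum.distrib sum_distrib_left)

lemma ev2_mult_right: "ev2 (\<lambda>u v. \<phi> u v * k) p = ev2 \<phi> p * k"
  by (simp add: ev2_mult mult.commute[of _ k])

lemma ev2_uminus: "ev2 (\<lambda>u v. - \<phi> u v) p = - ev2 \<phi> p"
  using ev2_mult[where k = "-1"] by simp

lemma ev2_diff: "ev2 (\<lambda>u v. \<phi> u v - \<psi> u v) p = ev2 \<phi> p - ev2 \<psi> p"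
  using ev2_add[where \<psi> = "\<lambda>u v. - \<psi> u v"] by (simp add: ev2_uminus)

lemma ev2_zero [simp]: "ev2 (\<lambda>u v. 0) p = 0"
  using ev2_mult[where k = 0] by simp

lemma ev2_mult_deep:
  "ev2 (\<lambda>u v. f u v * (k * g u v)) p = k * ev2 (\<lambda>u v. f u v * g u v) p"
  "ev2 (\<lambda>u v. f u v * (g u v * k)) p = k * ev2 (\<lambda>u v. f u v * g u v) p"
  "ev2 (\<lambda>u v. f u v * (h u v * (k * g u v))) p = k * ev2 (\<lambda>u v. f u v * (h u v * g u v)) p"
  "ev2 (\<lambda>u v. f u v * (h u v * (g u v * k))) p = k * ev2 (\<lambda>u v. f u v * (h u v * g u v)) p"
  "ev2 (\<lambda>u v. f u v * (h u v * (h2 u v * (k * g u v)))) p = k * ev2 (\<lambda>u v. f u v * (h u v * (h2 u v * g u v))) p"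
  "ev2 (\<lambda>u v. f u v * (h u v * (h2 u v * (g u v * k)))) p = k * ev2 (\<lambda>u v. f u v * (h u v * (h2 u v * g u v))) p"
  "ev2 (\<lambda>u v. f u v * (h u v * (h2 u v * (h3 u v * (k * g u v))))) p = k * ev2 (\<lambda>u v. f u v * (h u v * (h2 u v * (h3 u v * g u v)))) p"
  "ev2 (\<lambda>u v. f u v * (h u v * (h2 u v * (h3 u v * (g u v * k))))) p = k * ev2 (\<lambda>u v. f u v * (h u v * (h2 u v * (h3 u v * g u v)))) p"
  "ev2 (\<lambda>u v. f u v * (h u v * (h2 u v * (h3 u v * (h4 u v * (k * g u v)))))) p = k * ev2 (\<lambda>u v. f u v * (h u v * (h2 u v * (h3 u v * (h4 u v * g u v))))) p"
  "ev2 (\<lambda>u v. f u v * (h u v * (h2 u v * (h3 u v * (h4 u v * (g u v * k)))))) p = k * ev2 (\<lambda>u v. f u v * (h u v * (h2 u v * (h3 u v * (h4 u v * g u v))))) p"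
  "ev2 (\<lambda>u v. f u v * (h u v * (h2 u v * (h3 u v * (h4 u v * (h5 u v * (k * g u v))))))) p = k * ev2 (\<lambda>u v. f u v * (h u v * (h2 u v * (h3 u v * (h4 u v * (h5 u v * g u v)))))) p"
  "ev2 (\<lambda>u v. f u v * (h u v * (h2 u v * (h3 u v * (h4 u v * (h5 u v * (g u v * k))))))) p = k * ev2 (\<lambda>u v. f u v * (h u v * (h2 u v * (h3 u v * (h4 u v * (h5 u v * g u v)))))) p"
  "ev2 (\<lambda>u v. f u v * (h u v * (h2 u v * (h3 u v * (h4 u v * (h5 u v * (h6 u v * (k * g u v)))))))) p = k * ev2 (\<lambda>u v. f u v * (h u v * (h2 u v * (h3 u v * (h4 u v * (h5 u v * (h6 u v * g u v))))))) p"
  "ev2 (\<lambda>u v. f u v * (h u v * (h2 u v * (h3 u v * (h4 u v * (h5 u v * (h6 u v * (g u v * k)))))))) p = k * ev2 (\<lambda>u v. f u v * (h u v * (h2 u v * (h3 u v * (h4 u v * (h5 u v * (h6 u v * g u v))))))) p"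
  "ev2 (\<lambda>u v. f u v * (h u v * (h2 u v * (h3 u v * (h4 u v * (h5 u v * (h6 u v * (h7 u v * (k * g u v))))))))) p = k * ev2 (\<lambda>u v. f u v * (h u v * (h2 u v * (h3 u v * (h4 u v * (h5 u v * (h6 u v * (h7 u v * g u v)))))))) p"
  "ev2 (\<lambda>u v. f u v * (h u v * (h2 u v * (h3 u v * (h4 u v * (h5 u v * (h6 u v * (h7 u v * (g u v * k))))))))) p = k * ev2 (\<lambda>u v. f u v * (h u v * (h2 u v * (h3 u v * (h4 u v * (h5 u v * (h6 u v * (h7 u v * g u v)))))))) p"
  by (simp_all only: ev2_mult[symmetric] ac_simps)

lemmas ev2_lins = ev2_add ev2_mult ev2_mult_right ev2_uminus ev2_diff ev2_mult_deep

lemma ev2_ev: "ev (\<lambda>z. ev2 (F z) q) p = ev2 (\<lambda>u v. ev (\<lambda>z. F z u v) p) q"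
  unfolding ev2_def by (subst ev_swap) (simp add: case_prod_unfold)

text \<open>\<open>spl\<close>, \<open>del\<close> and \<open>QQ\<close> are the transposes of \<open>\<Delta>\<close> (counit terms included), of \<open>\<delta>''\<close> and of \<open>Q\<close>, by
  recursion on the first factor; \<open>EE x\<close> is the commutator of \<open>Q\<close> with multiplication by \<open>x\<close>.\<close>

fun spl :: "('g \<Rightarrow> int) \<Rightarrow> ('g list \<Rightarrow> 'g list \<Rightarrow> 'k::field) \<Rightarrow> 'g list \<Rightarrow> 'k" where
  "spl e \<phi> [] = \<phi> [] []"
| "spl e \<phi> (x # W) = spl e (\<lambda>P R. \<phi> (x # P) R) W
     + spl e (\<lambda>P R. sg (e x * word_deg e P) * \<phi> P (x # R)) W"

lemma spl_cong:
  "(\<And>P R. word_deg e R = word_deg e W - word_deg e P \<Longrightarrow> set P \<subseteq> set W \<Longrightarrow> set R \<subseteq> set W \<Longrightarrow> \<phi> P R = \<psi> P R)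
    \<Longrightarrow> spl e \<phi> W = spl e \<psi> W"
proof (induction e \<phi> W arbitrary: \<psi> rule: spl.induct)
  case (2 e \<phi> x W)
  have "spl e (\<lambda>P R. \<phi> (x # P) R) W = spl e (\<lambda>P R. \<psi> (x # P) R) W"
    by (rule "2.IH"(1)) (rule "2.prems"; auto)
  moreover have "spl e (\<lambda>P R. sg (e x * word_deg e P) * \<phi> P (x # R)) W
      = spl e (\<lambda>P R. sg (e x * word_deg e P) * \<psi> P (x # R)) W"
    by (rule "2.IH"(2), rule arg_cong[where f = "(*) _"], rule "2.prems") auto
  ultimately show ?case by simp
qed auto

lemma spl_add: "spl e (\<lambda>P R. \<phi> P R + \<psi> P R) W = spl e \<phi> W + spl e \<psi> W"
proof (induction e \<phi> W arbitrary: \<psi> rule: spl.induct)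
  case (2 e \<phi> x W)
  show ?case by (simp only: spl.simps "2.IH" distrib_left) (simp add: algebra_simps)
qed auto

lemma spl_mult: "spl e (\<lambda>P R. k * \<phi> P R) W = k * spl e \<phi> W"
proof (induction e \<phi> W rule: spl.induct)
  case (2 e \<phi> x W)
  show ?case by (simp only: spl.simps "2.IH" mult.left_commute[of _ k]) (simp add: algebra_simps)
qed auto

lemma spl_mult_right: "spl e (\<lambda>P R. \<phi> P R * k) W = spl e \<phi> W * k"
  by (simp add: spl_mult mult.commute[of _ k])

lemma spl_uminus: "spl e (\<lambda>P R. - \<phi> P R) W = - spl e \<phi> W"
  using spl_mult[where k = "-1"] by simp

lemma spl_diff: "spl e (\<lambda>P R. \<phi> P R - \<psi> P R) W = spl e \<phi> W - spl e \<psi> W"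
  using spl_add[where \<psi> = "\<lambda>P R. - \<psi> P R"] by (simp add: spl_uminus)

lemma spl_zero [simp]: "spl e (\<lambda>P R. 0) W = 0"
  using spl_mult[where k = 0] by simp

lemma spl_mult_deep:
  "spl e (\<lambda>P R. f P R * (k * g P R)) W = k * spl e (\<lambda>P R. f P R * g P R) W"
  "spl e (\<lambda>P R. f P R * (g P R * k)) W = k * spl e (\<lambda>P R. f P R * g P R) W"
  "spl e (\<lambda>P R. f P R * (h P R * (k * g P R))) W = k * spl e (\<lambda>P R. f P R * (h P R * g P R)) W"
  "spl e (\<lambda>P R. f P R * (h P R * (g P R * k))) W = k * spl e (\<lambda>P R. f P R * (h P R * g P R)) W"
  "spl e (\<lambda>P R. f P R * (h P R * (h2 P R * (k * g P R)))) W = k * spl e (\<lambda>P R. f P R * (h P R * (h2 P R * g P R))) W"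
  "spl e (\<lambda>P R. f P R * (h P R * (h2 P R * (g P R * k)))) W = k * spl e (\<lambda>P R. f P R * (h P R * (h2 P R * g P R))) W"
  "spl e (\<lambda>P R. f P R * (h P R * (h2 P R * (h3 P R * (k * g P R))))) W = k * spl e (\<lambda>P R. f P R * (h P R * (h2 P R * (h3 P R * g P R)))) W"
  "spl e (\<lambda>P R. f P R * (h P R * (h2 P R * (h3 P R * (g P R * k))))) W = k * spl e (\<lambda>P R. f P R * (h P R * (h2 P R * (h3 P R * g P R)))) W"
  "spl e (\<lambda>P R. f P R * (h P R * (h2 P R * (h3 P R * (h4 P R * (k * g P R)))))) W = k * spl e (\<lambda>P R. f P R * (h P R * (h2 P R * (h3 P R * (h4 P R * g P R))))) W"
  "spl e (\<lambda>P R. f P R * (h P R * (h2 P R * (h3 P R * (h4 P R * (g P R * k)))))) W = k * spl e (\<lambda>P R. f P R * (h P R * (h2 P R * (h3 P R * (h4 P R * g P R))))) W"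
  "spl e (\<lambda>P R. f P R * (h P R * (h2 P R * (h3 P R * (h4 P R * (h5 P R * (k * g P R))))))) W = k * spl e (\<lambda>P R. f P R * (h P R * (h2 P R * (h3 P R * (h4 P R * (h5 P R * g P R)))))) W"
  "spl e (\<lambda>P R. f P R * (h P R * (h2 P R * (h3 P R * (h4 P R * (h5 P R * (g P R * k))))))) W = k * spl e (\<lambda>P R. f P R * (h P R * (h2 P R * (h3 P R * (h4 P R * (h5 P R * g P R)))))) W"
  "spl e (\<lambda>P R. f P R * (h P R * (h2 P R * (h3 P R * (h4 P R * (h5 P R * (h6 P R * (k * g P R)))))))) W = k * spl e (\<lambda>P R. f P R * (h P R * (h2 P R * (h3 P R * (h4 P R * (h5 P R * (h6 P R * g P R))))))) W"
  "spl e (\<lambda>P R. f P R * (h P R * (h2 P R * (h3 P R * (h4 P R * (h5 P R * (h6 P R * (g P R * k)))))))) W = k * spl e (\<lambda>P R. f P R * (h P R * (h2 P R * (h3 P R * (h4 P R * (h5 P R * (h6 P R * g P R))))))) W"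
  "spl e (\<lambda>P R. f P R * (h P R * (h2 P R * (h3 P R * (h4 P R * (h5 P R * (h6 P R * (h7 P R * (k * g P R))))))))) W = k * spl e (\<lambda>P R. f P R * (h P R * (h2 P R * (h3 P R * (h4 P R * (h5 P R * (h6 P R * (h7 P R * g P R)))))))) W"
  "spl e (\<lambda>P R. f P R * (h P R * (h2 P R * (h3 P R * (h4 P R * (h5 P R * (h6 P R * (h7 P R * (g P R * k))))))))) W = k * spl e (\<lambda>P R. f P R * (h P R * (h2 P R * (h3 P R * (h4 P R * (h5 P R * (h6 P R * (h7 P R * g P R)))))))) W"
  by (simp_all only: spl_mult[symmetric] ac_simps)

lemmas spl_lins = spl_add spl_mult spl_mult_right spl_uminus spl_diff spl_mult_deep

lemma spl_ev: "ev (\<lambda>z. spl e (F z) W) p = spl e (\<lambda>P R. ev (\<lambda>z. F z P R) p) W"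
proof (induction W arbitrary: F)
  case (Cons x W)
  then show ?case by (simp add: ev_lins)
qed simp

lemma spl_ev2_1: "ev2 (\<lambda>u v. spl e (F u v) W) p = spl e (\<lambda>P R. ev2 (\<lambda>u v. F u v P R) p) W"
proof (induction W arbitrary: F)
  case (Cons x W)
  then show ?case by (simp add: ev2_lins)
qed simp

fun del :: "('g \<Rightarrow> int) \<Rightarrow> int \<Rightarrow> ('g \<Rightarrow> ('g \<times> 'g \<Rightarrow>\<^sub>0 'k::field)) \<Rightarrow>
    ('g list \<Rightarrow> 'g list \<Rightarrow> 'k) \<Rightarrow> 'g list \<Rightarrow> 'k" where
  "del e n cg \<phi> [] = 0"
| "del e n cg \<phi> (x # W) =
     spl e (\<lambda>P R. ev2 (\<lambda>u v. sg (e v * word_deg e P) * \<phi> (u # P) (v # R)) (cg x)) W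
     + sg (n * e x) * del e n cg (\<lambda>P R. \<phi> (x # P) R) W
     + sg (n * e x) * del e n cg (\<lambda>P R. sg (e x * word_deg e P) * \<phi> P (x # R)) W"

lemma del_add: "del e n cg (\<lambda>P R. \<phi> P R + \<psi> P R) W = del e n cg \<phi> W + del e n cg \<psi> W"
proof (induction e n cg \<phi> W arbitrary: \<psi> rule: del.induct)
  case (2 e n cg \<phi> x W)
  show ?case by (simp only: del.simps "2.IH" distrib_left ev2_add spl_add) (simp add: algebra_simps)
qed auto

lemma del_mult: "del e n cg (\<lambda>P R. k * \<phi> P R) W = k * del e n cg \<phi> W"
proof (induction e n cg \<phi> W rule: del.induct)
  case (2 e n cg \<phi> x W)
  show ?case by (simp only: del.simps "2.IH" mult.left_commute[of _ k] ev2_mult spl_mult) (simp add: algebra_simps)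
qed auto

lemma del_mult_right: "del e n cg (\<lambda>P R. \<phi> P R * k) W = del e n cg \<phi> W * k"
  by (simp add: del_mult mult.commute[of _ k])

lemma del_uminus: "del e n cg (\<lambda>P R. - \<phi> P R) W = - del e n cg \<phi> W"
  using del_mult[where k = "-1"] by simp

lemma del_diff: "del e n cg (\<lambda>P R. \<phi> P R - \<psi> P R) W = del e n cg \<phi> W - del e n cg \<psi> W"
  using del_add[where \<psi> = "\<lambda>P R. - \<psi> P R"] by (simp add: del_uminus)

lemma del_zero [simp]: "del e n cg (\<lambda>P R. 0) W = 0"
  using del_mult[where k = 0] by simp

lemma del_mult_deep:
  "del e n cg (\<lambda>P R. f P R * (k * g P R)) W = k * del e n cg (\<lambda>P R. f P R * g P R) W"
  "del e n cg (\<lambda>P R. f P R * (g P R * k)) W = k * del e n cg (\<lambda>P R. f P R * g P R) W"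
  "del e n cg (\<lambda>P R. f P R * (h P R * (k * g P R))) W = k * del e n cg (\<lambda>P R. f P R * (h P R * g P R)) W"
  "del e n cg (\<lambda>P R. f P R * (h P R * (g P R * k))) W = k * del e n cg (\<lambda>P R. f P R * (h P R * g P R)) W"
  "del e n cg (\<lambda>P R. f P R * (h P R * (h2 P R * (k * g P R)))) W = k * del e n cg (\<lambda>P R. f P R * (h P R * (h2 P R * g P R))) W"
  "del e n cg (\<lambda>P R. f P R * (h P R * (h2 P R * (g P R * k)))) W = k * del e n cg (\<lambda>P R. f P R * (h P R * (h2 P R * g P R))) W"
  "del e n cg (\<lambda>P R. f P R * (h P R * (h2 P R * (h3 P R * (k * g P R))))) W = k * del e n cg (\<lambda>P R. f P R * (h P R * (h2 P R * (h3 P R * g P R)))) W"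
  "del e n cg (\<lambda>P R. f P R * (h P R * (h2 P R * (h3 P R * (g P R * k))))) W = k * del e n cg (\<lambda>P R. f P R * (h P R * (h2 P R * (h3 P R * g P R)))) W"
  "del e n cg (\<lambda>P R. f P R * (h P R * (h2 P R * (h3 P R * (h4 P R * (k * g P R)))))) W = k * del e n cg (\<lambda>P R. f P R * (h P R * (h2 P R * (h3 P R * (h4 P R * g P R))))) W"
  "del e n cg (\<lambda>P R. f P R * (h P R * (h2 P R * (h3 P R * (h4 P R * (g P R * k)))))) W = k * del e n cg (\<lambda>P R. f P R * (h P R * (h2 P R * (h3 P R * (h4 P R * g P R))))) W"
  "del e n cg (\<lambda>P R. f P R * (h P R * (h2 P R * (h3 P R * (h4 P R * (h5 P R * (k * g P R))))))) W = k * del e n cg (\<lambda>P R. f P R * (h P R * (h2 P R * (h3 P R * (h4 P R * (h5 P R * g P R)))))) W"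
  "del e n cg (\<lambda>P R. f P R * (h P R * (h2 P R * (h3 P R * (h4 P R * (h5 P R * (g P R * k))))))) W = k * del e n cg (\<lambda>P R. f P R * (h P R * (h2 P R * (h3 P R * (h4 P R * (h5 P R * g P R)))))) W"
  "del e n cg (\<lambda>P R. f P R * (h P R * (h2 P R * (h3 P R * (h4 P R * (h5 P R * (h6 P R * (k * g P R)))))))) W = k * del e n cg (\<lambda>P R. f P R * (h P R * (h2 P R * (h3 P R * (h4 P R * (h5 P R * (h6 P R * g P R))))))) W"
  "del e n cg (\<lambda>P R. f P R * (h P R * (h2 P R * (h3 P R * (h4 P R * (h5 P R * (h6 P R * (g P R * k)))))))) W = k * del e n cg (\<lambda>P R. f P R * (h P R * (h2 P R * (h3 P R * (h4 P R * (h5 P R * (h6 P R * g P R))))))) W"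
  "del e n cg (\<lambda>P R. f P R * (h P R * (h2 P R * (h3 P R * (h4 P R * (h5 P R * (h6 P R * (h7 P R * (k * g P R))))))))) W = k * del e n cg (\<lambda>P R. f P R * (h P R * (h2 P R * (h3 P R * (h4 P R * (h5 P R * (h6 P R * (h7 P R * g P R)))))))) W"
  "del e n cg (\<lambda>P R. f P R * (h P R * (h2 P R * (h3 P R * (h4 P R * (h5 P R * (h6 P R * (h7 P R * (g P R * k))))))))) W = k * del e n cg (\<lambda>P R. f P R * (h P R * (h2 P R * (h3 P R * (h4 P R * (h5 P R * (h6 P R * (h7 P R * g P R)))))))) W"
  by (simp_all only: del_mult[symmetric] ac_simps)

lemmas del_lins = del_add del_mult del_mult_right del_uminus del_diff del_mult_deep

lemma del_ev: "ev (\<lambda>z. del e n cg (F z) W) p = del e n cg (\<lambda>P R. ev (\<lambda>z. F z P R) p) W"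
proof (induction W arbitrary: F)
  case (Cons x W)
  show ?case by (simp add: ev_lins Cons spl_ev ev2_ev)
qed simp

lemma del_cong:
  assumes "\<And>x u v. (u, v) \<in> Poly_Mapping.keys (cg x) \<Longrightarrow> e v = e x - n - e u"
    and "\<And>P R. word_deg e R = word_deg e W - n - word_deg e P \<Longrightarrow> \<phi> P R = \<psi> P R"
  shows "del e n cg \<phi> W = del e n cg \<psi> W"
  using assms
proof (induction e n cg \<phi> W arbitrary: \<psi> rule: del.induct)
  case (2 e n cg \<phi> x W)
  have "del e n cg (\<lambda>P R. \<phi> (x # P) R) W = del e n cg (\<lambda>P R. \<psi> (x # P) R) W"
    by (rule "2.IH"(1)[OF "2.prems"(1) "2.prems"(2)]; simp)
  moreover have "del e n cg (\<lambda>P R. sg (e x * word_deg e P) * \<phi> P (x # R)) W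
      = del e n cg (\<lambda>P R. sg (e x * word_deg e P) * \<psi> P (x # R)) W"
    by (rule "2.IH"(2)[OF "2.prems"(1)], simp, rule arg_cong[where f = "(*) _"], rule "2.prems"(2)) simp
  moreover have "spl e (\<lambda>P R. ev2 (\<lambda>u v. sg (e v * word_deg e P) * \<phi> (u # P) (v # R)) (cg x)) W
      = spl e (\<lambda>P R. ev2 (\<lambda>u v. sg (e v * word_deg e P) * \<psi> (u # P) (v # R)) (cg x)) W"
    by (intro spl_cong ev2_cong arg_cong[where f = "(*) _"] "2.prems"(2)) (simp add: "2.prems"(1))
  ultimately show ?case by simp
qed auto

fun EE :: "('g \<Rightarrow> int) \<Rightarrow> ('g \<Rightarrow> ('g \<Rightarrow>\<^sub>0 'k::field)) \<Rightarrow> ('g \<Rightarrow> 'g \<Rightarrow> ('g \<Rightarrow>\<^sub>0 'k)) \<Rightarrow>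
    'g \<Rightarrow> ('g list \<Rightarrow> 'k) \<Rightarrow> 'g list \<Rightarrow> 'k" where
  "EE e Dg Bg x \<phi> [] = ev (\<lambda>z. \<phi> [z]) (Dg x)"
| "EE e Dg Bg x \<phi> (y # W) = sg (e y * (e x + 1)) * EE e Dg Bg x (\<lambda>V. \<phi> (y # V)) W
     + ev (\<lambda>z. \<phi> (z # W)) (Bg x y)"

lemma EE_add: "EE e Dg Bg x (\<lambda>V. \<phi> V + \<psi> V) W = EE e Dg Bg x \<phi> W + EE e Dg Bg x \<psi> W"
proof (induction e Dg Bg x \<phi> W arbitrary: \<psi> rule: EE.induct)
  case (2 e Dg Bg x \<phi> y W)
  show ?case by (simp only: EE.simps "2.IH" ev_fun_add) (simp add: algebra_simps)
qed (auto simp: ev_fun_add)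

lemma EE_mult: "EE e Dg Bg x (\<lambda>V. k * \<phi> V) W = k * EE e Dg Bg x \<phi> W"
proof (induction e Dg Bg x \<phi> W rule: EE.induct)
  case (2 e Dg Bg x \<phi> y W)
  show ?case by (simp only: EE.simps "2.IH" ev_fun_mult) (simp add: algebra_simps)
qed (auto simp: ev_fun_mult)

lemma EE_mult_right: "EE e Dg Bg x (\<lambda>V. \<phi> V * k) W = EE e Dg Bg x \<phi> W * k"
  by (simp add: EE_mult mult.commute[of _ k])

lemma EE_uminus: "EE e Dg Bg x (\<lambda>V. - \<phi> V) W = - EE e Dg Bg x \<phi> W"
  using EE_mult[where k = "-1"] by simp

lemma EE_diff: "EE e Dg Bg x (\<lambda>V. \<phi> V - \<psi> V) W = EE e Dg Bg x \<phi> W - EE e Dg Bg x \<psi> W"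
  using EE_add[where \<psi> = "\<lambda>V. - \<psi> V"] by (simp add: EE_uminus)

lemma EE_zero [simp]: "EE e Dg Bg x (\<lambda>V. 0) W = 0"
  using EE_mult[where k = 0] by simp

lemma EE_mult_deep:
  "EE e Dg Bg x (\<lambda>V. f V * (k * g V)) W = k * EE e Dg Bg x (\<lambda>V. f V * g V) W"
  "EE e Dg Bg x (\<lambda>V. f V * (g V * k)) W = k * EE e Dg Bg x (\<lambda>V. f V * g V) W"
  "EE e Dg Bg x (\<lambda>V. f V * (h V * (k * g V))) W = k * EE e Dg Bg x (\<lambda>V. f V * (h V * g V)) W"
  "EE e Dg Bg x (\<lambda>V. f V * (h V * (g V * k))) W = k * EE e Dg Bg x (\<lambda>V. f V * (h V * g V)) W"
  "EE e Dg Bg x (\<lambda>V. f V * (h V * (h2 V * (k * g V)))) W = k * EE e Dg Bg x (\<lambda>V. f V * (h V * (h2 V * g V))) W"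
  "EE e Dg Bg x (\<lambda>V. f V * (h V * (h2 V * (g V * k)))) W = k * EE e Dg Bg x (\<lambda>V. f V * (h V * (h2 V * g V))) W"
  "EE e Dg Bg x (\<lambda>V. f V * (h V * (h2 V * (h3 V * (k * g V))))) W = k * EE e Dg Bg x (\<lambda>V. f V * (h V * (h2 V * (h3 V * g V)))) W"
  "EE e Dg Bg x (\<lambda>V. f V * (h V * (h2 V * (h3 V * (g V * k))))) W = k * EE e Dg Bg x (\<lambda>V. f V * (h V * (h2 V * (h3 V * g V)))) W"
  "EE e Dg Bg x (\<lambda>V. f V * (h V * (h2 V * (h3 V * (h4 V * (k * g V)))))) W = k * EE e Dg Bg x (\<lambda>V. f V * (h V * (h2 V * (h3 V * (h4 V * g V))))) W"
  "EE e Dg Bg x (\<lambda>V. f V * (h V * (h2 V * (h3 V * (h4 V * (g V * k)))))) W = k * EE e Dg Bg x (\<lambda>V. f V * (h V * (h2 V * (h3 V * (h4 V * g V))))) W"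
  "EE e Dg Bg x (\<lambda>V. f V * (h V * (h2 V * (h3 V * (h4 V * (h5 V * (k * g V))))))) W = k * EE e Dg Bg x (\<lambda>V. f V * (h V * (h2 V * (h3 V * (h4 V * (h5 V * g V)))))) W"
  "EE e Dg Bg x (\<lambda>V. f V * (h V * (h2 V * (h3 V * (h4 V * (h5 V * (g V * k))))))) W = k * EE e Dg Bg x (\<lambda>V. f V * (h V * (h2 V * (h3 V * (h4 V * (h5 V * g V)))))) W"
  "EE e Dg Bg x (\<lambda>V. f V * (h V * (h2 V * (h3 V * (h4 V * (h5 V * (h6 V * (k * g V)))))))) W = k * EE e Dg Bg x (\<lambda>V. f V * (h V * (h2 V * (h3 V * (h4 V * (h5 V * (h6 V * g V))))))) W"
  "EE e Dg Bg x (\<lambda>V. f V * (h V * (h2 V * (h3 V * (h4 V * (h5 V * (h6 V * (g V * k)))))))) W = k * EE e Dg Bg x (\<lambda>V. f V * (h V * (h2 V * (h3 V * (h4 V * (h5 V * (h6 V * g V))))))) W"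
  "EE e Dg Bg x (\<lambda>V. f V * (h V * (h2 V * (h3 V * (h4 V * (h5 V * (h6 V * (h7 V * (k * g V))))))))) W = k * EE e Dg Bg x (\<lambda>V. f V * (h V * (h2 V * (h3 V * (h4 V * (h5 V * (h6 V * (h7 V * g V)))))))) W"
  "EE e Dg Bg x (\<lambda>V. f V * (h V * (h2 V * (h3 V * (h4 V * (h5 V * (h6 V * (h7 V * (g V * k))))))))) W = k * EE e Dg Bg x (\<lambda>V. f V * (h V * (h2 V * (h3 V * (h4 V * (h5 V * (h6 V * (h7 V * g V)))))))) W"
  by (simp_all only: EE_mult[symmetric] ac_simps)

lemmas EE_lins = EE_add EE_mult EE_mult_right EE_uminus EE_diff EE_mult_deep

lemma EE_ev: "ev (\<lambda>z. EE e Dg Bg x (F z) W) p = EE e Dg Bg x (\<lambda>V. ev (\<lambda>z. F z V) p) W"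
proof (induction W arbitrary: F)
  case (Cons y W)
  show ?case by (simp add: ev_lins Cons ev_swap[where q = "Bg x y"])
qed (simp add: ev_swap[where q = "Dg x"])

lemma EE_cong:
  assumes "\<And>x z. z \<in> Poly_Mapping.keys (Dg x) \<Longrightarrow> e z = e x + 1"
    and "\<And>x y z. z \<in> Poly_Mapping.keys (Bg x y) \<Longrightarrow> e z = e x + e y + 1"
    and "\<And>V. word_deg e V = word_deg e W + e x + 1 \<Longrightarrow> \<phi> V = \<psi> V"
  shows "EE e Dg Bg x \<phi> W = EE e Dg Bg x \<psi> W"
  using assms
proof (induction e Dg Bg x \<phi> W arbitrary: \<psi> rule: EE.induct)
  case (2 e Dg Bg x \<phi> y W)
  have "EE e Dg Bg x (\<lambda>V. \<phi> (y # V)) W = EE e Dg Bg x (\<lambda>V. \<psi> (y # V)) W"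
    by (rule "2.IH"[OF "2.prems"(1,2) "2.prems"(3)]; simp)
  moreover have "ev (\<lambda>z. \<phi> (z # W)) (Bg x y) = ev (\<lambda>z. \<psi> (z # W)) (Bg x y)"
    by (intro ev_cong "2.prems"(3)) (simp add: "2.prems"(2))
  ultimately show ?case by simp
qed (auto intro!: ev_cong)

fun QQ :: "('g \<Rightarrow> int) \<Rightarrow> ('g \<Rightarrow> ('g \<Rightarrow>\<^sub>0 'k::field)) \<Rightarrow> ('g \<Rightarrow> 'g \<Rightarrow> ('g \<Rightarrow>\<^sub>0 'k)) \<Rightarrow>
    ('g list \<Rightarrow> 'k) \<Rightarrow> 'g list \<Rightarrow> 'k" where
  "QQ e Dg Bg \<phi> [] = 0"
| "QQ e Dg Bg \<phi> (x # W) = sg (e x) * QQ e Dg Bg (\<lambda>V. \<phi> (x # V)) W + EE e Dg Bg x \<phi> W"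

lemma QQ_add: "QQ e Dg Bg (\<lambda>V. \<phi> V + \<psi> V) W = QQ e Dg Bg \<phi> W + QQ e Dg Bg \<psi> W"
proof (induction e Dg Bg \<phi> W arbitrary: \<psi> rule: QQ.induct)
  case (2 e Dg Bg \<phi> x W)
  show ?case by (simp only: QQ.simps "2.IH" EE_add) (simp add: algebra_simps)
qed auto

lemma QQ_mult: "QQ e Dg Bg (\<lambda>V. k * \<phi> V) W = k * QQ e Dg Bg \<phi> W"
proof (induction e Dg Bg \<phi> W rule: QQ.induct)
  case (2 e Dg Bg \<phi> x W)
  show ?case by (simp only: QQ.simps "2.IH" EE_mult) (simp add: algebra_simps)
qed auto

lemma QQ_mult_right: "QQ e Dg Bg (\<lambda>V. \<phi> V * k) W = QQ e Dg Bg \<phi> W * k"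
  by (simp add: QQ_mult mult.commute[of _ k])

lemma QQ_uminus: "QQ e Dg Bg (\<lambda>V. - \<phi> V) W = - QQ e Dg Bg \<phi> W"
  using QQ_mult[where k = "-1"] by simp

lemma QQ_diff: "QQ e Dg Bg (\<lambda>V. \<phi> V - \<psi> V) W = QQ e Dg Bg \<phi> W - QQ e Dg Bg \<psi> W"
  using QQ_add[where \<psi> = "\<lambda>V. - \<psi> V"] by (simp add: QQ_uminus)

lemma QQ_zero [simp]: "QQ e Dg Bg (\<lambda>V. 0) W = 0"
  using QQ_mult[where k = 0] by simp

lemma QQ_mult_deep:
  "QQ e Dg Bg (\<lambda>V. f V * (k * g V)) W = k * QQ e Dg Bg (\<lambda>V. f V * g V) W"
  "QQ e Dg Bg (\<lambda>V. f V * (g V * k)) W = k * QQ e Dg Bg (\<lambda>V. f V * g V) W"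
  "QQ e Dg Bg (\<lambda>V. f V * (h V * (k * g V))) W = k * QQ e Dg Bg (\<lambda>V. f V * (h V * g V)) W"
  "QQ e Dg Bg (\<lambda>V. f V * (h V * (g V * k))) W = k * QQ e Dg Bg (\<lambda>V. f V * (h V * g V)) W"
  "QQ e Dg Bg (\<lambda>V. f V * (h V * (h2 V * (k * g V)))) W = k * QQ e Dg Bg (\<lambda>V. f V * (h V * (h2 V * g V))) W"
  "QQ e Dg Bg (\<lambda>V. f V * (h V * (h2 V * (g V * k)))) W = k * QQ e Dg Bg (\<lambda>V. f V * (h V * (h2 V * g V))) W"
  "QQ e Dg Bg (\<lambda>V. f V * (h V * (h2 V * (h3 V * (k * g V))))) W = k * QQ e Dg Bg (\<lambda>V. f V * (h V * (h2 V * (h3 V * g V)))) W"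
  "QQ e Dg Bg (\<lambda>V. f V * (h V * (h2 V * (h3 V * (g V * k))))) W = k * QQ e Dg Bg (\<lambda>V. f V * (h V * (h2 V * (h3 V * g V)))) W"
  "QQ e Dg Bg (\<lambda>V. f V * (h V * (h2 V * (h3 V * (h4 V * (k * g V)))))) W = k * QQ e Dg Bg (\<lambda>V. f V * (h V * (h2 V * (h3 V * (h4 V * g V))))) W"
  "QQ e Dg Bg (\<lambda>V. f V * (h V * (h2 V * (h3 V * (h4 V * (g V * k)))))) W = k * QQ e Dg Bg (\<lambda>V. f V * (h V * (h2 V * (h3 V * (h4 V * g V))))) W"
  "QQ e Dg Bg (\<lambda>V. f V * (h V * (h2 V * (h3 V * (h4 V * (h5 V * (k * g V))))))) W = k * QQ e Dg Bg (\<lambda>V. f V * (h V * (h2 V * (h3 V * (h4 V * (h5 V * g V)))))) W"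
  "QQ e Dg Bg (\<lambda>V. f V * (h V * (h2 V * (h3 V * (h4 V * (h5 V * (g V * k))))))) W = k * QQ e Dg Bg (\<lambda>V. f V * (h V * (h2 V * (h3 V * (h4 V * (h5 V * g V)))))) W"
  "QQ e Dg Bg (\<lambda>V. f V * (h V * (h2 V * (h3 V * (h4 V * (h5 V * (h6 V * (k * g V)))))))) W = k * QQ e Dg Bg (\<lambda>V. f V * (h V * (h2 V * (h3 V * (h4 V * (h5 V * (h6 V * g V))))))) W"
  "QQ e Dg Bg (\<lambda>V. f V * (h V * (h2 V * (h3 V * (h4 V * (h5 V * (h6 V * (g V * k)))))))) W = k * QQ e Dg Bg (\<lambda>V. f V * (h V * (h2 V * (h3 V * (h4 V * (h5 V * (h6 V * g V))))))) W"
  "QQ e Dg Bg (\<lambda>V. f V * (h V * (h2 V * (h3 V * (h4 V * (h5 V * (h6 V * (h7 V * (k * g V))))))))) W = k * QQ e Dg Bg (\<lambda>V. f V * (h V * (h2 V * (h3 V * (h4 V * (h5 V * (h6 V * (h7 V * g V)))))))) W"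
  "QQ e Dg Bg (\<lambda>V. f V * (h V * (h2 V * (h3 V * (h4 V * (h5 V * (h6 V * (h7 V * (g V * k))))))))) W = k * QQ e Dg Bg (\<lambda>V. f V * (h V * (h2 V * (h3 V * (h4 V * (h5 V * (h6 V * (h7 V * g V)))))))) W"
  by (simp_all only: QQ_mult[symmetric] ac_simps)

lemmas QQ_lins = QQ_add QQ_mult QQ_mult_right QQ_uminus QQ_diff QQ_mult_deep

lemma QQ_ev: "ev (\<lambda>z. QQ e Dg Bg (F z) W) p = QQ e Dg Bg (\<lambda>V. ev (\<lambda>z. F z V) p) W"
proof (induction W arbitrary: F)
  case (Cons x W)
  show ?case by (simp add: ev_lins Cons EE_ev)
qed simp

lemma QQ_cong:
  assumes "\<And>x z. z \<in> Poly_Mapping.keys (Dg x) \<Longrightarrow> e z = e x + 1"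
    and "\<And>x y z. z \<in> Poly_Mapping.keys (Bg x y) \<Longrightarrow> e z = e x + e y + 1"
    and "\<And>V. word_deg e V = word_deg e W + 1 \<Longrightarrow> \<phi> V = \<psi> V"
  shows "QQ e Dg Bg \<phi> W = QQ e Dg Bg \<psi> W"
  using assms
proof (induction e Dg Bg \<phi> W arbitrary: \<psi> rule: QQ.induct)
  case (2 e Dg Bg \<phi> x W)
  have "QQ e Dg Bg (\<lambda>V. \<phi> (x # V)) W = QQ e Dg Bg (\<lambda>V. \<psi> (x # V)) W"
    by (rule "2.IH"[OF "2.prems"(1,2) "2.prems"(3)]; simp)
  moreover have "EE e Dg Bg x \<phi> W = EE e Dg Bg x \<psi> W"
    by (intro EE_cong "2.prems") (simp_all add: algebra_simps)
  ultimately show ?case by simp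
qed auto

lemma spl_ev2:
  "ev2 (\<lambda>u v. spl e (F u v) W) p = spl e (\<lambda>P R. ev2 (\<lambda>u v. F u v P R) p) W"
  "ev2 (\<lambda>u v. f u v * (spl e (F u v) W)) p = spl e (\<lambda>P R. ev2 (\<lambda>u v. f u v * (F u v P R)) p) W"
  "ev2 (\<lambda>u v. f u v * (h u v * (spl e (F u v) W))) p = spl e (\<lambda>P R. ev2 (\<lambda>u v. f u v * (h u v * (F u v P R))) p) W"
  "ev2 (\<lambda>u v. f u v * (h u v * (h2 u v * (spl e (F u v) W)))) p = spl e (\<lambda>P R. ev2 (\<lambda>u v. f u v * (h u v * (h2 u v * (F u v P R)))) p) W"
  "ev2 (\<lambda>u v. f u v * (h u v * (h2 u v * (h3 u v * (spl e (F u v) W))))) p = spl e (\<lambda>P R. ev2 (\<lambda>u v. f u v * (h u v * (h2 u v * (h3 u v * (F u v P R))))) p) W"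
  "ev2 (\<lambda>u v. f u v * (h u v * (h2 u v * (h3 u v * (h4 u v * (spl e (F u v) W)))))) p = spl e (\<lambda>P R. ev2 (\<lambda>u v. f u v * (h u v * (h2 u v * (h3 u v * (h4 u v * (F u v P R)))))) p) W"
  "ev2 (\<lambda>u v. f u v * (h u v * (h2 u v * (h3 u v * (h4 u v * (h5 u v * (spl e (F u v) W))))))) p = spl e (\<lambda>P R. ev2 (\<lambda>u v. f u v * (h u v * (h2 u v * (h3 u v * (h4 u v * (h5 u v * (F u v P R))))))) p) W"
  "ev2 (\<lambda>u v. f u v * (h u v * (h2 u v * (h3 u v * (h4 u v * (h5 u v * (h6 u v * (spl e (F u v) W)))))))) p = spl e (\<lambda>P R. ev2 (\<lambda>u v. f u v * (h u v * (h2 u v * (h3 u v * (h4 u v * (h5 u v * (h6 u v * (F u v P R)))))))) p) W"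
  by (simp_all only: spl_ev2_1 spl_mult[symmetric])

lemma del_ev2_1: "ev2 (\<lambda>u v. del e n cg (F u v) W) p = del e n cg (\<lambda>P R. ev2 (\<lambda>u v. F u v P R) p) W"
  unfolding ev2_def using del_ev[of e n cg "\<lambda>z. F (fst z) (snd z)"] by (simp add: case_prod_unfold)

lemma EE_ev2_1: "ev2 (\<lambda>u v. EE e Dg Bg x (F u v) W) p = EE e Dg Bg x (\<lambda>V. ev2 (\<lambda>u v. F u v V) p) W"
  unfolding ev2_def using EE_ev[of e Dg Bg x "\<lambda>z. F (fst z) (snd z)"] by (simp add: case_prod_unfold)

lemma QQ_ev2_1: "ev2 (\<lambda>u v. QQ e Dg Bg (F u v) W) p = QQ e Dg Bg (\<lambda>V. ev2 (\<lambda>u v. F u v V) p) W"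
  unfolding ev2_def using QQ_ev[of e Dg Bg "\<lambda>z. F (fst z) (snd z)"] by (simp add: case_prod_unfold)

lemma del_ev2:
  "ev2 (\<lambda>u v. del e n cg (F u v) W) p = del e n cg (\<lambda>P R. ev2 (\<lambda>u v. F u v P R) p) W"
  "ev2 (\<lambda>u v. f u v * (del e n cg (F u v) W)) p = del e n cg (\<lambda>P R. ev2 (\<lambda>u v. f u v * (F u v P R)) p) W"
  "ev2 (\<lambda>u v. f u v * (h u v * (del e n cg (F u v) W))) p = del e n cg (\<lambda>P R. ev2 (\<lambda>u v. f u v * (h u v * (F u v P R))) p) W"
  "ev2 (\<lambda>u v. f u v * (h u v * (h2 u v * (del e n cg (F u v) W)))) p = del e n cg (\<lambda>P R. ev2 (\<lambda>u v. f u v * (h u v * (h2 u v * (F u v P R)))) p) W"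
  "ev2 (\<lambda>u v. f u v * (h u v * (h2 u v * (h3 u v * (del e n cg (F u v) W))))) p = del e n cg (\<lambda>P R. ev2 (\<lambda>u v. f u v * (h u v * (h2 u v * (h3 u v * (F u v P R))))) p) W"
  "ev2 (\<lambda>u v. f u v * (h u v * (h2 u v * (h3 u v * (h4 u v * (del e n cg (F u v) W)))))) p = del e n cg (\<lambda>P R. ev2 (\<lambda>u v. f u v * (h u v * (h2 u v * (h3 u v * (h4 u v * (F u v P R)))))) p) W"
  "ev2 (\<lambda>u v. f u v * (h u v * (h2 u v * (h3 u v * (h4 u v * (h5 u v * (del e n cg (F u v) W))))))) p = del e n cg (\<lambda>P R. ev2 (\<lambda>u v. f u v * (h u v * (h2 u v * (h3 u v * (h4 u v * (h5 u v * (F u v P R))))))) p) W"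
  "ev2 (\<lambda>u v. f u v * (h u v * (h2 u v * (h3 u v * (h4 u v * (h5 u v * (h6 u v * (del e n cg (F u v) W)))))))) p = del e n cg (\<lambda>P R. ev2 (\<lambda>u v. f u v * (h u v * (h2 u v * (h3 u v * (h4 u v * (h5 u v * (h6 u v * (F u v P R)))))))) p) W"
  by (simp_all only: del_ev2_1 del_mult[symmetric])

lemma EE_ev2:
  "ev2 (\<lambda>u v. EE e Dg Bg x (F u v) W) p = EE e Dg Bg x (\<lambda>V. ev2 (\<lambda>u v. F u v V) p) W"
  "ev2 (\<lambda>u v. f u v * (EE e Dg Bg x (F u v) W)) p = EE e Dg Bg x (\<lambda>V. ev2 (\<lambda>u v. f u v * (F u v V)) p) W"
  "ev2 (\<lambda>u v. f u v * (h u v * (EE e Dg Bg x (F u v) W))) p = EE e Dg Bg x (\<lambda>V. ev2 (\<lambda>u v. f u v * (h u v * (F u v V))) p) W"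
  "ev2 (\<lambda>u v. f u v * (h u v * (h2 u v * (EE e Dg Bg x (F u v) W)))) p = EE e Dg Bg x (\<lambda>V. ev2 (\<lambda>u v. f u v * (h u v * (h2 u v * (F u v V)))) p) W"
  "ev2 (\<lambda>u v. f u v * (h u v * (h2 u v * (h3 u v * (EE e Dg Bg x (F u v) W))))) p = EE e Dg Bg x (\<lambda>V. ev2 (\<lambda>u v. f u v * (h u v * (h2 u v * (h3 u v * (F u v V))))) p) W"
  "ev2 (\<lambda>u v. f u v * (h u v * (h2 u v * (h3 u v * (h4 u v * (EE e Dg Bg x (F u v) W)))))) p = EE e Dg Bg x (\<lambda>V. ev2 (\<lambda>u v. f u v * (h u v * (h2 u v * (h3 u v * (h4 u v * (F u v V)))))) p) W"
  "ev2 (\<lambda>u v. f u v * (h u v * (h2 u v * (h3 u v * (h4 u v * (h5 u v * (EE e Dg Bg x (F u v) W))))))) p = EE e Dg Bg x (\<lambda>V. ev2 (\<lambda>u v. f u v * (h u v * (h2 u v * (h3 u v * (h4 u v * (h5 u v * (F u v V))))))) p) W"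
  "ev2 (\<lambda>u v. f u v * (h u v * (h2 u v * (h3 u v * (h4 u v * (h5 u v * (h6 u v * (EE e Dg Bg x (F u v) W)))))))) p = EE e Dg Bg x (\<lambda>V. ev2 (\<lambda>u v. f u v * (h u v * (h2 u v * (h3 u v * (h4 u v * (h5 u v * (h6 u v * (F u v V)))))))) p) W"
  by (simp_all only: EE_ev2_1 EE_mult[symmetric])

lemma QQ_ev2:
  "ev2 (\<lambda>u v. QQ e Dg Bg (F u v) W) p = QQ e Dg Bg (\<lambda>V. ev2 (\<lambda>u v. F u v V) p) W"
  "ev2 (\<lambda>u v. f u v * (QQ e Dg Bg (F u v) W)) p = QQ e Dg Bg (\<lambda>V. ev2 (\<lambda>u v. f u v * (F u v V)) p) W"
  "ev2 (\<lambda>u v. f u v * (h u v * (QQ e Dg Bg (F u v) W))) p = QQ e Dg Bg (\<lambda>V. ev2 (\<lambda>u v. f u v * (h u v * (F u v V))) p) W"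
  "ev2 (\<lambda>u v. f u v * (h u v * (h2 u v * (QQ e Dg Bg (F u v) W)))) p = QQ e Dg Bg (\<lambda>V. ev2 (\<lambda>u v. f u v * (h u v * (h2 u v * (F u v V)))) p) W"
  "ev2 (\<lambda>u v. f u v * (h u v * (h2 u v * (h3 u v * (QQ e Dg Bg (F u v) W))))) p = QQ e Dg Bg (\<lambda>V. ev2 (\<lambda>u v. f u v * (h u v * (h2 u v * (h3 u v * (F u v V))))) p) W"
  "ev2 (\<lambda>u v. f u v * (h u v * (h2 u v * (h3 u v * (h4 u v * (QQ e Dg Bg (F u v) W)))))) p = QQ e Dg Bg (\<lambda>V. ev2 (\<lambda>u v. f u v * (h u v * (h2 u v * (h3 u v * (h4 u v * (F u v V)))))) p) W"
  "ev2 (\<lambda>u v. f u v * (h u v * (h2 u v * (h3 u v * (h4 u v * (h5 u v * (QQ e Dg Bg (F u v) W))))))) p = QQ e Dg Bg (\<lambda>V. ev2 (\<lambda>u v. f u v * (h u v * (h2 u v * (h3 u v * (h4 u v * (h5 u v * (F u v V))))))) p) W"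
  "ev2 (\<lambda>u v. f u v * (h u v * (h2 u v * (h3 u v * (h4 u v * (h5 u v * (h6 u v * (QQ e Dg Bg (F u v) W)))))))) p = QQ e Dg Bg (\<lambda>V. ev2 (\<lambda>u v. f u v * (h u v * (h2 u v * (h3 u v * (h4 u v * (h5 u v * (h6 u v * (F u v V)))))))) p) W"
  by (simp_all only: QQ_ev2_1 QQ_mult[symmetric])

text \<open>A differential graded Lie bialgebra in the shifted convention: the bracket
  \<open>Bg\<close> is graded symmetric of degree 1 and the cobracket \<open>cg\<close> lowers the
  degree by \<open>n\<close>. The identities of \<open>cg\<close> alone and with \<open>Dg\<close>
  are required for all functionals, since they hold on words before any quotient; the compatibility
  \<open>cg_Bg\<close> is tested by functionals that kill \<open>R\<close> in each variable.\<close>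

locale dg_lie_bialgebra =
  fixes e :: "'g \<Rightarrow> int" and n :: int
    and Dg :: "'g \<Rightarrow> ('g \<Rightarrow>\<^sub>0 'k::field)"
    and Bg :: "'g \<Rightarrow> 'g \<Rightarrow> ('g \<Rightarrow>\<^sub>0 'k)"
    and cg :: "'g \<Rightarrow> ('g \<times> 'g \<Rightarrow>\<^sub>0 'k)"
    and R :: "('g \<Rightarrow>\<^sub>0 'k) set"
  assumes Dg_deg: "z \<in> Poly_Mapping.keys (Dg x) \<Longrightarrow> e z = e x + 1"
    and Bg_deg: "z \<in> Poly_Mapping.keys (Bg x y) \<Longrightarrow> e z = e x + e y + 1"
    and cg_deg: "(u, v) \<in> Poly_Mapping.keys (cg x) \<Longrightarrow> e v = e x - n - e u"
    and R_hom: "r \<in> R \<Longrightarrow> \<exists>m. \<forall>z\<in>Poly_Mapping.keys r. e z = m"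
    and R_Dg: "(\<And>r. r \<in> R \<Longrightarrow> ev \<psi> r = 0) \<Longrightarrow> r \<in> R \<Longrightarrow> ev (\<lambda>x. ev \<psi> (Dg x)) r = 0"
    and R_Bg: "(\<And>r. r \<in> R \<Longrightarrow> ev \<psi> r = 0) \<Longrightarrow> r \<in> R \<Longrightarrow> ev (\<lambda>x. ev \<psi> (Bg x y)) r = 0"
    and R_cg: "(\<And>r v. r \<in> R \<Longrightarrow> ev (\<lambda>u. \<theta> u v) r = 0) \<Longrightarrow> (\<And>r u. r \<in> R \<Longrightarrow> ev (\<theta> u) r = 0) \<Longrightarrow>
      r \<in> R \<Longrightarrow> ev (\<lambda>x. ev2 \<theta> (cg x)) r = 0"
    and Bg_sym: "(\<And>r. r \<in> R \<Longrightarrow> ev \<psi> r = 0) \<Longrightarrow> ev \<psi> (Bg x y) = sg (e x * e y) * ev \<psi> (Bg y x)"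
    and Dg_Dg: "(\<And>r. r \<in> R \<Longrightarrow> ev \<psi> r = 0) \<Longrightarrow> ev (\<lambda>z. ev \<psi> (Dg z)) (Dg x) = 0"
    and Dg_Bg: "(\<And>r. r \<in> R \<Longrightarrow> ev \<psi> r = 0) \<Longrightarrow> ev (\<lambda>z. ev \<psi> (Dg z)) (Bg x y) =
      - (sg (e x) * ev (\<lambda>z. ev \<psi> (Bg x z)) (Dg y)
       + sg (e y * (e x + 1)) * ev (\<lambda>z. ev \<psi> (Bg y z)) (Dg x))"
    and Bg_jacobi: "(\<And>r. r \<in> R \<Longrightarrow> ev \<psi> r = 0) \<Longrightarrow> ev (\<lambda>w. ev \<psi> (Bg w z)) (Bg x y) =
      - (sg (e x) * ev (\<lambda>w. ev \<psi> (Bg x w)) (Bg y z)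
       + sg (e y * (e x + 1)) * ev (\<lambda>w. ev \<psi> (Bg y w)) (Bg x z))"
    and cg_swap: "ev2 (\<lambda>u v. sg (e u * e v) * \<theta> v u) (cg x) = - (sg n * ev2 \<theta> (cg x))"
    and cg_jacobi: "ev2 (\<lambda>u v. ev2 (\<lambda>u1 u2. \<Theta> u1 u2 v) (cg u)) (cg x)
      + ev2 (\<lambda>u v. ev2 (\<lambda>u1 u2. sg (e v * (e u1 + e u2)) * \<Theta> v u1 u2) (cg u)) (cg x)
      + ev2 (\<lambda>u v. ev2 (\<lambda>u1 u2. sg (e u1 * (e u2 + e v)) * \<Theta> u2 v u1) (cg u)) (cg x) = 0"
    and cg_Dg: "ev (\<lambda>z. ev2 \<theta> (cg z)) (Dg x) = sg n * ev2 (\<lambda>u v. ev (\<lambda>z. \<theta> z v) (Dg u)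
      + sg (e u) * ev (\<theta> u) (Dg v)) (cg x)"
    and cg_Bg: "(\<And>r v. r \<in> R \<Longrightarrow> ev (\<lambda>u. \<theta> u v) r = 0) \<Longrightarrow> (\<And>r u. r \<in> R \<Longrightarrow> ev (\<theta> u) r = 0) \<Longrightarrow>
      ev (\<lambda>z. ev2 \<theta> (cg z)) (Bg x y) =
        sg (n * (e x + 1)) * ev2 (\<lambda>u v. ev (\<lambda>z. \<theta> z v) (Bg x u)
          + sg ((e x + 1) * e u) * ev (\<theta> u) (Bg x v)) (cg y)
        + sg n * ev2 (\<lambda>u v. sg (e v * e y) * ev (\<lambda>z. \<theta> z v) (Bg u y)
          + sg (e u) * ev (\<theta> u) (Bg v y)) (cg x)"
begin

abbreviation "Spl \<equiv> spl e"
abbreviation "Del \<equiv> del e n cg"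
abbreviation "E \<equiv> EE e Dg Bg"
abbreviation "Q \<equiv> QQ e Dg Bg"

lemma Spl_cong: "(\<And>P R. word_deg e R = word_deg e W - word_deg e P \<Longrightarrow> \<phi> P R = \<psi> P R) \<Longrightarrow> Spl \<phi> W = Spl \<psi> W"
  by (rule spl_cong)

lemma Del_cong: "(\<And>P R. word_deg e R = word_deg e W - n - word_deg e P \<Longrightarrow> \<phi> P R = \<psi> P R) \<Longrightarrow> Del \<phi> W = Del \<psi> W"
  by (rule del_cong) (auto simp: cg_deg)

lemma E_cong: "(\<And>V. word_deg e V = word_deg e W + e x + 1 \<Longrightarrow> \<phi> V = \<psi> V) \<Longrightarrow> E x \<phi> W = E x \<psi> W"
  by (rule EE_cong) (auto simp: Dg_deg Bg_deg)

lemma Q_cong: "(\<And>V. word_deg e V = word_deg e W + 1 \<Longrightarrow> \<phi> V = \<psi> V) \<Longrightarrow> Q \<phi> W = Q \<psi> W"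
  by (rule QQ_cong) (auto simp: Dg_deg Bg_deg)

lemmas cps2 = ev_lins ev2_lins spl_lins del_lins EE_lins QQ_lins sg_simps algebra_simps
  Dg_deg Bg_deg cg_deg ev2_ev spl_ev spl_ev2 del_ev del_ev2 EE_ev EE_ev2 QQ_ev QQ_ev2
lemmas cps2_congs = ev_cong ev2_cong Spl_cong Del_cong E_cong Q_cong

section \<open>Coproduct, cobracket and coderivation on symmetric words\<close>

lemma Spl_swap: "Spl (\<lambda>P R. sg (word_deg e P * word_deg e R) * \<phi> R P) W = Spl \<phi> W"
proof (induction W arbitrary: \<phi>)
  case (Cons x W)
  show ?case
    using Cons[of "\<lambda>P R. \<phi> (x # P) R"] Cons[of "\<lambda>P R. sg (e x * word_deg e P) * \<phi> P (x # R)"]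
    by (simp add: cps2 cong: cps2_congs)
qed simp

lemma Spl_assoc: "Spl (\<lambda>P R. Spl (\<lambda>P1 P2. \<phi> P1 P2 R) P) W = Spl (\<lambda>P R. Spl (\<lambda>R1 R2. \<phi> P R1 R2) R) W"
proof (induction W arbitrary: \<phi>)
  case (Cons x W)
  show ?case
    using Cons[of "\<lambda>P1 P2 R. \<phi> (x # P1) P2 R"]
      Cons[of "\<lambda>P1 P2 R. sg (e x * word_deg e P1) * \<phi> P1 (x # P2) R"]
      Cons[of "\<lambda>P1 P2 R. sg (e x * (word_deg e P1 + word_deg e P2)) * \<phi> P1 P2 (x # R)"]
    by (simp add: cps2 cong: cps2_congs)
qed simp

text \<open>Where \<open>x\<close> is split, \<open>Spl_swap\<close> exchanges the remaining factors
  and \<open>cg_swap\<close> the two halves of \<open>x\<close>; the other terms follow by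
  induction.\<close>

lemma Del_swap: "Del (\<lambda>P R. sg (word_deg e P * word_deg e R) * \<phi> R P) W = - (sg n * Del \<phi> W)"
proof (induction W arbitrary: \<phi>)
  case (Cons x W)
  have "Spl (\<lambda>P R. ev2 (\<lambda>u v. sg (e v * word_deg e P) * (sg (word_deg e (u # P) * word_deg e (v # R)) * \<phi> (v # R) (u # P))) (cg x)) W
     = Spl (\<lambda>P R. sg (word_deg e P * word_deg e R) * ev2 (\<lambda>u v. sg (e u * e v) * (sg (e u * word_deg e R) * \<phi> (v # R) (u # P))) (cg x)) W"
    by (simp add: ev2_lins sg_simps algebra_simps)
  also have "\<dots> = Spl (\<lambda>P R. ev2 (\<lambda>u v. sg (e u * e v) * (sg (e u * word_deg e P) * \<phi> (v # P) (u # R))) (cg x)) W"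
    by (rule Spl_swap[of "\<lambda>P R. ev2 (\<lambda>u v. sg (e u * e v) * (sg (e u * word_deg e P) * \<phi> (v # P) (u # R))) (cg x)"])
  also have "\<dots> = - (sg n * Spl (\<lambda>P R. ev2 (\<lambda>u v. sg (e v * word_deg e P) * \<phi> (u # P) (v # R)) (cg x)) W)"
    by (simp add: cg_swap[of "\<lambda>v u. sg (e u * word_deg e P) * \<phi> (v # P) (u # R)" for P R] spl_lins)
  finally have A: "Spl (\<lambda>P R. ev2 (\<lambda>u v. sg (e v * word_deg e P) * (sg (word_deg e (u # P) * word_deg e (v # R)) * \<phi> (v # R) (u # P))) (cg x)) W
     + sg n * Spl (\<lambda>P R. ev2 (\<lambda>u v. sg (e v * word_deg e P) * \<phi> (u # P) (v # R)) (cg x)) W = 0" by simp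
  let ?G = "\<lambda>\<phi> W. Del (\<lambda>P R. sg (word_deg e P * word_deg e R) * \<phi> R P) W + sg n * Del \<phi> W"
  have G: "?G \<phi> W = 0" for \<phi> by (simp add: Cons)
  have "?G \<phi> (x # W) = sg (n * e x) * ?G (\<lambda>P R. \<phi> (x # P) R) W
     + sg (n * e x) * ?G (\<lambda>P R. sg (e x * word_deg e P) * \<phi> P (x # R)) W
     + (Spl (\<lambda>P R. ev2 (\<lambda>u v. sg (e v * word_deg e P) * (sg (word_deg e (u # P) * word_deg e (v # R)) * \<phi> (v # R) (u # P))) (cg x)) W
     + sg n * Spl (\<lambda>P R. ev2 (\<lambda>u v. sg (e v * word_deg e P) * \<phi> (u # P) (v # R)) (cg x)) W)"
    by (simp add: cps2 cong: cps2_congs)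
  then show ?case unfolding G A by (simp add: eq_neg_iff_add_eq_0)
qed simp

lemma E_Spl: "E x (\<lambda>V. Spl \<phi> V) W = Spl (\<lambda>P R. E x (\<lambda>V. \<phi> V R) P + sg ((e x + 1) * word_deg e P) * E x (\<phi> P) R) W"
proof (induction W arbitrary: \<phi>)
  case (Cons y W)
  show ?case by (simp add: Cons cps2 cong: cps2_congs)
qed (simp add: cps2)

lemma Q_Spl: "Q (\<lambda>V. Spl \<phi> V) W = Spl (\<lambda>P R. Q (\<lambda>V. \<phi> V R) P + sg (word_deg e P) * Q (\<phi> P) R) W"
proof (induction W arbitrary: \<phi>)
  case (Cons x W)
  show ?case by (simp add: Cons E_Spl cps2 cong: cps2_congs)
qed (simp add: cps2)

lemma Spl_assoc_swap: "Spl (\<lambda>P R. Spl (\<lambda>R1 R2. sg (word_deg e P * word_deg e R1) * \<phi> R1 P R2) R) W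
   = Spl (\<lambda>P R. Spl (\<lambda>R1 R2. \<phi> P R1 R2) R) W"
  by (simp only: Spl_assoc[symmetric] Spl_swap[of "\<lambda>P1 P2. \<phi> P1 P2 R" for R])

lemma Del_coLeibniz: "Del (\<lambda>P R. Spl (\<lambda>R1 R2. \<phi> P R1 R2) R) W = Spl (\<lambda>P R. Del (\<lambda>P1 P2. \<phi> P1 P2 R) P) W
   + Spl (\<lambda>P R. sg (n * word_deg e P) * Del (\<lambda>R1 R2. sg (word_deg e P * word_deg e R1) * \<phi> R1 P R2) R) W"
proof (induction W arbitrary: \<phi>)
  case (Cons x W)
  let ?G = "\<lambda>\<phi>. Del (\<lambda>P R. Spl (\<lambda>R1 R2. \<phi> P R1 R2) R) W - (Spl (\<lambda>P R. Del (\<lambda>P1 P2. \<phi> P1 P2 R) P) W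
   + Spl (\<lambda>P R. sg (n * word_deg e P) * Del (\<lambda>R1 R2. sg (word_deg e P * word_deg e R1) * \<phi> R1 P R2) R) W)"
  have G: "?G \<phi> = 0" for \<phi> by (simp add: Cons)
  \<comment> \<open>\<open>x\<close> is split: \<open>u\<close> goes to the first tensor factor, and
    \<open>v\<close> to the second in \<open>?A\<close> and to the third in \<open>?B\<close>.
    Coassociativity and cocommutativity of \<open>Spl\<close> identify the two ways of reaching
    each.\<close>
  let ?A = "\<lambda>P1 P2 R. ev2 (\<lambda>u v. sg (e v * word_deg e P1) * \<phi> (u # P1) (v # P2) R) (cg x)"
  let ?B = "\<lambda>P R1 R2. ev2 (\<lambda>u v. sg (e v * (word_deg e P + word_deg e R1)) * \<phi> (u # P) R1 (v # R2)) (cg x)"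
  have A: "Spl (\<lambda>P R. Spl (\<lambda>P1 P2. ?A P1 P2 R) P) W - Spl (\<lambda>P R. Spl (\<lambda>R1 R2. ?A P R1 R2) R) W = 0"
    by (simp only: Spl_assoc diff_self)
  have B: "Spl (\<lambda>P R. Spl (\<lambda>R1 R2. sg (word_deg e P * word_deg e R1) * ?B R1 P R2) R) W
   - Spl (\<lambda>P R. Spl (\<lambda>R1 R2. ?B P R1 R2) R) W = 0"
    by (simp only: Spl_assoc_swap[of ?B] diff_self)
  have "Del (\<lambda>P R. Spl (\<lambda>R1 R2. \<phi> P R1 R2) R) (x # W) - (Spl (\<lambda>P R. Del (\<lambda>P1 P2. \<phi> P1 P2 R) P) (x # W)
   + Spl (\<lambda>P R. sg (n * word_deg e P) * Del (\<lambda>R1 R2. sg (word_deg e P * word_deg e R1) * \<phi> R1 P R2) R) (x # W))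
   = sg (n * e x) * ?G (\<lambda>P1 P2 R. \<phi> (x # P1) P2 R)
   + sg (n * e x) * ?G (\<lambda>P1 P2 R. sg (e x * word_deg e P1) * \<phi> P1 (x # P2) R)
   + sg (n * e x) * ?G (\<lambda>P1 P2 R. sg (e x * (word_deg e P1 + word_deg e P2)) * \<phi> P1 P2 (x # R))
   - (Spl (\<lambda>P R. Spl (\<lambda>P1 P2. ?A P1 P2 R) P) W - Spl (\<lambda>P R. Spl (\<lambda>R1 R2. ?A P R1 R2) R) W)
   - (Spl (\<lambda>P R. Spl (\<lambda>R1 R2. sg (word_deg e P * word_deg e R1) * ?B R1 P R2) R) W
   - Spl (\<lambda>P R. Spl (\<lambda>R1 R2. ?B P R1 R2) R) W)"
    by (simp add: cps2 cong: cps2_congs)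
  then show ?case unfolding G A B by simp
qed (simp add: cps2)

text \<open>The transpose of the cyclic permutation \<tau>_12 \<tau>_23 with its Koszul sign;
  \<open>rot (rot \<phi>)\<close> belongs to \<tau>_23 \<tau>_12.\<close>

definition rot :: "('g list \<Rightarrow> 'g list \<Rightarrow> 'g list \<Rightarrow> 'k) \<Rightarrow> 'g list \<Rightarrow> 'g list \<Rightarrow> 'g list \<Rightarrow> 'k" where
  "rot \<phi> = (\<lambda>A B C. sg (word_deg e C * (word_deg e A + word_deg e B)) * \<phi> C A B)"

lemma rot_rot: "rot (rot \<phi>) = (\<lambda>A B C. sg (word_deg e A * (word_deg e B + word_deg e C)) * \<phi> B C A)"
  by (simp add: rot_def sg_simps algebra_simps)

lemma rot_rot_rot: "rot (rot (rot \<phi>)) = \<phi>"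
  by (simp add: rot_def sg_simps algebra_simps)

lemma Spl_rot_rot: "Spl (\<lambda>P R. Spl (\<lambda>P1 P2. rot (rot \<phi>) P1 P2 R) P) W = Spl (\<lambda>P R. Spl (\<lambda>P1 P2. \<phi> P1 P2 R) P) W"
proof -
  have "Spl (\<lambda>P R. Spl (\<lambda>P1 P2. rot (rot \<phi>) P1 P2 R) P) W
      = Spl (\<lambda>P R. sg (word_deg e P * word_deg e R) * Spl (\<lambda>R1 R2. \<phi> R1 R2 P) R) W"
    unfolding Spl_assoc by (rule Spl_cong) (simp add: rot_rot cps2 cong: cps2_congs)
  also have "\<dots> = Spl (\<lambda>P R. Spl (\<lambda>P1 P2. \<phi> P1 P2 R) P) W"
    by (rule Spl_swap[of "\<lambda>P R. Spl (\<lambda>P1 P2. \<phi> P1 P2 R) P"])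
  finally show ?thesis .
qed

text \<open>The transpose of (\<delta> \<otimes> id) \<Delta>, with counit terms; these expressions
  appear in the co-Jacobi sum when a factor is split only once.\<close>

definition J1 where "J1 \<phi> W = Spl (\<lambda>P R. Del (\<lambda>P1 P2. \<phi> P1 P2 R) P) W"

lemma J1_swap: "J1 (\<lambda>A B C. sg (word_deg e A * word_deg e B) * \<phi> B A C) W = - (sg n * J1 \<phi> W)"
  by (simp only: J1_def Del_swap[of "\<lambda>P1 P2. \<phi> P1 P2 R" for R] spl_lins)

text \<open>The coLeibniz rule describes the coproduct on the right half of the cobracket.
  Exchanging the halves with \<open>Del_swap\<close> gives a rule for the left half, in which the
  three tensor factors appear rotated.\<close>

lemma Del_Spl_left: "Del (\<lambda>P R. Spl (\<lambda>P1 P2. \<phi> P1 P2 R) P) W = - (sg n * (J1 (rot (rot \<phi>)) W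
   + J1 (\<lambda>A B C. sg (word_deg e B * word_deg e C) * rot (rot \<phi>) A C B) W))"
proof -
  have "Del (\<lambda>P R. Spl (\<lambda>P1 P2. \<phi> P1 P2 R) P) W
      = - (sg n * Del (\<lambda>P R. sg (word_deg e P * word_deg e R) * Spl (\<lambda>P1 P2. \<phi> P1 P2 P) R) W)"
    by (simp only: Del_swap[of "\<lambda>P R. Spl (\<lambda>P1 P2. \<phi> P1 P2 R) P"]) (simp add: sg_simps)
  also have "Del (\<lambda>P R. sg (word_deg e P * word_deg e R) * Spl (\<lambda>P1 P2. \<phi> P1 P2 P) R) W
      = Del (\<lambda>P R. Spl (\<lambda>R1 R2. rot (rot \<phi>) P R1 R2) R) W"
    unfolding rot_rot by (simp add: cps2 cong: cps2_congs)
  also have "\<dots> = J1 (rot (rot \<phi>)) W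
    + Spl (\<lambda>P R. sg (n * word_deg e P) * Del (\<lambda>R1 R2. sg (word_deg e P * word_deg e R1) * rot (rot \<phi>) R1 P R2) R) W"
    unfolding J1_def by (rule Del_coLeibniz)
  also have "Spl (\<lambda>P R. sg (n * word_deg e P) * Del (\<lambda>R1 R2. sg (word_deg e P * word_deg e R1) * rot (rot \<phi>) R1 P R2) R) W
    = Spl (\<lambda>P R. sg (word_deg e P * word_deg e R) * (sg (n * word_deg e R) * Del (\<lambda>R1 R2. sg (word_deg e R * word_deg e R1) * rot (rot \<phi>) R1 R R2) P)) W"
    by (rule Spl_swap[symmetric])
  also have "\<dots> = J1 (\<lambda>A B C. sg (word_deg e B * word_deg e C) * rot (rot \<phi>) A C B) W"
    unfolding J1_def rot_rot by (simp add: cps2 cong: cps2_congs)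
  finally show ?thesis .
qed

text \<open>The first factor \<open>x\<close> of the product is split by \<open>cg\<close> and its
  two parts are put in front of the tensor factors named by the indices. \<open>CC\<close> splits
  the left part once more and fills all three places; \<open>JJ\<close> is the transpose of
  (\<delta> \<otimes> id) \<delta>.\<close>

definition C12 where "C12 x \<phi> = (\<lambda>A B C. ev2 (\<lambda>u v. sg (e v * word_deg e A) * \<phi> (u # A) (v # B) C) (cg x))"
definition C13 where "C13 x \<phi> = (\<lambda>A B C. ev2 (\<lambda>u v. sg (e v * (word_deg e A + word_deg e B)) * \<phi> (u # A) B (v # C)) (cg x))"
definition C23 where "C23 x \<phi> = (\<lambda>A B C. ev2 (\<lambda>u v. sg (e u * word_deg e A + e v * (word_deg e A + word_deg e B)) * \<phi> A (u # B) (v # C)) (cg x))"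
definition CC where "CC x \<phi> = (\<lambda>A B C. ev2 (\<lambda>u v. ev2 (\<lambda>u1 u2.
   sg (e v * (word_deg e A + word_deg e B) + e u2 * word_deg e A) * \<phi> (u1 # A) (u2 # B) (v # C)) (cg u)) (cg x))"
definition JJ where "JJ \<phi> W = Del (\<lambda>P R. Del (\<lambda>P1 P2. \<phi> P1 P2 R) P) W"

text \<open>The factor \<open>x\<close> is split by both cobrackets (\<open>CC\<close>), by the
  outer one only (\<open>C13\<close>, \<open>C23\<close>, according to where the inner one sends the
  left part), by the inner one only (\<open>C12\<close>), or by neither, and then lands in one of
  three places.\<close>

lemma JJ_Cons: "JJ \<phi> (x # W) = Spl (\<lambda>P R. Spl (\<lambda>P1 P2. CC x \<phi> P1 P2 R) P) W
   + sg (n * e x + n) * (J1 (C13 x \<phi>) W + J1 (C23 x \<phi>) W)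
   + sg (n * e x) * Del (\<lambda>P R. Spl (\<lambda>P1 P2. C12 x \<phi> P1 P2 R) P) W
   + JJ (\<lambda>A B C. \<phi> (x # A) B C) W + JJ (\<lambda>A B C. sg (e x * word_deg e A) * \<phi> A (x # B) C) W
   + JJ (\<lambda>A B C. sg (e x * (word_deg e A + word_deg e B)) * \<phi> A B (x # C)) W"
  unfolding JJ_def J1_def C12_def C13_def C23_def CC_def by (simp add: cps2 cong: cps2_congs)

end

section \<open>The co-Jacobi identity on symmetric powers, and the square of the
  coderivation\<close>

context dg_lie_bialgebra begin

lemma rot_rot_C12: "rot (rot (C12 x \<phi>)) = C23 x (rot (rot \<phi>))"
  unfolding rot_rot C12_def C23_def by (simp add: ev2_lins sg_simps algebra_simps)

text \<open>Exchanging the first two tensor factors contributes -(-1)^n, and exchanging the two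
  halves of \<open>x\<close> by \<open>cg_swap\<close> contributes it once more, so the signs
  cancel.\<close>

lemma J1_C23: "J1 (\<lambda>A B C. sg (word_deg e B * word_deg e C) * C23 x \<phi> A C B) W = J1 (C13 x (rot (rot \<phi>))) W"
proof -
  have "(\<lambda>A B C. sg (word_deg e B * word_deg e C) * C23 x \<phi> A C B) = (\<lambda>A B C. sg (word_deg e A * word_deg e B) *
     (\<lambda>A B C. ev2 (\<lambda>u v. sg (e u * e v) * (sg (e u * e v + word_deg e A * word_deg e C + word_deg e A * word_deg e B + e u * word_deg e B
       + e v * word_deg e B + e v * word_deg e C) * \<phi> B (u # C) (v # A))) (cg x)) B A C)"
    by (simp add: C23_def ev2_lins sg_simps algebra_simps)
  then have "J1 (\<lambda>A B C. sg (word_deg e B * word_deg e C) * C23 x \<phi> A C B) W =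
     - (sg n * J1 (\<lambda>A B C. ev2 (\<lambda>u v. sg (e u * e v) * (sg (e u * e v + word_deg e A * word_deg e C + word_deg e A * word_deg e B + e u * word_deg e B
       + e v * word_deg e B + e v * word_deg e C) * \<phi> B (u # C) (v # A))) (cg x)) W)"
    by (simp only: J1_swap)
  also have "\<dots> = J1 (C13 x (rot (rot \<phi>))) W"
    by (simp add: cg_swap[of "\<lambda>v u. sg (e u * e v + word_deg e A * word_deg e C + word_deg e A * word_deg e B + e u * word_deg e B
       + e v * word_deg e B + e v * word_deg e C) * \<phi> B (u # C) (v # A)" for A B C])
     (simp add: J1_def C13_def rot_rot ev2_lins del_lins spl_lins sg_simps algebra_simps)
  finally show ?thesis .
qed

lemma Del_C12: "Del (\<lambda>P R. Spl (\<lambda>P1 P2. C12 x \<phi> P1 P2 R) P) W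
   = - (sg n * (J1 (C23 x (rot (rot \<phi>))) W + J1 (C13 x (rot \<phi>)) W))"
  by (simp only: Del_Spl_left rot_rot_C12 J1_C23 rot_rot_rot)

text \<open>This is the co-Jacobi identity of \<open>cg\<close> with the three parts of
  \<open>x\<close> standing before \<open>A\<close>, \<open>B\<close> and \<open>C\<close>; the sign
  in the test functional moves the parts past these words.\<close>

lemma CC_rot: "CC x \<phi> A B C + rot (rot (CC x (rot \<phi>))) A B C + rot (CC x (rot (rot \<phi>))) A B C = 0"
  using cg_jacobi[of "\<lambda>a b c. sg (e c * (word_deg e A + word_deg e B) + e b * word_deg e A) * \<phi> (a # A) (b # B) (c # C)" x]
  by (simp add: CC_def rot_def ev2_lins sg_simps algebra_simps)

lemma Spl_CC: "Spl (\<lambda>P R. Spl (\<lambda>P1 P2. CC x \<phi> P1 P2 R) P) W + Spl (\<lambda>P R. Spl (\<lambda>P1 P2. CC x (rot \<phi>) P1 P2 R) P) W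
   + Spl (\<lambda>P R. Spl (\<lambda>P1 P2. CC x (rot (rot \<phi>)) P1 P2 R) P) W = 0"
proof -
  let ?T = "\<lambda>F. Spl (\<lambda>P R. Spl (\<lambda>P1 P2. F P1 P2 R) P) W"
  have T: "?T (rot F) = ?T F" for F
    using Spl_rot_rot[of "rot F" W] by (simp add: rot_rot_rot)
  have "?T (CC x \<phi>) + ?T (CC x (rot \<phi>)) + ?T (CC x (rot (rot \<phi>)))
     = ?T (CC x \<phi>) + ?T (rot (rot (CC x (rot \<phi>)))) + ?T (rot (CC x (rot (rot \<phi>))))"
    by (simp only: T)
  also have "\<dots> = ?T (\<lambda>A B C. CC x \<phi> A B C + rot (rot (CC x (rot \<phi>))) A B C + rot (CC x (rot (rot \<phi>))) A B C)"
    by (simp only: spl_add)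
  also have "\<dots> = 0" by (simp only: CC_rot spl_zero)
  finally show ?thesis .
qed

text \<open>Over the three rotations the terms of \<open>JJ_Cons\<close> cancel by kind. Double
  splittings vanish by \<open>Spl_CC\<close>. \<open>Del_C12\<close> rewrites the \<open>C12\<close>
  terms as rotated \<open>C13\<close> and \<open>C23\<close> terms, which cancel the remaining
  single splittings. Where \<open>x\<close> stays whole, rotation permutes its three positions
  (\<open>L\<close>), so induction applies.\<close>

lemma JJ_rot: "JJ \<phi> W + JJ (rot \<phi>) W + JJ (rot (rot \<phi>)) W = 0"
proof (induction W arbitrary: \<phi>)
  case (Cons x W)
  have L: "(\<lambda>A. rot \<phi> (x # A)) = rot (\<lambda>A B C. sg (e x * word_deg e A) * \<phi> A (x # B) C)"
    "(\<lambda>A B C. sg (e x * word_deg e A) * rot \<phi> A (x # B) C) = rot (\<lambda>A B C. sg (e x * (word_deg e A + word_deg e B)) * \<phi> A B (x # C))"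
    "(\<lambda>A B C. sg (e x * (word_deg e A + word_deg e B)) * rot \<phi> A B (x # C)) = rot (\<lambda>A. \<phi> (x # A))" for \<phi>
    by (simp_all add: rot_def fun_eq_iff sg_simps algebra_simps)
  let ?T = "\<lambda>F. Spl (\<lambda>P R. Spl (\<lambda>P1 P2. F P1 P2 R) P) W"
  have T: "?T (CC x (rot (rot \<phi>))) = - ?T (CC x \<phi>) - ?T (CC x (rot \<phi>))"
    using Spl_CC[of x \<phi> W] by (simp add: algebra_simps eq_neg_iff_add_eq_0)
  have IH: "JJ (rot (rot F)) W = - JJ F W - JJ (rot F) W" for F
    using Cons[of F] by (simp add: algebra_simps eq_neg_iff_add_eq_0)
  show ?case
    unfolding JJ_Cons Del_C12 L rot_rot_rot T IH by (simp add: sg_simps algebra_simps)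
qed (simp add: JJ_def)

text \<open>A functional is \<open>good\<close> if it descends to the symmetric powers of the quotient by \<open>R\<close>.\<close>

definition good :: "('g list \<Rightarrow> 'k) \<Rightarrow> bool" where
  "good \<phi> \<longleftrightarrow> (\<forall>u x y v. \<phi> (u @ x # y # v) = sg (e x * e y) * \<phi> (u @ y # x # v)) \<and>
     (\<forall>u v. \<forall>r\<in>R. ev (\<lambda>z. \<phi> (u @ z # v)) r = 0)"

lemma goodI:
  assumes "\<And>u x y v. \<phi> (u @ x # y # v) = sg (e x * e y) * \<phi> (u @ y # x # v)"
    and "\<And>u v r. r \<in> R \<Longrightarrow> ev (\<lambda>z. \<phi> (u @ z # v)) r = 0"
  shows "good \<phi>"
  unfolding good_def using assms by blast

lemma goodD:
  assumes "good \<phi>"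
  shows "\<phi> (u @ x # y # v) = sg (e x * e y) * \<phi> (u @ y # x # v)"
    and "r \<in> R \<Longrightarrow> ev (\<lambda>z. \<phi> (u @ z # v)) r = 0"
  using assms unfolding good_def by blast+

lemma good_Cons:
  assumes "good \<phi>" shows "good (\<lambda>V. \<phi> (a # V))"
proof (rule goodI)
  fix u x y v
  show "\<phi> (a # u @ x # y # v) = sg (e x * e y) * \<phi> (a # u @ y # x # v)"
    using goodD(1)[OF assms, of "a # u" x y v] by simp
next
  fix u v r assume "r \<in> R"
  then show "ev (\<lambda>z. \<phi> (a # u @ z # v)) r = 0"
    using goodD(2)[OF assms, of r "a # u" v] by simp
qed

lemma good_swap: "good \<phi> \<Longrightarrow> \<phi> (x # y # W) = sg (e x * e y) * \<phi> (y # x # W)"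
  using goodD(1)[of \<phi> "[]" x y W] by simp

lemma good_kill: "good \<phi> \<Longrightarrow> r \<in> R \<Longrightarrow> ev (\<lambda>z. \<phi> (z # W)) r = 0"
  using goodD(2)[of \<phi> r "[]" W] by simp

text \<open>The operators \<open>E x\<close> and \<open>E y\<close> commute up to the operator of
  the bracket of \<open>x\<close> and \<open>y\<close>. At the empty word this is
  \<open>Dg_Bg\<close> together with the exchange of two differentiated factors; each further factor
  \<open>z\<close> adds one instance of \<open>Bg_jacobi\<close>.\<close>

lemma E_E:
  assumes "good \<phi>"
  shows "sg (e x) * E y (\<lambda>V. E x \<phi> V) W + sg (e y * (e x + 1)) * E x (\<lambda>V. E y \<phi> V) W + ev (\<lambda>w. E w \<phi> W) (Bg x y) = 0"
  using assms
proof (induction W arbitrary: \<phi>)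
  case Nil
  note k = good_kill[OF Nil]
  have "ev (\<lambda>z. ev (\<lambda>z'. \<phi> [z, z']) (Dg x)) (Dg y) = ev (\<lambda>z. ev (\<lambda>z'. sg ((e y + 1) * (e x + 1)) * \<phi> [z', z]) (Dg x)) (Dg y)"
    by (intro ev_cong) (subst good_swap[OF Nil], simp add: Dg_deg)
  also have "\<dots> = sg ((e y + 1) * (e x + 1)) * ev (\<lambda>z'. ev (\<lambda>z. \<phi> [z', z]) (Dg y)) (Dg x)"
    by (simp add: ev_lins) (subst ev_swap, simp)
  finally have A: "ev (\<lambda>z. ev (\<lambda>z'. \<phi> [z, z']) (Dg x)) (Dg y) - sg ((e y + 1) * (e x + 1)) * ev (\<lambda>z'. ev (\<lambda>z. \<phi> [z', z]) (Dg y)) (Dg x) = 0"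
    by simp
  have B: "ev (\<lambda>w. ev (\<lambda>z. \<phi> [z]) (Dg w)) (Bg x y) + (sg (e x) * ev (\<lambda>z. ev (\<lambda>z. \<phi> [z]) (Bg x z)) (Dg y)
       + sg (e y * (e x + 1)) * ev (\<lambda>z. ev (\<lambda>z. \<phi> [z]) (Bg y z)) (Dg x)) = 0"
    by (subst Dg_Bg) (use k in auto)
  have "sg (e x) * E y (\<lambda>V. E x \<phi> V) [] + sg (e y * (e x + 1)) * E x (\<lambda>V. E y \<phi> V) [] + ev (\<lambda>w. E w \<phi> []) (Bg x y)
    = (sg (e x + (e y + 1) * (e x + 1)) * (ev (\<lambda>z. ev (\<lambda>z'. \<phi> [z, z']) (Dg x)) (Dg y) - sg ((e y + 1) * (e x + 1)) * ev (\<lambda>z'. ev (\<lambda>z. \<phi> [z', z]) (Dg y)) (Dg x)))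
     + (ev (\<lambda>w. ev (\<lambda>z. \<phi> [z]) (Dg w)) (Bg x y) + (sg (e x) * ev (\<lambda>z. ev (\<lambda>z. \<phi> [z]) (Bg x z)) (Dg y)
       + sg (e y * (e x + 1)) * ev (\<lambda>z. ev (\<lambda>z. \<phi> [z]) (Bg y z)) (Dg x)))"
    by (simp add: cps2 cong: cps2_congs)
  then show ?case unfolding A B by simp
next
  case (Cons z W)
  let ?G = "\<lambda>\<phi> W. sg (e x) * E y (\<lambda>V. E x \<phi> V) W + sg (e y * (e x + 1)) * E x (\<lambda>V. E y \<phi> V) W + ev (\<lambda>w. E w \<phi> W) (Bg x y)"
  have G: "?G (\<lambda>V. \<phi> (z # V)) W = 0" by (rule Cons.IH[OF good_Cons[OF Cons.prems]])
  let ?J = "ev (\<lambda>w. ev (\<lambda>l. \<phi> (l # W)) (Bg w z)) (Bg x y) +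
      (sg (e x) * ev (\<lambda>w. ev (\<lambda>l. \<phi> (l # W)) (Bg x w)) (Bg y z)
       + sg (e y * (e x + 1)) * ev (\<lambda>w. ev (\<lambda>l. \<phi> (l # W)) (Bg y w)) (Bg x z))"
  have J: "?J = 0"
    by (subst Bg_jacobi) (use good_kill[OF Cons.prems] in auto)
  have "?G \<phi> (z # W) = sg (e z * (e x + e y)) * ?G (\<lambda>V. \<phi> (z # V)) W + ?J"
    by (simp add: cps2 cong: cps2_congs)
  then show ?case unfolding G J by simp
qed

text \<open>As \<open>E x\<close> is the commutator of \<open>Q\<close> with multiplication by
  \<open>x\<close>, this says that the square of \<open>Q\<close> commutes with that multiplication.
  The start is \<open>Dg_Dg\<close>, and the induction step is \<open>E_E\<close>.\<close>

lemma E_Q: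
  assumes "good \<phi>"
  shows "sg (e x) * Q (\<lambda>V. E x \<phi> V) W + E x (\<lambda>V. Q \<phi> V) W = 0"
  using assms
proof (induction W arbitrary: \<phi>)
  case Nil
  then show ?case by (simp add: cps2 Dg_Dg good_kill cong: cps2_congs)
next
  case (Cons y W)
  let ?G = "\<lambda>\<phi> W. sg (e x) * Q (\<lambda>V. E x \<phi> V) W + E x (\<lambda>V. Q \<phi> V) W"
  have G: "?G (\<lambda>V. \<phi> (y # V)) W = 0" by (rule Cons.IH[OF good_Cons[OF Cons.prems]])
  have "?G \<phi> (y # W) = sg (e y * e x) * ?G (\<lambda>V. \<phi> (y # V)) W +
      (sg (e x) * E y (\<lambda>V. E x \<phi> V) W + sg (e y * (e x + 1)) * E x (\<lambda>V. E y \<phi> V) W + ev (\<lambda>w. E w \<phi> W) (Bg x y))"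
    by (simp add: cps2 cong: cps2_congs)
  then show ?case unfolding G E_E[OF Cons.prems] by simp
qed

lemma Q_Q: "good \<phi> \<Longrightarrow> Q (\<lambda>V. Q \<phi> V) W = 0"
proof (induction W arbitrary: \<phi>)
  case (Cons x W)
  have "Q (\<lambda>V. Q \<phi> V) (x # W) = Q (\<lambda>V. Q (\<lambda>V. \<phi> (x # V)) V) W + (sg (e x) * Q (\<lambda>V. E x \<phi> V) W + E x (\<lambda>V. Q \<phi> V) W)"
    by (simp add: cps2 cong: cps2_congs)
  then show ?case using Cons.IH[OF good_Cons[OF Cons.prems]] E_Q[OF Cons.prems] by simp
qed simp

end

section \<open>Descent to symmetric powers, and the coderivation against the cobracket\<close>

context dg_lie_bialgebra begin

definition good2 :: "('g list \<Rightarrow> 'g list \<Rightarrow> 'k) \<Rightarrow> bool" where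
  "good2 \<phi> \<longleftrightarrow> (\<forall>W. good (\<lambda>P. \<phi> P W)) \<and> (\<forall>W. good (\<phi> W))"

lemma good2D: "good2 \<phi> \<Longrightarrow> good (\<lambda>P. \<phi> P W)" "good2 \<phi> \<Longrightarrow> good (\<phi> W)"
  unfolding good2_def by blast+

lemma good2_Cons: "good2 \<phi> \<Longrightarrow> good2 (\<lambda>P W. \<phi> (x # P) W)"
  unfolding good2_def using good_Cons by blast

lemma good_sg:
  assumes "good \<phi>" shows "good (\<lambda>P. sg (k * word_deg e P) * \<phi> P)"
proof (rule goodI)
  fix u x y v
  show "sg (k * word_deg e (u @ x # y # v)) * \<phi> (u @ x # y # v) =
       sg (e x * e y) * (sg (k * word_deg e (u @ y # x # v)) * \<phi> (u @ y # x # v))"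
    by (subst goodD(1)[OF assms]) (simp add: algebra_simps)
next
  fix u v r assume r: "r \<in> R"
  then obtain m where "\<And>z. z \<in> Poly_Mapping.keys r \<Longrightarrow> e z = m" using R_hom by blast
  then have "ev (\<lambda>z. sg (k * word_deg e (u @ z # v)) * \<phi> (u @ z # v)) r
    = ev (\<lambda>z. sg (k * (word_deg e u + m + word_deg e v)) * \<phi> (u @ z # v)) r"
    by (intro ev_cong) (simp add: algebra_simps)
  also have "\<dots> = 0" by (simp only: ev_fun_mult goodD(2)[OF assms r] mult_zero_right)
  finally show "ev (\<lambda>z. sg (k * word_deg e (u @ z # v)) * \<phi> (u @ z # v)) r = 0" .
qed

lemma good_mult:
  assumes "good \<phi>" shows "good (\<lambda>V. k * \<phi> V)"
proof (rule goodI)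
  fix u x y v
  show "k * \<phi> (u @ x # y # v) = sg (e x * e y) * (k * \<phi> (u @ y # x # v))"
    by (simp only: goodD(1)[OF assms, of u x y v] mult.left_commute)
next
  fix u v r assume "r \<in> R"
  then show "ev (\<lambda>z. k * \<phi> (u @ z # v)) r = 0"
    by (simp only: ev_fun_mult goodD(2)[OF assms] mult_zero_right)
qed

lemma good2_Cons_right: "good2 \<phi> \<Longrightarrow> good2 (\<lambda>P W. sg (e x * word_deg e P) * \<phi> P (x # W))"
  unfolding good2_def using good_Cons good_sg good_mult by blast

lemma good_ev2:
  assumes "\<And>u v. good (F u v)" shows "good (\<lambda>V. ev2 (\<lambda>u v. F u v V) p)"
proof (rule goodI)
  fix u x y v
  show "ev2 (\<lambda>ua va. F ua va (u @ x # y # v)) p = sg (e x * e y) * ev2 (\<lambda>ua va. F ua va (u @ y # x # v)) p"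
    unfolding ev2_mult[symmetric] by (intro ev2_cong goodD(1) assms)
next
  fix u v r assume "r \<in> R"
  then show "ev (\<lambda>z. ev2 (\<lambda>ua va. F ua va (u @ z # v)) p) r = 0"
    by (simp only: ev2_ev goodD(2)[OF assms] ev2_zero)
qed

lemma good2_cg: "good2 (\<lambda>P W. ev2 (\<lambda>u v. sg (e v * word_deg e P) * \<phi> (u # P) (v # W)) p)" if "good2 \<phi>"
  unfolding good2_def by (intro conjI allI good_ev2 good_sg good_mult good_Cons good2D that)

lemma good_Spl: "good2 \<phi> \<Longrightarrow> good (Spl \<phi>)"
proof (rule goodI)
  fix u x y v
  show "good2 \<phi> \<Longrightarrow> Spl \<phi> (u @ x # y # v) = sg (e x * e y) * Spl \<phi> (u @ y # x # v)"
  proof (induction u arbitrary: \<phi>)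
    case Nil
    note sw = good_swap[OF good2D(1)[OF Nil], where x = x and y = y] good_swap[OF good2D(2)[OF Nil], where x = x and y = y]
    show ?case unfolding append_Nil by (simp add: sw cps2 cong: cps2_congs)
  next
    case (Cons a u)
    show ?case
      using Cons.IH[OF good2_Cons[OF Cons.prems, of a]] Cons.IH[OF good2_Cons_right[OF Cons.prems, of a]]
      by (simp only: append_Cons spl.simps distrib_left)
  qed
next
  fix u v r assume r: "r \<in> R"
  then obtain m where m: "\<And>z. z \<in> Poly_Mapping.keys r \<Longrightarrow> e z = m" using R_hom by blast
  show "good2 \<phi> \<Longrightarrow> ev (\<lambda>z. Spl \<phi> (u @ z # v)) r = 0"
  proof (induction u arbitrary: \<phi>)
    case Nil
    have 1: "ev (\<lambda>z. Spl (\<lambda>P. \<phi> (z # P)) v) r = 0"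
      by (simp add: spl_ev good_kill[OF good2D(1)[OF Nil] r])
    have "ev (\<lambda>z. Spl (\<lambda>P W. sg (e z * word_deg e P) * \<phi> P (z # W)) v) r
        = ev (\<lambda>z. Spl (\<lambda>P W. sg (m * word_deg e P) * \<phi> P (z # W)) v) r"
      by (rule ev_cong) (simp add: m)
    also have "\<dots> = 0"
      by (simp add: spl_ev ev_lins good_kill[OF good2D(2)[OF Nil] r])
    finally show ?case using 1 by (simp add: ev_lins)
  next
    case (Cons a u)
    show ?case
      using Cons.IH[OF good2_Cons[OF Cons.prems, of a]] Cons.IH[OF good2_Cons_right[OF Cons.prems, of a]]
      by (simp add: ev_lins)
  qed
qed

lemma good_Del: "good2 \<phi> \<Longrightarrow> good (Del \<phi>)"
proof (rule goodI)
  fix w x y v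
  show "good2 \<phi> \<Longrightarrow> Del \<phi> (w @ x # y # v) = sg (e x * e y) * Del \<phi> (w @ y # x # v)"
  proof (induction w arbitrary: \<phi>)
    case Nil
    note sw1 = good_swap[OF good2D(1)[OF Nil]] and sw2 = good_swap[OF good2D(2)[OF Nil]]
    \<comment> \<open>The terms in which \<open>x\<close> is split. After the exchange of
      \<open>x\<close> and \<open>y\<close>, the whole factor \<open>y\<close> stands on the other
      side of the half of \<open>x\<close> that shares its tensor factor; each difference vanishes
      because \<open>\<phi>\<close> is good in that variable.\<close>
    let ?Z = "\<lambda>x y. Spl (\<lambda>P W. ev2 (\<lambda>u w.
        sg (e w * (e y + word_deg e P)) * (\<phi> (u # y # P) (w # W) - sg (e u * e y) * \<phi> (y # u # P) (w # W))
        + sg ((e y + e w) * word_deg e P) * (\<phi> (u # P) (w # y # W) - sg (e w * e y) * \<phi> (u # P) (y # w # W))) (cg x)) v"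
    have "\<phi> (u # y # P) (w # W) - sg (e u * e y) * \<phi> (y # u # P) (w # W) = 0" for u y P w W
      by (subst sw1) simp
    moreover have "\<phi> (u # P) (w # y # W) - sg (e w * e y) * \<phi> (u # P) (y # w # W) = 0" for u y P w W
      by (subst sw2) simp
    ultimately have Z: "?Z x y = 0" "?Z y x = 0"
      by (simp_all only: mult_zero_right add_0_left ev2_zero spl_zero)
    have "Del \<phi> (x # y # v) - sg (e x * e y) * Del \<phi> (y # x # v) = ?Z x y - sg (e x * e y) * ?Z y x"
      by (simp add: sw1[where x = x and y = y] sw2[where x = x and y = y] cps2 cong: cps2_congs)
    then show ?case unfolding Z by simp
  next
    case (Cons a w)
    show ?case
      using Cons.IH[OF good2_Cons[OF Cons.prems, of a]] Cons.IH[OF good2_Cons_right[OF Cons.prems, of a]]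
      goodD(1)[OF good_Spl[OF good2_cg[OF Cons.prems, of "cg a"]], of w x y v]
      by (simp only: append_Cons del.simps distrib_left mult.left_commute)
  qed
next
  fix w v r assume r: "r \<in> R"
  then obtain m where m: "\<And>z. z \<in> Poly_Mapping.keys r \<Longrightarrow> e z = m" using R_hom by blast
  show "good2 \<phi> \<Longrightarrow> ev (\<lambda>z. Del \<phi> (w @ z # v)) r = 0"
  proof (induction w arbitrary: \<phi>)
    case Nil
    have 1: "ev (\<lambda>z. Del (\<lambda>P. \<phi> (z # P)) v) r = 0"
      by (simp add: del_ev good_kill[OF good2D(1)[OF Nil] r])
    have 2: "ev (\<lambda>z. Del (\<lambda>P W. sg (m * word_deg e P) * \<phi> P (z # W)) v) r = 0"
      by (simp add: del_ev ev_lins good_kill[OF good2D(2)[OF Nil] r])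
    have "ev (\<lambda>z. ev2 (\<lambda>u v. sg (e v * word_deg e P) * \<phi> (u # P) (v # W)) (cg z)) r = 0" for P W
    proof (rule R_cg[OF _ _ r])
      fix r v assume r: "r \<in> R"
      show "ev (\<lambda>u. sg (e v * word_deg e P) * \<phi> (u # P) (v # W)) r = 0"
        by (simp add: ev_lins good_kill[OF good2D(1)[OF Nil] r])
    next
      fix r u assume r: "r \<in> R"
      then obtain m where m: "\<And>z. z \<in> Poly_Mapping.keys r \<Longrightarrow> e z = m" using R_hom by blast
      have "ev (\<lambda>v. sg (e v * word_deg e P) * \<phi> (u # P) (v # W)) r = ev (\<lambda>v. sg (m * word_deg e P) * \<phi> (u # P) (v # W)) r"
        by (rule ev_cong) (simp add: m)
      then show "ev (\<lambda>v. sg (e v * word_deg e P) * \<phi> (u # P) (v # W)) r = 0"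
        by (simp add: ev_lins good_kill[OF good2D(2)[OF Nil] r])
    qed
    then have 3: "ev (\<lambda>z. Spl (\<lambda>P W. ev2 (\<lambda>u v. sg (e v * word_deg e P) * \<phi> (u # P) (v # W)) (cg z)) v) r = 0"
      by (simp only: spl_ev spl_zero)
    have "ev (\<lambda>z. Del \<phi> ([] @ z # v)) r = ev (\<lambda>z. Spl (\<lambda>P W. ev2 (\<lambda>u v. sg (e v * word_deg e P) * \<phi> (u # P) (v # W)) (cg z)) v
        + sg (n * m) * Del (\<lambda>P. \<phi> (z # P)) v + sg (n * m) * Del (\<lambda>P W. sg (m * word_deg e P) * \<phi> P (z # W)) v) r"
      by (rule ev_cong) (simp add: m)
    then show ?case by (simp only: ev_fun_add ev_fun_mult 1 2 3) simp
  next
    case (Cons a w)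
    show ?case
      using Cons.IH[OF good2_Cons[OF Cons.prems, of a]] Cons.IH[OF good2_Cons_right[OF Cons.prems, of a]]
        goodD(2)[OF good_Spl[OF good2_cg[OF Cons.prems, of "cg a"]] r, of w v]
      by (simp add: ev_lins)
  qed
qed

text \<open>Here the relation is substituted for the index \<open>z\<close> of the operator rather
  than for a factor of the product. It is the case that arises when \<open>Q\<close> acts on the
  factor taken from the relation.\<close>

lemma E_kill: "good \<phi> \<Longrightarrow> r \<in> R \<Longrightarrow> ev (\<lambda>z. E z \<phi> W) r = 0"
proof (induction W arbitrary: \<phi>)
  case Nil
  then show ?case by (auto intro: R_Dg good_kill)
next
  case (Cons y W)
  obtain m where m: "\<And>z. z \<in> Poly_Mapping.keys r \<Longrightarrow> e z = m" using R_hom[OF Cons.prems(2)] by blast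
  have 1: "ev (\<lambda>z. E z (\<lambda>V. \<phi> (y # V)) W) r = 0"
    by (rule Cons.IH[OF good_Cons[OF Cons.prems(1)] Cons.prems(2)])
  have 2: "ev (\<lambda>z. ev (\<lambda>l. \<phi> (l # W)) (Bg z y)) r = 0"
    by (rule R_Bg[OF good_kill[OF Cons.prems(1)] Cons.prems(2)])
  have "ev (\<lambda>z. E z \<phi> (y # W)) r = ev (\<lambda>z. sg (e y * (m + 1)) * E z (\<lambda>V. \<phi> (y # V)) W + ev (\<lambda>l. \<phi> (l # W)) (Bg z y)) r"
    by (rule ev_cong) (simp add: m)
  then show ?case by (simp only: ev_fun_add ev_fun_mult 1 2) simp
qed

lemma R_Bg_right:
  assumes "\<And>r. r \<in> R \<Longrightarrow> ev \<psi> r = 0" "r \<in> R" shows "ev (\<lambda>y. ev \<psi> (Bg x y)) r = 0"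
proof -
  obtain m where m: "\<And>z. z \<in> Poly_Mapping.keys r \<Longrightarrow> e z = m" using R_hom[OF assms(2)] by blast
  have "ev (\<lambda>y. ev \<psi> (Bg x y)) r = ev (\<lambda>y. sg (e x * m) * ev \<psi> (Bg y x)) r"
    by (rule ev_cong) (subst Bg_sym[OF assms(1)], simp_all add: m)
  then show ?thesis using R_Bg[OF assms] by (simp add: ev_lins)
qed

lemma good_E: "good \<phi> \<Longrightarrow> good (E x \<phi>)"
proof (rule goodI)
  fix w y z v
  show "good \<phi> \<Longrightarrow> E x \<phi> (w @ y # z # v) = sg (e y * e z) * E x \<phi> (w @ z # y # v)"
  proof (induction w arbitrary: \<phi>)
    case Nil
    note sw = good_swap[OF Nil]
    let ?Z = "\<lambda>y z. ev (\<lambda>l. \<phi> (l # z # v) - sg (e l * e z) * \<phi> (z # l # v)) (Bg x y)"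
    have "\<phi> (l # z # v) - sg (e l * e z) * \<phi> (z # l # v) = 0" for l z by (subst sw) simp
    then have Z: "?Z y z = 0" "?Z z y = 0" by (simp_all only: ev_fun_zero)
    have "E x \<phi> (y # z # v) - sg (e y * e z) * E x \<phi> (z # y # v) = ?Z y z - sg (e y * e z) * ?Z z y"
      by (simp add: sw[where x = y and y = z] cps2 cong: cps2_congs)
    then show ?case unfolding Z by simp
  next
    case (Cons a w)
    have "ev (\<lambda>l. \<phi> (l # w @ y # z # v)) (Bg x a) = sg (e y * e z) * ev (\<lambda>l. \<phi> (l # w @ z # y # v)) (Bg x a)"
      unfolding ev_fun_mult[symmetric] by (intro ev_cong) (rule goodD(1)[OF good_Cons[OF Cons.prems]])
    then show ?case
      using Cons.IH[OF good_Cons[OF Cons.prems, of a]]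
      by (simp only: append_Cons EE.simps distrib_left mult.left_commute)
  qed
next
  fix w v r assume r: "r \<in> R"
  then obtain m where m: "\<And>z. z \<in> Poly_Mapping.keys r \<Longrightarrow> e z = m" using R_hom by blast
  show "good \<phi> \<Longrightarrow> ev (\<lambda>z. E x \<phi> (w @ z # v)) r = 0"
  proof (induction w arbitrary: \<phi>)
    case Nil
    have 1: "ev (\<lambda>z. E x (\<lambda>V. \<phi> (z # V)) v) r = 0"
      by (simp add: EE_ev good_kill[OF Nil r])
    have 2: "ev (\<lambda>z. ev (\<lambda>l. \<phi> (l # v)) (Bg x z)) r = 0"
      by (rule R_Bg_right[OF good_kill[OF Nil] r])
    have "ev (\<lambda>z. E x \<phi> ([] @ z # v)) r = ev (\<lambda>z. sg (m * (e x + 1)) * E x (\<lambda>V. \<phi> (z # V)) v + ev (\<lambda>l. \<phi> (l # v)) (Bg x z)) r"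
      by (rule ev_cong) (simp add: m)
    then show ?case by (simp only: ev_fun_add ev_fun_mult 1 2) simp
  next
    case (Cons a w)
    have "ev (\<lambda>z. ev (\<lambda>l. \<phi> (l # w @ z # v)) (Bg x a)) r = 0"
      by (subst ev_swap) (simp add: goodD(2)[OF good_Cons[OF Cons.prems] r])
    then show ?case
      using Cons.IH[OF good_Cons[OF Cons.prems, of a]] by (simp add: ev_lins)
  qed
qed

lemma good_Q: "good \<phi> \<Longrightarrow> good (Q \<phi>)"
proof (rule goodI)
  fix w x y v
  show "good \<phi> \<Longrightarrow> Q \<phi> (w @ x # y # v) = sg (e x * e y) * Q \<phi> (w @ y # x # v)"
  proof (induction w arbitrary: \<phi>)
    case Nil
    note sw = good_swap[OF Nil, where x = x and y = y]
    have B: "ev (\<lambda>l. \<phi> (l # v)) (Bg x y) = sg (e x * e y) * ev (\<lambda>l. \<phi> (l # v)) (Bg y x)"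
      by (rule Bg_sym[OF good_kill[OF Nil]])
    show ?case unfolding append_Nil by (simp add: sw B cps2 cong: cps2_congs)
  next
    case (Cons a w)
    show ?case
      using Cons.IH[OF good_Cons[OF Cons.prems, of a]] goodD(1)[OF good_E[OF Cons.prems], of a w x y v]
      by (simp only: append_Cons QQ.simps distrib_left mult.left_commute)
  qed
next
  fix w v r assume r: "r \<in> R"
  then obtain m where m: "\<And>z. z \<in> Poly_Mapping.keys r \<Longrightarrow> e z = m" using R_hom by blast
  show "good \<phi> \<Longrightarrow> ev (\<lambda>z. Q \<phi> (w @ z # v)) r = 0"
  proof (induction w arbitrary: \<phi>)
    case Nil
    have 1: "ev (\<lambda>z. Q (\<lambda>V. \<phi> (z # V)) v) r = 0"
      by (simp add: QQ_ev good_kill[OF Nil r])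
    have "ev (\<lambda>z. Q \<phi> ([] @ z # v)) r = ev (\<lambda>z. sg m * Q (\<lambda>V. \<phi> (z # V)) v + E z \<phi> v) r"
      by (rule ev_cong) (simp add: m)
    then show ?case by (simp only: ev_fun_add ev_fun_mult 1 E_kill[OF Nil r]) simp
  next
    case (Cons a w)
    show ?case
      using Cons.IH[OF good_Cons[OF Cons.prems, of a]] goodD(2)[OF good_E[OF Cons.prems] r, of a w v]
      by (simp add: ev_lins)
  qed
qed

text \<open>The terms in which \<open>x\<close> is first split by \<open>cg\<close> and then one of
  its halves acts on the tensor factor where it lies; they measure by how much \<open>E x\<close>
  fails to commute with the cobracket.\<close>

definition K where "K x \<phi> P W = sg n * ev2 (\<lambda>u v. sg (e v * word_deg e P) * (E u (\<lambda>V. \<phi> V (v # W)) P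
   + sg (e u + word_deg e P) * E v (\<phi> (u # P)) W)) (cg x)"

text \<open>The compatibility of \<open>cg\<close> with the operations is spread along the product:
  the empty word needs \<open>cg_Dg\<close>, and every further factor \<open>y\<close> needs one
  instance of \<open>cg_Bg\<close>.\<close>

lemma E_Del:
  assumes "good2 \<phi>"
  shows "E x (\<lambda>V. Del \<phi> V) W = sg (n * (e x + 1)) * Del (\<lambda>P W. E x (\<lambda>V. \<phi> V W) P + sg ((e x + 1) * word_deg e P) * E x (\<phi> P) W) W
    + Spl (K x \<phi>) W"
proof -
  let ?G = "\<lambda>\<phi> W. E x (\<lambda>V. Del \<phi> V) W - (sg (n * (e x + 1)) * Del (\<lambda>P W. E x (\<lambda>V. \<phi> V W) P + sg ((e x + 1) * word_deg e P) * E x (\<phi> P) W) W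
    + Spl (K x \<phi>) W)"
  have "?G \<phi> W = 0" using assms
  proof (induction W arbitrary: \<phi>)
    case Nil
    show ?case by (simp add: K_def cg_Dg cps2 cong: cps2_congs)
  next
    case (Cons y W)
    have G: "?G (\<lambda>P W. \<phi> (y # P) W) W = 0" "?G (\<lambda>P W. sg (e y * word_deg e P) * \<phi> P (y # W)) W = 0"
      by (rule Cons.IH[OF good2_Cons[OF Cons.prems]]) (rule Cons.IH[OF good2_Cons_right[OF Cons.prems]])
    let ?\<theta> = "\<lambda>P W u v. sg (e v * word_deg e P) * \<phi> (u # P) (v # W)"
    \<comment> \<open>The defect of \<open>cg_Bg\<close> for the bracket of \<open>x\<close> and
      \<open>y\<close>, whose two parts are put before the tensor factors \<open>P\<close> and
      \<open>W\<close>.\<close>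
    let ?B = "\<lambda>P W. ev (\<lambda>z. ev2 (?\<theta> P W) (cg z)) (Bg x y) - (
        sg (n * (e x + 1)) * ev2 (\<lambda>u v. ev (\<lambda>z. ?\<theta> P W z v) (Bg x u)
          + sg ((e x + 1) * e u) * ev (?\<theta> P W u) (Bg x v)) (cg y)
        + sg n * ev2 (\<lambda>u v. sg (e v * e y) * ev (\<lambda>z. ?\<theta> P W z v) (Bg u y)
          + sg (e u) * ev (?\<theta> P W u) (Bg v y)) (cg x))"
    have B: "?B P W = 0" for P W
      unfolding right_minus_eq
    proof (rule cg_Bg)
      fix r v assume r: "r \<in> R"
      show "ev (\<lambda>u. sg (e v * word_deg e P) * \<phi> (u # P) (v # W)) r = 0"
        by (simp add: ev_lins good_kill[OF good2D(1)[OF Cons.prems] r])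
    next
      fix r u assume r: "r \<in> R"
      then obtain m where m: "\<And>z. z \<in> Poly_Mapping.keys r \<Longrightarrow> e z = m" using R_hom by blast
      have "ev (\<lambda>v. sg (e v * word_deg e P) * \<phi> (u # P) (v # W)) r = ev (\<lambda>v. sg (m * word_deg e P) * \<phi> (u # P) (v # W)) r"
        by (rule ev_cong) (simp add: m)
      then show "ev (\<lambda>v. sg (e v * word_deg e P) * \<phi> (u # P) (v # W)) r = 0"
        by (simp add: ev_lins good_kill[OF good2D(2)[OF Cons.prems] r])
    qed
    \<comment> \<open>In these differences \<open>y\<close> changes places with a half of
      \<open>x\<close> beneath an operator \<open>E\<close> that does not involve that pair;
      goodness of \<open>\<phi>\<close> makes them 0.\<close>
    let ?S1 = "\<lambda>P W u v. E v (\<phi> (u # y # P)) W - sg (e u * e y) * E v (\<phi> (y # u # P)) W"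
    let ?S2 = "\<lambda>P W u v. E u (\<lambda>V. \<phi> V (v # y # W)) P - sg (e v * e y) * E u (\<lambda>V. \<phi> V (y # v # W)) P"
    have S: "?S1 P W u v = 0" "?S2 P W u v = 0" for P W u v
      unfolding right_minus_eq EE_mult[symmetric]
      by (intro E_cong good_swap[OF good2D(1)[OF Cons.prems]] good_swap[OF good2D(2)[OF Cons.prems]])+
    have "?G \<phi> (y # W) = sg (e y * (e x + 1) + n * e y) * ?G (\<lambda>P W. \<phi> (y # P) W) W
      + sg (e y * (e x + 1) + n * e y) * ?G (\<lambda>P W. sg (e y * word_deg e P) * \<phi> P (y # W)) W
      + Spl (\<lambda>P W. ?B P W) W
      - sg n * Spl (\<lambda>P W. ev2 (\<lambda>u v. sg (e v * (e y + word_deg e P) + e u + e y + word_deg e P) * ?S1 P W u v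
          + sg ((e y + e v) * word_deg e P) * ?S2 P W u v) (cg x)) W"
      by (simp add: K_def E_Spl cps2 cong: cps2_congs)
    then show ?case unfolding G B S by simp
  qed
  then show ?thesis by simp
qed

text \<open>When \<open>x\<close> is split, \<open>Q\<close> acts on \<open>u # P\<close> and on
  \<open>v # W\<close>. The parts with \<open>E u\<close> and \<open>E v\<close> make up
  \<open>K\<close>, which \<open>E_Del\<close> produces on the other side.\<close>

lemma Q_Del:
  assumes "good2 \<phi>"
  shows "Del (\<lambda>P W. Q (\<lambda>V. \<phi> V W) P + sg (word_deg e P) * Q (\<phi> P) W) W = sg n * Q (\<lambda>V. Del \<phi> V) W"
proof -
  let ?G = "\<lambda>\<phi> W. Del (\<lambda>P W. Q (\<lambda>V. \<phi> V W) P + sg (word_deg e P) * Q (\<phi> P) W) W - sg n * Q (\<lambda>V. Del \<phi> V) W"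
  have "?G \<phi> W = 0" using assms
  proof (induction W arbitrary: \<phi>)
    case (Cons x W)
    have G: "?G (\<lambda>P W. \<phi> (x # P) W) W = 0" "?G (\<lambda>P W. sg (e x * word_deg e P) * \<phi> P (x # W)) W = 0"
      by (rule Cons.IH[OF good2_Cons[OF Cons.prems]]) (rule Cons.IH[OF good2_Cons_right[OF Cons.prems]])
    let ?E = "E x (\<lambda>V. Del \<phi> V) W - (sg (n * (e x + 1)) * Del (\<lambda>P W. E x (\<lambda>V. \<phi> V W) P + sg ((e x + 1) * word_deg e P) * E x (\<phi> P) W) W
      + Spl (K x \<phi>) W)"
    have E: "?E = 0" using E_Del[OF Cons.prems] by simp
    have "?G \<phi> (x # W) = sg (n * e x + e x) * ?G (\<lambda>P W. \<phi> (x # P) W) W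
      + sg (n * e x + e x) * ?G (\<lambda>P W. sg (e x * word_deg e P) * \<phi> P (x # W)) W - sg n * ?E"
      by (simp add: K_def Q_Spl cps2 cong: cps2_congs)
    then show ?case unfolding G E by simp
  qed simp
  then show ?thesis by simp
qed

end

section \<open>Word operations modulo letter relations and shuffles\<close>

context letters begin

lemma kills_words_D:
  assumes "kills_words \<phi>" shows "kills_words (Dw \<phi>)"
proof -
  have "ev (\<lambda>z. Dw \<phi> (u @ z # v)) r = 0" if r: "r \<in> R" for u v r
    using assms
  proof (induction u arbitrary: \<phi>)
    case Nil
    obtain m where m: "z \<in> Poly_Mapping.keys r \<Longrightarrow> e z = m" for z
      using R_hom[OF r] by blast
    have 1: "ev (\<lambda>z. ev (\<lambda>l. \<phi> (l # v)) (dl z)) r = 0"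
      by (rule R_dl[OF kills_words_head[OF Nil] r])
    have 2: "ev (\<lambda>z. Dw (\<lambda>W. \<phi> (z # W)) v) r = 0"
      by (simp add: wD_ev[symmetric] kills_words_head[OF Nil r])
    have 3: "ev (\<lambda>z. head_mul mu \<phi> z v) r = 0"
      by (cases v) (simp_all add: R_mu_left[OF kills_words_head[OF Nil] r])
    have "ev (\<lambda>z. Dw \<phi> ([] @ z # v)) r = ev (\<lambda>z. ev (\<lambda>l. \<phi> (l # v)) (dl z)
        + sg m * Dw (\<lambda>W. \<phi> (z # W)) v + head_mul mu \<phi> z v) r"
      by (rule ev_cong) (simp add: m)
    then show ?case by (simp only: ev_fun_add ev_fun_mult 1 2 3) simp
  next
    case (Cons a u)
    note k = kills_words_Cons[OF Cons.prems]
    have k': "ev (\<lambda>z. \<phi> (l # u @ z # v)) r = 0" for l u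
      using k[of l] r by (simp add: kills_words_def)
    have 1: "ev (\<lambda>z. ev (\<lambda>l. \<phi> (l # u @ z # v)) (dl a)) r = 0"
      by (subst ev_swap) (simp add: k')
    have 2: "ev (\<lambda>z. head_mul mu \<phi> a (u @ z # v)) r = 0"
    proof (cases u)
      case Nil
      then show ?thesis by (simp add: R_mu_right[OF kills_words_head[OF Cons.prems] r])
    next
      case (Cons b u')
      then show ?thesis by (simp add: ev_swap[where q = "mu a b"] k')
    qed
    show ?case using Cons.IH[OF k[of a]] 1 2 by (simp add: ev_lins)
  qed
  then show ?thesis by (simp add: kills_words_def)
qed

lemma kills_words_Br_left:
  assumes "kills_words \<phi>" shows "kills_words (\<lambda>X. Br \<phi> X Y)"
proof -
  have "ev (\<lambda>z. Br \<phi> (u @ z # v) Y) r = 0" if r: "r \<in> R" for u v r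
    using assms
  proof (induction "length u + length Y" arbitrary: u Y \<phi> rule: less_induct)
    case less
    note k = kills_words_Cons[OF less.prems]
    obtain m where m: "z \<in> Poly_Mapping.keys r \<Longrightarrow> e z = m" for z
      using R_hom[OF r] by blast
    show ?case
    proof (cases Y)
      case Y: (Cons y Y')
      have 1: "ev (\<lambda>z. Br (\<lambda>W. \<phi> (y # W)) (u @ z # v) Y') r = 0"
        by (rule less.hyps) (simp_all add: k Y)
      show ?thesis
      proof (cases u)
        case Nil
        have 2: "ev (\<lambda>z. Br (\<lambda>W. \<phi> (z # W)) v Y) r = 0"
          by (simp add: br_ev[symmetric] kills_words_head[OF less.prems r])
        have 3: "ev (\<lambda>z. ev (\<lambda>l. Sh (\<lambda>W. \<phi> (l # W)) v Y') (el z y)) r = 0"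
          by (rule R_el_left[OF kills_words_head_sh[OF less.prems] r])
        have "ev (\<lambda>z. Br \<phi> (u @ z # v) Y) r = ev (\<lambda>z. sg (c * m) * Br (\<lambda>W. \<phi> (z # W)) v Y
           + sg (c * e y + e y * (m + word_deg e v)) * Br (\<lambda>W. \<phi> (y # W)) (u @ z # v) Y'
           + sg (e y * word_deg e v) * ev (\<lambda>l. Sh (\<lambda>W. \<phi> (l # W)) v Y') (el z y)) r"
          by (rule ev_cong) (simp add: m Y Nil)
        then show ?thesis by (simp only: ev_fun_add ev_fun_mult 1 2 3) simp
      next
        case (Cons a u')
        have 2: "ev (\<lambda>z. Br (\<lambda>W. \<phi> (a # W)) (u' @ z # v) Y) r = 0"
          by (rule less.hyps) (simp_all add: k Cons)
        have "ev (\<lambda>z. Sh (\<lambda>W. \<phi> (l # W)) (u' @ z # v) Y') r = 0" for l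
          using kills_words_sh[OF k[of l]] r by (simp add: kills_words_def)
        then have 3: "ev (\<lambda>z. ev (\<lambda>l. Sh (\<lambda>W. \<phi> (l # W)) (u' @ z # v) Y') (el a y)) r = 0"
          by (subst ev_swap) simp
        have "ev (\<lambda>z. Br \<phi> (u @ z # v) Y) r = ev (\<lambda>z. sg (c * e a) * Br (\<lambda>W. \<phi> (a # W)) (u' @ z # v) Y
           + sg (c * e y + e y * (e a + (word_deg e u' + m + word_deg e v))) * Br (\<lambda>W. \<phi> (y # W)) (u @ z # v) Y'
           + sg (e y * (word_deg e u' + m + word_deg e v)) * ev (\<lambda>l. Sh (\<lambda>W. \<phi> (l # W)) (u' @ z # v) Y') (el a y)) r"
          by (rule ev_cong) (simp add: m Y Cons algebra_simps)
        then show ?thesis by (simp only: ev_fun_add ev_fun_mult 1 2 3) simp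
      qed
    qed simp
  qed
  then show ?thesis by (simp add: kills_words_def)
qed

lemma kills_words_mult: "kills_words \<phi> \<Longrightarrow> kills_words (\<lambda>W. k * \<phi> W)"
  unfolding kills_words_def by (simp add: ev_lins)

lemma kills_words_sg:
  assumes "kills_words \<phi>" shows "kills_words (\<lambda>W. sg (k * word_deg e W) * \<phi> W)"
  unfolding kills_words_def
proof (intro allI ballI)
  fix u v r assume r: "r \<in> R"
  obtain m where m: "z \<in> Poly_Mapping.keys r \<Longrightarrow> e z = m" for z
    using R_hom[OF r] by blast
  have "ev (\<lambda>z. sg (k * word_deg e (u @ z # v)) * \<phi> (u @ z # v)) r
      = ev (\<lambda>z. sg (k * (word_deg e u + m + word_deg e v)) * \<phi> (u @ z # v)) r"
    by (rule ev_cong) (simp add: m algebra_simps)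
  then show "ev (\<lambda>z. sg (k * word_deg e (u @ z # v)) * \<phi> (u @ z # v)) r = 0"
    using assms r by (simp add: ev_lins kills_words_def)
qed

text \<open>\<open>D\<close> never produces the empty word. This is used because
  \<open>kills_sh\<close> says nothing about a shuffle with the empty word, so
  \<open>Sh \<phi> U Y\<close> is known to vanish only for nonempty \<open>U\<close>.\<close>

lemma wD_zero_nonempty: "(\<And>W. W \<noteq> [] \<Longrightarrow> \<phi> W = 0) \<Longrightarrow> Dw \<phi> X = 0"
proof (induction X arbitrary: \<phi>)
  case (Cons x X)
  then show ?case by (cases X) simp_all
qed simp

lemma br_zero_nonempty: "(\<And>W. W \<noteq> [] \<Longrightarrow> \<phi> W = 0) \<Longrightarrow> Br \<phi> X Y = 0"
proof (induction "length X + length Y" arbitrary: X Y \<phi> rule: less_induct)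
  case less
  then show ?case by (cases X; cases Y) simp_all
qed

definition kills_sh :: "('l list \<Rightarrow> 'k) \<Rightarrow> bool" where
  "kills_sh \<phi> \<longleftrightarrow> (\<forall>X Y. X \<noteq> [] \<longrightarrow> Y \<noteq> [] \<longrightarrow> Sh \<phi> X Y = 0)"

lemma kills_sh_D: "kills_words \<phi> \<Longrightarrow> kills_sh \<phi> \<Longrightarrow> kills_sh (Dw \<phi>)"
  unfolding kills_sh_def by (auto simp: D_sh wD_zero_nonempty)

lemma kills_sh_Br_left: "kills_sh \<phi> \<Longrightarrow> kills_sh (\<lambda>X. Br \<phi> X Y)"
  unfolding kills_sh_def by (auto simp: Br_sh_left br_zero_nonempty)

lemma kills_sh_mult: "kills_sh \<phi> \<Longrightarrow> kills_sh (\<lambda>X. k * \<phi> X)"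
  unfolding kills_sh_def by (auto simp: sh_mult)

lemma kills_sh_sg:
  assumes "kills_sh \<phi>" shows "kills_sh (\<lambda>W. sg (k * word_deg e W) * \<phi> W)"
  unfolding kills_sh_def
proof (intro allI impI)
  fix X Y :: "'l list" assume "X \<noteq> []" "Y \<noteq> []"
  moreover have "Sh (\<lambda>W. sg (k * word_deg e W) * \<phi> W) X Y = Sh (\<lambda>W. sg (k * (word_deg e X + word_deg e Y)) * \<phi> W) X Y"
    by (rule sh_cong) simp
  ultimately show "Sh (\<lambda>W. sg (k * word_deg e W) * \<phi> W) X Y = 0"
    using assms by (simp add: sh_mult kills_sh_def)
qed

text \<open>The transpose of the antisymmetrized deconcatenation, i.e. of \<open>\<delta>''\<close> on a single factor. The empty
  cuts are harmless for functionals that vanish on pairs containing an empty word.\<close>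

definition co :: "int \<Rightarrow> ('l list \<Rightarrow> 'l list \<Rightarrow> 'k) \<Rightarrow> 'l list \<Rightarrow> 'k" where
  "co n \<psi> X = sg n * dc (\<lambda>U V. sg (n * word_deg e U) * \<psi> U V
     - sg (word_deg e U * word_deg e V + n * word_deg e V) * \<psi> V U) X"

lemma dc_Nil_right: "(\<And>U V. V \<noteq> [] \<Longrightarrow> \<psi> U V = 0) \<Longrightarrow> dc \<psi> X = \<psi> X []"
proof (induction X arbitrary: \<psi>)
  case (Cons x X)
  then show ?case by simp
qed simp

lemma dc_Nil_left: "(\<And>U V. U \<noteq> [] \<Longrightarrow> \<psi> U V = 0) \<Longrightarrow> dc \<psi> X = \<psi> [] X"
proof (cases X)
  case (Cons x Y)
  assume "\<And>U V. U \<noteq> [] \<Longrightarrow> \<psi> U V = 0"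
  then have "dc (\<lambda>U V. \<psi> (x # U) V) Y = dc (\<lambda>U V. 0) Y" by (intro dc_cong) simp
  then show ?thesis by (simp add: Cons)
qed simp

text \<open>By \<open>dc_sh\<close> a cut of a shuffle consists of two shuffles. As \<theta> kills
  shuffles in each variable, only the cuts that keep \<open>X\<close> and \<open>Y\<close> whole and
  on opposite sides survive, and these two cancel by antisymmetry of \<theta>. Deconcatenation
  before antisymmetrization does not descend to \<H>; this cancellation is what makes the cobracket
  descend.\<close>

lemma co_sh:
  assumes l: "\<And>V. kills_sh (\<lambda>U. \<psi> U V)" and r: "\<And>U. kills_sh (\<psi> U)"
    and Nil: "\<And>V. \<psi> [] V = 0" "\<And>U. \<psi> U [] = 0"
  shows "kills_sh (co n \<psi>)"
proof -
  define \<theta> where "\<theta> = (\<lambda>U V. sg (n * word_deg e U) * \<psi> U V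
     - sg (word_deg e U * word_deg e V + n * word_deg e V) * \<psi> V U)"
  have \<theta>Nil: "\<theta> [] V = 0" "\<theta> U [] = 0" for U V by (simp_all add: \<theta>_def Nil)
  have \<theta>swap: "\<theta> X Y + sg (word_deg e X * word_deg e Y) * \<theta> Y X = 0" for X Y
    by (simp add: \<theta>_def sg_simps algebra_simps)
  have kl: "kills_sh (\<lambda>U. \<theta> U V)" for V
  proof -
    have "kills_sh (\<lambda>U. sg (n * word_deg e U) * \<psi> U V)" by (rule kills_sh_sg[OF l])
    moreover have "kills_sh (\<lambda>U. sg (word_deg e V * word_deg e U) * (sg (n * word_deg e V) * \<psi> V U))"
      by (rule kills_sh_sg[OF kills_sh_mult[OF r]])
    ultimately show ?thesis
      unfolding kills_sh_def \<theta>_def by (simp add: sh_diff sg_add mult.commute mult.left_commute)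
  qed
  have kr: "kills_sh (\<lambda>V. \<theta> U V)" for U
  proof -
    have "kills_sh (\<lambda>V. sg (n * word_deg e U) * \<psi> U V)" by (rule kills_sh_mult[OF r])
    moreover have "kills_sh (\<lambda>V. sg ((word_deg e U + n) * word_deg e V) * \<psi> V U)"
      by (rule kills_sh_sg[OF l])
    ultimately show ?thesis
      unfolding kills_sh_def \<theta>_def by (simp add: sh_diff distrib_right)
  qed
  have "Sh (dc \<theta>) X Y = 0" if "X \<noteq> []" "Y \<noteq> []" for X Y
  proof -
    have "Sh (dc \<theta>) X Y = dc (\<lambda>X1 X2. dc (\<lambda>Y1 Y2.
       sg (word_deg e X2 * word_deg e Y1) * Sh (\<lambda>A. Sh (\<lambda>B. \<theta> A B) X2 Y2) X1 Y1) Y) X"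
      by (rule dc_sh)
    \<comment> \<open>An empty \<open>X1\<close> leaves \<open>X2\<close> nonempty and so forces
      \<open>Y2 = []\<close>; a nonempty \<open>X1\<close> forces \<open>Y1 = []\<close> and then
      \<open>X2 = []\<close>.\<close>
    also have "\<dots> = dc (\<lambda>X1 X2. (if X1 = [] then sg (word_deg e X2 * word_deg e Y) * \<theta> Y X2 else 0) + (if X2 = [] then \<theta> X1 Y else 0)) X"
    proof (rule dc_cong)
      fix X1 X2 assume X: "X1 @ X2 = X"
      let ?f = "\<lambda>Y1 Y2. sg (word_deg e X2 * word_deg e Y1) * Sh (\<lambda>A. Sh (\<lambda>B. \<theta> A B) X2 Y2) X1 Y1"
      have z: "Sh (\<lambda>A. Sh (\<theta> A) X2 Y2) X1 Y1 = 0" if "X1 \<noteq> []" "Y1 \<noteq> []" for Y1 Y2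
      proof -
        have *: "Sh (\<lambda>A. \<theta> A B) X1 Y1 = 0" for B using kl[of B] that by (simp add: kills_sh_def)
        \<comment> \<open>The two shuffles act on different variables. The inner one is unfolded by
          induction with \<theta> arbitrary, until one of its words is empty and the vanishing in
          the first variable applies.\<close>
        have "Sh (\<lambda>A. Sh (\<theta> A) X2 Y2) X1 Y1 = 0" if "length X2 + length Y2 = N" "\<And>B. Sh (\<lambda>A. \<theta> A B) X1 Y1 = 0" for N X2 Y2 \<theta>
          using that
        proof (induction N arbitrary: X2 Y2 \<theta> rule: less_induct)
          case (less N)
          show ?case
          proof (cases "X2 = [] \<or> Y2 = []")
            case True then show ?thesis using less.prems(2) by auto
          next
            case False
            then obtain x X' y Y' where *: "X2 = x # X'" "Y2 = y # Y'" by (meson list.exhaust)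
            have "Sh (\<lambda>A. Sh (\<lambda>B. \<theta> A (x # B)) X' Y2) X1 Y1 = 0" "Sh (\<lambda>A. Sh (\<lambda>B. \<theta> A (y # B)) X2 Y') X1 Y1 = 0"
              by (rule less.IH[OF _ refl less.prems(2)]; use less.prems(1) * in simp)+
            then show ?thesis by (simp add: * sh_lins)
          qed
        qed
        from this[OF refl *] show ?thesis .
      qed
      have z2: "Sh (\<lambda>B. \<theta> A B) X2 Y2 = 0" if "X2 \<noteq> []" "Y2 \<noteq> []" for A Y2
        using kr[of A] that by (simp add: kills_sh_def)
      show "dc ?f Y = (if X1 = [] then sg (word_deg e X2 * word_deg e Y) * \<theta> Y X2 else 0) + (if X2 = [] then \<theta> X1 Y else 0)"
      proof (cases "X1 = []")
        case True
        then have "X2 \<noteq> []" using X \<open>X \<noteq> []\<close> by simp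
        then have "dc ?f Y = ?f Y []" by (intro dc_Nil_right) (simp add: z2 True)
        then show ?thesis using \<open>X2 \<noteq> []\<close> True by simp
      next
        case False
        then have "dc ?f Y = ?f [] Y" by (intro dc_Nil_left) (simp add: z)
        then show ?thesis using False \<open>Y \<noteq> []\<close> by (cases "X2 = []") (simp_all add: z2)
      qed
    qed
    also have "\<dots> = sg (word_deg e X * word_deg e Y) * \<theta> Y X + \<theta> X Y"
      unfolding dc_add using that
      by (subst dc_Nil_left, simp, subst dc_Nil_right) auto
    also have "\<dots> = 0" using \<theta>swap[of X Y] by (simp add: add.commute)
    finally show ?thesis .
  qed
  then show ?thesis unfolding kills_sh_def co_def \<theta>_def[symmetric] by (simp add: sh_mult)
qed

lemma co_kills_words:
  assumes l: "\<And>V. kills_words (\<lambda>U. \<psi> U V)" and r: "\<And>U. kills_words (\<psi> U)"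
    and Nil: "\<And>V. \<psi> [] V = 0" "\<And>U. \<psi> U [] = 0"
  shows "kills_words (co n \<psi>)"
proof -
  define \<theta> where "\<theta> = (\<lambda>U V. sg (n * word_deg e U) * \<psi> U V
     - sg (word_deg e U * word_deg e V + n * word_deg e V) * \<psi> V U)"
  have kdiff: "kills_words F \<Longrightarrow> kills_words G \<Longrightarrow> kills_words (\<lambda>W. F W - G W)" for F G
    unfolding kills_words_def by (simp add: ev_lins)
  have kl: "kills_words (\<lambda>U. \<theta> U V)" for V
  proof -
    have "kills_words (\<lambda>U. sg (n * word_deg e U) * \<psi> U V
       - sg (word_deg e V * word_deg e U) * (sg (n * word_deg e V) * \<psi> V U))"
      by (intro kdiff kills_words_sg kills_words_mult l r)
    then show ?thesis unfolding \<theta>_def by (simp add: sg_add mult.commute mult.left_commute)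
  qed
  have kr: "kills_words (\<lambda>V. \<theta> U V)" for U
  proof -
    have "kills_words (\<lambda>V. sg (n * word_deg e U) * \<psi> U V - sg ((word_deg e U + n) * word_deg e V) * \<psi> V U)"
      by (intro kdiff kills_words_sg kills_words_mult l r)
    then show ?thesis unfolding \<theta>_def by (simp add: distrib_right)
  qed
  have "ev (\<lambda>z. dc \<theta> (u @ z # v)) r = 0" if r: "r \<in> R" and "\<And>V. kills_words (\<lambda>U. \<theta> U V)" "\<And>U. kills_words (\<theta> U)" for u v r \<theta>
    using that(2,3)
  proof (induction u arbitrary: \<theta>)
    case Nil
    have "ev (\<lambda>z. dc (\<lambda>U. \<theta> (z # U)) v) r = 0"
      by (simp add: dc_ev[symmetric] kills_words_head[OF Nil(1) r])
    then show ?case using kills_words_head[OF Nil(2) r] by (simp add: ev_lins)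
  next
    case (Cons a u)
    have "ev (\<lambda>z. \<theta> [] ((a # u) @ z # v)) r = 0"
      using Cons.prems(2)[of "[]"] r by (simp only: kills_words_def)
    moreover have "ev (\<lambda>z. dc (\<lambda>U. \<theta> (a # U)) (u @ z # v)) r = 0"
      by (rule Cons.IH) (rule kills_words_Cons[OF Cons.prems(1)], rule Cons.prems(2))
    ultimately show ?case by (simp add: ev_lins)
  qed
  from this[OF _ kl kr] show ?thesis
    unfolding kills_words_def co_def \<theta>_def[symmetric] by (simp add: ev_lins)
qed

end

section \<open>The cobracket on words\<close>

context letters begin

lemma co_mult: "co n (\<lambda>U V. k * \<phi> U V) X = k * co n \<phi> X"
  by (simp add: co_def dc_lins algebra_simps)

lemma co_cong: "(\<And>U V. word_deg e V = word_deg e X - word_deg e U \<Longrightarrow> U @ V = X \<or> V @ U = X \<Longrightarrow> \<phi> U V = \<psi> U V) \<Longrightarrow> co n \<phi> X = co n \<psi> X"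
  unfolding co_def by (intro arg_cong[where f = "(*) _"] dc_cong) auto

lemma co_swap: "co n (\<lambda>U V. sg ((word_deg e U - n) * (word_deg e V - n)) * \<psi> V U) X = - (sg n * co n \<psi> X)"
  unfolding co_def by (simp add: dc_lins sg_simps algebra_simps)

lemma dc_assoc: "dc (\<lambda>U V. dc (\<lambda>U1 U2. \<psi> U1 U2 V) U) X = dc (\<lambda>U V. dc (\<lambda>V1 V2. \<psi> U V1 V2) V) X"
proof (induction X arbitrary: \<psi>)
  case (Cons x X)
  show ?case using Cons[of "\<lambda>U. \<psi> (x # U)"] by (simp add: dc_lins)
qed simp

text \<open>Cutting twice is cutting \<open>X\<close> into three pieces \<open>A\<close>,
  \<open>B\<close>, \<open>C\<close>, whichever half is cut again (\<open>dc_assoc\<close>). The two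
  antisymmetrizations give four orders of the pieces.\<close>

lemma co_co: "co n (\<lambda>U V. co n (\<lambda>U1 U2. \<Theta> U1 U2 V) U) X = dc (\<lambda>A V. dc (\<lambda>B C.
    sg (n * (word_deg e A + word_deg e B)) * (sg (n * word_deg e A) * \<Theta> A B C
      - sg (word_deg e A * word_deg e B + n * word_deg e B) * \<Theta> B A C)
    - sg ((word_deg e A + n) * (word_deg e B + word_deg e C)) * (sg (n * word_deg e B) * \<Theta> B C A
      - sg (word_deg e B * word_deg e C + n * word_deg e C) * \<Theta> C B A)) V) X"
proof -
  have 1: "dc (\<lambda>U V. sg (n * word_deg e U) * dc (\<lambda>U1 U2. sg (n * word_deg e U1) * \<Theta> U1 U2 V
      - sg (word_deg e U1 * word_deg e U2 + n * word_deg e U2) * \<Theta> U2 U1 V) U) X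
    = dc (\<lambda>A V. dc (\<lambda>B C. sg (n * (word_deg e A + word_deg e B)) * (sg (n * word_deg e A) * \<Theta> A B C
      - sg (word_deg e A * word_deg e B + n * word_deg e B) * \<Theta> B A C)) V) X"
    unfolding dc_assoc[symmetric] dc_mult[symmetric] by (intro dc_cong) auto
  have 2: "dc (\<lambda>U V. sg (word_deg e U * word_deg e V + n * word_deg e V) * dc (\<lambda>U1 U2. sg (n * word_deg e U1) * \<Theta> U1 U2 U
      - sg (word_deg e U1 * word_deg e U2 + n * word_deg e U2) * \<Theta> U2 U1 U) V) X
    = dc (\<lambda>A V. dc (\<lambda>B C. sg ((word_deg e A + n) * (word_deg e B + word_deg e C)) * (sg (n * word_deg e B) * \<Theta> B C A
      - sg (word_deg e B * word_deg e C + n * word_deg e C) * \<Theta> C B A)) V) X"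
    unfolding dc_mult[symmetric] by (intro dc_cong) (auto simp: distrib_right)
  have aux: "dc (\<lambda>U V. a U V * (k * F U V) - b U V * (k * G U V)) X
      = k * (dc (\<lambda>U V. a U V * F U V) X - dc (\<lambda>U V. b U V * G U V) X)" for k :: 'k and a b F G
    by (simp add: dc_lins right_diff_distrib)
  have "co n (\<lambda>U V. co n (\<lambda>U1 U2. \<Theta> U1 U2 V) U) X =
     dc (\<lambda>U V. sg (n * word_deg e U) * dc (\<lambda>U1 U2. sg (n * word_deg e U1) * \<Theta> U1 U2 V
      - sg (word_deg e U1 * word_deg e U2 + n * word_deg e U2) * \<Theta> U2 U1 V) U) X
     - dc (\<lambda>U V. sg (word_deg e U * word_deg e V + n * word_deg e V) * dc (\<lambda>U1 U2. sg (n * word_deg e U1) * \<Theta> U1 U2 U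
      - sg (word_deg e U1 * word_deg e U2 + n * word_deg e U2) * \<Theta> U2 U1 U) V) X"
    unfolding co_def aux sg_mult_self_left ..
  then show ?thesis by (simp only: 1 2) (simp only: dc_diff)
qed

text \<open>The antisymmetrization of a coassociative coproduct is a Lie cobracket: by
  \<open>co_co\<close> the cyclic sum has twelve terms, which cancel in pairs for every fixed triple
  of pieces.\<close>

lemma co_jacobi:
  "co n (\<lambda>U V. co n (\<lambda>U1 U2. \<Theta> U1 U2 V) U) X
   + co n (\<lambda>U V. co n (\<lambda>U1 U2. sg ((word_deg e V - n) * (word_deg e U1 - n + (word_deg e U2 - n))) * \<Theta> V U1 U2) U) X
   + co n (\<lambda>U V. co n (\<lambda>U1 U2. sg ((word_deg e U1 - n) * (word_deg e U2 - n + (word_deg e V - n))) * \<Theta> U2 V U1) U) X = 0"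
  unfolding co_co[of n "\<lambda>U1 U2 V. \<Theta> U1 U2 V"] co_co[of n "\<lambda>U1 U2 V. sg ((word_deg e V - n) * (word_deg e U1 - n + (word_deg e U2 - n))) * \<Theta> V U1 U2"]
    co_co[of n "\<lambda>U1 U2 V. sg ((word_deg e U1 - n) * (word_deg e U2 - n + (word_deg e V - n))) * \<Theta> U2 V U1"]
    dc_add[symmetric]
  by (simp add: sg_simps algebra_simps)

lemma co_D: "Dw (co n \<psi>) X = sg n * co n (\<lambda>U V. Dw (\<lambda>Z. \<psi> Z V) U + sg (word_deg e U - n) * Dw (\<psi> U) V) X"
  unfolding co_def by (simp add: wD_lins dc_D) (simp add: cps cong: cps_congs dc_deg_cong)

text \<open>In each term of \<open>dc_br\<close> two halves are bracketed and the other two are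
  shuffled. As \<theta> kills shuffles, one of the shuffled halves must be empty, so only one of the
  words is really cut and the other enters the bracket whole.\<close>

lemma br_dc_kill:
  assumes l: "\<And>V. kills_sh (\<lambda>U. \<theta> U V)" and r: "\<And>U. kills_sh (\<theta> U)"
    and Nil: "\<And>V. \<theta> [] V = 0" "\<And>U. \<theta> U [] = 0"
  shows "Br (dc \<theta>) X Y = dc (\<lambda>Y1 Y2. Br (\<lambda>A. \<theta> A Y2) X Y1 + sg ((word_deg e X + c) * word_deg e Y1) * Br (\<theta> Y1) X Y2) Y
    + dc (\<lambda>X1 X2. sg (word_deg e X2 * word_deg e Y) * Br (\<lambda>A. \<theta> A X2) X1 Y + sg (c * word_deg e X1) * Br (\<theta> X1) X2 Y) X"
proof -
  let ?a = "\<lambda>X1 X2 Y1 Y2. sg (word_deg e X2 * word_deg e Y1) * Br (\<lambda>A. Sh (\<lambda>B. \<theta> A B) X2 Y2) X1 Y1"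
  let ?b = "\<lambda>X1 X2 Y1 Y2. sg (word_deg e X2 * word_deg e Y1) * (sg (c * (word_deg e X1 + word_deg e Y1)) * Sh (\<lambda>A. Br (\<lambda>B. \<theta> A B) X2 Y2) X1 Y1)"
  have a0: "?a X1 X2 Y1 Y2 = 0" if "X2 \<noteq> []" "Y2 \<noteq> []" for X1 X2 Y1 Y2
    using r that by (simp add: kills_sh_def)
  \<comment> \<open>The shuffle in the first variable is hidden behind a bracket in the second. The
    bracket is unfolded by induction, whose contraction term needs the same statement with a shuffle
    in its place.\<close>
  have b0: "?b X1 X2 Y1 Y2 = 0" if "X1 \<noteq> []" "Y1 \<noteq> []" for X1 X2 Y1 Y2
  proof -
    have *: "Sh (\<lambda>A. \<theta> A B) X1 Y1 = 0" for B using l[of B] that by (simp add: kills_sh_def)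
    have "Sh (\<lambda>A. Br (\<theta> A) X2 Y2) X1 Y1 = 0" if "length X2 + length Y2 = N" "\<And>B. Sh (\<lambda>A. \<theta> A B) X1 Y1 = 0" for N X2 Y2 \<theta>
      using that
    proof (induction N arbitrary: X2 Y2 \<theta> rule: less_induct)
      case (less N)
      show ?case
      proof (cases "X2 = [] \<or> Y2 = []")
        case False
        then obtain x X' y Y' where *: "X2 = x # X'" "Y2 = y # Y'" by (meson list.exhaust)
        have 1: "Sh (\<lambda>A. Br (\<lambda>B. \<theta> A (x # B)) X' Y2) X1 Y1 = 0" "Sh (\<lambda>A. Br (\<lambda>B. \<theta> A (y # B)) X2 Y') X1 Y1 = 0"
          by (rule less.IH[OF _ refl less.prems(2)]; use less.prems(1) * in simp)+
        have 2: "Sh (\<lambda>A. Sh (\<lambda>B. \<theta> A (l # B)) X' Y') X1 Y1 = 0" for l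
        proof -
          have "Sh (\<lambda>A. Sh (\<lambda>B. \<theta> A B) X2 Y2) X1 Y1 = 0" if "length X2 + length Y2 = N" "\<And>B. Sh (\<lambda>A. \<theta> A B) X1 Y1 = 0" for N X2 Y2 \<theta>
            using that
          proof (induction N arbitrary: X2 Y2 \<theta> rule: less_induct)
            case (less N)
            show ?case
            proof (cases "X2 = [] \<or> Y2 = []")
              case True then show ?thesis using less.prems(2) by auto
            next
              case False
              then obtain x X' y Y' where *: "X2 = x # X'" "Y2 = y # Y'" by (meson list.exhaust)
              have "Sh (\<lambda>A. Sh (\<lambda>B. \<theta> A (x # B)) X' Y2) X1 Y1 = 0" "Sh (\<lambda>A. Sh (\<lambda>B. \<theta> A (y # B)) X2 Y') X1 Y1 = 0"
                by (rule less.IH[OF _ refl less.prems(2)]; use less.prems(1) * in simp)+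
              then show ?thesis by (simp add: * sh_lins)
            qed
          qed
          from this[OF refl less.prems(2)] show ?thesis .
        qed
        show ?thesis using 1 by (simp add: * sh_lins sh_ev 2)
      qed auto
    qed
    from this[OF refl *] show ?thesis by simp
  qed
  have A: "dc (\<lambda>X1 X2. dc (\<lambda>Y1 Y2. ?a X1 X2 Y1 Y2) Y) X
     = dc (\<lambda>Y1 Y2. Br (\<lambda>A. \<theta> A Y2) X Y1) Y + dc (\<lambda>X1 X2. sg (word_deg e X2 * word_deg e Y) * Br (\<lambda>A. \<theta> A X2) X1 Y) X"
  proof -
    have "dc (\<lambda>X1 X2. dc (\<lambda>Y1 Y2. ?a X1 X2 Y1 Y2) Y) X = dc (\<lambda>X1 X2. (if X2 = [] then dc (\<lambda>Y1 Y2. Br (\<lambda>A. \<theta> A Y2) X1 Y1) Y else 0)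
       + sg (word_deg e X2 * word_deg e Y) * Br (\<lambda>A. \<theta> A X2) X1 Y) X"
    proof (rule dc_cong)
      fix X1 X2
      show "dc (\<lambda>Y1 Y2. ?a X1 X2 Y1 Y2) Y = (if X2 = [] then dc (\<lambda>Y1 Y2. Br (\<lambda>A. \<theta> A Y2) X1 Y1) Y else 0)
       + sg (word_deg e X2 * word_deg e Y) * Br (\<lambda>A. \<theta> A X2) X1 Y"
      proof (cases "X2 = []")
        case True
        then show ?thesis by (simp add: Nil)
      next
        case False
        then have "dc (\<lambda>Y1 Y2. ?a X1 X2 Y1 Y2) Y = ?a X1 X2 Y []" by (intro dc_Nil_right a0)
        then show ?thesis using False by simp
      qed
    qed
    also have "\<dots> = dc (\<lambda>X1 X2. if X2 = [] then dc (\<lambda>Y1 Y2. Br (\<lambda>A. \<theta> A Y2) X1 Y1) Y else 0) X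
       + dc (\<lambda>X1 X2. sg (word_deg e X2 * word_deg e Y) * Br (\<lambda>A. \<theta> A X2) X1 Y) X"
      by (rule dc_add)
    also have "dc (\<lambda>X1 X2. if X2 = [] then dc (\<lambda>Y1 Y2. Br (\<lambda>A. \<theta> A Y2) X1 Y1) Y else 0) X = dc (\<lambda>Y1 Y2. Br (\<lambda>A. \<theta> A Y2) X Y1) Y"
      by (subst dc_Nil_right) simp_all
    finally show ?thesis .
  qed
  have B: "dc (\<lambda>X1 X2. dc (\<lambda>Y1 Y2. ?b X1 X2 Y1 Y2) Y) X
     = dc (\<lambda>Y1 Y2. sg ((word_deg e X + c) * word_deg e Y1) * Br (\<theta> Y1) X Y2) Y + dc (\<lambda>X1 X2. sg (c * word_deg e X1) * Br (\<theta> X1) X2 Y) X"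
  proof -
    have "dc (\<lambda>X1 X2. dc (\<lambda>Y1 Y2. ?b X1 X2 Y1 Y2) Y) X = dc (\<lambda>X1 X2. (if X1 = [] then dc (\<lambda>Y1 Y2. sg ((word_deg e X2 + c) * word_deg e Y1) * Br (\<theta> Y1) X2 Y2) Y else 0)
       + sg (c * word_deg e X1) * Br (\<theta> X1) X2 Y) X"
    proof (rule dc_cong)
      fix X1 X2
      show "dc (\<lambda>Y1 Y2. ?b X1 X2 Y1 Y2) Y = (if X1 = [] then dc (\<lambda>Y1 Y2. sg ((word_deg e X2 + c) * word_deg e Y1) * Br (\<theta> Y1) X2 Y2) Y else 0)
       + sg (c * word_deg e X1) * Br (\<theta> X1) X2 Y"
      proof (cases "X1 = []")
        case True
        moreover have "\<theta> [] = (\<lambda>V. 0)" by (simp add: fun_eq_iff Nil)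
        ultimately show ?thesis by (simp add: distrib_right sg_add mult.assoc)
      next
        case False
        then have "dc (\<lambda>Y1 Y2. ?b X1 X2 Y1 Y2) Y = ?b X1 X2 [] Y" by (intro dc_Nil_left b0)
        then show ?thesis using False by simp
      qed
    qed
    also have "\<dots> = dc (\<lambda>X1 X2. if X1 = [] then dc (\<lambda>Y1 Y2. sg ((word_deg e X2 + c) * word_deg e Y1) * Br (\<theta> Y1) X2 Y2) Y else 0) X
       + dc (\<lambda>X1 X2. sg (c * word_deg e X1) * Br (\<theta> X1) X2 Y) X"
      by (rule dc_add)
    also have "dc (\<lambda>X1 X2. if X1 = [] then dc (\<lambda>Y1 Y2. sg ((word_deg e X2 + c) * word_deg e Y1) * Br (\<theta> Y1) X2 Y2) Y else 0) X
       = dc (\<lambda>Y1 Y2. sg ((word_deg e X + c) * word_deg e Y1) * Br (\<theta> Y1) X Y2) Y"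
      by (subst dc_Nil_left) simp_all
    finally show ?thesis .
  qed
  have "Br (dc \<theta>) X Y = dc (\<lambda>X1 X2. dc (\<lambda>Y1 Y2. ?a X1 X2 Y1 Y2) Y) X + dc (\<lambda>X1 X2. dc (\<lambda>Y1 Y2. ?b X1 X2 Y1 Y2) Y) X"
    by (simp only: dc_br distrib_left dc_add)
  then show ?thesis unfolding A B by (simp only: dc_add ac_simps)
qed

text \<open>The cocycle condition between bracket and cobracket, and the one identity on words that
  uses the vanishing on shuffles. The factors with \<open>n * word_deg e\<close> turn the bracket of
  words into the shifted one, up to an overall sign common to all terms; \<open>c = 1 - n\<close>
  makes the other signs agree.\<close>

lemma co_br:
  assumes l: "\<And>V. kills_sh (\<lambda>U. \<psi> U V)" and r: "\<And>U. kills_sh (\<psi> U)"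
    and Nil: "\<And>V. \<psi> [] V = 0" "\<And>U. \<psi> U [] = 0" and c: "c = 1 - n"
  shows "sg (n * word_deg e X) * Br (co n \<psi>) X Y =
     sg (n * (word_deg e X - n + 1)) * co n (\<lambda>u v. sg (n * word_deg e X) * Br (\<lambda>z. \<psi> z v) X u
          + sg ((word_deg e X - n + 1) * (word_deg e u - n)) * (sg (n * word_deg e X) * Br (\<psi> u) X v)) Y
        + sg n * co n (\<lambda>u v. sg ((word_deg e v - n) * (word_deg e Y - n)) * (sg (n * word_deg e u) * Br (\<lambda>z. \<psi> z v) u Y)
          + sg (word_deg e u - n) * (sg (n * word_deg e v) * Br (\<psi> u) v Y)) X"
proof -
  define \<theta> where "\<theta> = (\<lambda>U V. sg (n * word_deg e U) * \<psi> U V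
     - sg (word_deg e U * word_deg e V + n * word_deg e V) * \<psi> V U)"
  have kl: "kills_sh (\<lambda>U. \<theta> U V)" for V
  proof -
    have "kills_sh (\<lambda>U. sg (n * word_deg e U) * \<psi> U V)" by (rule kills_sh_sg[OF l])
    moreover have "kills_sh (\<lambda>U. sg (word_deg e V * word_deg e U) * (sg (n * word_deg e V) * \<psi> V U))"
      by (rule kills_sh_sg[OF kills_sh_mult[OF r]])
    ultimately show ?thesis
      unfolding kills_sh_def \<theta>_def by (simp add: sh_diff sg_add mult.commute mult.left_commute)
  qed
  have kr: "kills_sh (\<lambda>V. \<theta> U V)" for U
  proof -
    have "kills_sh (\<lambda>V. sg (n * word_deg e U) * \<psi> U V)" by (rule kills_sh_mult[OF r])
    moreover have "kills_sh (\<lambda>V. sg ((word_deg e U + n) * word_deg e V) * \<psi> V U)"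
      by (rule kills_sh_sg[OF l])
    ultimately show ?thesis
      unfolding kills_sh_def \<theta>_def by (simp add: sh_diff distrib_right)
  qed
  have "Br (co n \<psi>) X Y = sg n * Br (dc \<theta>) X Y"
    unfolding co_def \<theta>_def by (simp only: br_mult)
  also have "Br (dc \<theta>) X Y = dc (\<lambda>Y1 Y2. Br (\<lambda>A. \<theta> A Y2) X Y1 + sg ((word_deg e X + c) * word_deg e Y1) * Br (\<theta> Y1) X Y2) Y
    + dc (\<lambda>X1 X2. sg (word_deg e X2 * word_deg e Y) * Br (\<lambda>A. \<theta> A X2) X1 Y + sg (c * word_deg e X1) * Br (\<theta> X1) X2 Y) X"
    by (rule br_dc_kill[OF kl kr]) (simp_all add: \<theta>_def Nil)
  finally have F: "Br (co n \<psi>) X Y = sg n * (dc (\<lambda>Y1 Y2. Br (\<lambda>A. \<theta> A Y2) X Y1 + sg ((word_deg e X + c) * word_deg e Y1) * Br (\<theta> Y1) X Y2) Y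
    + dc (\<lambda>X1 X2. sg (word_deg e X2 * word_deg e Y) * Br (\<lambda>A. \<theta> A X2) X1 Y + sg (c * word_deg e X1) * Br (\<theta> X1) X2 Y) X)" .
  show ?thesis unfolding F
    by (simp add: co_def \<theta>_def c cps cong: cps_congs dc_deg_cong)
qed

end

text \<open>Clipping a functional discards the words that are not generators.\<close>

definition clip :: "'l set \<Rightarrow> ('l list \<Rightarrow> 'k::field) \<Rightarrow> 'l list \<Rightarrow> 'k" where
  "clip L \<psi> W = (if W \<noteq> [] \<and> set W \<subseteq> L then \<psi> W else 0)"

definition clip2 :: "'l set \<Rightarrow> ('l list \<Rightarrow> 'l list \<Rightarrow> 'k::field) \<Rightarrow> 'l list \<Rightarrow> 'l list \<Rightarrow> 'k" where
  "clip2 L \<psi> U V = (if U \<noteq> [] \<and> set U \<subseteq> L \<and> V \<noteq> [] \<and> set V \<subseteq> L then \<psi> U V else 0)"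

lemma clip2_right: "clip2 L \<theta> U = (if U \<noteq> [] \<and> set U \<subseteq> L then clip L (\<theta> U) else (\<lambda>V. 0))"
  by (auto simp: clip_def clip2_def fun_eq_iff)

lemma clip2_left: "(\<lambda>U. clip2 L \<theta> U V) = (if V \<noteq> [] \<and> set V \<subseteq> L then clip L (\<lambda>U. \<theta> U V) else (\<lambda>U. 0))"
  by (auto simp: clip_def clip2_def fun_eq_iff)

lemma ev_delta: "ev (\<lambda>h. if h = g then 1 else 0) p = Poly_Mapping.lookup p g"
  by (auto simp: ev_def in_keys_iff if_distrib cong: if_cong)

text \<open>Keys are detected by evaluation at an indicator, so supports and degrees of an operation
  can be read off its transpose.\<close>

lemma in_keys_ev: "g \<in> Poly_Mapping.keys p \<Longrightarrow> ev (\<lambda>h. if h = g then 1 else 0) p \<noteq> 0"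
  by (simp add: ev_delta in_keys_iff)

lemma in_keys_ev2: "(u, v) \<in> Poly_Mapping.keys p \<Longrightarrow> ev2 (\<lambda>a b. if a = u \<and> b = v then 1 else 0) p \<noteq> 0"
  using in_keys_ev[of "(u, v)" p] by (simp add: ev2_def case_prod_unfold prod_eq_iff)

text \<open>\<open>L\<close> is the set of genuine letters. As the operations vanish elsewhere, the
  letter axioms can hold for all symbols of the type.\<close>

locale letters_support = letters +
  fixes L :: "'a set"
  assumes dl_L: "x \<notin> L \<Longrightarrow> dl x = 0"
    and mu_L: "x \<notin> L \<or> y \<notin> L \<Longrightarrow> mu x y = 0"
    and el_L: "x \<notin> L \<or> y \<notin> L \<Longrightarrow> el x y = 0"
begin

text \<open>A letter outside \<open>L\<close> either survives in the result, where the clipped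
  functional is 0, or is consumed by \<open>dl\<close> or \<open>mu\<close>, which are 0
  there.\<close>

lemma Dw_clip: "clip L (Dw (clip L \<psi>)) = Dw (clip L \<psi>)"
proof
  fix X
  have "Dw \<phi> X = 0" if "\<not> set X \<subseteq> L" "\<And>W. \<not> set W \<subseteq> L \<Longrightarrow> \<phi> W = 0" for \<phi>
    using that
  proof (induction X arbitrary: \<phi>)
    case (Cons x X)
    show ?case
    proof (cases "x \<in> L")
      case True
      then have X: "\<not> set X \<subseteq> L" using Cons.prems by auto
      then have 1: "Dw (\<lambda>W. \<phi> (x # W)) X = 0" by (intro Cons.IH Cons.prems(2)) simp_all
      have 2: "\<phi> (z # X) = 0" for z by (rule Cons.prems(2)) (use X in simp)
      have 3: "head_mul mu \<phi> x X = 0"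
      proof (cases X)
        case (Cons y Y)
        show ?thesis
        proof (cases "y \<in> L")
          case True
          then have "\<phi> (z # Y) = 0" for z by (intro Cons.prems(2)) (use X Cons in simp)
          then show ?thesis by (simp add: Cons)
        qed (simp add: Cons mu_L)
      qed simp
      show ?thesis by (simp add: 1 2 3)
    next
      case False
      have "(\<lambda>W. \<phi> (x # W)) = (\<lambda>W. 0)" by (rule ext, rule Cons.prems(2)) (use False in simp)
      moreover have "head_mul mu \<phi> x X = 0" using False by (cases X) (simp_all add: mu_L)
      ultimately show ?thesis by (simp add: dl_L False)
    qed
  qed simp
  from this[of "clip L \<psi>"] show "clip L (Dw (clip L \<psi>)) X = Dw (clip L \<psi>) X"
    by (auto simp: clip_def)
qed

lemma Br_invalid: "\<not> (set X \<subseteq> L \<and> set Y \<subseteq> L) \<Longrightarrow> Br (clip L \<psi>) X Y = 0"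
proof -
  have "Br \<phi> X Y = 0" if "\<not> (set X \<subseteq> L \<and> set Y \<subseteq> L)" "\<And>W. \<not> set W \<subseteq> L \<Longrightarrow> \<phi> W = 0" for \<phi> X Y
    using that
  proof (induction "length X + length Y" arbitrary: X Y \<phi> rule: less_induct)
    case less
    show ?case
    proof (cases "X = [] \<or> Y = []")
      case False
      then obtain x X' y Y' where *: "X = x # X'" "Y = y # Y'" by (meson list.exhaust)
      have 1: "Br (\<lambda>W. \<phi> (x # W)) X' Y = 0"
      proof (cases "x \<in> L")
        case True
        then show ?thesis using less.prems * by (intro less.hyps) auto
      next
        case False
        then have "(\<lambda>W. \<phi> (x # W)) = (\<lambda>W. 0)" by (intro ext less.prems(2)) simp
        then show ?thesis by simp
      qed
      have 2: "Br (\<lambda>W. \<phi> (y # W)) X Y' = 0"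
      proof (cases "y \<in> L")
        case True
        then show ?thesis using less.prems * by (intro less.hyps) auto
      next
        case False
        then have "(\<lambda>W. \<phi> (y # W)) = (\<lambda>W. 0)" by (intro ext less.prems(2)) simp
        then show ?thesis by simp
      qed
      have 3: "ev (\<lambda>z. Sh (\<lambda>W. \<phi> (z # W)) X' Y') (el x y) = 0"
      proof (cases "x \<in> L \<and> y \<in> L")
        case True
        have "Sh (\<lambda>W. \<phi> (z # W)) X' Y' = Sh (\<lambda>W. 0) X' Y'" for z
          by (rule sh_cong) (use True less.prems * in auto)
        then show ?thesis by simp
      qed (auto simp: el_L)
      show ?thesis using 1 2 3 by (simp add: *)
    qed auto
  qed
  then show "\<not> (set X \<subseteq> L \<and> set Y \<subseteq> L) \<Longrightarrow> Br (clip L \<psi>) X Y = 0" by (auto simp: clip_def)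
qed

lemma co_invalid: "X = [] \<or> \<not> set X \<subseteq> L \<Longrightarrow> co n (clip2 L \<theta>) X = 0"
proof -
  assume X: "X = [] \<or> \<not> set X \<subseteq> L"
  have "co n (clip2 L \<theta>) X = co n (\<lambda>U V. 0) X"
    by (rule co_cong) (use X in \<open>auto simp: clip2_def\<close>)
  then show ?thesis by (simp add: co_def)
qed

end

text \<open>\<open>Dg\<close>, \<open>Bg\<close>, \<open>cg\<close> and the relations of \<H> are
  described by evaluation only, so their definitions by explicit sums play no part in this section.
  The sign in \<open>ev_Bg\<close> is the product of those in \<ell>'_2 and \<ell>''_2: modulo 2
  their exponents add up to n x + 1.\<close>

locale letters_space = letters_support +
  fixes n :: int
    and Dg :: "'a list \<Rightarrow> ('a list \<Rightarrow>\<^sub>0 'b)"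
    and Bg :: "'a list \<Rightarrow> 'a list \<Rightarrow> ('a list \<Rightarrow>\<^sub>0 'b)"
    and cg :: "'a list \<Rightarrow> ('a list \<times> 'a list \<Rightarrow>\<^sub>0 'b)"
    and RH :: "('a list \<Rightarrow>\<^sub>0 'b) set"
  assumes c: "c = 1 - n"
    and ev_Dg: "ev \<psi> (Dg X) = wD e dl mu (clip L \<psi>) X"
    and ev_Bg: "ev \<psi> (Bg X Y) = - (sg (n * word_deg e X) * br e c el (clip L \<psi>) X Y)"
    and ev2_cg: "ev2 \<theta> (cg X) = letters.co e n (clip2 L \<theta>) X"
    and RH_iff: "(\<forall>r\<in>RH. ev \<psi> r = 0) \<longleftrightarrow> letters.kills_words R (clip L \<psi>) \<and> letters.kills_sh e (clip L \<psi>)"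
    and RH_hom: "r \<in> RH \<Longrightarrow> \<exists>m. \<forall>z\<in>Poly_Mapping.keys r. word_deg e z - n = m"
begin

lemma sg_c: "sg c = - sg n" "sg (c * k) = sg k * sg (n * k)" "sg (k * c) = sg k * sg (n * k)"
  using sg_add[of 1 n] sg_add[of k "- (n * k)"] by (simp_all add: c sg_diff left_diff_distrib right_diff_distrib mult.commute)

lemma Br_clip_left: "clip L (\<lambda>X. k X * Br (clip L \<psi>) X Y) = (\<lambda>X. k X * Br (clip L \<psi>) X Y)"
  using Br_invalid by (fastforce simp: clip_def fun_eq_iff)

lemma Br_clip_right: "clip L (\<lambda>Y. k Y * Br (clip L \<psi>) X Y) = (\<lambda>Y. k Y * Br (clip L \<psi>) X Y)"
  using Br_invalid by (fastforce simp: clip_def fun_eq_iff)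

lemma co_clip: "clip L (co n (clip2 L \<theta>)) = co n (clip2 L \<theta>)"
  using co_invalid by (auto simp: clip_def fun_eq_iff)

lemma kills_clip:
  assumes "\<And>r. r \<in> RH \<Longrightarrow> ev \<psi> r = 0"
  shows "kills_words (clip L \<psi>)" "kills_sh (clip L \<psi>)"
  using assms RH_iff[of \<psi>] by blast+

lemma ev_RH:
  assumes "clip L F = F" "kills_words F" "kills_sh F" "r \<in> RH" shows "ev F r = 0"
  using assms RH_iff[of F] by simp

lemma kills_clip2:
  assumes l: "\<And>r v. r \<in> RH \<Longrightarrow> ev (\<lambda>u. \<theta> u v) r = 0" and r: "\<And>r u. r \<in> RH \<Longrightarrow> ev (\<theta> u) r = 0"
  shows "kills_words (\<lambda>U. clip2 L \<theta> U V)" "kills_sh (\<lambda>U. clip2 L \<theta> U V)"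
    "kills_words (clip2 L \<theta> U)" "kills_sh (clip2 L \<theta> U)"
proof -
  have z: "kills_words (\<lambda>V. 0)" "kills_sh (\<lambda>V. 0)" by (simp_all add: kills_words_def kills_sh_def)
  show "kills_words (clip2 L \<theta> U)" "kills_sh (clip2 L \<theta> U)"
    unfolding clip2_right using z kills_clip[OF r] by simp_all
  show "kills_words (\<lambda>U. clip2 L \<theta> U V)" "kills_sh (\<lambda>U. clip2 L \<theta> U V)"
    unfolding clip2_left using z kills_clip[of "\<lambda>u. \<theta> u V", OF l] by simp_all
qed

lemma clip_ev_Dg: "clip L (\<lambda>z. ev \<psi> (Dg z)) = Dw (clip L \<psi>)"
  by (simp add: ev_Dg Dw_clip)

lemma clip_ev_Bg:
  "clip L (\<lambda>z. ev \<psi> (Bg z Y)) = (\<lambda>X. - (sg (n * word_deg e X) * Br (clip L \<psi>) X Y))"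
  "clip L (\<lambda>z. ev \<psi> (Bg X z)) = (\<lambda>Y. - (sg (n * word_deg e X) * Br (clip L \<psi>) X Y))"
  using Br_clip_left[of "\<lambda>X. - sg (n * word_deg e X)" \<psi> Y] Br_clip_right[of "\<lambda>Y. - sg (n * word_deg e X)" \<psi> X]
  by (simp_all add: ev_Bg)

lemma clip_ev2_cg: "clip L (\<lambda>z. ev2 \<theta> (cg z)) = co n (clip2 L \<theta>)"
  by (simp add: ev2_cg co_clip)

lemma is_dg_lie_bialgebra: "dg_lie_bialgebra (\<lambda>X. word_deg e X - n) n Dg Bg cg RH"
proof
  fix z x assume "z \<in> Poly_Mapping.keys (Dg x)"
  \<comment> \<open>If \<open>z\<close> had another degree, its indicator would vanish on all words
    that \<open>Dw\<close> hands to the functional.\<close>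
  from in_keys_ev[OF this] have nz: "Dw (clip L (\<lambda>h. if h = z then 1 else 0)) x \<noteq> 0" by (simp add: ev_Dg)
  show "word_deg e z - n = word_deg e x - n + 1"
  proof (rule ccontr)
    assume "\<not> ?thesis"
    then have "Dw (clip L (\<lambda>h. if h = z then 1 else 0)) x = Dw (\<lambda>W. 0) x"
      by (intro Dw_cong) (auto simp: clip_def)
    then show False using nz by simp
  qed
next
  fix z x y assume "z \<in> Poly_Mapping.keys (Bg x y)"
  from in_keys_ev[OF this] have nz: "Br (clip L (\<lambda>h. if h = z then 1 else 0)) x y \<noteq> 0" by (auto simp: ev_Bg)
  show "word_deg e z - n = word_deg e x - n + (word_deg e y - n) + 1"
  proof (rule ccontr)
    assume "\<not> ?thesis"
    then have "Br (clip L (\<lambda>h. if h = z then 1 else 0)) x y = Br (\<lambda>W. 0) x y"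
      by (intro Br_cong) (auto simp: clip_def c)
    then show False using nz by simp
  qed
next
  fix u v x assume "(u, v) \<in> Poly_Mapping.keys (cg x)"
  from in_keys_ev2[OF this] have nz: "co n (clip2 L (\<lambda>a b. if a = u \<and> b = v then 1 else 0)) x \<noteq> 0"
    by (simp add: ev2_cg)
  show "word_deg e v - n = word_deg e x - n - n - (word_deg e u - n)"
  proof (rule ccontr)
    assume "\<not> ?thesis"
    then have "co n (clip2 L (\<lambda>a b. if a = u \<and> b = v then 1 else 0)) x = co n (\<lambda>U V. 0) x"
      by (intro co_cong) (auto simp: clip2_def)
    then show False using nz by (simp add: co_def)
  qed
next
  fix r assume "r \<in> RH"
  then show "\<exists>m. \<forall>z\<in>Poly_Mapping.keys r. word_deg e z - n = m" by (rule RH_hom)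
next
  fix \<psi> r assume k: "\<And>r. r \<in> RH \<Longrightarrow> ev \<psi> r = 0" and r: "r \<in> RH"
  show "ev (\<lambda>x. ev \<psi> (Dg x)) r = 0"
    unfolding ev_Dg using kills_clip[OF k] r
    by (intro ev_RH Dw_clip kills_words_D kills_sh_D)
next
  fix \<psi> r y assume k: "\<And>r. r \<in> RH \<Longrightarrow> ev \<psi> r = 0" and r: "r \<in> RH"
  have "ev (\<lambda>x. sg (n * word_deg e x) * (- 1 * Br (clip L \<psi>) x y)) r = 0"
    using kills_clip[OF k] r
    by (intro ev_RH kills_words_sg kills_sh_sg kills_words_mult kills_sh_mult kills_words_Br_left kills_sh_Br_left)
      (use Br_clip_left[of "\<lambda>X. - sg (n * word_deg e X)" \<psi> y] in simp_all)
  then show "ev (\<lambda>x. ev \<psi> (Bg x y)) r = 0" by (simp add: ev_Bg)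
next
  fix \<theta> r assume l: "\<And>r v. r \<in> RH \<Longrightarrow> ev (\<lambda>u. \<theta> u v) r = 0" and r: "\<And>r u. r \<in> RH \<Longrightarrow> ev (\<theta> u) r = 0"
    and "r \<in> RH"
  then show "ev (\<lambda>x. ev2 \<theta> (cg x)) r = 0"
    unfolding ev2_cg
    by (intro ev_RH co_clip co_kills_words co_sh kills_clip2[OF l r]) (simp_all add: clip2_def)
next
  fix \<psi> x y assume k: "\<And>r. r \<in> RH \<Longrightarrow> ev \<psi> r = 0"
  show "ev \<psi> (Bg x y) = sg ((word_deg e x - n) * (word_deg e y - n)) * ev \<psi> (Bg y x)"
    using Br_skew[OF kills_clip(1)[OF k], of x y] by (simp add: ev_Bg sg_c sg_simps algebra_simps)
next
  fix \<psi> x assume k: "\<And>r. r \<in> RH \<Longrightarrow> ev \<psi> r = 0"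
  show "ev (\<lambda>z. ev \<psi> (Dg z)) (Dg x) = 0"
    unfolding ev_Dg[of "\<lambda>z. ev \<psi> (Dg z)"] clip_ev_Dg by (rule D_D[OF kills_clip(1)[OF k]])
next
  fix \<psi> x y assume k: "\<And>r. r \<in> RH \<Longrightarrow> ev \<psi> r = 0"
  note k = kills_clip(1)[OF k]
  \<comment> \<open>The target identity has the fixed word in the first argument of the bracket,
    while \<open>D_br\<close> also yields it in the second. The shift by 1 in the sign is the degree
    of \<open>D\<close>.\<close>
  have sk: "Dw (\<lambda>U. Br (clip L \<psi>) U y) x = - (sg (c + (word_deg e x + 1) * word_deg e y) * Dw (\<lambda>U. Br (clip L \<psi>) y U) x)"
  proof -
    have "Dw (\<lambda>U. Br (clip L \<psi>) U y) x = Dw (\<lambda>U. - (sg (c + (word_deg e x + 1) * word_deg e y) * Br (clip L \<psi>) y U)) x"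
      by (rule Dw_cong) (simp add: Br_skew[OF k, of _ y])
    then show ?thesis by (simp add: wD_lins)
  qed
  show "ev (\<lambda>z. ev \<psi> (Dg z)) (Bg x y) = - (sg (word_deg e x - n) * ev (\<lambda>z. ev \<psi> (Bg x z)) (Dg y)
       + sg ((word_deg e y - n) * (word_deg e x - n + 1)) * ev (\<lambda>z. ev \<psi> (Bg y z)) (Dg x))"
    unfolding ev_Bg[of "\<lambda>z. ev \<psi> (Dg z)"] ev_Dg[of "\<lambda>z. ev \<psi> (Bg x z)"] ev_Dg[of "\<lambda>z. ev \<psi> (Bg y z)"]
      clip_ev_Dg clip_ev_Bg
    by (simp only: D_br[OF k, of x y] sk) (simp add: sg_c wD_lins sg_simps algebra_simps)
next
  fix \<psi> x y z assume k: "\<And>r. r \<in> RH \<Longrightarrow> ev \<psi> r = 0"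
  note k = kills_clip(1)[OF k]
  \<comment> \<open>The sign depends on the inner bracket \<open>W\<close> only through its degree,
    which is fixed by homogeneity, so it can leave the outer bracket.\<close>
  have 1: "Br (\<lambda>W. - (sg (n * word_deg e W) * Br (clip L \<psi>) W z)) x y
    = - (sg (n * (word_deg e x + word_deg e y + c)) * Br (\<lambda>W. Br (clip L \<psi>) W z) x y)"
  proof -
    have "Br (\<lambda>W. - (sg (n * word_deg e W) * Br (clip L \<psi>) W z)) x y
      = Br (\<lambda>W. - (sg (n * (word_deg e x + word_deg e y + c)) * Br (clip L \<psi>) W z)) x y"
      by (rule Br_cong) simp
    then show ?thesis by (simp add: br_lins)
  qed
  show "ev (\<lambda>w. ev \<psi> (Bg w z)) (Bg x y) = - (sg (word_deg e x - n) * ev (\<lambda>w. ev \<psi> (Bg x w)) (Bg y z)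
       + sg ((word_deg e y - n) * (word_deg e x - n + 1)) * ev (\<lambda>w. ev \<psi> (Bg y w)) (Bg x z))"
    unfolding ev_Bg[of "\<lambda>w. ev \<psi> (Bg w z)"] ev_Bg[of "\<lambda>w. ev \<psi> (Bg x w)"] ev_Bg[of "\<lambda>w. ev \<psi> (Bg y w)"]
      clip_ev_Bg 1
    by (simp only: br_uminus br_mult Br_jacobi[OF k, of x y z]) (simp add: sg_c sg_simps algebra_simps)
next
  fix \<theta> :: "'a list \<Rightarrow> 'a list \<Rightarrow> 'b" and x
  have "clip2 L (\<lambda>u v. sg ((word_deg e u - n) * (word_deg e v - n)) * \<theta> v u)
    = (\<lambda>u v. sg ((word_deg e u - n) * (word_deg e v - n)) * clip2 L \<theta> v u)"
    by (auto simp: clip2_def fun_eq_iff)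
  then show "ev2 (\<lambda>u v. sg ((word_deg e u - n) * (word_deg e v - n)) * \<theta> v u) (cg x) = - (sg n * ev2 \<theta> (cg x))"
    unfolding ev2_cg by (simp only: co_swap)
next
  fix \<Theta> :: "'a list \<Rightarrow> 'a list \<Rightarrow> 'a list \<Rightarrow> 'b" and x
  \<comment> \<open>Evaluating \<open>cg\<close> twice clips the functional in stages;
    \<open>T\<close> has all three variables clipped at once, which is symmetric and lets
    \<open>co_jacobi\<close> apply.\<close>
  define T where "T = (\<lambda>A B C. if set A \<subseteq> L \<and> set B \<subseteq> L \<and> set C \<subseteq> L \<and> A \<noteq> [] \<and> B \<noteq> [] \<and> C \<noteq> [] then \<Theta> A B C else (0::'b))"
  have 1: "ev2 (\<lambda>u v. ev2 (\<lambda>u1 u2. F u1 u2 v) (cg u)) (cg x)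
    = co n (\<lambda>u v. co n (\<lambda>u1 u2. if set u1 \<subseteq> L \<and> set u2 \<subseteq> L \<and> set v \<subseteq> L \<and> u1 \<noteq> [] \<and> u2 \<noteq> [] \<and> v \<noteq> [] then F u1 u2 v else 0) u) x" for F
    unfolding ev2_cg
  proof (rule co_cong)
    fix U V
    have "co n (clip2 L (\<lambda>u1 u2. F u1 u2 V)) U = 0" if "U = [] \<or> \<not> set U \<subseteq> L"
      using that by (rule co_invalid)
    moreover have "co n (\<lambda>u1 u2. if set u1 \<subseteq> L \<and> set u2 \<subseteq> L \<and> set V \<subseteq> L \<and> u1 \<noteq> [] \<and> u2 \<noteq> [] \<and> V \<noteq> [] then F u1 u2 V else 0) U
      = (if V \<noteq> [] \<and> set V \<subseteq> L then co n (clip2 L (\<lambda>u1 u2. F u1 u2 V)) U else co n (\<lambda>U V. 0) U)"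
      by (auto simp: clip2_def intro!: co_cong)
    ultimately show "clip2 L (\<lambda>u v. co n (clip2 L (\<lambda>u1 u2. F u1 u2 v)) u) U V
      = co n (\<lambda>u1 u2. if set u1 \<subseteq> L \<and> set u2 \<subseteq> L \<and> set V \<subseteq> L \<and> u1 \<noteq> [] \<and> u2 \<noteq> [] \<and> V \<noteq> [] then F u1 u2 V else 0) U"
      by (auto simp: clip2_def co_def)
  qed
  have 2: "(if set u1 \<subseteq> L \<and> set u2 \<subseteq> L \<and> set v \<subseteq> L \<and> u1 \<noteq> [] \<and> u2 \<noteq> [] \<and> v \<noteq> [] then k * \<Theta> v u1 u2 else 0) = k * T v u1 u2"
    "(if set u1 \<subseteq> L \<and> set u2 \<subseteq> L \<and> set v \<subseteq> L \<and> u1 \<noteq> [] \<and> u2 \<noteq> [] \<and> v \<noteq> [] then k * \<Theta> u2 v u1 else 0) = k * T u2 v u1"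
    "(if set u1 \<subseteq> L \<and> set u2 \<subseteq> L \<and> set v \<subseteq> L \<and> u1 \<noteq> [] \<and> u2 \<noteq> [] \<and> v \<noteq> [] then \<Theta> u1 u2 v else 0) = T u1 u2 v" for u1 u2 v k
    by (auto simp: T_def)
  show "ev2 (\<lambda>u v. ev2 (\<lambda>u1 u2. \<Theta> u1 u2 v) (cg u)) (cg x)
      + ev2 (\<lambda>u v. ev2 (\<lambda>u1 u2. sg ((word_deg e v - n) * (word_deg e u1 - n + (word_deg e u2 - n))) * \<Theta> v u1 u2) (cg u)) (cg x)
      + ev2 (\<lambda>u v. ev2 (\<lambda>u1 u2. sg ((word_deg e u1 - n) * (word_deg e u2 - n + (word_deg e v - n))) * \<Theta> u2 v u1) (cg u)) (cg x) = 0"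
    unfolding 1[of \<Theta>] 1[of "\<lambda>u1 u2 v. sg ((word_deg e v - n) * (word_deg e u1 - n + (word_deg e u2 - n))) * \<Theta> v u1 u2"]
      1[of "\<lambda>u1 u2 v. sg ((word_deg e u1 - n) * (word_deg e u2 - n + (word_deg e v - n))) * \<Theta> u2 v u1"] 2
    by (rule co_jacobi)
next
  fix \<theta> :: "'a list \<Rightarrow> 'a list \<Rightarrow> 'b" and x
  have "clip2 L (\<lambda>u v. ev (\<lambda>z. \<theta> z v) (Dg u) + sg (word_deg e u - n) * ev (\<theta> u) (Dg v))
    = (\<lambda>U V. Dw (\<lambda>Z. clip2 L \<theta> Z V) U + sg (word_deg e U - n) * Dw (clip2 L \<theta> U) V)"
  proof (intro ext)
    fix U V
    have Dinv: "Dw (clip L \<psi>) X = 0" if "X = [] \<or> \<not> set X \<subseteq> L" for \<psi> X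
      using Dw_clip[of \<psi>] that by (auto simp: clip_def fun_eq_iff split: if_splits)
    show "clip2 L (\<lambda>u v. ev (\<lambda>z. \<theta> z v) (Dg u) + sg (word_deg e u - n) * ev (\<theta> u) (Dg v)) U V
      = Dw (\<lambda>Z. clip2 L \<theta> Z V) U + sg (word_deg e U - n) * Dw (clip2 L \<theta> U) V"
      unfolding clip2_left clip2_right[of L \<theta> U] ev_Dg
      by (simp add: clip2_def Dinv)
  qed
  then show "ev (\<lambda>z. ev2 \<theta> (cg z)) (Dg x) = sg n * ev2 (\<lambda>u v. ev (\<lambda>z. \<theta> z v) (Dg u)
      + sg (word_deg e u - n) * ev (\<theta> u) (Dg v)) (cg x)"
    unfolding ev2_cg[of "\<lambda>u v. ev (\<lambda>z. \<theta> z v) (Dg u) + sg (word_deg e u - n) * ev (\<theta> u) (Dg v)"]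
      ev_Dg[of "\<lambda>z. ev2 \<theta> (cg z)"] clip_ev2_cg
    by (simp only: co_D)
next
  fix \<theta> x y assume l: "\<And>r v. r \<in> RH \<Longrightarrow> ev (\<lambda>u. \<theta> u v) r = 0" and r: "\<And>r u. r \<in> RH \<Longrightarrow> ev (\<theta> u) r = 0"
  let ?\<psi> = "clip2 L \<theta>"
  have B1: "Br (\<lambda>z. ?\<psi> z v) a b = (if v \<noteq> [] \<and> set v \<subseteq> L then Br (clip L (\<lambda>z. \<theta> z v)) a b else 0)" for a b v
    unfolding clip2_left by simp
  have B2: "Br (?\<psi> u) a b = (if u \<noteq> [] \<and> set u \<subseteq> L then Br (clip L (\<theta> u)) a b else 0)" for a b u
    unfolding clip2_right by simp
  have 1: "clip2 L (\<lambda>u v. ev (\<lambda>z. \<theta> z v) (Bg x u) + sg ((word_deg e x - n + 1) * (word_deg e u - n)) * ev (\<theta> u) (Bg x v))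
    = (\<lambda>u v. - (sg (n * word_deg e x) * Br (\<lambda>z. ?\<psi> z v) x u + sg ((word_deg e x - n + 1) * (word_deg e u - n)) * (sg (n * word_deg e x) * Br (?\<psi> u) x v)))"
    by (intro ext, subst clip2_def) (auto simp: B1 B2 ev_Bg Br_invalid algebra_simps)
  have 2: "clip2 L (\<lambda>u v. sg ((word_deg e v - n) * (word_deg e y - n)) * ev (\<lambda>z. \<theta> z v) (Bg u y)
          + sg (word_deg e u - n) * ev (\<theta> u) (Bg v y))
    = (\<lambda>u v. - (sg ((word_deg e v - n) * (word_deg e y - n)) * (sg (n * word_deg e u) * Br (\<lambda>z. ?\<psi> z v) u y)
          + sg (word_deg e u - n) * (sg (n * word_deg e v) * Br (?\<psi> u) v y)))"
    by (intro ext, subst clip2_def) (auto simp: B1 B2 ev_Bg Br_invalid algebra_simps)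
  have m: "co n (\<lambda>u v. - F u v) X = - co n F X" for F X
    using co_mult[of n "-1" F X] by simp
  have "sg (n * word_deg e x) * Br (co n ?\<psi>) x y =
     sg (n * (word_deg e x - n + 1)) * co n (\<lambda>u v. sg (n * word_deg e x) * Br (\<lambda>z. ?\<psi> z v) x u
          + sg ((word_deg e x - n + 1) * (word_deg e u - n)) * (sg (n * word_deg e x) * Br (?\<psi> u) x v)) y
        + sg n * co n (\<lambda>u v. sg ((word_deg e v - n) * (word_deg e y - n)) * (sg (n * word_deg e u) * Br (\<lambda>z. ?\<psi> z v) u y)
          + sg (word_deg e u - n) * (sg (n * word_deg e v) * Br (?\<psi> u) v y)) x"
    by (rule co_br) (use kills_clip2[OF l r] c in \<open>simp_all add: clip2_def\<close>)
  then show "ev (\<lambda>z. ev2 \<theta> (cg z)) (Bg x y) =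
        sg (n * (word_deg e x - n + 1)) * ev2 (\<lambda>u v. ev (\<lambda>z. \<theta> z v) (Bg x u)
          + sg ((word_deg e x - n + 1) * (word_deg e u - n)) * ev (\<theta> u) (Bg x v)) (cg y)
        + sg n * ev2 (\<lambda>u v. sg ((word_deg e v - n) * (word_deg e y - n)) * ev (\<lambda>z. \<theta> z v) (Bg u y)
          + sg (word_deg e u - n) * ev (\<theta> u) (Bg v y)) (cg x)"
    unfolding ev2_cg[of "\<lambda>u v. ev (\<lambda>z. \<theta> z v) (Bg x u) + sg ((word_deg e x - n + 1) * (word_deg e u - n)) * ev (\<theta> u) (Bg x v)"]
      ev2_cg[of "\<lambda>u v. sg ((word_deg e v - n) * (word_deg e y - n)) * ev (\<lambda>z. \<theta> z v) (Bg u y)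
          + sg (word_deg e u - n) * ev (\<theta> u) (Bg v y)"]
      ev_Bg[of "\<lambda>z. ev2 \<theta> (cg z)"] clip_ev2_cg 1 2 m by simp
qed

end

section \<open>Koszul signs computed by removing one index\<close>

lemma koszul_Cons: "koszul f (k # js) = sg (f k * (\<Sum>j\<leftarrow>filter (\<lambda>j. j < k) js. f j)) * koszul f js"
proof -
  let ?P = "\<lambda>js. {(r, s). r < s \<and> s < length js \<and> js ! s < js ! r \<and> odd (f (js ! r)) \<and> odd (f (js ! s))}"
  let ?Q = "\<lambda>j. j < k \<and> odd (f k) \<and> odd (f j)"
  have fin: "finite (?P js)" for js
    by (rule finite_subset[of _ "{..<length js} \<times> {..<length js}"]) auto
  \<comment> \<open>Inversions either pair the new head with a later entry or are inversions of
    \<open>js\<close> shifted by one position.\<close>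
  have "?P (k # js) = (\<lambda>s. (0, Suc s)) ` {s. s < length js \<and> ?Q (js ! s)} \<union> (\<lambda>(r, s). (Suc r, Suc s)) ` ?P js" (is "?L = ?R")
  proof (intro equalityI subsetI)
    fix p assume "p \<in> ?L"
    then obtain r s where p: "p = (r, s)" "r < s" "s < length (k # js)" "(k # js) ! s < (k # js) ! r"
      "odd (f ((k # js) ! r))" "odd (f ((k # js) ! s))" by auto
    then obtain s' where "s = Suc s'" by (cases s) auto
    with p show "p \<in> ?R" by (cases r) (auto simp: image_iff)
  qed auto
  moreover have "card ?R = card {s. s < length js \<and> ?Q (js ! s)} + card (?P js)"
    by (subst card_Un_disjoint) (auto simp: fin card_image inj_on_def)
  ultimately have "card (?P (k # js)) = length (filter ?Q js) + card (?P js)"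
    by (simp add: length_filter_conv_card)
  moreover have "(-1) ^ length (filter ?Q js) = (sg (f k * (\<Sum>j\<leftarrow>filter (\<lambda>j. j < k) js. f j)) :: 'a)"
    by (induction js) (auto simp: sg_alt)
  ultimately show ?thesis by (simp add: koszul_def power_add)
qed

lemma koszul_Nil: "koszul f [] = 1"
  by (simp add: koszul_def)

lemma koszul_Cons_min: "(\<And>j. j \<in> set js \<Longrightarrow> k < j) \<Longrightarrow> koszul f (k # js) = koszul f js"
proof -
  assume "\<And>j. j \<in> set js \<Longrightarrow> k < j"
  then have "filter (\<lambda>j. j < k) js = []" by (force simp: filter_empty_conv)
  then show ?thesis by (simp add: koszul_Cons)
qed

text \<open>The smallest index forms an inversion with each entry of \<open>p\<close> and with no
  entry of \<open>r\<close>. The recursions below therefore always remove the smallest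
  index.\<close>

lemma koszul_insert_min:
  assumes "\<And>j. j \<in> set (p @ r) \<Longrightarrow> k < j"
  shows "koszul f (p @ k # r) = sg (f k * sum_list (map f p)) * (koszul f (p @ r) :: 'k::field)"
  using assms
proof (induction p)
  case Nil
  then show ?case by (simp add: koszul_Cons_min)
next
  case (Cons i p)
  have IH: "koszul f (p @ k # r) = sg (f k * sum_list (map f p)) * (koszul f (p @ r) :: 'k)"
    by (rule Cons.IH) (simp add: Cons.prems)
  have "filter (\<lambda>j. j < i) (k # r) = k # filter (\<lambda>j. j < i) r" using Cons.prems[of i] by simp
  then show ?case
    by (simp add: koszul_Cons[of _ i] IH sg_simps algebra_simps)
qed

lemma koszul_strict_sorted: "sorted_wrt (<) js \<Longrightarrow> koszul f js = 1"
  by (induction js) (auto simp: koszul_Nil koszul_Cons_min)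

section \<open>Koszul signs and sums over subsets\<close>

definition parts :: "nat set \<Rightarrow> (nat set \<times> nat set) set" where
  "parts S = {(I, J). I \<union> J = S \<and> I \<inter> J = {}}"

lemma parts_subset: "(I, J) \<in> parts S \<Longrightarrow> I \<subseteq> S \<and> J \<subseteq> S"
  by (auto simp: parts_def)

lemma parts_empty: "parts {} = {({}, {})}"
  by (auto simp: parts_def)

lemma finite_parts: "finite S \<Longrightarrow> finite (parts S)"
  by (rule finite_subset[of _ "Pow S \<times> Pow S"]) (auto simp: parts_def)

lemma sum_parts_insert:
  assumes "finite S" "k \<notin> S"
  shows "(\<Sum>(I, J)\<in>parts (insert k S). F I J)
    = (\<Sum>(I, J)\<in>parts S. F (insert k I) J) + (\<Sum>(I, J)\<in>parts S. F I (insert k J))"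
proof -
  have 1: "parts (insert k S) = (\<lambda>(I, J). (insert k I, J)) ` parts S \<union> (\<lambda>(I, J). (I, insert k J)) ` parts S" (is "?L = ?R")
  proof (intro equalityI subsetI)
    fix p assume "p \<in> ?L"
    then obtain I J where p: "p = (I, J)" "I \<union> J = insert k S" "I \<inter> J = {}" by (auto simp: parts_def)
    show "p \<in> ?R"
    proof (cases "k \<in> I")
      case True
      then have "(I - {k}, J) \<in> parts S" "p = (insert k (I - {k}), J)" using p assms by (auto simp: parts_def)
      then show ?thesis by force
    next
      case False
      then have "(I, J - {k}) \<in> parts S" "p = (I, insert k (J - {k}))" using p assms by (auto simp: parts_def)
      then show ?thesis by force
    qed
  qed (use assms in \<open>auto simp: parts_def\<close>)
  have inj: "inj_on (\<lambda>(I, J). (insert k I, J)) (parts S)" "inj_on (\<lambda>(I, J). (I, insert k J)) (parts S)"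
    using assms(2) by (auto simp: inj_on_def parts_def insert_ident)
  have disj: "(\<lambda>(I, J). (insert k I, J)) ` parts S \<inter> (\<lambda>(I, J). (I, insert k J)) ` parts S = {}"
    using assms(2) by (auto simp: parts_def)
  have "(\<Sum>(I, J)\<in>parts (insert k S). F I J) = (\<Sum>(I, J)\<in>(\<lambda>(I, J). (insert k I, J)) ` parts S. F I J)
    + (\<Sum>(I, J)\<in>(\<lambda>(I, J). (I, insert k J)) ` parts S. F I J)"
    unfolding 1 using finite_parts[OF assms(1)] by (intro sum.union_disjoint disj) auto
  then show ?thesis
    unfolding sum.reindex[OF inj(1)] sum.reindex[OF inj(2)] by (simp add: case_prod_unfold comp_def)
qed

abbreviation "sl \<equiv> sorted_list_of_set"

lemma sl_insert_min: "finite S \<Longrightarrow> (\<And>j. j \<in> S \<Longrightarrow> k < j) \<Longrightarrow> sl (insert k S) = k # sl S"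
  by (subst sorted_list_of_set_insert) (auto intro!: insort_is_Cons simp: less_imp_le)

lemma sl_set: "sorted_wrt (<) ks \<Longrightarrow> sl (set ks) = ks"
  by (simp add: sorted_list_of_set.idem_if_sorted_distinct strict_sorted_iff)

lemma sum_parts_Cons:
  assumes "finite S" "\<And>j. j \<in> S \<Longrightarrow> k < j"
  shows "(\<Sum>(I, J)\<in>parts (insert k S). F (sl I) (sl J))
    = (\<Sum>(I, J)\<in>parts S. F (k # sl I) (sl J)) + (\<Sum>(I, J)\<in>parts S. F (sl I) (k # sl J))"
proof -
  have *: "sl (insert k I) = k # sl I" if "I \<subseteq> S" for I
    using that assms by (intro sl_insert_min) (auto intro: finite_subset)
  have "k \<notin> S" using assms(2) by blast
  show ?thesis
    unfolding sum_parts_insert[OF assms(1) \<open>k \<notin> S\<close>, of "\<lambda>I J. F (sl I) (sl J)"]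
    by (intro arg_cong2[of _ _ _ _ "(+)"] sum.cong) (auto simp: * dest!: parts_subset)
qed

lemma word_deg_map: "word_deg e (map w p) = sum_list (map (\<lambda>i. e (w i)) p)"
  by (simp add: word_deg_def comp_def)

text \<open>The smallest index belongs either to \<open>I\<close>, where it stands first and costs
  no sign, or to \<open>J\<close>, where it has passed all of \<open>I\<close>. These are the two
  branches of \<open>spl\<close>.\<close>

lemma sum_parts_spl:
  fixes \<phi> :: "'g list \<Rightarrow> 'g list \<Rightarrow> 'k::field"
  assumes "sorted_wrt (<) ks"
  shows "(\<Sum>(I, J)\<in>parts (set ks). koszul (\<lambda>i. e (w i)) (sl I @ sl J) * \<phi> (map w (sl I)) (map w (sl J)))
    = spl e \<phi> (map w ks)"
  using assms
proof (induction ks arbitrary: \<phi>)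
  case Nil
  then show ?case by (simp add: parts_empty koszul_Nil)
next
  case (Cons k ks)
  let ?f = "\<lambda>i. e (w i)" let ?kz = "koszul (\<lambda>i. e (w i)) :: nat list \<Rightarrow> 'k"
  have lt: "k < j" if "j \<in> set ks" for j using Cons.prems that by simp
  have sub: "set (sl I) \<subseteq> set ks \<and> set (sl J) \<subseteq> set ks" if "(I, J) \<in> parts (set ks)" for I J
    using parts_subset[OF that] by (metis finite_set finite_subset set_sorted_list_of_set)
  have "(\<Sum>(I, J)\<in>parts (insert k (set ks)). ?kz (sl I @ sl J) * \<phi> (map w (sl I)) (map w (sl J)))
    = (\<Sum>(I, J)\<in>parts (set ks). ?kz ((k # sl I) @ sl J) * \<phi> (map w (k # sl I)) (map w (sl J)))
      + (\<Sum>(I, J)\<in>parts (set ks). ?kz (sl I @ k # sl J) * \<phi> (map w (sl I)) (map w (k # sl J)))"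
    by (rule sum_parts_Cons[where F = "\<lambda>p r. ?kz (p @ r) * \<phi> (map w p) (map w r)"]) (auto simp: lt)
  also have "(\<Sum>(I, J)\<in>parts (set ks). ?kz ((k # sl I) @ sl J) * \<phi> (map w (k # sl I)) (map w (sl J)))
    = spl e (\<lambda>P R. \<phi> (w k # P) R) (map w ks)"
    unfolding Cons.IH[of "\<lambda>P R. \<phi> (w k # P) R", symmetric, OF Cons.prems[unfolded sorted_wrt.simps, THEN conjunct2]]
  proof (intro sum.cong refl, clarify)
    fix I J assume "(I, J) \<in> parts (set ks)"
    from sub[OF this] have "?kz ((k # sl I) @ sl J) = ?kz (sl I @ sl J)"
      by (simp, intro koszul_Cons_min) (auto simp: lt)
    then show "?kz ((k # sl I) @ sl J) * \<phi> (map w (k # sl I)) (map w (sl J))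
      = ?kz (sl I @ sl J) * \<phi> (w k # map w (sl I)) (map w (sl J))" by simp
  qed
  also have "(\<Sum>(I, J)\<in>parts (set ks). ?kz (sl I @ k # sl J) * \<phi> (map w (sl I)) (map w (k # sl J)))
    = spl e (\<lambda>P R. sg (e (w k) * word_deg e P) * \<phi> P (w k # R)) (map w ks)"
    unfolding Cons.IH[of "\<lambda>P R. sg (e (w k) * word_deg e P) * \<phi> P (w k # R)", symmetric, OF Cons.prems[unfolded sorted_wrt.simps, THEN conjunct2]]
  proof (intro sum.cong refl, clarify)
    fix I J assume "(I, J) \<in> parts (set ks)"
    from sub[OF this] have "?kz (sl I @ k # sl J) = sg (e (w k) * word_deg e (map w (sl I))) * ?kz (sl I @ sl J)"
      unfolding word_deg_map by (intro koszul_insert_min) (auto simp: lt)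
    then show "?kz (sl I @ k # sl J) * \<phi> (map w (sl I)) (map w (k # sl J))
      = ?kz (sl I @ sl J) * (sg (e (w k) * word_deg e (map w (sl I))) * \<phi> (map w (sl I)) (w k # map w (sl J)))" by simp
  qed
  finally show ?case by simp
qed

text \<open>The recursion for the explicit sum of \<delta>'' before any symmetry is used:
  \<open>u\<close> remains behind the left factors and \<open>v\<close> before the right ones,
  whereas \<open>del\<close> puts \<open>u\<close> in front. In the sign,
  \<open>e u + e v + n\<close> is the degree of the factor that was split.\<close>

fun dlt :: "('g \<Rightarrow> int) \<Rightarrow> int \<Rightarrow> ('g \<Rightarrow> ('g \<times> 'g \<Rightarrow>\<^sub>0 'k::field)) \<Rightarrow>
    ('g list \<Rightarrow> 'g \<Rightarrow> 'g \<Rightarrow> 'g list \<Rightarrow> 'k) \<Rightarrow> 'g list \<Rightarrow> 'k" where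
  "dlt e n cg \<theta> [] = 0"
| "dlt e n cg \<theta> (x # W) =
     spl e (\<lambda>P R. sg (e x * word_deg e P) * ev2 (\<lambda>u v. sg (n * word_deg e P) * \<theta> P u v R) (cg x)) W
     + dlt e n cg (\<lambda>P u v R. sg (n * e x) * \<theta> (x # P) u v R) W
     + dlt e n cg (\<lambda>P u v R. sg (e x * (word_deg e P + e u + e v + n)) * \<theta> P u v (x # R)) W"

lemma sum_parts_dlt:
  fixes \<theta> :: "'g list \<Rightarrow> 'g \<Rightarrow> 'g \<Rightarrow> 'g list \<Rightarrow> 'k::field"
  assumes deg: "\<And>x u v. (u, v) \<in> Poly_Mapping.keys (cg x) \<Longrightarrow> e v = e x - n - e u" and "sorted_wrt (<) ks"
  shows "(\<Sum>s\<in>set ks. \<Sum>(I, J)\<in>parts (set ks - {s}). koszul (\<lambda>i. e (w i)) (sl I @ s # sl J) *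
      ev2 (\<lambda>u v. sg (n * word_deg e (map w (sl I))) * \<theta> (map w (sl I)) u v (map w (sl J))) (cg (w s)))
    = dlt e n cg \<theta> (map w ks)"
  using assms(2)
proof (induction ks arbitrary: \<theta>)
  case (Cons k ks)
  let ?f = "\<lambda>i. e (w i)" let ?kz = "koszul (\<lambda>i. e (w i)) :: nat list \<Rightarrow> 'k"
  have lt: "k < j" if "j \<in> set ks" for j using Cons.prems that by simp
  have sorted: "sorted_wrt (<) ks" using Cons.prems by simp
  have sub: "set (sl I) \<subseteq> set ks \<and> set (sl J) \<subseteq> set ks" if "(I, J) \<in> parts (set ks - S)" for I J S
    using parts_subset[OF that] by (metis Diff_subset finite_set finite_subset set_sorted_list_of_set subset_trans)
  let ?F = "\<lambda>\<theta> s p r. ?kz (p @ s # r) * ev2 (\<lambda>u v. sg (n * word_deg e (map w p)) * \<theta> (map w p) u v (map w r)) (cg (w s))"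
  have k: "k \<notin> set ks" using lt by blast
  have "(\<Sum>s\<in>set (k # ks). \<Sum>(I, J)\<in>parts (set (k # ks) - {s}). ?F \<theta> s (sl I) (sl J))
    = (\<Sum>(I, J)\<in>parts (set ks). ?F \<theta> k (sl I) (sl J)) + (\<Sum>s\<in>set ks. \<Sum>(I, J)\<in>parts (insert k (set ks - {s})). ?F \<theta> s (sl I) (sl J))"
    using k by (simp add: insert_Diff_if cong: if_cong) (intro sum.cong refl, auto)
  also have "(\<Sum>s\<in>set ks. \<Sum>(I, J)\<in>parts (insert k (set ks - {s})). ?F \<theta> s (sl I) (sl J))
    = (\<Sum>s\<in>set ks. (\<Sum>(I, J)\<in>parts (set ks - {s}). ?F \<theta> s (k # sl I) (sl J)) + (\<Sum>(I, J)\<in>parts (set ks - {s}). ?F \<theta> s (sl I) (k # sl J)))"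
    by (intro sum.cong refl sum_parts_Cons) (auto simp: lt)
  also have "\<dots> = (\<Sum>s\<in>set ks. \<Sum>(I, J)\<in>parts (set ks - {s}). ?F (\<lambda>P u v R. sg (n * e (w k)) * \<theta> (w k # P) u v R) s (sl I) (sl J))
      + (\<Sum>s\<in>set ks. \<Sum>(I, J)\<in>parts (set ks - {s}). ?F (\<lambda>P u v R. sg (e (w k) * (word_deg e P + e u + e v + n)) * \<theta> P u v (w k # R)) s (sl I) (sl J))"
    unfolding sum.distrib
  proof (intro arg_cong2[of _ _ _ _ "(+)"] sum.cong refl; clarify)
    fix s I J assume s: "s \<in> set ks" and IJ: "(I, J) \<in> parts (set ks - {s})"
    have "?kz ((k # sl I) @ s # sl J) = ?kz (sl I @ s # sl J)"
      using sub[OF IJ] s by (simp, intro koszul_Cons_min) (auto simp: lt)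
    then show "?F \<theta> s (k # sl I) (sl J) = ?F (\<lambda>P u v R. sg (n * e (w k)) * \<theta> (w k # P) u v R) s (sl I) (sl J)"
      by (simp add: distrib_left sg_add mult.assoc mult.left_commute)
    have "?kz ((sl I @ [s]) @ k # sl J) = sg (?f k * sum_list (map ?f (sl I @ [s]))) * ?kz ((sl I @ [s]) @ sl J)"
      using sub[OF IJ] s by (intro koszul_insert_min) (auto simp: lt)
    then have K: "?kz (sl I @ s # k # sl J) = sg (e (w k) * (word_deg e (map w (sl I)) + e (w s))) * ?kz (sl I @ s # sl J)"
      by (simp add: word_deg_map)
    have E: "ev2 (\<lambda>u v. sg (n * word_deg e (map w (sl I))) * (sg (e (w k) * (word_deg e (map w (sl I)) + e u + e v + n)) * \<theta> (map w (sl I)) u v (w k # map w (sl J)))) (cg (w s))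
      = ev2 (\<lambda>u v. sg (e (w k) * (word_deg e (map w (sl I)) + e (w s))) * (sg (n * word_deg e (map w (sl I))) * \<theta> (map w (sl I)) u v (w k # map w (sl J)))) (cg (w s))"
      by (rule ev2_cong) (simp add: deg mult.left_commute)
    show "?F \<theta> s (sl I) (k # sl J) = ?F (\<lambda>P u v R. sg (e (w k) * (word_deg e P + e u + e v + n)) * \<theta> P u v (w k # R)) s (sl I) (sl J)"
      unfolding K E by (simp add: ev2_mult)
  qed
  also have "\<dots> = dlt e n cg (\<lambda>P u v R. sg (n * e (w k)) * \<theta> (w k # P) u v R) (map w ks)
    + dlt e n cg (\<lambda>P u v R. sg (e (w k) * (word_deg e P + e u + e v + n)) * \<theta> P u v (w k # R)) (map w ks)"
    by (intro arg_cong2[of _ _ _ _ "(+)"] Cons.IH sorted)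
  also have "(\<Sum>(I, J)\<in>parts (set ks). ?F \<theta> k (sl I) (sl J)) =
    spl e (\<lambda>P R. sg (e (w k) * word_deg e P) * ev2 (\<lambda>u v. sg (n * word_deg e P) * \<theta> P u v R) (cg (w k))) (map w ks)"
    unfolding sum_parts_spl[OF sorted, symmetric]
  proof (intro sum.cong refl, clarify)
    fix I J assume IJ: "(I, J) \<in> parts (set ks)"
    have "?kz (sl I @ k # sl J) = sg (e (w k) * word_deg e (map w (sl I))) * ?kz (sl I @ sl J)"
      unfolding word_deg_map using sub[of I J "{}"] IJ by (intro koszul_insert_min) (auto simp: lt)
    then show "?F \<theta> k (sl I) (sl J) = ?kz (sl I @ sl J) *
       (sg (e (w k) * word_deg e (map w (sl I))) * ev2 (\<lambda>u v. sg (n * word_deg e (map w (sl I))) * \<theta> (map w (sl I)) u v (map w (sl J))) (cg (w k)))"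
      by simp
  qed
  finally show ?case by (simp add: add.assoc)
qed simp

lemma sl_Diff_insert:
  assumes "k \<notin> S" "i \<in> S" "finite S" "\<And>j. j \<in> S \<Longrightarrow> k < j"
  shows "sl (insert k S - {i}) = k # sl (S - {i})"
proof -
  have "insert k S - {i} = insert k (S - {i})" using assms by auto
  then show ?thesis using assms by (simp only:) (intro sl_insert_min, auto)
qed

text \<open>One factor is replaced and its image is moved to the front, as in the formula for
  \<open>m\<close>; \<open>e z - d\<close> is the degree of the replaced factor. With
  \<open>d = 1\<close> this serves \<open>m\<close>, and with \<open>Bg x\<close> of degree
  \<open>e x + 1\<close> it serves the inner sum of the bracket part.\<close>

fun mm :: "('g \<Rightarrow> int) \<Rightarrow> int \<Rightarrow> ('g \<Rightarrow> ('g \<Rightarrow>\<^sub>0 'k::field)) \<Rightarrow> ('g \<Rightarrow> 'g list \<Rightarrow> 'k) \<Rightarrow> 'g list \<Rightarrow> 'k" where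
  "mm e d Dg \<theta> [] = 0"
| "mm e d Dg \<theta> (x # W) = ev (\<lambda>z. \<theta> z W) (Dg x) + mm e d Dg (\<lambda>z R. sg (e x * (e z - d)) * \<theta> z (x # R)) W"

lemma sum_mm:
  fixes \<theta> :: "'g \<Rightarrow> 'g list \<Rightarrow> 'k::field"
  assumes deg: "\<And>x z. z \<in> Poly_Mapping.keys (Dg x) \<Longrightarrow> e z = e x + d" and "sorted_wrt (<) ks"
  shows "(\<Sum>i\<in>set ks. koszul (\<lambda>i. e (w i)) (i # sl (set ks - {i})) * ev (\<lambda>z. \<theta> z (map w (sl (set ks - {i})))) (Dg (w i)))
    = mm e d Dg \<theta> (map w ks)"
  using assms(2)
proof (induction ks arbitrary: \<theta>)
  case (Cons k ks)
  let ?f = "\<lambda>i. e (w i)" let ?kz = "koszul (\<lambda>i. e (w i)) :: nat list \<Rightarrow> 'k"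
  have lt: "k < j" if "j \<in> set ks" for j using Cons.prems that by simp
  have k: "k \<notin> set ks" using lt by blast
  have sorted: "sorted_wrt (<) ks" using Cons.prems by simp
  have "(\<Sum>i\<in>set ks. ?kz (i # sl (insert k (set ks) - {i})) * ev (\<lambda>z. \<theta> z (map w (sl (insert k (set ks) - {i})))) (Dg (w i)))
    = (\<Sum>i\<in>set ks. ?kz (i # sl (set ks - {i})) * ev (\<lambda>z. sg (e (w k) * (e z - d)) * \<theta> z (w k # map w (sl (set ks - {i})))) (Dg (w i)))"
  proof (intro sum.cong refl)
    fix i assume i: "i \<in> set ks"
    have sl: "sl (insert k (set ks) - {i}) = k # sl (set ks - {i})"
      by (rule sl_Diff_insert) (auto simp: k i lt)
    have K0: "?kz ([i] @ k # sl (set ks - {i})) = sg (?f k * sum_list (map ?f [i])) * ?kz ([i] @ sl (set ks - {i}))"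
      by (rule koszul_insert_min) (use i in \<open>auto simp: lt\<close>)
    have K: "?kz (i # k # sl (set ks - {i})) = sg (e (w k) * e (w i)) * ?kz (i # sl (set ks - {i}))"
      using K0 by simp
    have E: "ev (\<lambda>z. sg (e (w k) * (e z - d)) * \<theta> z (w k # map w (sl (set ks - {i})))) (Dg (w i))
      = ev (\<lambda>z. sg (e (w k) * e (w i)) * \<theta> z (w k # map w (sl (set ks - {i})))) (Dg (w i))"
      by (intro ev_cong) (simp add: deg)
    show "?kz (i # sl (insert k (set ks) - {i})) * ev (\<lambda>z. \<theta> z (map w (sl (insert k (set ks) - {i})))) (Dg (w i))
      = ?kz (i # sl (set ks - {i})) * ev (\<lambda>z. sg (e (w k) * (e z - d)) * \<theta> z (w k # map w (sl (set ks - {i})))) (Dg (w i))"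
      unfolding sl K E by (simp add: ev_fun_mult)
  qed
  also have "\<dots> = mm e d Dg (\<lambda>z R. sg (e (w k) * (e z - d)) * \<theta> z (w k # R)) (map w ks)"
    by (rule Cons.IH[OF sorted])
  finally have 1: "(\<Sum>i\<in>set ks. ?kz (i # sl (insert k (set ks) - {i})) * ev (\<lambda>z. \<theta> z (map w (sl (insert k (set ks) - {i})))) (Dg (w i)))
    = mm e d Dg (\<lambda>z R. sg (e (w k) * (e z - d)) * \<theta> z (w k # R)) (map w ks)" .
  have "insert k (set ks) - {k} = set ks" using k by blast
  moreover have "?kz (k # ks) = 1" by (rule koszul_strict_sorted[OF Cons.prems])
  ultimately show ?case using k by (simp add: 1 sl_set[OF sorted])
qed simp

text \<open>The first branch pairs \<open>x\<close> with a later factor. In the second,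
  \<open>x\<close> is passed over by a pair whose total degree is \<open>e z - 1\<close>, because
  \<open>Bg\<close> has degree 1.\<close>

fun ll :: "('g \<Rightarrow> int) \<Rightarrow> ('g \<Rightarrow> 'g \<Rightarrow> ('g \<Rightarrow>\<^sub>0 'k::field)) \<Rightarrow> ('g \<Rightarrow> 'g list \<Rightarrow> 'k) \<Rightarrow> 'g list \<Rightarrow> 'k" where
  "ll e Bg \<theta> [] = 0"
| "ll e Bg \<theta> (x # W) = mm e (e x + 1) (Bg x) \<theta> W + ll e Bg (\<lambda>z R. sg (e x * (e z - 1)) * \<theta> z (x # R)) W"

lemma sum_ll:
  fixes \<theta> :: "'g \<Rightarrow> 'g list \<Rightarrow> 'k::field"
  assumes deg: "\<And>x y z. z \<in> Poly_Mapping.keys (Bg x y) \<Longrightarrow> e z = e x + e y + 1" and "sorted_wrt (<) ks"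
  shows "(\<Sum>j\<in>set ks. \<Sum>i\<in>{i \<in> set ks. i < j}. koszul (\<lambda>i. e (w i)) (i # j # sl (set ks - {i, j})) *
      ev (\<lambda>z. \<theta> z (map w (sl (set ks - {i, j})))) (Bg (w i) (w j))) = ll e Bg \<theta> (map w ks)"
  using assms(2)
proof (induction ks arbitrary: \<theta>)
  case (Cons k ks)
  let ?f = "\<lambda>i. e (w i)" let ?kz = "koszul (\<lambda>i. e (w i)) :: nat list \<Rightarrow> 'k"
  have lt: "k < j" if "j \<in> set ks" for j using Cons.prems that by simp
  have k: "k \<notin> set ks" using lt by blast
  have sorted: "sorted_wrt (<) ks" using Cons.prems by simp
  let ?F = "\<lambda>S i j. ?kz (i # j # sl (S - {i, j})) * ev (\<lambda>z. \<theta> z (map w (sl (S - {i, j})))) (Bg (w i) (w j))"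
  have e1: "{i \<in> set (k # ks). i < k} = {}" using lt by force
  have e2: "{i \<in> set (k # ks). i < j} = insert k {i \<in> set ks. i < j}" if "j \<in> set ks" for j
    using lt[OF that] by auto
  have split: "sum G (set (k # ks)) = G k + sum G (set ks)" for G :: "nat \<Rightarrow> 'k" using k by simp
  have "(\<Sum>j\<in>set (k # ks). \<Sum>i\<in>{i \<in> set (k # ks). i < j}. ?F (set (k # ks)) i j)
    = (\<Sum>j\<in>set ks. \<Sum>i\<in>{i \<in> set (k # ks). i < j}. ?F (set (k # ks)) i j)"
    by (subst split) (simp only: e1 sum.empty add_0_left)
  also have "\<dots> = (\<Sum>j\<in>set ks. ?F (set (k # ks)) k j + (\<Sum>i\<in>{i \<in> set ks. i < j}. ?F (set (k # ks)) i j))"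
    by (intro sum.cong refl) (simp only: e2, subst sum.insert, auto simp: k)
  also have "\<dots> = (\<Sum>j\<in>set ks. ?F (set (k # ks)) k j) + (\<Sum>j\<in>set ks. \<Sum>i\<in>{i \<in> set ks. i < j}. ?F (set (k # ks)) i j)"
    by (rule sum.distrib)
  also have "(\<Sum>j\<in>set ks. ?F (set (k # ks)) k j)
    = (\<Sum>j\<in>set ks. ?kz (j # sl (set ks - {j})) * ev (\<lambda>z. \<theta> z (map w (sl (set ks - {j})))) (Bg (w k) (w j)))"
  proof (intro sum.cong refl)
    fix j assume j: "j \<in> set ks"
    have S: "set (k # ks) - {k, j} = set ks - {j}" using k by auto
    have "?kz (k # j # sl (set ks - {j})) = ?kz (j # sl (set ks - {j}))"
      by (rule koszul_Cons_min) (use j in \<open>auto simp: lt\<close>)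
    then show "?F (set (k # ks)) k j = ?kz (j # sl (set ks - {j})) * ev (\<lambda>z. \<theta> z (map w (sl (set ks - {j})))) (Bg (w k) (w j))"
      unfolding S by simp
  qed
  also have "\<dots> = mm e (e (w k) + 1) (Bg (w k)) \<theta> (map w ks)"
    by (rule sum_mm[OF _ sorted]) (simp add: deg)
  also have "(\<Sum>j\<in>set ks. \<Sum>i\<in>{i \<in> set ks. i < j}. ?F (set (k # ks)) i j)
    = (\<Sum>j\<in>set ks. \<Sum>i\<in>{i \<in> set ks. i < j}. ?kz (i # j # sl (set ks - {i, j})) *
        ev (\<lambda>z. sg (e (w k) * (e z - 1)) * \<theta> z (w k # map w (sl (set ks - {i, j})))) (Bg (w i) (w j)))"
  proof (intro sum.cong refl)
    fix i j assume j: "j \<in> set ks" and i: "i \<in> {i \<in> set ks. i < j}"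
    have "set (k # ks) - {i, j} = insert k (set ks - {i, j})" using i j lt by auto
    then have S: "sl (set (k # ks) - {i, j}) = k # sl (set ks - {i, j})"
      by (simp only:) (intro sl_insert_min, auto simp: lt)
    have "?kz ([i, j] @ k # sl (set ks - {i, j})) = sg (?f k * sum_list (map ?f [i, j])) * ?kz ([i, j] @ sl (set ks - {i, j}))"
      by (rule koszul_insert_min) (use i j in \<open>auto simp: lt\<close>)
    then have K: "?kz (i # j # k # sl (set ks - {i, j})) = sg (e (w k) * (e (w i) + e (w j))) * ?kz (i # j # sl (set ks - {i, j}))"
      by simp
    have E: "ev (\<lambda>z. sg (e (w k) * (e z - 1)) * \<theta> z (w k # map w (sl (set ks - {i, j})))) (Bg (w i) (w j))
      = ev (\<lambda>z. sg (e (w k) * (e (w i) + e (w j))) * \<theta> z (w k # map w (sl (set ks - {i, j})))) (Bg (w i) (w j))"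
      by (intro ev_cong) (simp add: deg)
    show "?F (set (k # ks)) i j = ?kz (i # j # sl (set ks - {i, j})) *
        ev (\<lambda>z. sg (e (w k) * (e z - 1)) * \<theta> z (w k # map w (sl (set ks - {i, j})))) (Bg (w i) (w j))"
      unfolding S K E ev_fun_mult by simp
  qed
  also have "\<dots> = ll e Bg (\<lambda>z R. sg (e (w k) * (e z - 1)) * \<theta> z (w k # R)) (map w ks)"
    by (rule Cons.IH[OF sorted])
  finally show ?case by simp
qed simp

lemma mm_mult: "mm e d Dg (\<lambda>z R. k * \<theta> z R) W = k * mm e d Dg \<theta> W"
proof (induction e d Dg \<theta> W rule: mm.induct)
  case (2 e d Dg \<theta> x W)
  show ?case by (simp only: mm.simps mult.left_commute[of _ k] "2.IH" ev_fun_mult distrib_left[of k])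
qed simp

lemma ll_mult: "ll e Bg (\<lambda>z R. k * \<theta> z R) W = k * ll e Bg \<theta> W"
proof (induction e Bg \<theta> W rule: ll.induct)
  case (2 e Bg \<theta> x W)
  show ?case by (simp only: ll.simps mult.left_commute[of _ k] "2.IH" mm_mult distrib_left[of k])
qed simp

lemma dlt_mult: "dlt e n cg (\<lambda>P u v R. k * \<theta> P u v R) W = k * dlt e n cg \<theta> W"
proof (induction e n cg \<theta> W rule: dlt.induct)
  case (2 e n cg \<theta> x W)
  show ?case by (simp only: dlt.simps mult.left_commute[of _ k] "2.IH" ev2_mult spl_mult distrib_left[of k])
qed simp

section \<open>Images moved to the front against images left in place\<close>

context dg_lie_bialgebra begin

lemma good_snoc: "good \<phi> \<Longrightarrow> \<phi> (P @ [u]) = sg (e u * word_deg e P) * \<phi> (u # P)"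
proof (induction P arbitrary: \<phi>)
  case (Cons a P)
  have "\<phi> ((a # P) @ [u]) = sg (e u * word_deg e P) * \<phi> (a # u # P)"
    using Cons.IH[OF good_Cons[OF Cons.prems, of a]] by simp
  also have "\<phi> (a # u # P) = sg (e a * e u) * \<phi> (u # a # P)" by (rule good_swap[OF Cons.prems])
  finally show ?case by (simp add: sg_simps algebra_simps)
qed simp

text \<open>\<open>E\<close> leaves the image where the factor stood, \<open>mm\<close> moves it to
  the front. A good functional does not notice the difference beyond the sign of passing
  \<open>y\<close>.\<close>

lemma mm_good: "good \<phi> \<Longrightarrow> E x \<phi> W = ev (\<lambda>z. \<phi> (z # W)) (Dg x) + mm e (e x + 1) (Bg x) (\<lambda>z R. \<phi> (z # R)) W"
proof (induction W arbitrary: \<phi>)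
  case (Cons y W)
  have 1: "sg (e y * (e z - (e x + 1))) * \<phi> (z # y # R) = sg (e y * (e x + 1)) * \<phi> (y # z # R)" for z R
    by (subst good_swap[OF Cons.prems]) (simp add: sg_simps algebra_simps)
  have 2: "ev (\<lambda>z. \<phi> (z # y # W)) (Dg x) = ev (\<lambda>z. sg (e y * (e x + 1)) * \<phi> (y # z # W)) (Dg x)"
    by (rule ev_cong) (subst good_swap[OF Cons.prems], simp add: Dg_deg mult.commute)
  show ?case
    by (simp only: EE.simps mm.simps 1 2 mm_mult ev_fun_mult Cons.IH[OF good_Cons[OF Cons.prems, of y]]
        distrib_left[of "sg (e y * (e x + 1))"] add.assoc) (simp only: add.commute)
qed simp

lemma mm_ll_good: "good \<phi> \<Longrightarrow> mm e 1 Dg (\<lambda>z R. \<phi> (z # R)) W + ll e Bg (\<lambda>z R. \<phi> (z # R)) W = Q \<phi> W"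
proof (induction W arbitrary: \<phi>)
  case (Cons x W)
  have 1: "sg (e x * (e z - 1)) * \<phi> (z # x # R) = sg (e x) * \<phi> (x # z # R)" for z R
    by (subst good_swap[OF Cons.prems]) (simp add: sg_simps algebra_simps)
  show ?case
    unfolding QQ.simps mm_good[OF Cons.prems] Cons.IH[OF good_Cons[OF Cons.prems, of x], symmetric]
    by (simp only: mm.simps ll.simps 1 mm_mult ll_mult distrib_left[of "sg (e x)"] add.assoc)
      (simp only: add.left_commute add.commute)
qed simp

text \<open>Goodness in the first variable brings \<open>u\<close> from the end of the left word to
  its front, and goodness in the second lets \<open>x\<close> pass \<open>v\<close>. The sign of the
  first move reduces that of \<open>dlt\<close> to \<open>e v * word_deg e P\<close>, since
  \<open>e x\<close> and \<open>e u + e v + n\<close> agree.\<close>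

lemma dlt_good: "good2 \<phi> \<Longrightarrow> dlt e n cg (\<lambda>P u v R. \<phi> (P @ [u]) (v # R)) W = Del \<phi> W"
proof (induction W arbitrary: \<phi>)
  case (Cons x W)
  have sn: "\<phi> (P @ [u]) (v # R) = sg (e u * word_deg e P) * \<phi> (u # P) (v # R)" for P u v R
    by (rule good_snoc[OF good2D(1)[OF Cons.prems]])
  have "spl e (\<lambda>P R. sg (e x * word_deg e P) * ev2 (\<lambda>u v. sg (n * word_deg e P) * \<phi> (P @ [u]) (v # R)) (cg x)) W
    = spl e (\<lambda>P R. ev2 (\<lambda>u v. sg (e v * word_deg e P) * \<phi> (u # P) (v # R)) (cg x)) W"
    unfolding sn ev2_mult[symmetric] by (intro Spl_cong ev2_cong) (simp add: cg_deg sg_simps algebra_simps)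
  moreover have "dlt e n cg (\<lambda>P u v R. sg (n * e x) * \<phi> ((x # P) @ [u]) (v # R)) W = sg (n * e x) * Del (\<lambda>P R. \<phi> (x # P) R) W"
    using Cons.IH[OF good2_Cons[OF Cons.prems, of x]] by (simp add: dlt_mult)
  moreover have "(\<lambda>P u v R. sg (e x * (word_deg e P + e u + e v + n)) * \<phi> (P @ [u]) (v # x # R))
     = (\<lambda>P u v R. sg (n * e x) * (sg (e x * word_deg e (P @ [u])) * \<phi> (P @ [u]) (x # v # R)))"
    by (intro ext, subst good_swap[OF good2D(2)[OF Cons.prems]]) (simp add: sg_simps algebra_simps)
  then have "dlt e n cg (\<lambda>P u v R. sg (e x * (word_deg e P + e u + e v + n)) * \<phi> (P @ [u]) (v # x # R)) W
     = sg (n * e x) * Del (\<lambda>P R. sg (e x * word_deg e P) * \<phi> P (x # R)) W"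
    using Cons.IH[OF good2_Cons_right[OF Cons.prems, of x]] by (simp only: dlt_mult)
  ultimately show ?case by (simp only: dlt.simps del.simps append_Cons)
qed simp

end

section \<open>Shuffle permutations as interleavings of index lists\<close>

lemma sum_shuffles_Cons:
  fixes F :: "'a list \<Rightarrow> 'b::comm_monoid_add"
  assumes "x \<noteq> y"
  shows "(\<Sum>js\<in>shuffles (x # xs) (y # ys). F js)
    = (\<Sum>js\<in>shuffles xs (y # ys). F (x # js)) + (\<Sum>js\<in>shuffles (x # xs) ys. F (y # js))"
  unfolding shuffles.simps using assms
  by (subst sum.union_disjoint) (auto simp: sum.reindex inj_on_def)

text \<open>All indices in \<open>vs\<close> exceed those in \<open>us\<close>, so an index of
  \<open>vs\<close> that comes early is inverted exactly with the indices of \<open>us\<close> still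
  to come; this is the sign in \<open>sh\<close>.\<close>

lemma sum_shuffles_sh:
  fixes \<phi> :: "'g list \<Rightarrow> 'k::field"
  assumes "sorted_wrt (<) us" "sorted_wrt (<) vs" "\<And>u v. u \<in> set us \<Longrightarrow> v \<in> set vs \<Longrightarrow> u < v"
  shows "(\<Sum>js\<in>shuffles us vs. koszul (\<lambda>i. e (w i)) js * \<phi> (map w js)) = sh e \<phi> (map w us) (map w vs)"
  using assms
proof (induction us vs arbitrary: \<phi> rule: shuffles.induct)
  case (1 ys)
  then show ?case by (simp add: koszul_strict_sorted)
next
  case (2 xs)
  then show ?case by (simp add: koszul_strict_sorted)
next
  case (3 x xs y ys)
  let ?f = "\<lambda>i. e (w i)" let ?kz = "koszul (\<lambda>i. e (w i)) :: nat list \<Rightarrow> 'k"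
  have "x \<noteq> y" using "3.prems"(3)[of x y] by simp
  have "(\<Sum>js\<in>shuffles (x # xs) (y # ys). ?kz js * \<phi> (map w js))
    = (\<Sum>js\<in>shuffles xs (y # ys). ?kz (x # js) * \<phi> (map w (x # js))) + (\<Sum>js\<in>shuffles (x # xs) ys. ?kz (y # js) * \<phi> (map w (y # js)))"
    by (rule sum_shuffles_Cons[OF \<open>x \<noteq> y\<close>])
  also have "(\<Sum>js\<in>shuffles xs (y # ys). ?kz (x # js) * \<phi> (map w (x # js)))
    = (\<Sum>js\<in>shuffles xs (y # ys). ?kz js * \<phi> (w x # map w js))"
  proof (intro sum.cong refl)
    fix js assume "js \<in> shuffles xs (y # ys)"
    then have "set js = set xs \<union> set (y # ys)" by (rule set_shuffles)
    then have "?kz (x # js) = ?kz js" using "3.prems" by (intro koszul_Cons_min) auto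
    then show "?kz (x # js) * \<phi> (map w (x # js)) = ?kz js * \<phi> (w x # map w js)" by simp
  qed
  also have "\<dots> = sh e (\<lambda>W. \<phi> (w x # W)) (map w xs) (map w (y # ys))"
    by (rule "3.IH"(1)) (use "3.prems" in auto)
  also have "(\<Sum>js\<in>shuffles (x # xs) ys. ?kz (y # js) * \<phi> (map w (y # js)))
    = sg (e (w y) * word_deg e (map w (x # xs))) * (\<Sum>js\<in>shuffles (x # xs) ys. ?kz js * \<phi> (w y # map w js))"
    unfolding sum_distrib_left
  proof (intro sum.cong refl)
    fix js assume js: "js \<in> shuffles (x # xs) ys"
    \<comment> \<open>The entries of \<open>js\<close> below \<open>y\<close> are those of
      \<open>x # xs\<close> in their order; this computes the inversions caused by \<open>y\<close>
      in front.\<close>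
    have "filter (\<lambda>j. j < y) js \<in> shuffles (filter (\<lambda>j. j < y) (x # xs)) (filter (\<lambda>j. j < y) ys)"
      unfolding filter_shuffles[symmetric] using js by (rule imageI)
    moreover have "filter (\<lambda>j. j < y) (x # xs) = x # xs" using "3.prems"(3) by (intro filter_True) auto
    moreover have "filter (\<lambda>j. j < y) ys = []" using "3.prems"(2) by (force simp: filter_empty_conv)
    ultimately have "filter (\<lambda>j. j < y) js = x # xs" by simp
    then have "?kz (y # js) = sg (e (w y) * word_deg e (map w (x # xs))) * ?kz js"
      unfolding koszul_Cons[of _ y] word_deg_map by simp
    then show "?kz (y # js) * \<phi> (map w (y # js)) = sg (e (w y) * word_deg e (map w (x # xs))) * (?kz js * \<phi> (w y # map w js))"
      by simp
  qed
  also have "(\<Sum>js\<in>shuffles (x # xs) ys. ?kz js * \<phi> (w y # map w js)) = sh e (\<lambda>W. \<phi> (w y # W)) (map w (x # xs)) (map w ys)"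
    by (rule "3.IH"(2)) (use "3.prems" in auto)
  finally show ?case by simp
qed

text \<open>The sum in \<open>\<ell>\<^sub>2\<close> over the positions at which a letter of the first word precedes one of the second.\<close>

fun adj :: "('g \<Rightarrow> int) \<Rightarrow> int \<Rightarrow> ('g \<Rightarrow> 'g \<Rightarrow> ('g \<Rightarrow>\<^sub>0 'k::field)) \<Rightarrow> nat \<Rightarrow> (nat \<Rightarrow> 'g) \<Rightarrow> ('g list \<Rightarrow> 'k) \<Rightarrow> nat list \<Rightarrow> 'k" where
  "adj e c el p w \<phi> [] = 0"
| "adj e c el p w \<phi> (j # js) = (case js of [] \<Rightarrow> 0 | k # ks \<Rightarrow>
      if j < p \<and> p \<le> k then ev (\<lambda>z. \<phi> (z # map w ks)) (el (w j) (w k)) else 0)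
    + sg (c * e (w j)) * adj e c el p w (\<lambda>W. \<phi> (w j # W)) js"

lemma adj_zero: "(\<forall>j\<in>set js. p \<le> j) \<or> (\<forall>j\<in>set js. j < p) \<Longrightarrow> adj e c el p w \<phi> js = 0"
proof (induction js arbitrary: \<phi>)
  case (Cons j js)
  then have "adj e c el p w (\<lambda>W. \<phi> (w j # W)) js = 0" by auto
  then show ?case using Cons.prems by (cases js) (auto simp: not_less)
qed simp

lemma adj_sum:
  fixes \<phi> :: "'g list \<Rightarrow> 'k::field"
  shows "(\<Sum>k<length js. if k + 1 < length js \<and> js ! k < p \<and> p \<le> js ! (k + 1)
     then sg (c * word_deg e (take k (map w js))) * ev (\<lambda>z. \<phi> (take k (map w js) @ z # drop (k + 2) (map w js))) (el (map w js ! k) (map w js ! (k + 1)))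
     else 0) = adj e c el p w \<phi> js"
proof (induction js arbitrary: \<phi>)
  case (Cons j js)
  let ?G = "\<lambda>\<phi> js k. if k + 1 < length js \<and> js ! k < p \<and> p \<le> js ! (k + 1)
     then sg (c * word_deg e (take k (map w js))) * ev (\<lambda>z. \<phi> (take k (map w js) @ z # drop (k + 2) (map w js))) (el (map w js ! k) (map w js ! (k + 1)))
     else (0::'k)"
  have "?G \<phi> (j # js) (Suc k) = sg (c * e (w j)) * ?G (\<lambda>W. \<phi> (w j # W)) js k" if "k < length js" for k
    using that by (simp add: distrib_left sg_add mult.assoc)
  then have "(\<Sum>k<length js. ?G \<phi> (j # js) (Suc k)) = sg (c * e (w j)) * (\<Sum>k<length js. ?G (\<lambda>W. \<phi> (w j # W)) js k)"
    unfolding sum_distrib_left by (intro sum.cong) auto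
  also have "\<dots> = sg (c * e (w j)) * adj e c el p w (\<lambda>W. \<phi> (w j # W)) js"
    by (simp only: Cons.IH[of "\<lambda>W. \<phi> (w j # W)"])
  finally have 1: "(\<Sum>k<length js. ?G \<phi> (j # js) (Suc k)) = sg (c * e (w j)) * adj e c el p w (\<lambda>W. \<phi> (w j # W)) js" .
  have 2: "?G \<phi> (j # js) 0 = (case js of [] \<Rightarrow> 0 | k # ks \<Rightarrow>
      if j < p \<and> p \<le> k then ev (\<lambda>z. \<phi> (z # map w ks)) (el (w j) (w k)) else 0)"
    by (cases js) simp_all
  show ?case
    unfolding list.size(4) add_0_right add_Suc_right sum.lessThan_Suc_shift adj.simps 1[symmetric] 2[symmetric] by simp
qed simp

text \<open>Sorting interleavings by their first index separates the position at the front from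
  later ones. Taking \<open>x\<close> first gives either a later contraction or one at once with
  \<open>y\<close>; taking \<open>y\<close> first allows a later contraction only.\<close>

lemma sum_shuffles_br:
  fixes \<phi> :: "'g list \<Rightarrow> 'k::field"
  assumes "sorted_wrt (<) us" "sorted_wrt (<) vs" "\<And>u. u \<in> set us \<Longrightarrow> u < p" "\<And>v. v \<in> set vs \<Longrightarrow> p \<le> v"
  shows "(\<Sum>js\<in>shuffles us vs. koszul (\<lambda>i. e (w i)) js * adj e c el p w \<phi> js) = br e c el \<phi> (map w us) (map w vs)"
  using assms
proof (induction us vs arbitrary: \<phi> rule: shuffles.induct)
  case (1 ys)
  then show ?case by (simp add: adj_zero)
next
  case (2 xs)
  then show ?case by (simp add: adj_zero)
next
  case (3 x xs y ys)
  let ?f = "\<lambda>i. e (w i)" let ?kz = "koszul (\<lambda>i. e (w i)) :: nat list \<Rightarrow> 'k"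
  have lt: "u < v" if "u \<in> set (x # xs)" "v \<in> set (y # ys)" for u v
    using "3.prems"(3)[OF that(1)] "3.prems"(4)[OF that(2)] by simp
  have "x \<noteq> y" using lt[of x y] by simp
  have kx: "?kz (x # js) = ?kz js" if "js \<in> shuffles xs (y # ys)" for js
    using set_shuffles[OF that] "3.prems" lt by (intro koszul_Cons_min) auto
  have ky: "?kz (y # js) = sg (e (w y) * word_deg e (map w us)) * ?kz js" if "js \<in> shuffles us ys" "set us \<subseteq> set (x # xs)" for js us
  proof -
    have "filter (\<lambda>j. j < y) js \<in> shuffles (filter (\<lambda>j. j < y) us) (filter (\<lambda>j. j < y) ys)"
      unfolding filter_shuffles[symmetric] using that(1) by (rule imageI)
    moreover have "filter (\<lambda>j. j < y) us = us" using lt that(2) by (intro filter_True) auto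
    moreover have "filter (\<lambda>j. j < y) ys = []" using "3.prems"(2) by (force simp: filter_empty_conv)
    ultimately have "filter (\<lambda>j. j < y) js = us" by simp
    then show ?thesis unfolding koszul_Cons[of _ y] word_deg_map by simp
  qed
  let ?t = "\<lambda>js. case js of [] \<Rightarrow> 0 | k # ks \<Rightarrow> if x < p \<and> p \<le> k then ev (\<lambda>z. \<phi> (z # map w ks)) (el (w x) (w k)) else 0"
  have "(\<Sum>js\<in>shuffles (x # xs) (y # ys). ?kz js * adj e c el p w \<phi> js)
    = (\<Sum>js\<in>shuffles xs (y # ys). ?kz (x # js) * adj e c el p w \<phi> (x # js)) + (\<Sum>js\<in>shuffles (x # xs) ys. ?kz (y # js) * adj e c el p w \<phi> (y # js))"
    by (rule sum_shuffles_Cons[OF \<open>x \<noteq> y\<close>])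
  also have "(\<Sum>js\<in>shuffles xs (y # ys). ?kz (x # js) * adj e c el p w \<phi> (x # js))
    = (\<Sum>js\<in>shuffles xs (y # ys). ?kz js * ?t js) + sg (c * e (w x)) * (\<Sum>js\<in>shuffles xs (y # ys). ?kz js * adj e c el p w (\<lambda>W. \<phi> (w x # W)) js)"
    unfolding sum_distrib_left sum.distrib[symmetric]
    by (intro sum.cong refl) (simp only: kx adj.simps distrib_left mult.left_commute)
  also have "(\<Sum>js\<in>shuffles xs (y # ys). ?kz js * adj e c el p w (\<lambda>W. \<phi> (w x # W)) js) = br e c el (\<lambda>W. \<phi> (w x # W)) (map w xs) (map w (y # ys))"
    by (rule "3.IH"(1)) (use "3.prems" in auto)
  \<comment> \<open>\<open>x\<close> can be contracted at once only if the next index is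
    \<open>y\<close>: a next index from \<open>xs\<close> lies below \<open>p\<close>.\<close>
  also have "(\<Sum>js\<in>shuffles xs (y # ys). ?kz js * ?t js) = (\<Sum>js\<in>shuffles xs ys. ?kz (y # js) * ?t (y # js))"
  proof (cases xs)
    case (Cons x' xs')
    have "x' \<noteq> y" using lt[of x' y] Cons by simp
    have "\<not> p \<le> x'" using "3.prems"(3)[of x'] Cons by simp
    show ?thesis unfolding Cons sum_shuffles_Cons[OF \<open>x' \<noteq> y\<close>] using \<open>\<not> p \<le> x'\<close> by simp
  qed simp
  also have "\<dots> = sg (e (w y) * word_deg e (map w xs)) * (\<Sum>js\<in>shuffles xs ys. ?kz js * ev (\<lambda>z. \<phi> (z # map w js)) (el (w x) (w y)))"
    unfolding sum_distrib_left
  proof (intro sum.cong refl)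
    fix js assume js: "js \<in> shuffles xs ys"
    show "?kz (y # js) * ?t (y # js) = sg (e (w y) * word_deg e (map w xs)) * (?kz js * ev (\<lambda>z. \<phi> (z # map w js)) (el (w x) (w y)))"
      unfolding ky[OF js set_subset_Cons] using "3.prems"(3)[of x] "3.prems"(4)[of y] by simp
  qed
  also have "(\<Sum>js\<in>shuffles xs ys. ?kz js * ev (\<lambda>z. \<phi> (z # map w js)) (el (w x) (w y)))
    = sh e (\<lambda>W. ev (\<lambda>z. \<phi> (z # W)) (el (w x) (w y))) (map w xs) (map w ys)"
    by (rule sum_shuffles_sh) (use "3.prems" lt in auto)
  also have "(\<Sum>js\<in>shuffles (x # xs) ys. ?kz (y # js) * adj e c el p w \<phi> (y # js))
    = sg (e (w y) * word_deg e (map w (x # xs)) + c * e (w y)) * (\<Sum>js\<in>shuffles (x # xs) ys. ?kz js * adj e c el p w (\<lambda>W. \<phi> (w y # W)) js)"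
    unfolding sum_distrib_left
  proof (intro sum.cong refl)
    fix js assume js: "js \<in> shuffles (x # xs) ys"
    have "adj e c el p w \<phi> (y # js) = sg (c * e (w y)) * adj e c el p w (\<lambda>W. \<phi> (w y # W)) js"
      using "3.prems"(4)[of y] by (cases js) simp_all
    then show "?kz (y # js) * adj e c el p w \<phi> (y # js)
      = sg (e (w y) * word_deg e (map w (x # xs)) + c * e (w y)) * (?kz js * adj e c el p w (\<lambda>W. \<phi> (w y # W)) js)"
      unfolding ky[OF js subset_refl] by (simp add: sg_add)
  qed
  also have "(\<Sum>js\<in>shuffles (x # xs) ys. ?kz js * adj e c el p w (\<lambda>W. \<phi> (w y # W)) js) = br e c el (\<lambda>W. \<phi> (w y # W)) (map w (x # xs)) (map w ys)"
    by (rule "3.IH"(2)) (use "3.prems" in auto)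
  finally show ?case by (simp add: sh_ev algebra_simps)
qed

text \<open>Listing the inverse of a shuffle permutation shows which position each place is filled
  from. Each block is met in increasing order exactly because \<sigma> is increasing on it.\<close>

lemma Bat_bij: "bij_betw (\<lambda>\<sigma>. map (inv \<sigma>) [0..<p + q]) (Bat p q) (shuffles [0..<p] [p..<p + q])"
proof (rule bij_betwI')
  fix \<sigma> \<tau> assume "\<sigma> \<in> Bat p q" "\<tau> \<in> Bat p q"
  then have s: "\<sigma> permutes {..<p + q}" and t: "\<tau> permutes {..<p + q}" by (auto simp: Bat_def)
  show "(map (inv \<sigma>) [0..<p + q] = map (inv \<tau>) [0..<p + q]) = (\<sigma> = \<tau>)"
  proof
    assume *: "map (inv \<sigma>) [0..<p + q] = map (inv \<tau>) [0..<p + q]"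
    have "inv \<sigma> i = inv \<tau> i" for i
    proof (cases "i < p + q")
      case True
      have "map (inv \<sigma>) [0..<p + q] ! i = map (inv \<tau>) [0..<p + q] ! i" by (simp only: *)
      then show ?thesis using True by simp
    next
      case False
      then show ?thesis using permutes_not_in[OF permutes_inv[OF s]] permutes_not_in[OF permutes_inv[OF t]] by simp
    qed
    then have "inv \<sigma> = inv \<tau>" by blast
    then have "inv (inv \<sigma>) = inv (inv \<tau>)" by simp
    then show "\<sigma> = \<tau>" using permutes_inv_inv[OF s] permutes_inv_inv[OF t] by simp
  qed simp
next
  fix \<sigma> assume "\<sigma> \<in> Bat p q"
  then have s: "\<sigma> permutes {..<p + q}" and m: "strict_mono_on {..<p} \<sigma>" "strict_mono_on {p..<p + q} \<sigma>"
    by (auto simp: Bat_def)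
  let ?js = "map (inv \<sigma>) [0..<p + q]"
  have s': "inv \<sigma> permutes {..<p + q}" by (rule permutes_inv[OF s])
  have dist: "distinct ?js"
    using inj_on_subset[OF permutes_inj[OF s'] subset_UNIV] by (simp add: distinct_map)
  have set: "set ?js = {..<p + q}"
    using permutes_image[OF s'] by (simp add: atLeast0LessThan)
  \<comment> \<open>Where \<sigma> is increasing its inverse is too, on pairs of places whose
    positions lie in the same block.\<close>
  have inc: "inv \<sigma> i < inv \<sigma> j" if "i < j" "inv \<sigma> i \<in> S" "inv \<sigma> j \<in> S" "strict_mono_on S \<sigma>" for i j S
  proof (rule ccontr)
    assume "\<not> ?thesis"
    then consider "inv \<sigma> j < inv \<sigma> i" | "inv \<sigma> j = inv \<sigma> i" by linarith
    then have "\<sigma> (inv \<sigma> j) \<le> \<sigma> (inv \<sigma> i)"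
      using that strict_mono_onD[OF that(4)] by cases (auto simp: less_imp_le)
    then show False using that(1) by (simp add: permutes_inverses[OF s])
  qed
  have sorted: "sorted_wrt (<) (filter P ?js)" if P: "\<And>i. i < p + q \<Longrightarrow> P i \<Longrightarrow> i \<in> S" and S: "strict_mono_on S \<sigma>" for P S
  proof -
    have "sorted_wrt (\<lambda>i j. i < j \<and> i < p + q \<and> j < p + q) [0..<p + q]"
      by (rule sorted_wrt_mono_rel[OF _ sorted_wrt_upt]) auto
    then have "sorted_wrt (\<lambda>i j. i < j \<and> i < p + q \<and> j < p + q) (filter (P \<circ> inv \<sigma>) [0..<p + q])"
      by (rule sorted_wrt_filter)
    then have "sorted_wrt (\<lambda>i j. inv \<sigma> i < inv \<sigma> j) (filter (P \<circ> inv \<sigma>) [0..<p + q])"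
    proof (rule sorted_wrt_mono_rel[rotated])
      fix i j assume "i \<in> set (filter (P \<circ> inv \<sigma>) [0..<p + q])" "j \<in> set (filter (P \<circ> inv \<sigma>) [0..<p + q])"
        "i < j \<and> i < p + q \<and> j < p + q"
      then show "inv \<sigma> i < inv \<sigma> j"
        using permutes_in_image[OF s'] by (intro inc[OF _ P P S]) auto
    qed
    then show ?thesis by (simp add: filter_map sorted_wrt_map)
  qed
  have eq: "xs = ys" if "sorted_wrt (<) xs" "sorted_wrt (<) ys" "set xs = set ys" for xs ys :: "nat list"
    by (rule trans[OF sl_set[OF that(1), symmetric, unfolded that(3)] sl_set[OF that(2)]])
  have 1: "filter (\<lambda>i. i < p) ?js = [0..<p]"
  proof (rule eq)
    show "sorted_wrt (<) (filter (\<lambda>i. i < p) ?js)" by (rule sorted[OF _ m(1)]) simp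
    show "set (filter (\<lambda>i. i < p) ?js) = set [0..<p]" unfolding set_filter set by auto
  qed (rule sorted_wrt_upt)
  have 2: "filter (\<lambda>i. \<not> i < p) ?js = [p..<p + q]"
  proof (rule eq)
    show "sorted_wrt (<) (filter (\<lambda>i. \<not> i < p) ?js)" by (rule sorted[OF _ m(2)]) simp
    show "set (filter (\<lambda>i. \<not> i < p) ?js) = set [p..<p + q]" unfolding set_filter set by auto
  qed (rule sorted_wrt_upt)
  show "?js \<in> shuffles [0..<p] [p..<p + q]"
    using partition_in_shuffles[of ?js "\<lambda>i. i < p"] unfolding 1 2 .
next
  fix js assume js: "js \<in> shuffles [0..<p] [p..<p + q]"
  have set: "set js = {..<p + q}" using set_shuffles[OF js] by auto
  have len: "length js = p + q" using length_shuffles[OF js] by simp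
  have dist: "distinct js" using js by (rule distinct_disjoint_shuffles[rotated 3]) auto
  \<comment> \<open>\<open>js\<close> read as a permutation, the identity beyond the end of the
    list; the shuffle permutation sought is its inverse.\<close>
  define \<tau> where "\<tau> = (\<lambda>i. if i < p + q then js ! i else i)"
  have bij: "bij_betw \<tau> {..<p + q} {..<p + q}"
    unfolding bij_betw_def
  proof
    show "inj_on \<tau> {..<p + q}" using dist len by (auto simp: inj_on_def \<tau>_def nth_eq_iff_index_eq)
    have "\<tau> ` {..<p + q} = set js" by (auto simp: \<tau>_def set_conv_nth len)
    then show "\<tau> ` {..<p + q} = {..<p + q}" by (simp add: set)
  qed
  then have t: "\<tau> permutes {..<p + q}" by (rule bij_imp_permutes) (simp add: \<tau>_def)
  let ?\<sigma> = "inv \<tau>"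
  have fl: "filter (\<lambda>i. i < p) js = [0..<p]"
  proof -
    have "filter (\<lambda>i. i < p) js \<in> shuffles (filter (\<lambda>i. i < p) [0..<p]) (filter (\<lambda>i. i < p) [p..<p + q])"
      unfolding filter_shuffles[symmetric] using js by (rule imageI)
    moreover have "filter (\<lambda>i. i < p) [0..<p] = [0..<p]" "filter (\<lambda>i. i < p) [p..<p + q] = []"
      by (auto intro: filter_True simp: filter_empty_conv)
    ultimately show ?thesis by simp
  qed
  have fr: "filter (\<lambda>i. p \<le> i) js = [p..<p + q]"
  proof -
    have "filter (\<lambda>i. p \<le> i) js \<in> shuffles (filter (\<lambda>i. p \<le> i) [0..<p]) (filter (\<lambda>i. p \<le> i) [p..<p + q])"
      unfolding filter_shuffles[symmetric] using js by (rule imageI)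
    moreover have "filter (\<lambda>i. p \<le> i) [0..<p] = []" "filter (\<lambda>i. p \<le> i) [p..<p + q] = [p..<p + q]"
      by (auto intro: filter_True simp: filter_empty_conv)
    ultimately show ?thesis by simp
  qed
  \<comment> \<open>If the subsequence of entries satisfying \<open>P\<close> is increasing, then so
    are these entries at their positions in the full list.\<close>
  have srt: "sorted_wrt (\<lambda>a b. P a \<and> P b \<longrightarrow> a < b) xs" if "sorted_wrt (<) (filter P xs)" for P and xs :: "nat list"
    using that by (induction xs) (auto split: if_splits)
  have mono: "strict_mono_on S ?\<sigma>" if S: "S \<subseteq> {..<p + q}" "\<And>i. i \<in> S \<Longrightarrow> P i" and f: "sorted_wrt (<) (filter P js)" for S P
  proof (rule strict_mono_onI)
    fix i j assume ij: "i \<in> S" "j \<in> S" "i < j"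
    have lt: "?\<sigma> i < p + q" "?\<sigma> j < p + q" using S ij permutes_in_image[OF permutes_inv[OF t]] by auto
    have nth: "js ! ?\<sigma> i = i" "js ! ?\<sigma> j = j"
      using permutes_inverses(1)[OF t, of i] permutes_inverses(1)[OF t, of j] lt by (auto simp: \<tau>_def)
    show "?\<sigma> i < ?\<sigma> j"
    proof (rule ccontr)
      assume "\<not> ?thesis"
      moreover have "?\<sigma> i \<noteq> ?\<sigma> j" using nth ij by auto
      ultimately have "?\<sigma> j < ?\<sigma> i" by simp
      then have "P (js ! ?\<sigma> j) \<and> P (js ! ?\<sigma> i) \<longrightarrow> js ! ?\<sigma> j < js ! ?\<sigma> i"
        using srt[OF f] lt len by (auto simp: sorted_wrt_iff_nth_less)
      then show False using nth ij S by auto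
    qed
  qed
  have "?\<sigma> \<in> Bat p q"
    unfolding Bat_def mem_Collect_eq
  proof (intro conjI permutes_inv[OF t])
    show "strict_mono_on {..<p} ?\<sigma>" by (rule mono[where P = "\<lambda>i. i < p"]) (auto simp: fl)
    show "strict_mono_on {p..<p + q} ?\<sigma>" by (rule mono[where P = "\<lambda>i. p \<le> i"]) (auto simp: fr)
  qed
  moreover have "map (inv ?\<sigma>) [0..<p + q] = js"
    unfolding permutes_inv_inv[OF t] by (rule nth_equalityI) (auto simp: len \<tau>_def)
  ultimately show "\<exists>\<sigma>\<in>Bat p q. js = map (inv \<sigma>) [0..<p + q]" by (intro bexI[of _ ?\<sigma>]) simp_all
qed

lemma map_nth_append:
  "map ((!) (u @ v)) [0..<length u] = u" "map ((!) (u @ v)) [length u..<length u + length v] = v"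
  by (rule nth_equalityI; simp add: nth_append)+

lemma rearrange_map: "rearrange \<sigma> w = map ((!) w) (map (inv \<sigma>) [0..<length w])"
  by (simp add: rearrange_def)

lemma sum_Bat: "(\<Sum>\<sigma>\<in>Bat p q. F (map (inv \<sigma>) [0..<p + q])) = (\<Sum>js\<in>shuffles [0..<p] [p..<p + q]. F js)"
  by (rule sum.reindex_bij_betw[OF Bat_bij])

lemma ev_bat: "ev \<phi> (bat e u v) = sh e \<phi> u v"
proof -
  let ?w = "(!) (u @ v)"
  let ?F = "\<lambda>js. koszul (\<lambda>i. e (?w i)) js * \<phi> (map ?w js)"
  have "ev \<phi> (bat e u v) = (\<Sum>\<sigma>\<in>Bat (length u) (length v).
      ?F (map (inv \<sigma>) [0..<length u + length v]))"
    unfolding bat_def by (simp add: rearrange_map koszul_inv_def del: map_map map_append)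
  also have "\<dots> = (\<Sum>js\<in>shuffles [0..<length u] [length u..<length u + length v]. ?F js)"
    by (rule sum_Bat[of ?F])
  also have "\<dots> = sh e \<phi> (map ?w [0..<length u]) (map ?w [length u..<length u + length v])"
    by (rule sum_shuffles_sh) (auto simp: sorted_wrt_upt)
  finally show ?thesis by (simp only: map_nth_append)
qed

lemma ev_ell2:
  "ev \<phi> (ell2 scale a b brk X Y)
    = br (ldeg a) (b - a + 1) (\<lambda>x y. Poly_Mapping.single (ell_letter scale a b brk x y) 1) \<phi> X Y"
    (is "_ = br ?e ?c ?el \<phi> X Y")
proof -
  let ?w = "(!) (X @ Y)" and ?p = "length X" and ?q = "length Y"
  let ?kz = "koszul (\<lambda>i. ?e (?w i))"
  let ?F = "\<lambda>js. ?kz js * adj ?e ?c ?el ?p ?w \<phi> js"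
  have "ev \<phi> (ell2 scale a b brk X Y)
      = (\<Sum>\<sigma>\<in>Bat ?p ?q. ?F (map (inv \<sigma>) [0..<?p + ?q]))"
    unfolding ell2_def Let_def ev_sum
  proof (rule sum.cong[OF refl])
    fix \<sigma> :: "nat \<Rightarrow> nat"
    let ?js = "map (inv \<sigma>) [0..<?p + ?q]"
    let ?W = "map ?w ?js"
    have W: "rearrange \<sigma> (X @ Y) = ?W" by (simp add: rearrange_map)
    have k: "koszul_inv ?e (X @ Y) \<sigma> = ?kz ?js" by (simp add: koszul_inv_def)
    let ?F = "\<lambda>k. sg (?c * word_deg ?e (take k ?W)) * ev (\<lambda>z. \<phi> (take k ?W @ z # drop (k + 2) ?W)) (?el (?W ! k) (?W ! (k + 1)))"
    have "(\<Sum>k\<in>{k. k + 1 < ?p + ?q \<and> inv \<sigma> k < ?p \<and> ?p \<le> inv \<sigma> (k + 1)}. ?F k)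
      = (\<Sum>k<length ?js. if k + 1 < length ?js \<and> ?js ! k < ?p \<and> ?p \<le> ?js ! (k + 1) then ?F k else 0)"
      by (rule sum.mono_neutral_cong_left) auto
    also have "\<dots> = adj ?e ?c ?el ?p ?w \<phi> ?js" by (rule adj_sum)
    finally have "ev \<phi> (\<Sum>k\<in>{k. k + 1 < ?p + ?q \<and> inv \<sigma> k < ?p \<and> ?p \<le> inv \<sigma> (k + 1)}. Poly_Mapping.single
          (take k ?W @ ell_letter scale a b brk (?W ! k) (?W ! (k + 1)) # drop (k + 2) ?W)
          (?kz ?js * (-1) powi (?c * hdeg a (take k ?W)))) = ?kz ?js * adj ?e ?c ?el ?p ?w \<phi> ?js"
      by (simp add: sum_distrib_left[symmetric] hdeg_def sg_fold mult.assoc del: map_map)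
    then show "(\<Sum>k\<in>{k. k + 1 < ?p + ?q \<and> inv \<sigma> k < ?p \<and> ?p \<le> inv \<sigma> (k + 1)}. ev \<phi> (Poly_Mapping.single
          (take k (rearrange \<sigma> (X @ Y)) @ ell_letter scale a b brk (rearrange \<sigma> (X @ Y) ! k) (rearrange \<sigma> (X @ Y) ! (k + 1)) # drop (k + 2) (rearrange \<sigma> (X @ Y)))
          (koszul_inv ?e (X @ Y) \<sigma> * (-1) powi (?c * hdeg a (take k (rearrange \<sigma> (X @ Y))))))) = ?kz ?js * adj ?e ?c ?el ?p ?w \<phi> ?js"
      unfolding W k ev_sum .
  qed
  also have "\<dots> = (\<Sum>js\<in>shuffles [0..<?p] [?p..<?p + ?q]. ?F js)"
    by (rule sum_Bat[of ?F])
  also have "\<dots> = br ?e ?c ?el \<phi> (map ?w [0..<?p]) (map ?w [?p..<?p + ?q])"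
    by (rule sum_shuffles_br) (auto simp: sorted_wrt_upt)
  finally show ?thesis by (simp only: map_nth_append)
qed

lemma ev_D:
  "ev \<phi> (D scale a mul d X) = wD (ldeg a) (\<lambda>x. Poly_Mapping.single (d_letter d x) 1)
     (\<lambda>x y. Poly_Mapping.single (mu_letter scale a mul x y) 1) \<phi> X"
proof (induction X arbitrary: \<phi>)
  case Nil
  show ?case by (simp add: D_def d1_def mu1_def)
next
  case (Cons x X)
  have 1: "ev \<phi> (d1 a d (x # X)) = \<phi> (d_letter d x # X) + sg (ldeg a x) * ev (\<lambda>W. \<phi> (x # W)) (d1 a d X)"
    by (simp add: d1_def sum.lessThan_Suc_shift sum_distrib_left hdeg_def sg_fold sg_add mult.assoc del: sum.lessThan_Suc)
  have 2: "ev \<phi> (mu1 scale a mul (x # X)) = head_mul (\<lambda>x y. Poly_Mapping.single (mu_letter scale a mul x y) 1) \<phi> x X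
      + sg (ldeg a x) * ev (\<lambda>W. \<phi> (x # W)) (mu1 scale a mul X)"
    by (cases X) (simp_all add: mu1_def sum.lessThan_Suc_shift sum_distrib_left hdeg_def sg_fold sg_add mult.assoc del: sum.lessThan_Suc)
  show ?case using Cons.IH[of "\<lambda>W. \<phi> (x # W)"]
    by (simp add: D_def 1 2 distrib_left[symmetric])
qed

lemma nths_sl:
  assumes "I \<subseteq> {..<length Xs}"
  shows "nths Xs I = map ((!) Xs) (sl I)"
proof -
  have "nths Xs I = map ((!) Xs) (filter (\<lambda>i. i \<in> I) [0..<length Xs])"
  proof (induction Xs rule: rev_induct)
    case (snoc x Xs)
    then show ?case by (auto simp: nths_append nth_append)
  qed simp
  also have "filter (\<lambda>i. i \<in> I) [0..<length Xs] = sl (set (filter (\<lambda>i. i \<in> I) [0..<length Xs]))"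
    by (rule sl_set[symmetric]) (simp add: sorted_wrt_filter sorted_wrt_upt)
  also have "set (filter (\<lambda>i. i \<in> I) [0..<length Xs]) = I" using assms by auto
  finally show ?thesis .
qed

section \<open>The bicoalgebra of a differential graded (a,b)-algebra\<close>

context dg_ab_algebra begin

definition letter_set :: "(int \<times> 'v) set" where
  "letter_set = gens (algebra_space scale A)"

abbreviation "rels \<equiv> grels (algebra_space scale A)"

text \<open>Zero on letters \<open>(i, x)\<close> with \<open>x \<notin> A i\<close>, so that the identities hold for all letters.\<close>

definition dl :: "int \<times> 'v \<Rightarrow> (int \<times> 'v \<Rightarrow>\<^sub>0 'k)" where
  "dl x = (if x \<in> letter_set then Poly_Mapping.single (d_letter d x) 1 else 0)"

definition mu :: "int \<times> 'v \<Rightarrow> int \<times> 'v \<Rightarrow> (int \<times> 'v \<Rightarrow>\<^sub>0 'k)" where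
  "mu x y = (if x \<in> letter_set \<and> y \<in> letter_set then Poly_Mapping.single (mu_letter scale a mul x y) 1 else 0)"

definition el :: "int \<times> 'v \<Rightarrow> int \<times> 'v \<Rightarrow> (int \<times> 'v \<Rightarrow>\<^sub>0 'k)" where
  "el x y = (if x \<in> letter_set \<and> y \<in> letter_set then Poly_Mapping.single (ell_letter scale a b brk x y) 1 else 0)"

definition kills :: "(int \<times> 'v \<Rightarrow> 'k) \<Rightarrow> bool" where
  "kills \<psi> \<longleftrightarrow> (\<forall>r\<in>rels. ev \<psi> r = 0)"

lemma in_letter_set: "(i, x) \<in> letter_set \<longleftrightarrow> x \<in> A i"
  by (simp add: letter_set_def algebra_space_def)

lemma not_letter [simp]:
  "x \<notin> letter_set \<Longrightarrow> dl x = 0" "x \<notin> letter_set \<Longrightarrow> mu x y = 0" "y \<notin> letter_set \<Longrightarrow> mu x y = 0"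
  "x \<notin> letter_set \<Longrightarrow> el x y = 0" "y \<notin> letter_set \<Longrightarrow> el x y = 0"
  by (simp_all add: dl_def mu_def el_def)

lemma kills_iff: "kills \<psi> \<longleftrightarrow> (\<forall>i s t. \<forall>x\<in>A i. \<forall>y\<in>A i.
    \<psi> (i, scale s x + scale t y) = s * \<psi> (i, x) + t * \<psi> (i, y))"
proof -
  have "kills \<psi> \<longleftrightarrow> (\<forall>i s t. \<forall>x\<in>A i. \<forall>y\<in>A i.
    ev \<psi> (Poly_Mapping.single (i, scale s x + scale t y) 1
                - Poly_Mapping.single (i, x) s - Poly_Mapping.single (i, y) t) = 0)"
    unfolding kills_def algebra_space_def gspace.simps by blast
  then show ?thesis by (simp add: diff_diff_eq)
qed

lemma kills_comb: "kills \<psi> \<Longrightarrow> x \<in> A i \<Longrightarrow> y \<in> A i \<Longrightarrow> \<psi> (i, scale s x + scale t y) = s * \<psi> (i, x) + t * \<psi> (i, y)"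
  by (simp add: kills_iff)

lemma kills_scale: "kills \<psi> \<Longrightarrow> x \<in> A i \<Longrightarrow> \<psi> (i, scale s x) = s * \<psi> (i, x)"
  using kills_comb[of \<psi> x i x s 0] by simp

lemma kills_add: "kills \<psi> \<Longrightarrow> x \<in> A i \<Longrightarrow> y \<in> A i \<Longrightarrow> \<psi> (i, x + y) = \<psi> (i, x) + \<psi> (i, y)"
  using kills_comb[of \<psi> x i y 1 1] by simp

lemma kills_add_scale: "kills \<psi> \<Longrightarrow> x \<in> A i \<Longrightarrow> y \<in> A i \<Longrightarrow> \<psi> (i, x + scale t y) = \<psi> (i, x) + t * \<psi> (i, y)"
  using kills_comb[of \<psi> x i y 1 t] by simp

lemma zero_A: "0 \<in> A i"
  by (rule subspace_0[OF subspace_A])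

lemma scale_A: "x \<in> A i \<Longrightarrow> scale s x \<in> A i"
  by (rule subspace_scale[OF subspace_A])

lemma add_A: "x \<in> A i \<Longrightarrow> y \<in> A i \<Longrightarrow> x + y \<in> A i"
  by (rule subspace_add[OF subspace_A])

lemma kills_0: "kills \<psi> \<Longrightarrow> \<psi> (i, 0) = 0"
  using kills_scale[of \<psi> 0 i 0] zero_A by simp

lemma linear_combination:
  "Vector_Spaces.linear scale scale f \<Longrightarrow> f (scale s y + scale t z) = scale s (f y) + scale t (f z)"
  by (simp add: linear_iff_module_hom module_hom.add module_hom.scale)

lemma linear_comb:
  "mul x (scale s y + scale t z) = scale s (mul x y) + scale t (mul x z)"
  "mul (scale s y + scale t z) x = scale s (mul y x) + scale t (mul z x)"
  "brk x (scale s y + scale t z) = scale s (brk x y) + scale t (brk x z)"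
  "brk (scale s y + scale t z) x = scale s (brk y x) + scale t (brk z x)"
  "d (scale s y + scale t z) = scale s (d y) + scale t (d z)"
  by (rule linear_combination mul_linear brk_linear d_linear)+

lemma ev_dl: "x \<in> A i \<Longrightarrow> ev \<psi> (dl (i, x)) = \<psi> (i + 1, d x)"
  by (simp add: dl_def in_letter_set d_letter_def)

text \<open>\<open>mu_letter\<close> stores its sign inside the letter, as a scalar multiple of the
  algebra element. It becomes a coefficient only under a functional that kills the relations of the
  letters.\<close>

lemma ev_mu: "kills \<psi> \<Longrightarrow> x \<in> A i \<Longrightarrow> y \<in> A j \<Longrightarrow> ev \<psi> (mu (i, x) (j, y)) = sg (i + a - 1) * \<psi> (i + j + a, mul x y)"
  by (simp add: mu_def in_letter_set mu_letter_def ldeg_def sg_fold kills_scale mul_degree)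

lemma ev_el: "kills \<psi> \<Longrightarrow> x \<in> A i \<Longrightarrow> y \<in> A j \<Longrightarrow>
    ev \<psi> (el (i, x) (j, y)) = sg ((b - a + 1) * (i + a - 1)) * \<psi> (i + j + b, brk x y)"
  by (simp add: el_def in_letter_set ell_letter_def ldeg_def sg_fold kills_scale brk_degree)

lemma kills_dl: "kills \<psi> \<Longrightarrow> kills (\<lambda>x. ev \<psi> (dl x))"
  unfolding kills_iff[of "\<lambda>x. ev \<psi> (dl x)"]
  by (simp add: ev_dl add_A scale_A linear_comb kills_comb d_degree)

lemma kills_mu_left:
  assumes "kills \<psi>" shows "kills (\<lambda>x. ev \<psi> (mu x y))"
proof (cases "y \<in> letter_set")
  case True
  obtain j z where y: "y = (j, z)" by (cases y)
  then have "z \<in> A j" using True by (simp add: in_letter_set)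
  then show ?thesis using assms unfolding y kills_iff[of "\<lambda>x. ev \<psi> (mu x (j, z))"]
    by (simp add: ev_mu add_A scale_A linear_comb kills_comb mul_degree distrib_left mult.left_commute)
qed (simp add: kills_def)

lemma kills_mu_right:
  assumes "kills \<psi>" shows "kills (\<lambda>y. ev \<psi> (mu x y))"
proof (cases "x \<in> letter_set")
  case True
  obtain j z where y: "x = (j, z)" by (cases x)
  then have "z \<in> A j" using True by (simp add: in_letter_set)
  then show ?thesis using assms unfolding y kills_iff[of "\<lambda>y. ev \<psi> (mu (j, z) y)"]
    by (simp add: ev_mu add_A scale_A linear_comb kills_comb mul_degree distrib_left mult.left_commute)
qed (simp add: kills_def)

lemma kills_el_left:
  assumes "kills \<psi>" shows "kills (\<lambda>x. ev \<psi> (el x y))"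
proof (cases "y \<in> letter_set")
  case True
  obtain j z where y: "y = (j, z)" by (cases y)
  then have "z \<in> A j" using True by (simp add: in_letter_set)
  then show ?thesis using assms unfolding y kills_iff[of "\<lambda>x. ev \<psi> (el x (j, z))"]
    by (simp add: ev_el add_A scale_A linear_comb kills_comb brk_degree distrib_left mult.left_commute)
qed (simp add: kills_def)

lemma kills_el_right:
  assumes "kills \<psi>" shows "kills (\<lambda>y. ev \<psi> (el x y))"
proof (cases "x \<in> letter_set")
  case True
  obtain j z where y: "x = (j, z)" by (cases x)
  then have "z \<in> A j" using True by (simp add: in_letter_set)
  then show ?thesis using assms unfolding y kills_iff[of "\<lambda>y. ev \<psi> (el (j, z) y)"]
    by (simp add: ev_el add_A scale_A linear_comb kills_comb brk_degree distrib_left mult.left_commute)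
qed (simp add: kills_def)

lemma in_A: "x \<in> A i \<Longrightarrow> i = j \<Longrightarrow> x \<in> A j" by simp

text \<open>A letter carries its degree, and different bracketings yield it in different syntactic
  forms. Hence the degree is a variable \<open>k\<close> with an equation, here and in the other
  \<open>val_\<close> lemmas.\<close>

lemma val_skew:
  assumes "kills \<psi>" "x \<in> A i" "y \<in> A j" "k = i + j + b"
  shows "\<psi> (k, brk x y) = - (sg ((i + b) * (j + b)) * \<psi> (k, brk y x))"
proof -
  have yx: "brk y x \<in> A k" by (rule in_A[OF brk_degree[OF assms(3,2)]]) (simp add: assms)
  have "\<psi> (k, brk x y) = \<psi> (k, scale (- sg ((i + b) * (j + b))) (brk y x))"
    using brk_skew[OF assms(2,3)] by (simp add: sg_fold)
  then show ?thesis unfolding kills_scale[OF assms(1) yx] by simp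
qed

lemma val_jacobi:
  assumes "kills \<psi>" "x \<in> A i" "y \<in> A j" "z \<in> A l" "k = i + j + l + 2 * b"
  shows "\<psi> (k, brk (brk y z) x) = - (sg ((j + b) * (i + b) + (i + b) * (l + b)) * \<psi> (k, brk (brk x y) z)
     + sg ((j + b) * (i + b) + (l + b) * (j + b)) * \<psi> (k, brk (brk z x) y))"
proof -
  have m: "brk (brk x y) z \<in> A k" "brk (brk y z) x \<in> A k" "brk (brk z x) y \<in> A k"
    using brk_degree[OF brk_degree[OF assms(2,3)] assms(4)] brk_degree[OF brk_degree[OF assms(3,4)] assms(2)]
      brk_degree[OF brk_degree[OF assms(4,2)] assms(3)] by (simp_all add: assms(5) algebra_simps)
  let ?s = "sg ((i + b) * (l + b))" and ?t = "sg ((j + b) * (i + b))" and ?u = "sg ((l + b) * (j + b))"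
  have "\<psi> (k, scale ?s (brk (brk x y) z) + scale ?t (brk (brk y z) x) + scale ?u (brk (brk z x) y)) = 0"
    using brk_jacobi[OF assms(2-4)] by (simp add: sg_fold kills_0 assms(1))
  then have "?s * \<psi> (k, brk (brk x y) z) + ?t * \<psi> (k, brk (brk y z) x) + ?u * \<psi> (k, brk (brk z x) y) = 0"
    using m by (simp add: kills_add kills_scale add_A scale_A assms(1))
  then have "?t * (?s * \<psi> (k, brk (brk x y) z) + ?t * \<psi> (k, brk (brk y z) x) + ?u * \<psi> (k, brk (brk z x) y)) = 0"
    by simp
  then have "\<psi> (k, brk (brk y z) x) + (?t * ?s * \<psi> (k, brk (brk x y) z) + ?t * ?u * \<psi> (k, brk (brk z x) y)) = 0"
    by (simp add: distrib_left sg_mult_self_left mult.assoc add_ac)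
  then show ?thesis unfolding eq_neg_iff_add_eq_0 sg_add .
qed

lemma val_commute:
  assumes "kills \<psi>" "x \<in> A i" "y \<in> A j" "k = i + j + a"
  shows "\<psi> (k, mul x y) = sg ((i + a) * (j + a)) * \<psi> (k, mul y x)"
proof -
  have yx: "mul y x \<in> A k" by (rule in_A[OF mul_degree[OF assms(3,2)]]) (simp add: assms)
  have "\<psi> (k, mul x y) = \<psi> (k, scale (sg ((i + a) * (j + a))) (mul y x))"
    using mul_commute[OF assms(2,3)] by (simp add: sg_fold)
  then show ?thesis unfolding kills_scale[OF assms(1) yx] by simp
qed

lemma val_leibniz:
  assumes "kills \<psi>" "x \<in> A i" "y \<in> A j" "z \<in> A l" "k = i + j + l + a + b"
  shows "\<psi> (k, brk x (mul y z)) = \<psi> (k, mul (brk x y) z) + sg ((j + a) * (i + b)) * \<psi> (k, mul y (brk x z))"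
proof -
  have m: "mul (brk x y) z \<in> A k" by (rule in_A[OF mul_degree[OF brk_degree[OF assms(2,3)] assms(4)]]) (simp add: assms)
  have m': "mul y (brk x z) \<in> A k" by (rule in_A[OF mul_degree[OF assms(3) brk_degree[OF assms(2,4)]]]) (simp add: assms)
  show ?thesis unfolding brk_leibniz[OF assms(2-4)] sg_fold by (rule kills_add_scale[OF assms(1) m m'])
qed

lemma val_d_mul:
  assumes "kills \<psi>" "x \<in> A i" "y \<in> A j" "k = i + j + a + 1"
  shows "\<psi> (k, d (mul x y)) = \<psi> (k, mul (d x) y) + sg (i + a) * \<psi> (k, mul x (d y))"
proof -
  have m: "mul (d x) y \<in> A k" by (rule in_A[OF mul_degree[OF d_degree[OF assms(2)] assms(3)]]) (simp add: assms)
  have m': "mul x (d y) \<in> A k" by (rule in_A[OF mul_degree[OF assms(2) d_degree[OF assms(3)]]]) (simp add: assms)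
  show ?thesis unfolding d_mul[OF assms(2-3)] sg_fold by (rule kills_add_scale[OF assms(1) m m'])
qed

lemma val_d_brk:
  assumes "kills \<psi>" "x \<in> A i" "y \<in> A j" "k = i + j + b + 1"
  shows "\<psi> (k, d (brk x y)) = \<psi> (k, brk (d x) y) + sg (i + b) * \<psi> (k, brk x (d y))"
proof -
  have m: "brk (d x) y \<in> A k" by (rule in_A[OF brk_degree[OF d_degree[OF assms(2)] assms(3)]]) (simp add: assms)
  have m': "brk x (d y) \<in> A k" by (rule in_A[OF brk_degree[OF assms(2) d_degree[OF assms(3)]]]) (simp add: assms)
  show ?thesis unfolding d_brk[OF assms(2-3)] sg_fold by (rule kills_add_scale[OF assms(1) m m'])
qed

lemmas ev_letters = ev_dl ev_mu ev_el kills_dl kills_mu_left kills_mu_right kills_el_left kills_el_right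
  d_degree mul_degree brk_degree

lemma letter_cases:
  obtains "x \<notin> letter_set" | i y where "x = (i, y)" "y \<in> A i"
  by (cases x) (use in_letter_set in blast)

lemma letters: "letters (ldeg a) (b - a + 1) dl mu el rels"
proof
  let ?e = "ldeg a" and ?c = "b - a + 1"
  show "?e z = ?e x + 1" if "z \<in> Poly_Mapping.keys (dl x)" for x z
    using that by (auto simp: dl_def d_letter_def ldeg_def split: if_splits prod.splits)
  show "?e z = ?e x + ?e y + 1" if "z \<in> Poly_Mapping.keys (mu x y)" for x y z
    using that by (auto simp: mu_def mu_letter_def ldeg_def split: if_splits prod.splits)
  show "?e z = ?e x + ?e y + ?c" if "z \<in> Poly_Mapping.keys (el x y)" for x y z
    using that by (auto simp: el_def ell_letter_def ldeg_def split: if_splits prod.splits)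
  show "\<exists>m. \<forall>z\<in>Poly_Mapping.keys r. ?e z = m" if r: "r \<in> rels" for r
  proof -
    obtain i x y s t where r: "r = Poly_Mapping.single (i, scale s x + scale t y) 1
                - Poly_Mapping.single (i, x) s - Poly_Mapping.single (i, y) t"
      using r by (auto simp: algebra_space_def)
    have "Poly_Mapping.keys r \<subseteq> {(i, scale s x + scale t y), (i, x), (i, y)}"
      unfolding r by (auto simp: in_keys_iff lookup_minus lookup_single when_def split: if_splits)
    then have "\<forall>z\<in>Poly_Mapping.keys r. ?e z = i + a - 1" by (auto simp: ldeg_def)
    then show ?thesis by blast
  qed
  fix \<psi> :: "int \<times> 'v \<Rightarrow> 'k" assume "\<And>r. r \<in> rels \<Longrightarrow> ev \<psi> r = 0"
  then have k: "kills \<psi>" by (simp add: kills_def)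
  show "ev (\<lambda>x. ev \<psi> (dl x)) r = 0" "ev (\<lambda>x. ev \<psi> (mu x y)) r = 0" "ev (\<lambda>y. ev \<psi> (mu x y)) r = 0"
    "ev (\<lambda>x. ev \<psi> (el x y)) r = 0" if "r \<in> rels" for r x y
    using kills_dl[OF k] kills_mu_left[OF k] kills_mu_right[OF k] kills_el_left[OF k] that
    by (simp_all add: kills_def)
  note S = sg_simps algebra_simps sg_alt[of 2]
  fix x y z :: "int \<times> 'v"
  show "ev (\<lambda>w. ev \<psi> (dl w)) (dl x) = 0"
    by (cases x rule: letter_cases) (simp_all add: k ev_letters d_square kills_0)
  show "ev \<psi> (el x y) = - (sg (?c + ?e x * ?e y) * ev \<psi> (el y x))"
  proof (cases x rule: letter_cases)
    case x: (2 i x')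
    show ?thesis
    proof (cases y rule: letter_cases)
      case y: (2 j y')
      have "\<psi> (j + i + b, brk y' x') = - (sg ((j + b) * (i + b)) * \<psi> (j + i + b, brk x' y'))"
        by (rule val_skew) (use k x y in auto)
      then show ?thesis using x y by (simp add: k ev_letters ldeg_def S)
    qed simp
  qed simp
  show "ev \<psi> (mu x y) = - (sg (?e x * ?e y) * ev \<psi> (mu y x))"
  proof (cases x rule: letter_cases)
    case x: (2 i x')
    show ?thesis
    proof (cases y rule: letter_cases)
      case y: (2 j y')
      have "\<psi> (j + i + a, mul y' x') = sg ((j + a) * (i + a)) * \<psi> (j + i + a, mul x' y')"
        by (rule val_commute) (use k x y in auto)
      then show ?thesis using x y by (simp add: k ev_letters ldeg_def S)
    qed simp
  qed simp
  show "ev (\<lambda>w. ev \<psi> (dl w)) (mu x y) = - ev (\<lambda>w. ev \<psi> (mu w y)) (dl x) - sg (?e x) * ev (\<lambda>w. ev \<psi> (mu x w)) (dl y)"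
  proof (cases x rule: letter_cases)
    case x: (2 i x')
    show ?thesis
    proof (cases y rule: letter_cases)
      case y: (2 j y')
      have "\<psi> (i + j + a + 1, d (mul x' y')) = \<psi> (i + j + a + 1, mul (d x') y') + sg (i + a) * \<psi> (i + j + a + 1, mul x' (d y'))"
        by (rule val_d_mul) (use k x y in auto)
      then show ?thesis using x y by (simp add: k ev_letters ldeg_def) (simp add: S)
    qed simp
  qed simp
  show "ev (\<lambda>w. ev \<psi> (dl w)) (el x y) = sg ?c * ev (\<lambda>w. ev \<psi> (el w y)) (dl x) + sg (?e x + ?c) * ev (\<lambda>w. ev \<psi> (el x w)) (dl y)"
  proof (cases x rule: letter_cases)
    case x: (2 i x')
    show ?thesis
    proof (cases y rule: letter_cases)
      case y: (2 j y')
      have "\<psi> (i + j + b + 1, d (brk x' y')) = \<psi> (i + j + b + 1, brk (d x') y') + sg (i + b) * \<psi> (i + j + b + 1, brk x' (d y'))"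
        by (rule val_d_brk) (use k x y in auto)
      then show ?thesis using x y by (simp add: k ev_letters ldeg_def) (simp add: S)
    qed simp
  qed simp
  show "ev (\<lambda>w. ev \<psi> (mu w z)) (mu x y) = - (sg (?e x) * ev (\<lambda>w. ev \<psi> (mu x w)) (mu y z))"
  proof (cases x rule: letter_cases)
    case x: (2 i x')
    show ?thesis
    proof (cases y rule: letter_cases)
      case y: (2 j y')
      show ?thesis
      proof (cases z rule: letter_cases)
        case z: (2 l z')
        have "mul x' (mul y' z') = mul (mul x' y') z'" by (rule mul_assoc) (use x y z in auto)
        then show ?thesis using x y z by (simp add: k ev_letters ldeg_def) (simp add: S)
      qed simp
    qed simp
  qed simp
  show "ev (\<lambda>w. ev \<psi> (el x w)) (mu y z) = sg (?e x + ?c) * ev (\<lambda>w. ev \<psi> (mu w z)) (el x y)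
        + sg ((?e y + 1) * (?e x + ?c)) * ev (\<lambda>w. ev \<psi> (mu y w)) (el x z)"
  proof (cases x rule: letter_cases)
    case x: (2 i x')
    show ?thesis
    proof (cases y rule: letter_cases)
      case y: (2 j y')
      show ?thesis
      proof (cases z rule: letter_cases)
        case z: (2 l z')
        have *: "\<psi> (h, brk x' (mul y' z')) = \<psi> (h, mul (brk x' y') z') + sg ((j + a) * (i + b)) * \<psi> (h, mul y' (brk x' z'))"
          if "h = i + j + l + a + b" for h by (rule val_leibniz) (use k x y z that in auto)
        show ?thesis using x y z by (simp add: k ev_letters ldeg_def *) (simp add: S)
      qed simp
    qed simp
  qed simp
  show "ev (\<lambda>w. ev \<psi> (el x w)) (el y z) = sg (?c * ?e x + ?c) * ev (\<lambda>w. ev \<psi> (el w z)) (el x y)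
        + sg (?e x * ?e y + ?c * ?e x + ?c * ?e y + ?c) * ev (\<lambda>w. ev \<psi> (el y w)) (el x z)"
  proof (cases x rule: letter_cases)
    case x: (2 i x')
    show ?thesis
    proof (cases y rule: letter_cases)
      case y: (2 j y')
      show ?thesis
      proof (cases z rule: letter_cases)
        case z: (2 l z')
        \<comment> \<open>The axiom states Jacobi cyclically with left-nested brackets. The facts 1
          to 3 rewrite the right-nested ones by antisymmetry until only the three cyclic terms
          occur, and 4 eliminates one of them.\<close>
        have 1: "\<psi> (h, brk x' (brk y' z')) = - (sg ((i + b) * (j + l + b + b)) * \<psi> (h, brk (brk y' z') x'))"
          if "h = i + j + l + 2 * b" for h by (rule val_skew[OF k _ brk_degree]) (use x y z that in auto)
        have 2: "\<psi> (h, brk y' (brk x' z')) = - (sg ((j + b) * (i + l + b + b)) * \<psi> (h, brk (brk x' z') y'))"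
          if "h = i + j + l + 2 * b" for h by (rule val_skew[OF k _ brk_degree]) (use x y z that in auto)
        have 3: "\<psi> (h, brk (brk x' z') y') = - (sg ((i + b) * (l + b)) * \<psi> (h, brk (brk z' x') y'))"
          if "h = i + j + l + 2 * b" for h
        proof -
          have m: "brk (brk z' x') y' \<in> A h"
            using brk_degree[OF brk_degree[OF z(2) x(2)] y(2)] by (simp add: that algebra_simps)
          have "brk x' z' = scale (- sg ((i + b) * (l + b))) (brk z' x')"
            using brk_skew[of x' i z' l] x z by (simp add: sg_fold)
          then have "brk (brk x' z') y' = scale (- sg ((i + b) * (l + b))) (brk (brk z' x') y')"
            using linear_comb(4)[of "- sg ((i + b) * (l + b))" "brk z' x'" 0 0 y'] by simp
          then show ?thesis using kills_scale[OF k m, of "- sg ((i + b) * (l + b))"] by simp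
        qed
        have 4: "\<psi> (h, brk (brk y' z') x') = - (sg ((j + b) * (i + b) + (i + b) * (l + b)) * \<psi> (h, brk (brk x' y') z')
     + sg ((j + b) * (i + b) + (l + b) * (j + b)) * \<psi> (h, brk (brk z' x') y'))"
          if "h = i + j + l + 2 * b" for h by (rule val_jacobi) (use k x y z that in auto)
        show ?thesis using x y z by (simp add: k ev_letters ldeg_def 1 2 3 4) (simp add: S)
      qed simp
    qed simp
  qed simp
qed

end

section \<open>Words of letters as generators of the shuffle quotient\<close>

context dg_ab_algebra begin

abbreviation "ltdeg \<equiv> ldeg a :: int \<times> 'v \<Rightarrow> int"

definition word_set :: "(int \<times> 'v) list set" where
  "word_set = {w. w \<noteq> [] \<and> set w \<subseteq> letter_set}"

lemma gens_H: "gens (H_space scale A a) = word_set"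
  by (simp add: H_space_def bat_quotient_def tensor_plus_def V_space_def shift_def word_set_def letter_set_def)

lemma clip_word_set: "clip letter_set \<psi> W = (if W \<in> word_set then \<psi> W else 0)"
  by (simp add: clip_def word_set_def)

lemma letter_ops:
  "x \<in> letter_set \<Longrightarrow> d_letter d x \<in> letter_set"
  "x \<in> letter_set \<Longrightarrow> y \<in> letter_set \<Longrightarrow> mu_letter scale a mul x y \<in> letter_set"
  "x \<in> letter_set \<Longrightarrow> y \<in> letter_set \<Longrightarrow> ell_letter scale a b brk x y \<in> letter_set"
  by (cases x; cases y; auto simp: in_letter_set d_letter_def mu_letter_def ell_letter_def d_degree mul_degree
      brk_degree scale_A)+

lemma letter_ops_eq:
  "x \<in> letter_set \<Longrightarrow> dl x = Poly_Mapping.single (d_letter d x) 1"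
  "x \<in> letter_set \<Longrightarrow> y \<in> letter_set \<Longrightarrow> mu x y = Poly_Mapping.single (mu_letter scale a mul x y) 1"
  "x \<in> letter_set \<Longrightarrow> y \<in> letter_set \<Longrightarrow> el x y = Poly_Mapping.single (ell_letter scale a b brk x y) 1"
  by (simp_all add: dl_def mu_def el_def)

text \<open>On words of genuine letters the operations stay within the genuine letters, so the
  extension by 0 makes no difference. This connects the plain formulas to the locale
  \<open>letters\<close>.\<close>

lemma wD_letters:
  assumes "set X \<subseteq> letter_set" "\<And>W. W \<in> word_set \<Longrightarrow> \<phi> W = \<psi> W"
  shows "wD e (\<lambda>x. Poly_Mapping.single (d_letter d x) 1) (\<lambda>x y. Poly_Mapping.single (mu_letter scale a mul x y) 1) \<phi> X
    = wD e dl mu \<psi> X"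
  using assms
proof (induction X arbitrary: \<phi> \<psi>)
  case (Cons x X)
  have "wD e (\<lambda>x. Poly_Mapping.single (d_letter d x) 1) (\<lambda>x y. Poly_Mapping.single (mu_letter scale a mul x y) 1) (\<lambda>W. \<phi> (x # W)) X
    = wD e dl mu (\<lambda>W. \<psi> (x # W)) X"
    by (rule Cons.IH) (use Cons.prems in \<open>auto simp: word_set_def\<close>)
  moreover have "\<phi> (d_letter d x # X) = \<psi> (d_letter d x # X)"
    by (rule Cons.prems(2)) (use Cons.prems(1) in \<open>auto simp: word_set_def letter_ops\<close>)
  moreover have "\<phi> (mu_letter scale a mul x y # Y) = \<psi> (mu_letter scale a mul x y # Y)" if "X = y # Y" for y Y
    by (rule Cons.prems(2)) (use that Cons.prems(1) in \<open>auto simp: word_set_def letter_ops\<close>)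
  ultimately show ?case using Cons.prems(1) by (cases X) (simp_all add: letter_ops_eq)
qed simp

lemma br_letters:
  assumes "set X \<subseteq> letter_set" "set Y \<subseteq> letter_set" "\<And>W. W \<in> word_set \<Longrightarrow> \<phi> W = \<psi> W"
  shows "br e c (\<lambda>x y. Poly_Mapping.single (ell_letter scale a b brk x y) 1) \<phi> X Y = br e c el \<psi> X Y"
  using assms
proof (induction "length X + length Y" arbitrary: X Y \<phi> \<psi> rule: less_induct)
  case less
  let ?el = "\<lambda>x y. Poly_Mapping.single (ell_letter scale a b brk x y) (1::'k)"
  show ?case
  proof (cases "X = [] \<or> Y = []")
    case False
    then obtain x X' y Y' where *: "X = x # X'" "Y = y # Y'" by (meson list.exhaust)
    have 1: "br e c ?el (\<lambda>W. \<phi> (x # W)) X' (y # Y') = br e c el (\<lambda>W. \<psi> (x # W)) X' (y # Y')"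
      by (rule less.hyps) (use less.prems * in \<open>auto simp: word_set_def\<close>)
    have 2: "br e c ?el (\<lambda>W. \<phi> (y # W)) (x # X') Y' = br e c el (\<lambda>W. \<psi> (y # W)) (x # X') Y'"
      by (rule less.hyps) (use less.prems * in \<open>auto simp: word_set_def\<close>)
    have 3: "sh e (\<lambda>W. \<phi> (ell_letter scale a b brk x y # W)) X' Y' = sh e (\<lambda>W. \<psi> (ell_letter scale a b brk x y # W)) X' Y'"
      by (intro sh_cong less.prems(3)) (use less.prems(1,2) * in \<open>auto simp: word_set_def letter_ops\<close>)
    show ?thesis unfolding * br.simps 1 2 using less.prems(1,2) * by (simp add: 3 letter_ops_eq)
  qed auto
qed

text \<open>The value 0 off the generators makes the evaluation formulas with clipped functionals
  valid for all lists, as \<open>letters_space\<close> demands.\<close>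

definition Dg :: "(int \<times> 'v) list \<Rightarrow> ((int \<times> 'v) list \<Rightarrow>\<^sub>0 'k)" where
  "Dg X = (if X \<in> word_set then D scale a mul d X else 0)"

definition Bg :: "(int \<times> 'v) list \<Rightarrow> (int \<times> 'v) list \<Rightarrow> ((int \<times> 'v) list \<Rightarrow>\<^sub>0 'k)" where
  "Bg X Y = (if X \<in> word_set \<and> Y \<in> word_set then ell2'' scale a b brk X Y else 0)"

text \<open>This is \<delta>'' on a product with a single factor, where \<open>I\<close> and
  \<open>J\<close> are empty.\<close>

definition cg :: "(int \<times> 'v) list \<Rightarrow> ((int \<times> 'v) list \<times> (int \<times> 'v) list \<Rightarrow>\<^sub>0 'k)" where
  "cg X = (if X \<in> word_set then \<Sum>j\<in>{1..<length X}. let U = take j X; V = drop j X; u = hdeg2 a b U; v = hdeg2 a b V in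
     smul ((-1) powi ((a - b) * u)) (Poly_Mapping.single (U, V) 1 + Poly_Mapping.single (V, U) ((-1) powi (u * v + a - b + 1)))
     else 0)"

abbreviation "H_rels \<equiv> grels (H_space scale A a)"

lemma H_rels_eq: "H_rels = {lin (\<lambda>g. Poly_Mapping.single (u @ g # v) 1) r |u v r.
      set u \<subseteq> letter_set \<and> set v \<subseteq> letter_set \<and> r \<in> rels} \<union> {bat ltdeg u v |u v. u \<in> word_set \<and> v \<in> word_set}"
proof -
  have "gdeg (V_space scale A a) = ltdeg" by (simp add: gdeg_spaces)
  then show ?thesis
    by (simp add: H_space_def bat_quotient_def tensor_plus_def V_space_def shift_def word_set_def letter_set_def)
qed

lemma keys_rels: "r \<in> rels \<Longrightarrow> Poly_Mapping.keys r \<subseteq> letter_set"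
proof -
  assume "r \<in> rels"
  then obtain i x y s t where r: "r = Poly_Mapping.single (i, scale s x + scale t y) 1
                - Poly_Mapping.single (i, x) s - Poly_Mapping.single (i, y) t" "x \<in> A i" "y \<in> A i"
    by (auto simp: algebra_space_def)
  have "Poly_Mapping.keys r \<subseteq> {(i, scale s x + scale t y), (i, x), (i, y)}"
    unfolding r(1) by (auto simp: in_keys_iff lookup_minus lookup_single when_def split: if_splits)
  then show ?thesis using r(2,3) by (auto simp: in_letter_set add_A scale_A)
qed

lemma dc_sum: "dc \<psi> X = (\<Sum>j\<le>length X. \<psi> (take j X) (drop j X))"
  by (induction \<psi> X rule: dc.induct) (simp_all add: sum.atMost_Suc_shift del: sum.atMost_Suc)

sublocale lts: letters ltdeg "b - a + 1" dl mu el rels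
  by (rule letters)

sublocale lts: letters_support ltdeg "b - a + 1" dl mu el rels letter_set
  by unfold_locales auto

text \<open>The two kinds of relations in \<open>H_rels\<close> correspond to the two conditions.
  \<open>H_rels\<close> mentions genuine letters and nonempty words only, whereas the conditions
  range over all lists; clipping makes the additional instances trivially true.\<close>

lemma RH_iff: "(\<forall>r\<in>H_rels. ev \<psi> r = 0) \<longleftrightarrow> lts.kills_words (clip letter_set \<psi>) \<and> lts.kills_sh (clip letter_set \<psi>)"
    (is "_ \<longleftrightarrow> ?w \<and> ?s")
proof -
  let ?W = "\<forall>u v r. set u \<subseteq> letter_set \<longrightarrow> set v \<subseteq> letter_set \<longrightarrow> r \<in> rels \<longrightarrow> ev (\<lambda>z. \<psi> (u @ z # v)) r = 0"
  let ?S = "\<forall>u v. u \<in> word_set \<longrightarrow> v \<in> word_set \<longrightarrow> sh ltdeg \<psi> u v = 0"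
  have "(\<forall>r\<in>H_rels. ev \<psi> r = 0) \<longleftrightarrow> (\<forall>u v r. set u \<subseteq> letter_set \<longrightarrow> set v \<subseteq> letter_set \<longrightarrow> r \<in> rels \<longrightarrow>
      ev \<psi> (lin (\<lambda>g. Poly_Mapping.single (u @ g # v) 1) r) = 0)
      \<and> (\<forall>u v. u \<in> word_set \<longrightarrow> v \<in> word_set \<longrightarrow> ev \<psi> (bat ltdeg u v) = 0)"
    unfolding H_rels_eq ball_Un
  proof (rule arg_cong2[where f = "(\<and>)"])
    show "(\<forall>r\<in>{f u v |u v. P u \<and> Q v}. F r = 0) \<longleftrightarrow> (\<forall>u v. P u \<longrightarrow> Q v \<longrightarrow> F (f u v) = 0)"
      for f :: "(int \<times> 'v) list \<Rightarrow> (int \<times> 'v) list \<Rightarrow> ((int \<times> 'v) list \<Rightarrow>\<^sub>0 'k)" and F :: "_ \<Rightarrow> 'k" and P Q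
      by blast
    show "(\<forall>r\<in>{f u v r |u v r. P u \<and> Q v \<and> R r}. F r = 0) \<longleftrightarrow> (\<forall>u v r. P u \<longrightarrow> Q v \<longrightarrow> R r \<longrightarrow> F (f u v r) = 0)"
      for f :: "(int \<times> 'v) list \<Rightarrow> (int \<times> 'v) list \<Rightarrow> (int \<times> 'v \<Rightarrow>\<^sub>0 'k) \<Rightarrow> ((int \<times> 'v) list \<Rightarrow>\<^sub>0 'k)" and F :: "_ \<Rightarrow> 'k" and P Q R
      by blast
  qed
  also have "\<dots> \<longleftrightarrow> ?W \<and> ?S" by (simp add: ev_bat)
  also have "?W \<longleftrightarrow> ?w"
  proof -
    \<comment> \<open>The keys of \<open>r\<close> are genuine letters, so whether the word is
      clipped depends on \<open>u\<close> and \<open>v\<close> alone.\<close>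
    have 1: "ev (\<lambda>z. clip letter_set \<psi> (u @ z # v)) r = (if set u \<subseteq> letter_set \<and> set v \<subseteq> letter_set then ev (\<lambda>z. \<psi> (u @ z # v)) r else 0)"
      if r: "r \<in> rels" for u v r
    proof -
      have "ev (\<lambda>z. clip letter_set \<psi> (u @ z # v)) r
        = ev (\<lambda>z. if set u \<subseteq> letter_set \<and> set v \<subseteq> letter_set then \<psi> (u @ z # v) else 0) r"
        by (rule ev_cong) (use keys_rels[OF r] in \<open>auto simp: clip_def\<close>)
      then show ?thesis by (cases "set u \<subseteq> letter_set \<and> set v \<subseteq> letter_set") auto
    qed
    show ?thesis
    proof
      assume W: ?W
      have "ev (\<lambda>z. clip letter_set \<psi> (u @ z # v)) r = 0" if "r \<in> rels" for u v r
        unfolding 1[OF that] using W that by simp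
      then show ?w unfolding lts.kills_words_def by blast
    next
      assume w: ?w
      have "ev (\<lambda>z. \<psi> (u @ z # v)) r = 0" if "set u \<subseteq> letter_set" "set v \<subseteq> letter_set" "r \<in> rels" for u v r
      proof -
        have "ev (\<lambda>z. clip letter_set \<psi> (u @ z # v)) r = 0"
          using w that(3) unfolding lts.kills_words_def by blast
        then show ?thesis unfolding 1[OF that(3)] using that by simp
      qed
      then show ?W by blast
    qed
  qed
  also have "?S \<longleftrightarrow> ?s"
  proof -
    have 1: "sh ltdeg (clip letter_set \<psi>) u v = (if u \<in> word_set \<and> v \<in> word_set then sh ltdeg \<psi> u v else 0)"
      if "u \<noteq> []" "v \<noteq> []" for u v
    proof -
      have "sh ltdeg (clip letter_set \<psi>) u v = sh ltdeg (\<lambda>W. if u \<in> word_set \<and> v \<in> word_set then \<psi> W else 0) u v"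
        by (rule sh_cong) (use that in \<open>auto simp: clip_def word_set_def\<close>)
      then show ?thesis by (cases "u \<in> word_set \<and> v \<in> word_set") auto
    qed
    show ?thesis
    proof
      assume S: ?S
      have "sh ltdeg (clip letter_set \<psi>) u v = 0" if "u \<noteq> []" "v \<noteq> []" for u v
        unfolding 1[OF that] using S by simp
      then show ?s unfolding lts.kills_sh_def by blast
    next
      assume s: ?s
      have "sh ltdeg \<psi> u v = 0" if uv: "u \<in> word_set" "v \<in> word_set" for u v
      proof -
        have ne: "u \<noteq> []" "v \<noteq> []" using uv by (simp_all add: word_set_def)
        then have "sh ltdeg (clip letter_set \<psi>) u v = 0"
          using s unfolding lts.kills_sh_def by blast
        then show ?thesis unfolding 1[OF ne] using uv by simp
      qed
      then show ?S by blast
    qed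
  qed
  finally show ?thesis .
qed

text \<open>A key of the wrong degree is excluded by its indicator: the insertion of a homogeneous
  letter relation, or a shuffle, only evaluates functionals at words of one degree.\<close>

lemma RH_hom:
  assumes "r \<in> H_rels" shows "\<exists>m. \<forall>z\<in>Poly_Mapping.keys r. word_deg ltdeg z - (a - b) = m"
proof -
  from assms consider "r \<in> {lin (\<lambda>g. Poly_Mapping.single (u @ g # v) 1) r |u v r.
      set u \<subseteq> letter_set \<and> set v \<subseteq> letter_set \<and> r \<in> rels}"
    | "r \<in> {bat ltdeg u v |u v. u \<in> word_set \<and> v \<in> word_set}"
    unfolding H_rels_eq by (rule UnE)
  then show ?thesis
  proof cases
    case 1
    then obtain u v s where 1: "r = lin (\<lambda>g. Poly_Mapping.single (u @ g # v) 1) s" "s \<in> rels"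
      by (elim CollectE exE conjE) (rule that)
    obtain m where m: "\<forall>z\<in>Poly_Mapping.keys s. ltdeg z = m" using lts.R_hom[OF 1(2)] by blast
    have "word_deg ltdeg w = word_deg ltdeg u + m + word_deg ltdeg v" if "w \<in> Poly_Mapping.keys r" for w
    proof (rule ccontr)
      assume n: "\<not> ?thesis"
      have "ev (\<lambda>g. (if u @ g # v = w then 1 else 0)) s = ev (\<lambda>g. 0 :: 'k) s"
      proof (rule ev_cong)
        fix g assume "g \<in> Poly_Mapping.keys s"
        then have "ltdeg g = m" using m by blast
        then have "word_deg ltdeg (u @ g # v) = word_deg ltdeg u + m + word_deg ltdeg v" by simp
        then show "(if u @ g # v = w then 1 else 0) = (0 :: 'k)" using n by force
      qed
      then have "ev (\<lambda>h. if h = w then 1 else 0) r = (0 :: 'k)" unfolding 1(1) ev_lin ev_single by simp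
      then show False using in_keys_ev[OF that] by blast
    qed
    then have "\<forall>z\<in>Poly_Mapping.keys r. word_deg ltdeg z - (a - b) = word_deg ltdeg u + m + word_deg ltdeg v - (a - b)" by simp
    then show ?thesis by (rule exI)
  next
    case 2
    then obtain u v where 2: "r = bat ltdeg u v"
      by (elim CollectE exE conjE) (rule that)
    have "word_deg ltdeg w = word_deg ltdeg u + word_deg ltdeg v" if "w \<in> Poly_Mapping.keys r" for w
    proof (rule ccontr)
      assume n: "\<not> ?thesis"
      have "sh ltdeg (\<lambda>h. (if h = w then 1 else 0)) u v = sh ltdeg (\<lambda>h. 0 :: 'k) u v"
        by (rule sh_cong) (use n in force)
      then have "ev (\<lambda>h. if h = w then 1 else 0) r = (0 :: 'k)" unfolding 2 ev_bat by simp
      then show False using in_keys_ev[OF that] by blast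
    qed
    then have "\<forall>z\<in>Poly_Mapping.keys r. word_deg ltdeg z - (a - b) = word_deg ltdeg u + word_deg ltdeg v - (a - b)" by simp
    then show ?thesis by (rule exI)
  qed
qed

lemma ev_Dg: "ev \<psi> (Dg X) = wD ltdeg dl mu (clip letter_set \<psi>) X"
proof (cases "X \<in> word_set")
  case True
  then show ?thesis
    unfolding Dg_def by (simp add: ev_D) (rule wD_letters, auto simp: word_set_def clip_word_set)
next
  case False
  then have "clip letter_set (wD ltdeg dl mu (clip letter_set \<psi>)) X = 0" by (simp add: clip_word_set)
  then show ?thesis using False by (simp add: Dg_def lts.Dw_clip)
qed

lemma ev_Bg: "ev \<psi> (Bg X Y) = - (sg ((a - b) * word_deg ltdeg X) * br ltdeg (b - a + 1) el (clip letter_set \<psi>) X Y)"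
proof (cases "X \<in> word_set \<and> Y \<in> word_set")
  case True
  then have 1: "br ltdeg (b - a + 1) (\<lambda>x y. Poly_Mapping.single (ell_letter scale a b brk x y) 1) \<psi> X Y
      = br ltdeg (b - a + 1) el (clip letter_set \<psi>) X Y"
    by (intro br_letters) (auto simp: word_set_def clip_word_set)
  show ?thesis unfolding 1[symmetric] using True
    by (simp add: Bg_def ell2''_def ell2'_def ev_ell2 sg_fold hdeg2_def hdeg_def sg_simps algebra_simps)
next
  case False
  then have "X = [] \<or> Y = [] \<or> \<not> (set X \<subseteq> letter_set \<and> set Y \<subseteq> letter_set)" by (auto simp: word_set_def)
  then have "br ltdeg (b - a + 1) el (clip letter_set \<psi>) X Y = 0"
    using lts.Br_invalid[of X Y \<psi>] by auto
  then show ?thesis unfolding Bg_def if_not_P[OF False] by simp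
qed

lemma ev2_cg: "ev2 \<theta> (cg X) = lts.co (a - b) (clip2 letter_set \<theta>) X"
proof (cases "X \<in> word_set")
  case True
  let ?n = "a - b" and ?w = "word_deg ltdeg"
  let ?F = "\<lambda>U V. sg (?n * ?w U) * clip2 letter_set \<theta> U V - sg (?w U * ?w V + ?n * ?w V) * clip2 letter_set \<theta> V U"
  \<comment> \<open>Deconcatenation includes the cuts at 0 and at \<open>length X\<close>, which the
    cobracket leaves out; they have an empty half, where \<open>clip2\<close> vanishes.\<close>
  have "(\<Sum>j\<le>length X. ?F (take j X) (drop j X)) = (\<Sum>j\<in>{1..<length X}. ?F (take j X) (drop j X))"
    by (rule sum.mono_neutral_right) (auto simp: clip2_def not_less Suc_le_eq)
  moreover have "ev2 \<theta> (cg X) = sg ?n * (\<Sum>j\<in>{1..<length X}. ?F (take j X) (drop j X))"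
    unfolding cg_def if_P[OF True] ev2_def ev_sum sum_distrib_left
  proof (rule sum.cong[OF refl])
    fix j assume j: "j \<in> {1..<length X}"
    have "clip2 letter_set \<theta> (take j X) (drop j X) = \<theta> (take j X) (drop j X)"
      "clip2 letter_set \<theta> (drop j X) (take j X) = \<theta> (drop j X) (take j X)"
      using j True set_take_subset[of j X] set_drop_subset[of j X] by (auto simp: clip2_def word_set_def)
    then show "ev (case_prod \<theta>) (let U = take j X; V = drop j X; u = hdeg2 a b U; v = hdeg2 a b V in
     smul ((-1) powi (?n * u)) (Poly_Mapping.single (U, V) 1 + Poly_Mapping.single (V, U) ((-1) powi (u * v + a - b + 1))))
      = sg ?n * ?F (take j X) (drop j X)"
      by (simp add: Let_def sg_fold hdeg2_def hdeg_def sg_simps algebra_simps)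
  qed
  ultimately show ?thesis by (simp add: lts.co_def dc_sum)
next
  case False
  then have "X = [] \<or> \<not> set X \<subseteq> letter_set" by (auto simp: word_set_def)
  then show ?thesis using False by (simp add: cg_def ev2_def lts.co_invalid)
qed

sublocale lts: letters_space ltdeg "b - a + 1" dl mu el rels letter_set "a - b" Dg Bg cg H_rels
  by unfold_locales (rule ev_Dg ev_Bg ev2_cg RH_iff | erule RH_hom | simp)+

lemma hdeg2_eq: "hdeg2 a b = (\<lambda>X. word_deg ltdeg X - (a - b))"
  by (simp add: fun_eq_iff hdeg2_def hdeg_def)

sublocale H: dg_lie_bialgebra "hdeg2 a b" "a - b" Dg Bg cg H_rels
  unfolding hdeg2_eq by (rule lts.is_dg_lie_bialgebra)

end

text \<open>Degrees and membership in the target are tested by functionals with no symmetry at all.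
  They cannot be handled through \<open>del\<close>, which agrees with the explicit sum on good
  functionals, so homogeneity is proved for \<open>dlt\<close>, \<open>mm\<close> and
  \<open>ll\<close> directly.\<close>

lemma dlt_zero:
  assumes "\<And>x u v. (u, v) \<in> Poly_Mapping.keys (cg x) \<Longrightarrow> e v = e x - n - e u"
    and "\<And>P u v R. word_deg e P + e u + e v + word_deg e R = word_deg e W - n \<Longrightarrow> \<theta> P u v R = 0"
  shows "dlt e n cg \<theta> W = 0"
  using assms(2)
proof (induction W arbitrary: \<theta>)
  case (Cons x W)
  have "spl e (\<lambda>P R. sg (e x * word_deg e P) * ev2 (\<lambda>u v. sg (n * word_deg e P) * \<theta> P u v R) (cg x)) W = spl e (\<lambda>P R. 0) W"
  proof (rule spl_cong)
    fix P R assume R: "word_deg e R = word_deg e W - word_deg e P"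
    have "ev2 (\<lambda>u v. sg (n * word_deg e P) * \<theta> P u v R) (cg x) = ev2 (\<lambda>u v. 0) (cg x)"
    proof (rule ev2_cong)
      fix u v assume uv: "(u, v) \<in> Poly_Mapping.keys (cg x)"
      have "\<theta> P u v R = 0" by (rule Cons.prems) (use assms(1)[OF uv] R in simp)
      then show "sg (n * word_deg e P) * \<theta> P u v R = 0" by simp
    qed
    then show "sg (e x * word_deg e P) * ev2 (\<lambda>u v. sg (n * word_deg e P) * \<theta> P u v R) (cg x) = 0" by simp
  qed
  moreover have "dlt e n cg (\<lambda>P u v R. sg (n * e x) * \<theta> (x # P) u v R) W = 0"
    by (rule Cons.IH, rule mult_zero_right[THEN trans[rotated]], rule arg_cong[where f = "(*) _"], rule Cons.prems) simp
  moreover have "dlt e n cg (\<lambda>P u v R. sg (e x * (word_deg e P + e u + e v + n)) * \<theta> P u v (x # R)) W = 0"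
    by (rule Cons.IH, rule mult_zero_right[THEN trans[rotated]], rule arg_cong[where f = "(*) _"], rule Cons.prems) simp
  ultimately show ?case by simp
qed simp

lemma mm_zero:
  assumes "\<And>x z. z \<in> Poly_Mapping.keys (Dg x) \<Longrightarrow> e z = e x + d"
    and "\<And>z R. e z + word_deg e R = word_deg e W + d \<Longrightarrow> \<theta> z R = 0"
  shows "mm e d Dg \<theta> W = 0"
  using assms(2)
proof (induction W arbitrary: \<theta>)
  case (Cons x W)
  have "ev (\<lambda>z. \<theta> z W) (Dg x) = ev (\<lambda>z. 0) (Dg x)"
    by (rule ev_cong, rule Cons.prems) (simp add: assms(1))
  moreover have "mm e d Dg (\<lambda>z R. sg (e x * (e z - d)) * \<theta> z (x # R)) W = 0"
    by (rule Cons.IH, rule mult_zero_right[THEN trans[rotated]], rule arg_cong[where f = "(*) _"], rule Cons.prems) simp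
  ultimately show ?case by simp
qed simp

lemma ll_zero:
  assumes deg: "\<And>x y z. z \<in> Poly_Mapping.keys (Bg x y) \<Longrightarrow> e z = e x + e y + 1"
    and "\<And>z R. e z + word_deg e R = word_deg e W + 1 \<Longrightarrow> \<theta> z R = 0"
  shows "ll e Bg \<theta> W = 0"
  using assms(2)
proof (induction W arbitrary: \<theta>)
  case (Cons x W)
  have "mm e (e x + 1) (Bg x) \<theta> W = 0"
    by (rule mm_zero) (simp_all add: deg Cons.prems)
  moreover have "ll e Bg (\<lambda>z R. sg (e x * (e z - 1)) * \<theta> z (x # R)) W = 0"
    by (rule Cons.IH, rule mult_zero_right[THEN trans[rotated]], rule arg_cong[where f = "(*) _"], rule Cons.prems) simp
  ultimately show ?case by simp
qed simp

lemma del_cong_set: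
  assumes "\<And>x u v. (u, v) \<in> Poly_Mapping.keys (cg x) \<Longrightarrow> u \<in> L \<and> v \<in> L" "set W \<subseteq> L"
    and "\<And>P R. set P \<subseteq> L \<Longrightarrow> set R \<subseteq> L \<Longrightarrow> \<phi> P R = \<psi> P R"
  shows "del e n cg \<phi> W = del e n cg \<psi> W"
  using assms(2,3)
proof (induction W arbitrary: \<phi> \<psi>)
  case (Cons x W)
  have "spl e (\<lambda>P R. ev2 (\<lambda>u v. sg (e v * word_deg e P) * \<phi> (u # P) (v # R)) (cg x)) W
      = spl e (\<lambda>P R. ev2 (\<lambda>u v. sg (e v * word_deg e P) * \<psi> (u # P) (v # R)) (cg x)) W"
  proof (rule spl_cong, rule ev2_cong, rule arg_cong[where f = "(*) _"])
    fix P R u v assume "set P \<subseteq> set W" "set R \<subseteq> set W" "(u, v) \<in> Poly_Mapping.keys (cg x)"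
    then show "\<phi> (u # P) (v # R) = \<psi> (u # P) (v # R)"
      using Cons.prems(1) assms(1) by (intro Cons.prems(2)) auto
  qed
  moreover have "del e n cg (\<lambda>P R. \<phi> (x # P) R) W = del e n cg (\<lambda>P R. \<psi> (x # P) R) W"
    by (rule Cons.IH) (use Cons.prems in auto)
  moreover have "del e n cg (\<lambda>P R. sg (e x * word_deg e P) * \<phi> P (x # R)) W = del e n cg (\<lambda>P R. sg (e x * word_deg e P) * \<psi> P (x # R)) W"
    by (rule Cons.IH) (use Cons.prems in auto)
  ultimately show ?case by simp
qed simp

section \<open>Good functionals of several variables\<close>

context dg_lie_bialgebra begin

definition good3 :: "('g list \<Rightarrow> 'g list \<Rightarrow> 'g list \<Rightarrow> 'k) \<Rightarrow> bool" where
  "good3 \<chi> \<longleftrightarrow> (\<forall>P. good2 (\<chi> P)) \<and> (\<forall>R. good2 (\<lambda>P1 P2. \<chi> P1 P2 R))"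

lemma good_zero: "good (\<lambda>V. 0)"
  by (rule goodI) simp_all

lemma good_add: "good \<phi> \<Longrightarrow> good \<psi> \<Longrightarrow> good (\<lambda>V. \<phi> V + \<psi> V)"
proof (rule goodI)
  fix u x y v assume "good \<phi>" "good \<psi>"
  then show "\<phi> (u @ x # y # v) + \<psi> (u @ x # y # v) = sg (e x * e y) * (\<phi> (u @ y # x # v) + \<psi> (u @ y # x # v))"
    using goodD(1)[of \<phi> u x y v] goodD(1)[of \<psi> u x y v] by (simp only: distrib_left)
qed (simp add: ev_fun_add goodD(2))

text \<open>\<open>T\<close> acts on auxiliary variables, is homogeneous and commutes with
  \<open>ev\<close>. Being good is a family of linear conditions on the remaining variable, so it
  passes through \<open>T\<close>.\<close>

lemma good_linear:
  assumes "\<And>c F. T (\<lambda>x. c * F x) = c * T F" "\<And>(F :: 'g \<Rightarrow> _) r. ev (\<lambda>z. T (F z)) r = T (\<lambda>x. ev (\<lambda>z. F z x) r)"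
    and "T (\<lambda>x. 0) = 0" "\<And>x. good (\<chi> x)"
  shows "good (\<lambda>V. T (\<lambda>x. \<chi> x V))"
proof (rule goodI)
  fix u x y v
  have "\<chi> p (u @ x # y # v) = sg (e x * e y) * \<chi> p (u @ y # x # v)" for p
    by (rule goodD(1)[OF assms(4)])
  then show "T (\<lambda>p. \<chi> p (u @ x # y # v)) = sg (e x * e y) * T (\<lambda>p. \<chi> p (u @ y # x # v))"
    by (simp only: assms(1)[symmetric])
next
  fix u v r assume r: "r \<in> R"
  have "ev (\<lambda>z. \<chi> p (u @ z # v)) r = 0" for p
    by (rule goodD(2)[OF assms(4) r])
  then show "ev (\<lambda>z. T (\<lambda>p. \<chi> p (u @ z # v))) r = 0"
    by (simp only: assms(2)[of "\<lambda>z p. \<chi> p (u @ z # v)"] assms(3))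
qed

lemma good_Spl_param:
  assumes "\<And>P1 P2. good (\<chi> P1 P2)" shows "good (\<lambda>V. Spl (\<lambda>P1 P2. \<chi> P1 P2 V) W)"
  using good_linear[of "\<lambda>F. Spl (\<lambda>P1 P2. F (P1, P2)) W" "\<lambda>(P1, P2). \<chi> P1 P2"] assms
  by (simp add: spl_mult spl_ev split_paired_all)

lemma good_Del_param:
  assumes "\<And>P1 P2. good (\<chi> P1 P2)" shows "good (\<lambda>V. Del (\<lambda>P1 P2. \<chi> P1 P2 V) W)"
  using good_linear[of "\<lambda>F. Del (\<lambda>P1 P2. F (P1, P2)) W" "\<lambda>(P1, P2). \<chi> P1 P2"] assms
  by (simp add: del_mult del_ev split_paired_all)

lemma good_Q_param:
  assumes "\<And>P. good (\<chi> P)" shows "good (\<lambda>V. Q (\<lambda>P. \<chi> P V) W)"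
  using good_linear[of "\<lambda>F. Q F W" \<chi>] assms
  by (simp add: QQ_mult QQ_ev)

lemma good_sg_right: "good \<phi> \<Longrightarrow> good (\<lambda>P. sg (word_deg e P * k) * \<phi> P)"
  using good_sg[of \<phi> k] by (simp add: mult.commute)

lemma good2_twist: "good2 \<phi> \<Longrightarrow> good2 (\<lambda>P R. sg (word_deg e P * word_deg e R) * \<phi> R P)"
  by (auto simp: good2_def intro: good_sg good_sg_right)

lemma good3D:
  assumes "good3 \<chi>"
  shows "good2 (\<chi> P)" "good2 (\<lambda>P1 P2. \<chi> P1 P2 P3)" "good (\<lambda>P. \<chi> P P2 P3)" "good (\<lambda>P. \<chi> P1 P P3)" "good (\<chi> P1 P2)"
  using assms by (auto simp: good3_def good2_def)

lemma good3_rot: "good3 \<chi> \<Longrightarrow> good3 (rot \<chi>)"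
  unfolding good3_def[of "rot \<chi>"] good2_def
  unfolding rot_def ring_distribs sg_add mult.assoc
  by (intro conjI allI good_sg good_sg_right good_mult; rule good3D; assumption)

end

section \<open>Relations of the symmetric powers and evaluation on generators\<close>

context dg_ab_algebra begin

definition S_set :: "(int \<times> 'v) list list set" where
  "S_set = {W. W \<noteq> [] \<and> set W \<subseteq> word_set}"

abbreviation "S_rels \<equiv> grels (S_space scale A a b)"

lemma gens_S: "gens (S_space scale A a b) = S_set"
  by (simp add: S_space_def sym_plus_def tensor_plus_def shift_def gens_H S_set_def)

lemma nth_S: "W \<in> S_set \<Longrightarrow> i < length W \<Longrightarrow> W ! i \<in> word_set"
  using nth_mem[of i W] by (auto simp: S_set_def)

lemma clip_S: "clip word_set \<phi> W = (if W \<in> S_set then \<phi> W else 0)"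
  by (simp add: clip_def S_set_def)

lemma clip2_S: "clip2 word_set \<phi> P R = (if P \<in> S_set \<and> R \<in> S_set then \<phi> P R else 0)"
  by (simp add: clip2_def S_set_def)

lemma S_rels_eq: "S_rels = {lin (\<lambda>g. Poly_Mapping.single (u @ g # v) 1) r |u v r.
      set u \<subseteq> word_set \<and> set v \<subseteq> word_set \<and> r \<in> H_rels}
    \<union> {Poly_Mapping.single (u @ g # h # v) 1 - Poly_Mapping.single (u @ h # g # v) (sg (hdeg2 a b g * hdeg2 a b h)) |u v g h.
        set u \<subseteq> word_set \<and> set v \<subseteq> word_set \<and> g \<in> word_set \<and> h \<in> word_set}"
proof -
  have "grels (shift (a - b) (H_space scale A a)) = H_rels" "gens (shift (a - b) (H_space scale A a)) = word_set"
    by (simp_all add: shift_def gens_H)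
  then show ?thesis
    by (simp add: S_space_def sym_plus_def tensor_plus_def gdeg_spaces sg_fold)
qed

text \<open>Relations of \<H> involve generators only. Clipping therefore cannot destroy a relation
  by discarding some of its terms.\<close>

lemma keys_H_rels:
  assumes "r \<in> H_rels" shows "Poly_Mapping.keys r \<subseteq> word_set"
proof (rule subsetI, rule ccontr)
  fix w assume w: "w \<in> Poly_Mapping.keys r" "w \<notin> word_set"
  let ?\<delta> = "\<lambda>h. if h = w then 1 else 0 :: 'k"
  from assms consider "r \<in> {lin (\<lambda>g. Poly_Mapping.single (u @ g # v) 1) r |u v r.
      set u \<subseteq> letter_set \<and> set v \<subseteq> letter_set \<and> r \<in> rels}"
    | "r \<in> {bat ltdeg u v |u v. u \<in> word_set \<and> v \<in> word_set}"
    unfolding H_rels_eq by (rule UnE)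
  then have "ev ?\<delta> r = 0"
  proof cases
    case 1
    then obtain u v s where 1: "r = lin (\<lambda>g. Poly_Mapping.single (u @ g # v) 1) s" "set u \<subseteq> letter_set" "set v \<subseteq> letter_set" "s \<in> rels"
      by (elim CollectE exE conjE) (rule that)
    have "ev (\<lambda>g. ?\<delta> (u @ g # v)) s = ev (\<lambda>g. 0 :: 'k) s"
    proof (rule ev_cong)
      fix g assume "g \<in> Poly_Mapping.keys s"
      then have "u @ g # v \<in> word_set" using keys_rels[OF 1(4)] 1(2,3) by (auto simp: word_set_def)
      then show "?\<delta> (u @ g # v) = 0" using w(2) by auto
    qed
    then show ?thesis unfolding 1(1) ev_lin ev_single by simp
  next
    case 2
    then obtain u v where 2: "r = bat ltdeg u v" "u \<in> word_set" "v \<in> word_set"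
      by (elim CollectE exE conjE) (rule that)
    have "sh ltdeg ?\<delta> u v = sh ltdeg (\<lambda>h. 0 :: 'k) u v"
    proof (rule sh_cong)
      fix W assume "set W = set u \<union> set v"
      then have "W \<in> word_set" using 2(2,3) by (auto simp: word_set_def)
      then show "?\<delta> W = 0" using w(2) by auto
    qed
    then show ?thesis unfolding 2(1) ev_bat by simp
  qed
  then show False using in_keys_ev[OF w(1)] by blast
qed

lemma good_clip:
  assumes "H.good \<phi>" shows "H.good (clip word_set \<phi>)"
proof (rule H.goodI)
  fix u x y v
  show "clip word_set \<phi> (u @ x # y # v) = sg (hdeg2 a b x * hdeg2 a b y) * clip word_set \<phi> (u @ y # x # v)"
    using H.goodD(1)[OF assms, of u x y v] by (simp add: clip_def)
next
  fix u v r assume r: "r \<in> H_rels"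
  \<comment> \<open>The letter \<open>z\<close> ranges over keys of \<open>r\<close>, all of them
    generators, so clipping depends on \<open>u\<close> and \<open>v\<close> only and acts as a
    constant factor.\<close>
  have "ev (\<lambda>z. clip word_set \<phi> (u @ z # v)) r = ev (\<lambda>z. (if set u \<subseteq> word_set \<and> set v \<subseteq> word_set then 1 else 0) * \<phi> (u @ z # v)) r"
    by (rule ev_cong) (use keys_H_rels[OF r] in \<open>auto simp: clip_def\<close>)
  then show "ev (\<lambda>z. clip word_set \<phi> (u @ z # v)) r = 0"
    by (simp only: ev_fun_mult H.goodD(2)[OF assms r]) simp
qed

lemma good2_clip2:
  assumes "H.good2 \<phi>" shows "H.good2 (clip2 word_set \<phi>)"
proof (unfold H.good2_def, intro conjI allI)
  fix W
  show "H.good (\<lambda>P. clip2 word_set \<phi> P W)"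
    unfolding clip2_left by (simp add: good_clip H.good_zero H.good2D(1)[OF assms])
  show "H.good (clip2 word_set \<phi> W)"
    unfolding clip2_right by (simp add: good_clip H.good_zero H.good2D(2)[OF assms])
qed

lemma kills_S_rels:
  assumes "H.good \<phi>" "r \<in> S_rels" shows "ev \<phi> r = 0"
proof -
  from assms(2) consider "r \<in> {lin (\<lambda>g. Poly_Mapping.single (u @ g # v) 1) r |u v r.
      set u \<subseteq> word_set \<and> set v \<subseteq> word_set \<and> r \<in> H_rels}"
    | "r \<in> {Poly_Mapping.single (u @ g # h # v) 1 - Poly_Mapping.single (u @ h # g # v) (sg (hdeg2 a b g * hdeg2 a b h)) |u v g h.
        set u \<subseteq> word_set \<and> set v \<subseteq> word_set \<and> g \<in> word_set \<and> h \<in> word_set}"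
    unfolding S_rels_eq by (rule UnE)
  then show ?thesis
  proof cases
    case 1
    then obtain u v s where 1: "r = lin (\<lambda>g. Poly_Mapping.single (u @ g # v) 1) s" "s \<in> H_rels"
      by (elim CollectE exE conjE) (rule that)
    then show ?thesis using H.goodD(2)[OF assms(1) 1(2)] by simp
  next
    case 2
    then obtain u v g h where "r = Poly_Mapping.single (u @ g # h # v) 1 - Poly_Mapping.single (u @ h # g # v) (sg (hdeg2 a b g * hdeg2 a b h))"
      by (elim CollectE exE conjE) (rule that)
    then show ?thesis using H.goodD(1)[OF assms(1), of u g h v] by simp
  qed
qed

lemma good_if_kills_S_rels:
  assumes "\<And>r. r \<in> S_rels \<Longrightarrow> ev \<phi> r = 0" shows "H.good (clip word_set \<phi>)"
proof (rule H.goodI)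
  fix u x y v
  show "clip word_set \<phi> (u @ x # y # v) = sg (hdeg2 a b x * hdeg2 a b y) * clip word_set \<phi> (u @ y # x # v)"
  proof (cases "set (u @ x # y # v) \<subseteq> word_set")
    case True
    have "Poly_Mapping.single (u @ x # y # v) 1 - Poly_Mapping.single (u @ y # x # v) (sg (hdeg2 a b x * hdeg2 a b y)) \<in> S_rels"
      unfolding S_rels_eq using True by (intro UnI2 CollectI exI conjI) (rule refl, simp_all)
    from assms[OF this] show ?thesis using True by (simp add: clip_def)
  qed (auto simp: clip_def)
next
  fix u v r assume r: "r \<in> H_rels"
  have "ev (\<lambda>z. clip word_set \<phi> (u @ z # v)) r = ev (\<lambda>z. (if set u \<subseteq> word_set \<and> set v \<subseteq> word_set then 1 else 0) * \<phi> (u @ z # v)) r"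
    by (rule ev_cong) (use keys_H_rels[OF r] in \<open>auto simp: clip_def\<close>)
  also have "\<dots> = 0"
  proof (cases "set u \<subseteq> word_set \<and> set v \<subseteq> word_set")
    case True
    have "lin (\<lambda>g. Poly_Mapping.single (u @ g # v) 1) r \<in> S_rels"
      unfolding S_rels_eq using True r by (intro UnI1 CollectI exI conjI) (rule refl, simp_all)
    from assms[OF this] show ?thesis using True by simp
  next
    case False
    show ?thesis unfolding if_not_P[OF False] by simp
  qed
  finally show "ev (\<lambda>z. clip word_set \<phi> (u @ z # v)) r = 0" .
qed

lemma keys_cg:
  assumes "(u, v) \<in> Poly_Mapping.keys (cg x)" shows "u \<in> word_set \<and> v \<in> word_set"
proof (rule ccontr)
  assume n: "\<not> ?thesis"
  have "clip2 letter_set (\<lambda>s t. if s = u \<and> t = v then 1 else 0) = (\<lambda>s t. 0 :: 'k)"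
    using n by (auto simp: clip2_def word_set_def fun_eq_iff)
  then have "ev2 (\<lambda>s t. if s = u \<and> t = v then 1 else 0) (cg x) = (0 :: 'k)"
    by (simp add: ev2_cg lts.co_def)
  then show False using in_keys_ev2[OF assms] by blast
qed

text \<open>\<Delta> omits empty \<open>I\<close> and \<open>J\<close>, while \<open>spl\<close>
  includes them. Since \<open>G\<close> vanishes at the empty word the sums agree, and
  \<open>F\<close> matters only on pairs of generators.\<close>

lemma eval_Delta:
  fixes F :: "_ \<Rightarrow> 'k"
  assumes W: "W \<in> S_set" and F: "\<And>P R. P \<in> S_set \<Longrightarrow> R \<in> S_set \<Longrightarrow> F (P, R) = G P R"
    and G: "\<And>R. G [] R = 0" "\<And>P. G P [] = 0"
  shows "ev F (Delta a b W) = H.Spl G W"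
proof -
  let ?N = "{..<length W}"
  let ?kz = "\<lambda>(I, J). koszul (\<lambda>i. hdeg2 a b (W ! i)) (sl I @ sl J) :: 'k"
  have "ev F (Delta a b W) = (\<Sum>x\<in>{(I, J). I \<union> J = ?N \<and> I \<inter> J = {} \<and> I \<noteq> {} \<and> J \<noteq> {}}.
      ?kz x * F (nths W (fst x), nths W (snd x)))"
    by (simp add: Delta_def eps_def case_prod_unfold)
  also have "\<dots> = (\<Sum>x\<in>parts ?N. ?kz x * G (map ((!) W) (sl (fst x))) (map ((!) W) (sl (snd x))))"
  proof (rule sum.mono_neutral_cong_left)
    show "finite (parts ?N)" by (rule finite_parts) simp
    show "{(I, J). I \<union> J = ?N \<and> I \<inter> J = {} \<and> I \<noteq> {} \<and> J \<noteq> {}} \<subseteq> parts ?N" by (auto simp: parts_def)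
    show "\<forall>x\<in>parts ?N - {(I, J). I \<union> J = ?N \<and> I \<inter> J = {} \<and> I \<noteq> {} \<and> J \<noteq> {}}.
      ?kz x * G (map ((!) W) (sl (fst x))) (map ((!) W) (sl (snd x))) = 0"
      by (auto simp: parts_def G)
  next
    fix x assume "x \<in> {(I, J). I \<union> J = ?N \<and> I \<inter> J = {} \<and> I \<noteq> {} \<and> J \<noteq> {}}"
    then obtain I J where x: "x = (I, J)" "I \<subseteq> ?N" "J \<subseteq> ?N" "I \<noteq> {}" "J \<noteq> {}" by auto
    have fin: "finite I" "finite J" using x finite_subset[of _ ?N] by auto
    have "map ((!) W) (sl I) \<in> S_set" "map ((!) W) (sl J) \<in> S_set"
      using x fin by (auto simp: S_set_def intro!: nth_S[OF W])
    then show "?kz x * F (nths W (fst x), nths W (snd x)) = ?kz x * G (map ((!) W) (sl (fst x))) (map ((!) W) (sl (snd x)))"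
      using x by (simp add: nths_sl F)
  qed
  also have "\<dots> = (\<Sum>(I, J)\<in>parts (set [0..<length W]). koszul (\<lambda>i. hdeg2 a b (W ! i)) (sl I @ sl J) * G (map ((!) W) (sl I)) (map ((!) W) (sl J)))"
    by (simp add: case_prod_unfold atLeast0LessThan)
  also have "\<dots> = H.Spl G (map ((!) W) [0..<length W])"
    by (rule sum_parts_spl) simp
  finally show ?thesis by (simp add: map_nth)
qed

text \<open>For an arbitrary functional, so that it also serves the degree and membership tests.
  Clipping is harmless because every word occurring in \<delta>'' of a generator is a
  generator.\<close>

lemma ev_delta_dlt:
  fixes F :: "_ \<Rightarrow> 'k"
  assumes W: "W \<in> S_set"
  shows "ev F (delta a b W) = dlt (hdeg2 a b) (a - b) cg (\<lambda>P u v R. clip2 word_set (\<lambda>P R. F (P, R)) (P @ [u]) (v # R)) W"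
proof -
  let ?N = "{..<length W}" and ?n = "a - b" and ?wd = "word_deg (hdeg2 a b)"
  let ?kz = "koszul (\<lambda>i. hdeg2 a b (W ! i)) :: nat list \<Rightarrow> 'k"
  let ?m = "\<lambda>I. map ((!) W) (sl I)"
  let ?\<theta> = "\<lambda>P u v R. clip2 word_set (\<lambda>P R. F (P, R)) (P @ [u]) (v # R)"
  have "ev F (delta a b W) = (\<Sum>s\<in>?N. \<Sum>(I, J)\<in>parts (?N - {s}).
      ?kz (sl I @ s # sl J) * ev2 (\<lambda>u v. sg (?n * ?wd (?m I)) * ?\<theta> (?m I) u v (?m J)) (cg (W ! s)))"
    unfolding delta_def ev_sum parts_def
  proof (intro sum.cong refl)
    fix s x assume s: "s \<in> ?N" and "x \<in> {(I, J). I \<union> J = ?N - {s} \<and> I \<inter> J = {}}"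
    then obtain I J where x: "x = (I, J)" and IJ: "I \<union> J = ?N - {s}" "I \<inter> J = {}" by auto
    have I: "I \<subseteq> ?N" "J \<subseteq> ?N" using IJ by auto
    have fin: "finite I" "finite J" using I finite_subset[of _ ?N] by auto
    have X: "W ! s \<in> word_set" using s by (simp add: nth_S[OF W])
    have mI: "set (?m I) \<subseteq> word_set" "set (?m J) \<subseteq> word_set"
      using I fin by (auto intro!: nth_S[OF W])
    have \<theta>: "?\<theta> (?m I) u v (?m J) = F (?m I @ [u], [v] @ ?m J)" if "u \<in> word_set" "v \<in> word_set" for u v
      using that mI by (simp add: clip2_def)
    let ?X = "W ! s"
    have "(\<Sum>j\<in>{1..<length ?X}. ev F (let U = take j ?X; V = drop j ?X; u = hdeg2 a b U; v = hdeg2 a b V in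
             smul ((-1) powi (?n * (?wd (?m I) + u)))
               (Poly_Mapping.single (?m I @ [U], [V] @ ?m J) 1
                + Poly_Mapping.single (?m I @ [V], [U] @ ?m J) ((-1) powi (u * v + a - b + 1)))))
      = ev2 (\<lambda>u v. sg (?n * ?wd (?m I)) * ?\<theta> (?m I) u v (?m J)) (cg ?X)"
      unfolding cg_def if_P[OF X] ev2_def ev_sum
    proof (rule sum.cong[OF refl])
      fix j assume j: "j \<in> {1..<length ?X}"
      have "take j ?X \<in> word_set" "drop j ?X \<in> word_set"
        using j X set_take_subset[of j ?X] set_drop_subset[of j ?X] by (auto simp: word_set_def)
      note t = \<theta>[OF this] \<theta>[OF this(2,1)]
      show "ev F (let U = take j ?X; V = drop j ?X; u = hdeg2 a b U; v = hdeg2 a b V in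
             smul ((-1) powi (?n * (?wd (?m I) + u)))
               (Poly_Mapping.single (?m I @ [U], [V] @ ?m J) 1
                + Poly_Mapping.single (?m I @ [V], [U] @ ?m J) ((-1) powi (u * v + a - b + 1))))
        = ev (\<lambda>(u, v). sg (?n * ?wd (?m I)) * ?\<theta> (?m I) u v (?m J)) (let U = take j ?X; V = drop j ?X; u = hdeg2 a b U; v = hdeg2 a b V in
     smul ((-1) powi (?n * u)) (Poly_Mapping.single (U, V) 1 + Poly_Mapping.single (V, U) ((-1) powi (u * v + a - b + 1))))"
        unfolding Let_def ev_smul ev_add ev_single case_prod_conv t sg_fold distrib_left sg_add
        by (simp add: algebra_simps)
    qed
    then have main: "ev F (smul (eps a b W (sl I @ [s] @ sl J))
          (\<Sum>j\<in>{1..<length ?X}. let U = take j ?X; V = drop j ?X; u = hdeg2 a b U; v = hdeg2 a b V in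
             smul ((-1) powi (?n * (?wd (nths W I) + u)))
               (Poly_Mapping.single (nths W I @ [U], [V] @ nths W J) 1
                + Poly_Mapping.single (nths W I @ [V], [U] @ nths W J) ((-1) powi (u * v + a - b + 1)))))
      = ?kz (sl I @ s # sl J) * ev2 (\<lambda>u v. sg (?n * ?wd (?m I)) * ?\<theta> (?m I) u v (?m J)) (cg ?X)"
      unfolding nths_sl[OF I(1)] nths_sl[OF I(2)] ev_smul ev_sum eps_def by simp
    show "ev F (case x of (I, J) \<Rightarrow> smul (eps a b W (sl I @ [s] @ sl J))
          (\<Sum>j\<in>{1..<length ?X}. let U = take j ?X; V = drop j ?X; u = hdeg2 a b U; v = hdeg2 a b V in
             smul ((-1) powi (?n * (?wd (nths W I) + u)))
               (Poly_Mapping.single (nths W I @ [U], [V] @ nths W J) 1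
                + Poly_Mapping.single (nths W I @ [V], [U] @ nths W J) ((-1) powi (u * v + a - b + 1)))))
      = (case x of (I, J) \<Rightarrow> ?kz (sl I @ s # sl J) * ev2 (\<lambda>u v. sg (?n * ?wd (?m I)) * ?\<theta> (?m I) u v (?m J)) (cg ?X))"
      unfolding x case_prod_conv by (rule main)
  qed
  also have "\<dots> = (\<Sum>s\<in>set [0..<length W]. \<Sum>(I, J)\<in>parts (set [0..<length W] - {s}).
      ?kz (sl I @ s # sl J) * ev2 (\<lambda>u v. sg (?n * ?wd (?m I)) * ?\<theta> (?m I) u v (?m J)) (cg (W ! s)))"
    by (simp only: set_upt atLeast0LessThan)
  also have "\<dots> = dlt (hdeg2 a b) ?n cg ?\<theta> (map ((!) W) [0..<length W])"
    by (rule sum_parts_dlt[OF H.cg_deg]) simp_all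
  finally show ?thesis by (simp only: map_nth)
qed

text \<open>\<open>F\<close> may come from a map that is awkward off the generators. The clipped
  \<open>F\<close> equals the clipped \<open>G\<close>, which is good; \<open>dlt_good\<close>
  applies to it, and on generators the recursion never sees the clipping.\<close>

lemma eval_delta:
  fixes F :: "_ \<Rightarrow> 'k"
  assumes W: "W \<in> S_set" and F: "\<And>P R. P \<in> S_set \<Longrightarrow> R \<in> S_set \<Longrightarrow> F (P, R) = G P R"
    and G: "\<And>R. G [] R = 0" "\<And>P. G P [] = 0" and "H.good2 G"
  shows "ev F (delta a b W) = H.Del G W"
proof -
  have FG: "clip2 word_set (\<lambda>P R. F (P, R)) = clip2 word_set G"
    by (auto simp: fun_eq_iff clip2_S F)
  have "ev F (delta a b W) = H.Del (clip2 word_set G) W"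
    unfolding ev_delta_dlt[OF W] FG by (rule H.dlt_good[OF good2_clip2[OF assms(5)]])
  also have "\<dots> = H.Del G W"
    by (rule del_cong_set[where L = word_set]) (use W keys_cg G in \<open>auto simp: S_set_def clip2_def\<close>)
  finally show ?thesis .
qed

end

lemma EE_cong_set:
  assumes "\<And>x z. z \<in> Poly_Mapping.keys (Dg x) \<Longrightarrow> z \<in> L" "\<And>x y z. z \<in> Poly_Mapping.keys (Bg x y) \<Longrightarrow> z \<in> L"
    and "set W \<subseteq> L" "\<And>V. V \<noteq> [] \<Longrightarrow> set V \<subseteq> L \<Longrightarrow> \<phi> V = \<psi> V"
  shows "EE e Dg Bg x \<phi> W = EE e Dg Bg x \<psi> W"
  using assms(3,4)
proof (induction W arbitrary: \<phi> \<psi>)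
  case Nil
  have "ev (\<lambda>z. \<phi> [z]) (Dg x) = ev (\<lambda>z. \<psi> [z]) (Dg x)"
    by (rule ev_cong, rule Nil.prems(2)) (use assms(1) in auto)
  then show ?case by simp
next
  case (Cons y W)
  have "ev (\<lambda>z. \<phi> (z # W)) (Bg x y) = ev (\<lambda>z. \<psi> (z # W)) (Bg x y)"
    by (rule ev_cong, rule Cons.prems(2)) (use assms(2) Cons.prems(1) in auto)
  moreover have "EE e Dg Bg x (\<lambda>V. \<phi> (y # V)) W = EE e Dg Bg x (\<lambda>V. \<psi> (y # V)) W"
    by (rule Cons.IH) (use Cons.prems in auto)
  ultimately show ?case by simp
qed

lemma QQ_cong_set:
  assumes "\<And>x z. z \<in> Poly_Mapping.keys (Dg x) \<Longrightarrow> z \<in> L" "\<And>x y z. z \<in> Poly_Mapping.keys (Bg x y) \<Longrightarrow> z \<in> L"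
    and "set W \<subseteq> L" "\<And>V. V \<noteq> [] \<Longrightarrow> set V \<subseteq> L \<Longrightarrow> \<phi> V = \<psi> V"
  shows "QQ e Dg Bg \<phi> W = QQ e Dg Bg \<psi> W"
  using assms(3,4)
proof (induction W arbitrary: \<phi> \<psi>)
  case (Cons x W)
  have "QQ e Dg Bg (\<lambda>V. \<phi> (x # V)) W = QQ e Dg Bg (\<lambda>V. \<psi> (x # V)) W"
    by (rule Cons.IH) (use Cons.prems in auto)
  moreover have "EE e Dg Bg x \<phi> W = EE e Dg Bg x \<psi> W"
    by (rule EE_cong_set[OF assms(1,2)]) (use Cons.prems in auto)
  ultimately show ?case by simp
qed simp

lemma ev_lcomp: "ev \<phi> ((f \<odot> g) x) = ev (\<lambda>y. ev \<phi> (f y)) (g x)"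
  by (simp add: lcomp_def)

lemma ev_lid: "ev \<phi> (lid x) = \<phi> x"
  by (simp add: lid_def)

lemma ev_ktensor: "ev \<phi> (ktensor e f k g (x, y)) = sg (k * e x) * ev (\<lambda>s. ev (\<lambda>t. \<phi> (s, t)) (g y)) (f x)"
  by (simp add: ktensor_def sg_fold)

lemma ev_reassoc: "ev \<phi> (reassoc ((x, y), z)) = \<phi> (x, y, z)"
  by (simp add: reassoc_def)

lemma ev_twist: "ev \<phi> (twist e (x, y)) = sg (e x * e y) * \<phi> (y, x)"
  by (simp add: twist_def sg_fold)

lemma ev_twist12: "ev \<phi> (twist12 e (x, y, z)) = sg (e x * e y) * \<phi> (y, x, z)"
  and ev_twist23: "ev \<phi> (twist23 e (x, y, z)) = sg (e y * e z) * \<phi> (x, z, y)"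
  by (simp_all add: twist12_def twist23_def sg_fold)

lemmas ev_maps = ev_lid ev_ktensor ev_reassoc ev_twist ev_twist12 ev_twist23

lemma tensor_space:
  "gens (P \<otimes>\<^sub>s R) = gens P \<times> gens R" "gdeg (P \<otimes>\<^sub>s R) (g, h) = gdeg P g + gdeg R h"
  by (simp_all add: tensor_def)

lemma kills_tensor:
  assumes "\<And>r. r \<in> grels (P \<otimes>\<^sub>s R) \<Longrightarrow> ev \<phi> r = 0"
  shows "r \<in> grels P \<Longrightarrow> h \<in> gens R \<Longrightarrow> ev (\<lambda>g. \<phi> (g, h)) r = 0"
    and "g \<in> gens P \<Longrightarrow> r' \<in> grels R \<Longrightarrow> ev (\<lambda>h. \<phi> (g, h)) r' = 0"
proof -
  assume "r \<in> grels P" "h \<in> gens R"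
  then have "tens r (Poly_Mapping.single h 1) \<in> grels (P \<otimes>\<^sub>s R)"
    unfolding tensor_def gspace.simps by (intro UnI1 CollectI exI conjI) (rule refl)
  from assms[OF this] show "ev (\<lambda>g. \<phi> (g, h)) r = 0" by simp
next
  assume "g \<in> gens P" "r' \<in> grels R"
  then have "tens (Poly_Mapping.single g 1) r' \<in> grels (P \<otimes>\<^sub>s R)"
    unfolding tensor_def gspace.simps by (intro UnI2 CollectI exI conjI) (rule refl)
  from assms[OF this] show "ev (\<lambda>h. \<phi> (g, h)) r' = 0" by simp
qed

section \<open>The coderivation on generators, and the relations of tensor products\<close>

context dg_ab_algebra begin

lemma keys_Dg:
  assumes "z \<in> Poly_Mapping.keys (Dg X)" shows "z \<in> word_set"
proof (rule ccontr)
  assume "z \<notin> word_set"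
  then have "clip letter_set (\<lambda>h. if h = z then 1 else 0) = (\<lambda>h. 0 :: 'k)" by (auto simp: clip_word_set fun_eq_iff)
  then have "ev (\<lambda>h. if h = z then 1 else 0) (Dg X) = (0 :: 'k)" by (simp add: ev_Dg)
  then show False using in_keys_ev[OF assms] by blast
qed

lemma keys_Bg:
  assumes "z \<in> Poly_Mapping.keys (Bg X Y)" shows "z \<in> word_set"
proof (rule ccontr)
  assume "z \<notin> word_set"
  then have "clip letter_set (\<lambda>h. if h = z then 1 else 0) = (\<lambda>h. 0 :: 'k)" by (auto simp: clip_word_set fun_eq_iff)
  then have "ev (\<lambda>h. if h = z then 1 else 0) (Bg X Y) = (0 :: 'k)" by (simp add: ev_Bg)
  then show False using in_keys_ev[OF assms] by blast
qed

text \<open>The formula for \<open>Q\<close> puts the new factor in front, which is the form of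
  \<open>mm\<close> and \<open>ll\<close>. No goodness is assumed, so the degree tests can use it
  too.\<close>

lemma ev_Q_mm_ll:
  fixes F :: "_ \<Rightarrow> 'k"
  assumes W: "W \<in> S_set"
  shows "ev F (Q_map scale a b mul brk d W) = mm (hdeg2 a b) 1 Dg (\<lambda>z R. clip word_set F (z # R)) W
    + ll (hdeg2 a b) Bg (\<lambda>z R. clip word_set F (z # R)) W"
proof -
  let ?N = "{..<length W}" let ?w = "(!) W" and ?\<theta> = "\<lambda>z R. clip word_set F (z # R)"
  let ?kz = "koszul (\<lambda>i. hdeg2 a b (W ! i)) :: nat list \<Rightarrow> 'k"
  have N: "?N = set [0..<length W]" by (simp add: atLeast0LessThan)
  have K: "nths W K = map ?w (sl K)" "F (z # map ?w (sl K)) = ?\<theta> z (map ?w (sl K))"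
    if "K \<subseteq> ?N" "z \<in> word_set" for K z
  proof -
    have "finite K" using that(1) finite_subset by blast
    then have "set (map ?w (sl K)) \<subseteq> word_set" using that(1) by (auto intro!: nth_S[OF W])
    then show "F (z # map ?w (sl K)) = ?\<theta> z (map ?w (sl K))" using that(2) by (simp add: clip_def)
  qed (rule nths_sl[OF that(1)])
  have "ev F (m_map scale a b mul d W) = (\<Sum>i\<in>?N. ?kz (i # sl (?N - {i})) * ev (\<lambda>z. ?\<theta> z (map ?w (sl (?N - {i})))) (Dg (W ! i)))"
    unfolding m_map_def Let_def ev_sum ev_smul ev_lin ev_single eps_def
  proof (intro sum.cong refl arg_cong[where f = "(*) _"])
    fix i assume "i \<in> ?N"
    then have D: "D scale a mul d (W ! i) = Dg (W ! i)" using nth_S[OF W] by (simp add: Dg_def)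
    show "ev (\<lambda>z. 1 * F (z # nths W (?N - {i}))) (D scale a mul d (W ! i)) = ev (\<lambda>z. ?\<theta> z (map ?w (sl (?N - {i})))) (Dg (W ! i))"
      unfolding D by (rule ev_cong) (simp add: nths_sl K(2) keys_Dg)
  qed
  also have "\<dots> = mm (hdeg2 a b) 1 Dg ?\<theta> (map ?w [0..<length W])"
    unfolding N by (rule sum_mm[OF H.Dg_deg]) simp_all
  finally have m: "ev F (m_map scale a b mul d W) = mm (hdeg2 a b) 1 Dg ?\<theta> W" by (simp only: map_nth)
  have "ev F (ell_map scale a b brk W) = (\<Sum>j\<in>?N. \<Sum>i\<in>{i \<in> ?N. i < j}. ?kz (i # j # sl (?N - {i, j})) *
      ev (\<lambda>z. ?\<theta> z (map ?w (sl (?N - {i, j})))) (Bg (W ! i) (W ! j)))"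
    unfolding ell_map_def Let_def ev_sum ev_smul ev_lin ev_single eps_def
  proof (rule sum.cong[OF refl], rule sum.cong)
    fix j assume j: "j \<in> ?N"
    then show "{..<j} = {i \<in> ?N. i < j}" by auto
    fix i assume "i \<in> {i \<in> ?N. i < j}"
    then have B: "ell2'' scale a b brk (W ! i) (W ! j) = Bg (W ! i) (W ! j)" using nth_S[OF W] j by (simp add: Bg_def)
    have "ev (\<lambda>z. 1 * F (z # nths W (?N - {i, j}))) (Bg (W ! i) (W ! j)) = ev (\<lambda>z. ?\<theta> z (map ?w (sl (?N - {i, j})))) (Bg (W ! i) (W ! j))"
      by (rule ev_cong) (simp add: nths_sl K(2) keys_Bg)
    then show "?kz (i # j # sl (?N - {i, j})) * ev (\<lambda>z. 1 * F (z # nths W (?N - {i, j}))) (ell2'' scale a b brk (W ! i) (W ! j))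
      = ?kz (i # j # sl (?N - {i, j})) * ev (\<lambda>z. ?\<theta> z (map ?w (sl (?N - {i, j})))) (Bg (W ! i) (W ! j))"
      unfolding B by simp
  qed
  also have "\<dots> = ll (hdeg2 a b) Bg ?\<theta> (map ?w [0..<length W])"
    unfolding N by (rule sum_ll[OF H.Bg_deg]) simp_all
  finally have l: "ev F (ell_map scale a b brk W) = ll (hdeg2 a b) Bg ?\<theta> W" by (simp only: map_nth)
  show ?thesis by (simp add: Q_map_def m l)
qed

lemma eval_Q:
  fixes F :: "_ \<Rightarrow> 'k"
  assumes W: "W \<in> S_set" and F: "\<And>V. V \<in> S_set \<Longrightarrow> F V = G V" and "H.good G"
  shows "ev F (Q_map scale a b mul brk d W) = H.Q G W"
proof -
  have FG: "clip word_set F = clip word_set G"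
    by (auto simp: fun_eq_iff clip_S F)
  have "ev F (Q_map scale a b mul brk d W) = H.Q (clip word_set G) W"
    unfolding ev_Q_mm_ll[OF W] FG by (rule H.mm_ll_good[OF good_clip[OF assms(3)]])
  also have "\<dots> = H.Q G W"
    by (rule QQ_cong_set[where L = word_set]) (use W keys_Dg keys_Bg in \<open>auto simp: S_set_def clip_def\<close>)
  finally show ?thesis .
qed

lemma keys_S_rels:
  assumes "r \<in> S_rels" shows "Poly_Mapping.keys r \<subseteq> S_set"
proof (rule subsetI, rule ccontr)
  fix w assume w: "w \<in> Poly_Mapping.keys r" "w \<notin> S_set"
  let ?\<delta> = "\<lambda>h. if h = w then 1 else 0 :: 'k"
  from assms consider "r \<in> {lin (\<lambda>g. Poly_Mapping.single (u @ g # v) 1) r |u v r.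
      set u \<subseteq> word_set \<and> set v \<subseteq> word_set \<and> r \<in> H_rels}"
    | "r \<in> {Poly_Mapping.single (u @ g # h # v) 1 - Poly_Mapping.single (u @ h # g # v) (sg (hdeg2 a b g * hdeg2 a b h)) |u v g h.
        set u \<subseteq> word_set \<and> set v \<subseteq> word_set \<and> g \<in> word_set \<and> h \<in> word_set}"
    unfolding S_rels_eq by (rule UnE)
  then have "ev ?\<delta> r = 0"
  proof cases
    case 1
    then obtain u v s where 1: "r = lin (\<lambda>g. Poly_Mapping.single (u @ g # v) 1) s" "set u \<subseteq> word_set" "set v \<subseteq> word_set" "s \<in> H_rels"
      by (elim CollectE exE conjE) (rule that)
    have "ev (\<lambda>g. ?\<delta> (u @ g # v)) s = ev (\<lambda>g. 0 :: 'k) s"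
    proof (rule ev_cong)
      fix g assume "g \<in> Poly_Mapping.keys s"
      then have "u @ g # v \<in> S_set" using keys_H_rels[OF 1(4)] 1(2,3) by (auto simp: S_set_def)
      then show "?\<delta> (u @ g # v) = 0" using w(2) by auto
    qed
    then show ?thesis unfolding 1(1) ev_lin ev_single by simp
  next
    case 2
    then obtain u v g h where 2: "r = Poly_Mapping.single (u @ g # h # v) 1 - Poly_Mapping.single (u @ h # g # v) (sg (hdeg2 a b g * hdeg2 a b h))"
      "set u \<subseteq> word_set" "set v \<subseteq> word_set" "g \<in> word_set" "h \<in> word_set"
      by (elim CollectE exE conjE) (rule that)
    have "u @ g # h # v \<in> S_set" "u @ h # g # v \<in> S_set" using 2 by (auto simp: S_set_def)
    then have "u @ g # h # v \<noteq> w" "u @ h # g # v \<noteq> w" using w(2) by blast+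
    then show ?thesis unfolding 2(1) ev_diff ev_single by simp
  qed
  then show False using in_keys_ev[OF w(1)] by blast
qed

section \<open>The axioms of a codifferential bicoalgebra\<close>

abbreviation "SS \<equiv> S_space scale A a b"
abbreviation "deg \<equiv> word_deg (hdeg2 a b :: (int \<times> 'v) list \<Rightarrow> int)"
abbreviation "\<Delta> \<equiv> Delta a b :: (int \<times> 'v) list list \<Rightarrow> (_ \<Rightarrow>\<^sub>0 'k)"
abbreviation "\<delta> \<equiv> delta a b :: (int \<times> 'v) list list \<Rightarrow> (_ \<Rightarrow>\<^sub>0 'k)"
abbreviation "QS \<equiv> Q_map scale a b mul brk d"

definition clip3 :: "((int \<times> 'v) list list \<times> (int \<times> 'v) list list \<times> (int \<times> 'v) list list \<Rightarrow> 'k) \<Rightarrow>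
    (int \<times> 'v) list list \<Rightarrow> (int \<times> 'v) list list \<Rightarrow> (int \<times> 'v) list list \<Rightarrow> 'k" where
  "clip3 \<phi> P1 P2 P3 = (if P1 \<in> S_set \<and> P2 \<in> S_set \<and> P3 \<in> S_set then \<phi> (P1, P2, P3) else 0)"

lemma Nil_S [simp]: "[] \<notin> S_set"
  by (simp add: S_set_def)

lemma clip3_Nil [simp]: "clip3 \<phi> [] = (\<lambda>P2 P3. 0)" "clip3 \<phi> P1 [] = (\<lambda>P3. 0)" "clip3 \<phi> P1 P2 [] = 0"
  by (simp_all add: clip3_def fun_eq_iff)

lemma clip2_Nil [simp]: "clip2 word_set \<phi> [] = (\<lambda>P2. 0)" "clip2 word_set \<phi> P1 [] = 0"
  by (simp_all add: clip2_S fun_eq_iff)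

lemma good2_if_kills:
  assumes "\<And>r. r \<in> grels (SS \<otimes>\<^sub>s SS) \<Longrightarrow> ev \<phi> r = 0"
  shows "H.good2 (clip2 word_set (\<lambda>P R. \<phi> (P, R)))"
proof (unfold H.good2_def, intro conjI allI)
  fix W
  have S: "W \<noteq> [] \<and> set W \<subseteq> word_set \<longleftrightarrow> W \<in> gens SS" by (simp add: gens_S S_set_def)
  have l: "H.good (clip word_set (\<lambda>P. \<phi> (P, W)))" if "W \<in> gens SS"
    by (rule good_if_kills_S_rels) (rule kills_tensor(1)[OF assms _ that])
  show "H.good (\<lambda>P. clip2 word_set (\<lambda>P R. \<phi> (P, R)) P W)"
    unfolding clip2_left S using l by (simp add: H.good_zero)
  have r: "H.good (clip word_set (\<lambda>R. \<phi> (W, R)))" if "W \<in> gens SS"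
    by (rule good_if_kills_S_rels) (rule kills_tensor(2)[OF assms that])
  show "H.good (clip2 word_set (\<lambda>P R. \<phi> (P, R)) W)"
    unfolding clip2_right S using r by (simp add: H.good_zero)
qed

text \<open>Threefold tensors are bracketed to the right: the relations of the first variable come
  from the outer tensor product, those of the other two from the inner one through
  \<open>good2_if_kills\<close>.\<close>

lemma good3_if_kills:
  assumes "\<And>r. r \<in> grels (SS \<otimes>\<^sub>s SS \<otimes>\<^sub>s SS) \<Longrightarrow> ev \<phi> r = 0"
  shows "H.good3 (clip3 \<phi>)"
proof -
  have right: "H.good2 (clip3 \<phi> P)" for P
  proof (cases "P \<in> S_set")
    case True
    then have "clip3 \<phi> P = clip2 word_set (\<lambda>P2 P3. \<phi> (P, P2, P3))" by (simp add: fun_eq_iff clip3_def clip2_S)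
    moreover have "H.good2 (clip2 word_set (\<lambda>P2 P3. \<phi> (P, P2, P3)))"
    proof (rule good2_if_kills)
      show "ev (\<lambda>x. \<phi> (P, x)) r = 0" if "r \<in> grels (SS \<otimes>\<^sub>s SS)" for r
        by (rule kills_tensor(2)[where P = SS, OF assms _ that]) (simp_all add: gens_S True)
    qed
    ultimately show ?thesis by simp
  next
    case False
    then have "clip3 \<phi> P = (\<lambda>P2 P3. 0)" by (simp add: fun_eq_iff clip3_def)
    then show ?thesis by (simp add: H.good2_def H.good_zero)
  qed
  have left: "H.good (\<lambda>P. clip3 \<phi> P P2 P3)" for P2 P3
  proof (cases "P2 \<in> S_set \<and> P3 \<in> S_set")
    case True
    then have "(\<lambda>P. clip3 \<phi> P P2 P3) = clip word_set (\<lambda>P. \<phi> (P, P2, P3))" by (simp add: fun_eq_iff clip3_def clip_S)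
    moreover have "H.good (clip word_set (\<lambda>P. \<phi> (P, P2, P3)))"
    proof (rule good_if_kills_S_rels)
      have mem: "(P2, P3) \<in> gens (SS \<otimes>\<^sub>s SS)" using True by (simp add: tensor_space gens_S)
      show "ev (\<lambda>P. \<phi> (P, P2, P3)) r = 0" if "r \<in> S_rels" for r
        by (rule kills_tensor(1)[where P = SS and R = "SS \<otimes>\<^sub>s SS", OF assms that mem])
    qed
    ultimately show ?thesis by simp
  next
    case False
    then have "(\<lambda>P. clip3 \<phi> P P2 P3) = (\<lambda>P. 0)" by (auto simp: fun_eq_iff clip3_def)
    then show ?thesis by (simp add: H.good_zero)
  qed
  show ?thesis
    unfolding H.good3_def using right left H.good2D(1)[OF right] by (auto simp: H.good2_def)
qed

lemma Delta_zero:
  assumes W: "W \<in> S_set" and \<phi>: "\<And>P R. P \<in> S_set \<Longrightarrow> R \<in> S_set \<Longrightarrow> deg P + deg R = deg W \<Longrightarrow> \<phi> (P, R) = 0"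
  shows "ev \<phi> (\<Delta> W) = 0"
proof -
  have "ev \<phi> (\<Delta> W) = H.Spl (clip2 word_set (\<lambda>P R. \<phi> (P, R))) W"
    by (rule eval_Delta[OF W]) (simp_all add: clip2_S)
  also have "\<dots> = H.Spl (\<lambda>P R. 0) W"
    by (rule H.Spl_cong) (simp add: clip2_S \<phi>)
  finally show ?thesis by simp
qed

lemma delta_zero:
  assumes W: "W \<in> S_set" and \<phi>: "\<And>P R. P \<in> S_set \<Longrightarrow> R \<in> S_set \<Longrightarrow> deg P + deg R = deg W - (a - b) \<Longrightarrow> \<phi> (P, R) = 0"
  shows "ev \<phi> (\<delta> W) = 0"
  unfolding ev_delta_dlt[OF W]
  by (rule dlt_zero[OF H.cg_deg]) (simp_all add: clip2_S \<phi> algebra_simps)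

lemma Q_zero:
  assumes W: "W \<in> S_set" and \<phi>: "\<And>V. V \<in> S_set \<Longrightarrow> deg V = deg W + 1 \<Longrightarrow> \<phi> V = 0"
  shows "ev \<phi> (QS W) = 0"
proof -
  have "mm (hdeg2 a b) 1 Dg (\<lambda>z R. clip word_set \<phi> (z # R)) W = 0"
    by (rule mm_zero[OF H.Dg_deg]) (simp_all add: clip_S \<phi>)
  moreover have "ll (hdeg2 a b) Bg (\<lambda>z R. clip word_set \<phi> (z # R)) W = 0"
    by (rule ll_zero[OF H.Bg_deg]) (simp_all add: clip_S \<phi>)
  ultimately show ?thesis by (simp add: ev_Q_mm_ll[OF W])
qed

text \<open>The composite of \<open>\<phi>\<close> with \<open>f\<close> need only agree on
  generators with a good functional: relations have no other keys, and good functionals kill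
  them.\<close>

lemma induces_SI:
  assumes "\<And>\<phi> W. W \<in> S_set \<Longrightarrow> (\<And>h. h \<in> gens P' \<Longrightarrow> \<phi> h = 0) \<Longrightarrow> ev \<phi> (f W) = 0"
    and "\<And>\<phi>. (\<And>r. r \<in> grels P' \<Longrightarrow> ev \<phi> r = 0) \<Longrightarrow> \<exists>G. H.good G \<and> (\<forall>W\<in>S_set. ev \<phi> (f W) = G W)"
  shows "induces SS P' f"
proof (rule inducesI)
  fix \<phi> :: "_ \<Rightarrow> 'k" and r assume \<phi>: "\<And>r. r \<in> grels P' \<Longrightarrow> ev \<phi> r = 0" and r: "r \<in> grels SS"
  obtain G where G: "H.good G" "\<And>W. W \<in> S_set \<Longrightarrow> ev \<phi> (f W) = G W" using assms(2)[OF \<phi>] by blast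
  have "ev (\<lambda>W. ev \<phi> (f W)) r = ev G r"
    by (rule ev_cong) (use G(2) keys_S_rels[OF r] in blast)
  then show "ev (\<lambda>W. ev \<phi> (f W)) r = 0" using kills_S_rels[OF G(1) r] by simp
qed (use assms(1) in \<open>simp add: gens_S\<close>)

lemma eval_Delta':
  assumes "W \<in> S_set" shows "ev \<phi> (\<Delta> W) = H.Spl (clip2 word_set (\<lambda>P R. \<phi> (P, R))) W"
  by (rule eval_Delta[OF assms]) (simp_all add: clip2_S)

lemma eval_delta':
  assumes "\<And>r. r \<in> grels (SS \<otimes>\<^sub>s SS) \<Longrightarrow> ev \<phi> r = 0" "W \<in> S_set"
  shows "ev \<phi> (\<delta> W) = H.Del (clip2 word_set (\<lambda>P R. \<phi> (P, R))) W"
  by (rule eval_delta[OF assms(2) _ _ _ good2_if_kills[OF assms(1)]]) (simp_all add: clip2_S)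

lemma eval_Q':
  assumes "\<And>r. r \<in> grels SS \<Longrightarrow> ev \<phi> r = 0" "W \<in> S_set"
  shows "ev \<phi> (QS W) = H.Q (clip word_set \<phi>) W"
  by (rule eval_Q[OF assms(2) _ good_if_kills_S_rels[OF assms(1)]]) (simp_all add: clip_S)

lemma induces_Delta: "induces SS (SS \<otimes>\<^sub>s SS) \<Delta>"
proof (rule induces_SI)
  show "ev \<phi> (\<Delta> W) = 0" if "W \<in> S_set" "\<And>h. h \<in> gens (SS \<otimes>\<^sub>s SS) \<Longrightarrow> \<phi> h = 0" for \<phi> W
    using that by (intro Delta_zero) (simp_all add: tensor_space gens_S)
  show "\<exists>G. H.good G \<and> (\<forall>W\<in>S_set. ev \<phi> (\<Delta> W) = G W)" if k: "\<And>r. r \<in> grels (SS \<otimes>\<^sub>s SS) \<Longrightarrow> ev \<phi> r = 0" for \<phi>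
    using H.good_Spl[OF good2_if_kills[OF k]] eval_Delta' by blast
qed

lemma induces_delta: "induces SS (SS \<otimes>\<^sub>s SS) \<delta>"
proof (rule induces_SI)
  show "ev \<phi> (\<delta> W) = 0" if "W \<in> S_set" "\<And>h. h \<in> gens (SS \<otimes>\<^sub>s SS) \<Longrightarrow> \<phi> h = 0" for \<phi> W
    using that by (intro delta_zero) (simp_all add: tensor_space gens_S)
  show "\<exists>G. H.good G \<and> (\<forall>W\<in>S_set. ev \<phi> (\<delta> W) = G W)" if k: "\<And>r. r \<in> grels (SS \<otimes>\<^sub>s SS) \<Longrightarrow> ev \<phi> r = 0" for \<phi>
    using H.good_Del[OF good2_if_kills[OF k]] eval_delta'[OF k] by blast
qed

lemma induces_Q: "induces SS SS QS"
proof (rule induces_SI)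
  show "ev \<phi> (QS W) = 0" if "W \<in> S_set" "\<And>h. h \<in> gens SS \<Longrightarrow> \<phi> h = 0" for \<phi> W
    using that by (intro Q_zero) (simp_all add: gens_S)
  show "\<exists>G. H.good G \<and> (\<forall>W\<in>S_set. ev \<phi> (QS W) = G W)" if k: "\<And>r. r \<in> grels SS \<Longrightarrow> ev \<phi> r = 0" for \<phi>
    using H.good_Q[OF good_if_kills_S_rels[OF k]] eval_Q'[OF k] by blast
qed

lemma degrees:
  "has_degree 0 SS (SS \<otimes>\<^sub>s SS) \<Delta>" "has_degree (- (a - b)) SS (SS \<otimes>\<^sub>s SS) \<delta>" "has_degree 1 SS SS QS"
proof -
  show "has_degree 0 SS (SS \<otimes>\<^sub>s SS) \<Delta>"
    by (rule has_degreeI, rule Delta_zero) (simp_all add: tensor_space gens_S gdeg_spaces)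
  show "has_degree (- (a - b)) SS (SS \<otimes>\<^sub>s SS) \<delta>"
    by (rule has_degreeI, rule delta_zero) (simp_all add: tensor_space gens_S gdeg_spaces)
  show "has_degree 1 SS SS QS"
    by (rule has_degreeI, rule Q_zero) (simp_all add: gens_S gdeg_spaces)
qed

lemma Delta_cocommutative: "same_map SS (SS \<otimes>\<^sub>s SS) (twist deg \<odot> \<Delta>) \<Delta>"
proof (rule same_mapI, unfold gens_S)
  fix \<phi> :: "_ \<Rightarrow> 'k" and W assume W: "W \<in> S_set"
  let ?\<chi> = "clip2 word_set (\<lambda>P R. \<phi> (P, R))"
  have "ev \<phi> ((twist deg \<odot> \<Delta>) W) = H.Spl (\<lambda>P R. sg (deg P * deg R) * ?\<chi> R P) W"
    unfolding ev_lcomp by (rule eval_Delta[OF W]) (simp_all add: ev_maps clip2_S)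
  then show "ev \<phi> ((twist deg \<odot> \<Delta>) W) = ev \<phi> (\<Delta> W)"
    by (simp only: H.Spl_swap eval_Delta'[OF W])
qed

lemma delta_skew: "same_map SS (SS \<otimes>\<^sub>s SS) (twist deg \<odot> \<delta>) (\<lambda>x. - smul ((-1) powi (a - b)) (\<delta> x))"
proof (rule same_mapI, unfold gens_S)
  fix \<phi> :: "_ \<Rightarrow> 'k" and W assume k: "\<And>r. r \<in> grels (SS \<otimes>\<^sub>s SS) \<Longrightarrow> ev \<phi> r = 0" and W: "W \<in> S_set"
  let ?\<chi> = "clip2 word_set (\<lambda>P R. \<phi> (P, R))"
  have "ev \<phi> ((twist deg \<odot> \<delta>) W) = H.Del (\<lambda>P R. sg (deg P * deg R) * ?\<chi> R P) W"
    unfolding ev_lcomp by (rule eval_delta[OF W _ _ _ H.good2_twist[OF good2_if_kills[OF k]]])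
      (simp_all add: ev_maps clip2_S)
  then show "ev \<phi> ((twist deg \<odot> \<delta>) W) = ev \<phi> (- smul ((-1) powi (a - b)) (\<delta> W))"
    by (simp only: H.Del_swap eval_delta'[OF k W] ev_uminus ev_smul sg_fold)
qed

abbreviation "Delta_id \<equiv> reassoc \<odot> ktensor deg \<Delta> 0 lid"
abbreviation "id_Delta \<equiv> ktensor deg lid 0 \<Delta>"
abbreviation "delta_id \<equiv> reassoc \<odot> ktensor deg \<delta> 0 lid"
abbreviation "id_delta \<equiv> ktensor deg lid (a - b) \<delta>"
abbreviation "Q_id_Q \<equiv> \<lambda>x. ktensor deg QS 0 lid x + ktensor deg lid 1 QS x"

lemma ev_id_maps:
  "ev \<phi> (Delta_id (P, R)) = ev (\<lambda>x. \<phi> (fst x, snd x, R)) (\<Delta> P)"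
  "ev \<phi> (id_Delta (P, R)) = ev (\<lambda>x. \<phi> (P, x)) (\<Delta> R)"
  "ev \<phi> (delta_id (P, R)) = ev (\<lambda>x. \<phi> (fst x, snd x, R)) (\<delta> P)"
  "ev \<phi> (id_delta (P, R)) = sg ((a - b) * deg P) * ev (\<lambda>x. \<phi> (P, x)) (\<delta> R)"
  "ev \<psi> (Q_id_Q (P, R)) = ev (\<lambda>V. \<psi> (V, R)) (QS P) + sg (deg P) * ev (\<lambda>V. \<psi> (P, V)) (QS R)"
proof -
  have "ev \<phi> (reassoc (x, R)) = \<phi> (fst x, snd x, R)" for x :: "_ \<times> _"
    by (cases x) (simp only: ev_maps fst_conv snd_conv)
  then show "ev \<phi> (Delta_id (P, R)) = ev (\<lambda>x. \<phi> (fst x, snd x, R)) (\<Delta> P)"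
    "ev \<phi> (delta_id (P, R)) = ev (\<lambda>x. \<phi> (fst x, snd x, R)) (\<delta> P)"
    by (simp_all add: ev_lcomp ev_maps)
qed (simp_all add: ev_maps)

lemma Delta_coassociative: "same_map SS (SS \<otimes>\<^sub>s SS \<otimes>\<^sub>s SS) (Delta_id \<odot> \<Delta>) (id_Delta \<odot> \<Delta>)"
proof (rule same_mapI, unfold gens_S)
  fix \<phi> :: "_ \<Rightarrow> 'k" and W assume W: "W \<in> S_set"
  let ?\<chi> = "clip3 \<phi>"
  have "ev \<phi> ((Delta_id \<odot> \<Delta>) W) = H.Spl (\<lambda>P R. H.Spl (\<lambda>P1 P2. ?\<chi> P1 P2 R) P) W"
    unfolding ev_lcomp[of _ Delta_id]
  proof (rule eval_Delta[OF W])
    fix P R assume "P \<in> S_set" "R \<in> S_set"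
    then show "ev \<phi> (Delta_id (P, R)) = H.Spl (\<lambda>P1 P2. ?\<chi> P1 P2 R) P"
      unfolding ev_id_maps by (intro eval_Delta) (simp_all add: clip3_def)
  qed simp_all
  also have "\<dots> = H.Spl (\<lambda>P R. H.Spl (?\<chi> P) R) W"
    by (rule H.Spl_assoc)
  also have "\<dots> = ev \<phi> ((id_Delta \<odot> \<Delta>) W)"
    unfolding ev_lcomp[of _ id_Delta]
  proof (rule eval_Delta[OF W, symmetric])
    fix P R assume "P \<in> S_set" "R \<in> S_set"
    then show "ev \<phi> (id_Delta (P, R)) = H.Spl (?\<chi> P) R"
      unfolding ev_id_maps by (intro eval_Delta) (simp_all add: clip3_def)
  qed simp_all
  finally show "ev \<phi> ((Delta_id \<odot> \<Delta>) W) = ev \<phi> ((id_Delta \<odot> \<Delta>) W)" .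
qed

text \<open>Stated for any good \<open>\<chi>\<close> that agrees with \<open>\<phi>\<close> on
  generators, since the co-Jacobi identity uses it for \<open>\<chi>\<close> and both of its
  rotations. The inner cobracket has to be good in both variables before the outer one can be
  evaluated.\<close>

lemma eval_delta_delta:
  assumes W: "W \<in> S_set" and \<chi>: "H.good3 \<chi>" "\<And>P2 P3. \<chi> [] P2 P3 = 0" "\<And>P1 P3. \<chi> P1 [] P3 = 0" "\<And>P1 P2. \<chi> P1 P2 [] = 0"
    and \<phi>: "\<And>P1 P2 P3. P1 \<in> S_set \<Longrightarrow> P2 \<in> S_set \<Longrightarrow> P3 \<in> S_set \<Longrightarrow> \<phi> (P1, P2, P3) = \<chi> P1 P2 P3"
  shows "ev \<phi> ((delta_id \<odot> \<delta>) W) = H.JJ \<chi> W"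
  unfolding ev_lcomp[of _ delta_id] H.JJ_def
proof (rule eval_delta[OF W])
  fix P R assume "P \<in> S_set" "R \<in> S_set"
  then show "ev \<phi> (delta_id (P, R)) = H.Del (\<lambda>P1 P2. \<chi> P1 P2 R) P"
    unfolding ev_id_maps by (intro eval_delta) (simp_all add: \<phi> \<chi> H.good3D(2))
next
  show "H.good2 (\<lambda>P R. H.Del (\<lambda>P1 P2. \<chi> P1 P2 R) P)"
    unfolding H.good2_def by (intro conjI allI H.good_Del H.good_Del_param H.good3D \<chi>(1))
qed (simp_all add: \<chi>)

lemma delta_coJacobi:
  "same_map SS (SS \<otimes>\<^sub>s SS \<otimes>\<^sub>s SS)
     (\<lambda>x. (delta_id \<odot> \<delta>) x + (twist12 deg \<odot> twist23 deg \<odot> delta_id \<odot> \<delta>) x + (twist23 deg \<odot> twist12 deg \<odot> delta_id \<odot> \<delta>) x)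
     (\<lambda>x. 0)"
proof (rule same_mapI, unfold gens_S)
  fix \<phi> :: "_ \<Rightarrow> 'k" and W assume k: "\<And>r. r \<in> grels (SS \<otimes>\<^sub>s SS \<otimes>\<^sub>s SS) \<Longrightarrow> ev \<phi> r = 0" and W: "W \<in> S_set"
  note g = good3_if_kills[OF k]
  let ?\<chi> = "clip3 \<phi>"
  have 1: "ev \<phi> ((delta_id \<odot> \<delta>) W) = H.JJ ?\<chi> W"
    by (rule eval_delta_delta[OF W g]) (simp_all add: clip3_def)
  have "ev \<phi> ((twist12 deg \<odot> twist23 deg \<odot> delta_id \<odot> \<delta>) W) = ev (\<lambda>x. ev \<phi> ((twist12 deg \<odot> twist23 deg) x)) ((delta_id \<odot> \<delta>) W)"
    by (simp add: ev_lcomp)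
  \<comment> \<open>Applied to a generator \<open>(A, B, C)\<close>, the two twists produce exactly
    the order and the sign of \<open>rot\<close>.\<close>
  also have "\<dots> = H.JJ (H.rot ?\<chi>) W"
    by (rule eval_delta_delta[OF W H.good3_rot[OF g]]) (simp_all add: H.rot_def clip3_def ev_lcomp ev_maps sg_simps algebra_simps)
  finally have 2: "ev \<phi> ((twist12 deg \<odot> twist23 deg \<odot> delta_id \<odot> \<delta>) W) = H.JJ (H.rot ?\<chi>) W" .
  have "ev \<phi> ((twist23 deg \<odot> twist12 deg \<odot> delta_id \<odot> \<delta>) W) = ev (\<lambda>x. ev \<phi> ((twist23 deg \<odot> twist12 deg) x)) ((delta_id \<odot> \<delta>) W)"
    by (simp add: ev_lcomp)
  also have "\<dots> = H.JJ (H.rot (H.rot ?\<chi>)) W"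
    by (rule eval_delta_delta[OF W H.good3_rot[OF H.good3_rot[OF g]]]) (simp_all add: H.rot_rot clip3_def ev_lcomp ev_maps sg_simps algebra_simps)
  finally have 3: "ev \<phi> ((twist23 deg \<odot> twist12 deg \<odot> delta_id \<odot> \<delta>) W) = H.JJ (H.rot (H.rot ?\<chi>)) W" .
  show "ev \<phi> ((delta_id \<odot> \<delta>) W + (twist12 deg \<odot> twist23 deg \<odot> delta_id \<odot> \<delta>) W + (twist23 deg \<odot> twist12 deg \<odot> delta_id \<odot> \<delta>) W) = ev \<phi> 0"
    unfolding ev_add 1 2 3 H.JJ_rot by simp
qed

lemma coLeibniz:
  "same_map SS (SS \<otimes>\<^sub>s SS \<otimes>\<^sub>s SS) (id_Delta \<odot> \<delta>) (\<lambda>x. (delta_id \<odot> \<Delta>) x + (twist12 deg \<odot> id_delta \<odot> \<Delta>) x)"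
proof (rule same_mapI, unfold gens_S)
  fix \<phi> :: "_ \<Rightarrow> 'k" and W assume k: "\<And>r. r \<in> grels (SS \<otimes>\<^sub>s SS \<otimes>\<^sub>s SS) \<Longrightarrow> ev \<phi> r = 0" and W: "W \<in> S_set"
  note g = good3_if_kills[OF k]
  let ?\<chi> = "clip3 \<phi>"
  have 1: "ev \<phi> ((id_Delta \<odot> \<delta>) W) = H.Del (\<lambda>P R. H.Spl (?\<chi> P) R) W"
    unfolding ev_lcomp[of _ id_Delta]
  proof (rule eval_delta[OF W])
    fix P R assume "P \<in> S_set" "R \<in> S_set"
    then show "ev \<phi> (id_Delta (P, R)) = H.Spl (?\<chi> P) R"
      unfolding ev_id_maps by (intro eval_Delta) (simp_all add: clip3_def)
  next
    show "H.good2 (\<lambda>P R. H.Spl (?\<chi> P) R)"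
      unfolding H.good2_def by (intro conjI allI H.good_Spl H.good_Spl_param H.good3D g)
  qed simp_all
  have 2: "ev \<phi> ((delta_id \<odot> \<Delta>) W) = H.Spl (\<lambda>P R. H.Del (\<lambda>P1 P2. ?\<chi> P1 P2 R) P) W"
    unfolding ev_lcomp[of _ delta_id]
  proof (rule eval_Delta[OF W])
    fix P R assume "P \<in> S_set" "R \<in> S_set"
    then show "ev \<phi> (delta_id (P, R)) = H.Del (\<lambda>P1 P2. ?\<chi> P1 P2 R) P"
      unfolding ev_id_maps by (intro eval_delta[OF _ _ _ _ H.good3D(2)[OF g]]) (simp_all add: clip3_def)
  qed simp_all
  have 3: "ev \<phi> ((twist12 deg \<odot> id_delta \<odot> \<Delta>) W)
    = H.Spl (\<lambda>P R. sg ((a - b) * deg P) * H.Del (\<lambda>R1 R2. sg (deg P * deg R1) * ?\<chi> R1 P R2) R) W"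
    unfolding ev_lcomp[of _ _ \<Delta>]
  proof (rule eval_Delta[OF W])
    fix P R assume PR: "P \<in> S_set" "R \<in> S_set"
    \<comment> \<open>The twist is absorbed into the functional before the cobracket acts on
      \<open>R\<close>: with \<open>P\<close> fixed it contributes only a sign linear in the degree
      of \<open>R1\<close>, which preserves goodness.\<close>
    have "ev (\<lambda>x. ev \<phi> (twist12 deg (P, x))) (\<delta> R) = H.Del (\<lambda>R1 R2. sg (deg P * deg R1) * ?\<chi> R1 P R2) R"
    proof (rule eval_delta)
      show "H.good2 (\<lambda>R1 R2. sg (deg P * deg R1) * ?\<chi> R1 P R2)"
        unfolding H.good2_def by (intro conjI allI H.good_sg H.good_mult H.good3D g)
    qed (use PR in \<open>simp_all add: ev_maps clip3_def\<close>)
    then show "ev \<phi> ((twist12 deg \<odot> id_delta) (P, R)) = sg ((a - b) * deg P) * H.Del (\<lambda>R1 R2. sg (deg P * deg R1) * ?\<chi> R1 P R2) R"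
      unfolding ev_lcomp ev_id_maps by simp
  qed simp_all
  show "ev \<phi> ((id_Delta \<odot> \<delta>) W) = ev \<phi> ((delta_id \<odot> \<Delta>) W + (twist12 deg \<odot> id_delta \<odot> \<Delta>) W)"
    unfolding ev_add 1 2 3 by (rule H.Del_coLeibniz)
qed

lemma Q_square: "same_map SS SS (QS \<odot> QS) (\<lambda>x. 0)"
proof (rule same_mapI, unfold gens_S)
  fix \<phi> :: "_ \<Rightarrow> 'k" and W assume k: "\<And>r. r \<in> S_rels \<Longrightarrow> ev \<phi> r = 0" and W: "W \<in> S_set"
  let ?\<chi> = "clip word_set \<phi>"
  note g = good_if_kills_S_rels[OF k]
  have "ev \<phi> ((QS \<odot> QS) W) = H.Q (H.Q ?\<chi>) W"
    unfolding ev_lcomp by (rule eval_Q[OF W eval_Q'[OF k] H.good_Q[OF g]])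
  then show "ev \<phi> ((QS \<odot> QS) W) = ev \<phi> 0"
    using H.Q_Q[OF g] by simp
qed

lemma eval_Q_id_Q:
  assumes "P \<in> S_set" "R \<in> S_set" "\<And>r. r \<in> grels (SS \<otimes>\<^sub>s SS) \<Longrightarrow> ev \<phi> r = 0"
  shows "ev \<phi> (Q_id_Q (P, R)) = H.Q (\<lambda>V. clip2 word_set (\<lambda>P R. \<phi> (P, R)) V R) P
    + sg (deg P) * H.Q (clip2 word_set (\<lambda>P R. \<phi> (P, R)) P) R"
proof -
  note g = good2_if_kills[OF assms(3)]
  have "ev (\<lambda>V. \<phi> (V, R)) (QS P) = H.Q (\<lambda>V. clip2 word_set (\<lambda>P R. \<phi> (P, R)) V R) P"
    by (rule eval_Q[OF assms(1) _ H.good2D(1)[OF g]]) (use assms(1,2) in \<open>simp add: clip2_S\<close>)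
  moreover have "ev (\<lambda>V. \<phi> (P, V)) (QS R) = H.Q (clip2 word_set (\<lambda>P R. \<phi> (P, R)) P) R"
    by (rule eval_Q[OF assms(2) _ H.good2D(2)[OF g]]) (use assms(1,2) in \<open>simp add: clip2_S\<close>)
  ultimately show ?thesis unfolding ev_id_maps by simp
qed

lemma Q_coderivation_Delta: "same_map SS (SS \<otimes>\<^sub>s SS) (Q_id_Q \<odot> \<Delta>) (\<Delta> \<odot> QS)"
proof (rule same_mapI, unfold gens_S)
  fix \<phi> :: "_ \<Rightarrow> 'k" and W assume k: "\<And>r. r \<in> grels (SS \<otimes>\<^sub>s SS) \<Longrightarrow> ev \<phi> r = 0" and W: "W \<in> S_set"
  let ?\<chi> = "clip2 word_set (\<lambda>P R. \<phi> (P, R))"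
  note g = good2_if_kills[OF k]
  have "ev \<phi> ((Q_id_Q \<odot> \<Delta>) W) = H.Spl (\<lambda>P R. H.Q (\<lambda>V. ?\<chi> V R) P + sg (deg P) * H.Q (?\<chi> P) R) W"
    unfolding ev_lcomp
  proof (rule eval_Delta[OF W])
    fix P R assume "P \<in> S_set" "R \<in> S_set"
    then show "ev \<phi> (Q_id_Q (P, R)) = H.Q (\<lambda>V. ?\<chi> V R) P + sg (deg P) * H.Q (?\<chi> P) R"
      by (rule eval_Q_id_Q[OF _ _ k])
  qed simp_all
  also have "\<dots> = H.Q (H.Spl ?\<chi>) W" by (rule H.Q_Spl[symmetric])
  also have "\<dots> = ev \<phi> ((\<Delta> \<odot> QS) W)"
    unfolding ev_lcomp by (rule eval_Q[OF W eval_Delta' H.good_Spl[OF g], symmetric])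
  finally show "ev \<phi> ((Q_id_Q \<odot> \<Delta>) W) = ev \<phi> ((\<Delta> \<odot> QS) W)" .
qed

lemma Q_coderivation_delta:
  "same_map SS (SS \<otimes>\<^sub>s SS) (Q_id_Q \<odot> \<delta>) (\<lambda>x. smul ((-1) powi (a - b)) ((\<delta> \<odot> QS) x))"
proof (rule same_mapI, unfold gens_S)
  fix \<phi> :: "_ \<Rightarrow> 'k" and W assume k: "\<And>r. r \<in> grels (SS \<otimes>\<^sub>s SS) \<Longrightarrow> ev \<phi> r = 0" and W: "W \<in> S_set"
  let ?\<chi> = "clip2 word_set (\<lambda>P R. \<phi> (P, R))"
  note g = good2_if_kills[OF k]
  have "ev \<phi> ((Q_id_Q \<odot> \<delta>) W) = H.Del (\<lambda>P R. H.Q (\<lambda>V. ?\<chi> V R) P + sg (deg P) * H.Q (?\<chi> P) R) W"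
    unfolding ev_lcomp
  proof (rule eval_delta[OF W])
    fix P R assume "P \<in> S_set" "R \<in> S_set"
    then show "ev \<phi> (Q_id_Q (P, R)) = H.Q (\<lambda>V. ?\<chi> V R) P + sg (deg P) * H.Q (?\<chi> P) R"
      by (rule eval_Q_id_Q[OF _ _ k])
  next
    have "H.good (\<lambda>P. sg (deg P) * H.Q (?\<chi> P) R)" for R
    proof -
      have "H.good (\<lambda>P. H.Q (?\<chi> P) R)" by (rule H.good_Q_param[OF H.good2D(1)[OF g]])
      from H.good_sg[OF this, where k = 1] show ?thesis by simp
    qed
    then show "H.good2 (\<lambda>P R. H.Q (\<lambda>V. ?\<chi> V R) P + sg (deg P) * H.Q (?\<chi> P) R)"
      unfolding H.good2_def
      by (intro conjI allI H.good_add H.good_Q H.good_Q_param H.good_mult H.good2D[OF g])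
  qed simp_all
  also have "\<dots> = sg (a - b) * H.Q (H.Del ?\<chi>) W" by (rule H.Q_Del[OF g])
  also have "H.Q (H.Del ?\<chi>) W = ev \<phi> ((\<delta> \<odot> QS) W)"
    unfolding ev_lcomp by (rule eval_Q[OF W eval_delta'[OF k] H.good_Del[OF g], symmetric])
  finally show "ev \<phi> ((Q_id_Q \<odot> \<delta>) W) = ev \<phi> (smul ((-1) powi (a - b)) ((\<delta> \<odot> QS) W))"
    by (simp only: ev_smul sg_fold)
qed

lemma codifferential_bicoalgebra_S: "codifferential_bicoalgebra (a - b) SS \<Delta> \<delta> QS"
  unfolding codifferential_bicoalgebra_def Let_def gdeg_spaces
  by (intro conjI induces_Delta induces_delta induces_Q degrees Delta_cocommutative Delta_coassociative
      delta_skew delta_coJacobi coLeibniz Q_square Q_coderivation_Delta Q_coderivation_delta)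

end

theorem mainTheorem1:
  fixes scale :: "'k::field \<Rightarrow> 'v::ab_group_add \<Rightarrow> 'v"
    and A :: "int \<Rightarrow> 'v set"
    and a b :: int
    and mul brk :: "'v \<Rightarrow> 'v \<Rightarrow> 'v"
    and d :: "'v \<Rightarrow> 'v"
  assumes "dg_ab_algebra scale A a b mul brk d"
  shows "codifferential_bicoalgebra (a - b) (S_space scale A a b)
           (Delta a b) (delta a b) (Q_map scale a b mul brk d)"
  by (rule dg_ab_algebra.codifferential_bicoalgebra_S[OF assms])

end
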